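(* The following finite groups $K$ are rigid relative to their automorphism group $\operatorname{Aut}K$. (i) The symmetric group $S_n$ and the alternating group $A_n$, for every $n\geq2$. (ii) The $2$-fold cover $\widetilde{A}_n$ of $A_n$, for every $n\geq4$ with $n\neq6$.
   Context: The double cover. For $n\geq2$, $\widetilde{S}_n$ is the group with generators $z$ and $[ab]$, for all distinct $a,b\in\{1,\dots,n\}$, and relations: $z$ is central, $z^2=e$, $[ab]=z[ba]$, $[ab]^2=e$, and $[ab][bc][ab]=z[ac]$ for distinct $a,b,c$. There is a surjective homomorphism $\theta:\widetilde{S}_n\to S_n$ with $\theta(z)=e$, $\theta([ab])=(ab)$ and kernel $\{e,z\}$ of order $2$. One defines $\widetilde{A}_n=\theta^{-1}(A_n)$. A compact quantum group is a pair $(A,\Delta)$ where $A$ is a von Neumann algebra and $\Delta:A\to A\overline{\otimes}A$ is a faithful normal unital $*$-homomorphism with $(\Delta\otimes\mathrm{id})\Delta=(\mathrm{id}\otimes\Delta)\Delta$, such that there is a faithful normal state $\varphi$ with $(\mathrm{id}\otimes\varphi)\Delta(a)=\varphi(a)1=(\varphi\otimes\mathrm{id})\Delta(a)$ for all $a$. This state is unique (Haar state); $(A,\Delta)$ is of Kac type if it is a trace. Quantum group isomorphisms $(A,\Delta_A)\to(B,\Delta_B)$ are $*$-isomorphisms $\pi:A\to B$ with $\Delta_B\circ\pi=(\pi\otimes\pi)\circ\Delta_A$. A Kac type $(A,\Delta_A)$ is rigid relative to an action $\mathcal{G}\curvearrowright^\alpha(A,\Delta_A)$ by quantum group automorphisms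 if whenever $(B,\Delta_B)$ is a Kac type compact quantum group, $\mathcal{G}\curvearrowright^\beta(B,\Delta_B)$ is an action by quantum group automorphisms and $\pi:A\to B$ is a Haar state preserving von Neumann algebra isomorphism with $\beta_g\circ\pi=\pi\circ\alpha_g$ for all $g\in\mathcal{G}$, there exist a quantum group isomorphism $\pi_0:(A,\Delta_A)\to(B,\Delta_B)$ and $\zeta\in\operatorname{Aut}\mathcal{G}$ with $\beta_{\zeta(g)}\circ\pi_0=\pi_0\circ\alpha_g$ for all $g\in\mathcal{G}$. A finite group $K$ is regarded as the compact quantum group $(L^\infty(K),\Delta_K)$ with $\Delta_K(F)(k_1,k_2)=F(k_1k_2)$ and Haar state given by the normalized counting measure. "$K$ is rigid relative to $\operatorname{Aut}K$" means that $(L^\infty(K),\Delta_K)$ is rigid relative to the action $\alpha\cdot F=F\circ\alpha^{-1}$ of $\operatorname{Aut}K$. (For finite $K$ this is equivalent to: whenever $\Lambda$ is a group and $\pi:K\to\Lambda$ is a bijection with $\pi\circ\alpha\circ\pi^{-1}\in\operatorname{Aut}\Lambda$ for all $\alpha\in\operatorname{Aut}K$, then $\Lambda\cong K$.) *)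

theory Defs
  imports
    "HOL-Analysis.Analysis"
    "HOL-Library.FuncSet"
    "HOL-Algebra.Sym_Groups"
    "HOL-Algebra.Bij"
begin

section \<open>Bounded operators on \<open>\<ell>\<^sup>2(I)\<close>\<close>

text \<open>
  Choosing an orthonormal basis, every Hilbert space is of the form \<open>\<ell>\<^sup>2(I)\<close>, and
  \<open>\<ell>\<^sup>2(I) \<otimes> \<ell>\<^sup>2(J) = \<ell>\<^sup>2(I \<times> J)\<close>.  Vectors are functions vanishing off the index set \<open>I\<close>, and
  operators are made total by sending every function outside \<open>\<ell>\<^sup>2(I)\<close> to zero, so that equality of
  operators is equality of HOL functions and the product of operators is \<open>(\<circ>)\<close>.
\<close>

type_synonym 'i vec = "'i \<Rightarrow> complex"
type_synonym 'i oper = "'i vec \<Rightarrow> 'i vec"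

definition ell2 :: "'i set \<Rightarrow> 'i vec set" where
  "ell2 I = {x. (\<forall>i. i \<notin> I \<longrightarrow> x i = 0) \<and> (\<lambda>i. (cmod (x i))\<^sup>2) summable_on I}"

definition l2_inner :: "'i vec \<Rightarrow> 'i vec \<Rightarrow> complex" where
  "l2_inner x y = (\<Sum>\<^sub>\<infinity>i. cnj (x i) * y i)"

definition l2_norm :: "'i vec \<Rightarrow> real" where
  "l2_norm x = sqrt (\<Sum>\<^sub>\<infinity>i. (cmod (x i))\<^sup>2)"

definition delta :: "'i \<Rightarrow> 'i vec" where
  "delta i = (\<lambda>j. if j = i then 1 else 0)"

definition bop :: "'i set \<Rightarrow> 'i oper set" where
  "bop I = {T.
     (\<forall>x\<in>ell2 I. T x \<in> ell2 I) \<and>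
     (\<forall>x. x \<notin> ell2 I \<longrightarrow> T x = (\<lambda>i. 0)) \<and>
     (\<forall>x\<in>ell2 I. \<forall>y\<in>ell2 I. T (\<lambda>i. x i + y i) = (\<lambda>i. T x i + T y i)) \<and>
     (\<forall>c. \<forall>x\<in>ell2 I. T (\<lambda>i. c * x i) = (\<lambda>i. c * T x i)) \<and>
     (\<exists>C. \<forall>x\<in>ell2 I. l2_norm (T x) \<le> C * l2_norm x)}"

definition op_zero :: "'i oper" where
  "op_zero = (\<lambda>x i. 0)"

definition op_id :: "'i set \<Rightarrow> 'i oper" where
  "op_id I = (\<lambda>x. if x \<in> ell2 I then x else (\<lambda>i. 0))"

definition op_add :: "'i oper \<Rightarrow> 'i oper \<Rightarrow> 'i oper" where
  "op_add S T = (\<lambda>x i. S x i + T x i)"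

definition op_scale :: "complex \<Rightarrow> 'i oper \<Rightarrow> 'i oper" where
  "op_scale c T = (\<lambda>x i. c * T x i)"

definition op_adj :: "'i set \<Rightarrow> 'i oper \<Rightarrow> 'i oper" where
  "op_adj I T = (THE S. S \<in> bop I \<and> (\<forall>x\<in>ell2 I. \<forall>y\<in>ell2 I. l2_inner (T x) y = l2_inner x (S y)))"

text \<open>\<open>S \<otimes> T = (S \<otimes> 1)(1 \<otimes> T)\<close>, where \<open>1 \<otimes> T\<close> acts on the second variable of a function on
  \<open>I \<times> J\<close> and \<open>S \<otimes> 1\<close> on the first.\<close>

definition op_tensor :: "'i set \<Rightarrow> 'j set \<Rightarrow> 'i oper \<Rightarrow> 'j oper \<Rightarrow> ('i \<times> 'j) oper" where
  "op_tensor I J S T = (\<lambda>x. if x \<in> ell2 (I \<times> J)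
     then (\<lambda>(i, j). S (\<lambda>k. T (\<lambda>l. x (k, l)) j) i) else (\<lambda>_. 0))"

text \<open>The identification of operators on \<open>(H \<otimes> K) \<otimes> L\<close> with operators on \<open>H \<otimes> (K \<otimes> L)\<close>.\<close>

definition op_assoc :: "(('i \<times> 'j) \<times> 'k) oper \<Rightarrow> ('i \<times> ('j \<times> 'k)) oper" where
  "op_assoc T = (\<lambda>x (i, (j, k)). T (\<lambda>((i', j'), k'). x (i', (j', k'))) ((i, j), k))"


section \<open>Von Neumann algebras\<close>

definition commutant :: "'i set \<Rightarrow> 'i oper set \<Rightarrow> 'i oper set" where
  "commutant I M = {T \<in> bop I. \<forall>a\<in>M. T \<circ> a = a \<circ> T}"

definition von_neumann_algebra :: "'i set \<Rightarrow> 'i oper set \<Rightarrow> bool" where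
  "von_neumann_algebra I A \<longleftrightarrow>
     A \<subseteq> bop I \<and> (\<forall>a\<in>A. op_adj I a \<in> A) \<and> commutant I (commutant I A) = A"

definition vn_tensor ::
  "'i set \<Rightarrow> 'i oper set \<Rightarrow> 'j set \<Rightarrow> 'j oper set \<Rightarrow> ('i \<times> 'j) oper set" where
  "vn_tensor I A J B = commutant (I \<times> J) (commutant (I \<times> J)
     {op_tensor I J a b | a b. a \<in> A \<and> b \<in> B})"

text \<open>Normal (i.e. ultraweakly continuous) linear functionals, and linear maps into
  the bounded operators on \<open>\<ell>\<^sup>2(J)\<close> that are continuous for the ultraweak topologies.\<close>

definition normal_functional :: "'i set \<Rightarrow> 'i oper set \<Rightarrow> ('i oper \<Rightarrow> complex) \<Rightarrow> bool" where
  "normal_functional I A \<omega> \<longleftrightarrow> (\<exists>\<xi> \<eta> :: nat \<Rightarrow> 'i vec.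
     (\<forall>n. \<xi> n \<in> ell2 I \<and> \<eta> n \<in> ell2 I) \<and>
     summable (\<lambda>n. (l2_norm (\<xi> n))\<^sup>2) \<and> summable (\<lambda>n. (l2_norm (\<eta> n))\<^sup>2) \<and>
     (\<forall>a\<in>A. \<omega> a = (\<Sum>n. l2_inner (\<xi> n) (a (\<eta> n)))))"

definition normal_linear_map ::
  "'i set \<Rightarrow> 'i oper set \<Rightarrow> 'j set \<Rightarrow> ('i oper \<Rightarrow> 'j oper) \<Rightarrow> bool" where
  "normal_linear_map I A J f \<longleftrightarrow>
     (\<forall>a\<in>A. f a \<in> bop J) \<and>
     (\<forall>a\<in>A. \<forall>b\<in>A. f (op_add a b) = op_add (f a) (f b)) \<and>
     (\<forall>c. \<forall>a\<in>A. f (op_scale c a) = op_scale c (f a)) \<and>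
     (\<forall>\<omega>. normal_functional J (bop J) \<omega> \<longrightarrow> normal_functional I A (\<lambda>a. \<omega> (f a)))"

definition star_hom ::
  "'i set \<Rightarrow> 'i oper set \<Rightarrow> 'j set \<Rightarrow> 'j oper set \<Rightarrow> ('i oper \<Rightarrow> 'j oper) \<Rightarrow> bool" where
  "star_hom I A J B f \<longleftrightarrow>
     (\<forall>a\<in>A. f a \<in> B) \<and>
     (\<forall>a\<in>A. \<forall>b\<in>A. f (op_add a b) = op_add (f a) (f b)) \<and>
     (\<forall>c. \<forall>a\<in>A. f (op_scale c a) = op_scale c (f a)) \<and>
     (\<forall>a\<in>A. \<forall>b\<in>A. f (a \<circ> b) = f a \<circ> f b) \<and>
     (\<forall>a\<in>A. f (op_adj I a) = op_adj J (f a))"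

text \<open>Normality of a bijective \<open>*\<close>-homomorphism between von Neumann algebras is automatic.\<close>

definition vn_iso ::
  "'i set \<Rightarrow> 'i oper set \<Rightarrow> 'j set \<Rightarrow> 'j oper set \<Rightarrow> ('i oper \<Rightarrow> 'j oper) \<Rightarrow> bool" where
  "vn_iso I A J B f \<longleftrightarrow> star_hom I A J B f \<and> bij_betw f A B"

text \<open>The unique normal linear map from the von Neumann algebra tensor product of \<open>A\<close> and \<open>B\<close> to
  the bounded operators on \<open>\<ell>\<^sup>2(L)\<close> that sends \<open>a \<otimes> b\<close> to \<open>F a b\<close>.  It exists in all uses below:
  tensor products of normal \<open>*\<close>-homomorphisms and slice maps of normal functionals.\<close>

definition normal_ext ::
  "'i set \<Rightarrow> 'i oper set \<Rightarrow> 'j set \<Rightarrow> 'j oper set \<Rightarrow> 'l set \<Rightarrow> ('i oper \<Rightarrow> 'j oper \<Rightarrow> 'l oper)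
    \<Rightarrow> ('i \<times> 'j) oper \<Rightarrow> 'l oper" where
  "normal_ext I A J B L F = (THE h.
     h \<in> extensional (vn_tensor I A J B) \<and>
     normal_linear_map (I \<times> J) (vn_tensor I A J B) L h \<and>
     (\<forall>a\<in>A. \<forall>b\<in>B. h (op_tensor I J a b) = F a b))"

definition map_tensor ::
  "'i set \<Rightarrow> 'i oper set \<Rightarrow> 'j set \<Rightarrow> 'j oper set \<Rightarrow> 'k set \<Rightarrow> 'l set
    \<Rightarrow> ('i oper \<Rightarrow> 'k oper) \<Rightarrow> ('j oper \<Rightarrow> 'l oper) \<Rightarrow> ('i \<times> 'j) oper \<Rightarrow> ('k \<times> 'l) oper" where
  "map_tensor I A J B K L f g = normal_ext I A J B (K \<times> L) (\<lambda>a b. op_tensor K L (f a) (g b))"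

text \<open>\<open>id \<otimes> \<phi>\<close> and \<open>\<phi> \<otimes> id\<close> on the tensor square of \<open>A\<close>.\<close>

definition slice_right ::
  "'i set \<Rightarrow> 'i oper set \<Rightarrow> ('i oper \<Rightarrow> complex) \<Rightarrow> ('i \<times> 'i) oper \<Rightarrow> 'i oper" where
  "slice_right I A \<phi> = normal_ext I A I A I (\<lambda>a b. op_scale (\<phi> b) a)"

definition slice_left ::
  "'i set \<Rightarrow> 'i oper set \<Rightarrow> ('i oper \<Rightarrow> complex) \<Rightarrow> ('i \<times> 'i) oper \<Rightarrow> 'i oper" where
  "slice_left I A \<phi> = normal_ext I A I A I (\<lambda>a b. op_scale (\<phi> a) b)"

definition faithful_normal_state :: "'i set \<Rightarrow> 'i oper set \<Rightarrow> ('i oper \<Rightarrow> complex) \<Rightarrow> bool" where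
  "faithful_normal_state I A \<phi> \<longleftrightarrow>
     normal_functional I A \<phi> \<and> \<phi> (op_id I) = 1 \<and>
     (\<forall>a\<in>A. \<phi> (op_adj I a \<circ> a) \<in> \<real>\<^sub>\<ge>\<^sub>0) \<and>
     (\<forall>a\<in>A. \<phi> (op_adj I a \<circ> a) = 0 \<longrightarrow> a = op_zero)"


section \<open>Compact quantum groups\<close>

record 'i qgrp =
  index :: "'i set"
  alg :: "'i oper set"
  comult :: "'i oper \<Rightarrow> ('i \<times> 'i) oper"

definition qg_square :: "'i qgrp \<Rightarrow> ('i \<times> 'i) oper set" where
  "qg_square Q = vn_tensor (index Q) (alg Q) (index Q) (alg Q)"

definition coassociative :: "'i qgrp \<Rightarrow> bool" where
  "coassociative Q \<longleftrightarrow> (let I = index Q; A = alg Q; \<Delta> = comult Q in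
     \<forall>a\<in>A. op_assoc (map_tensor I A I A (I \<times> I) I \<Delta> id (\<Delta> a))
           = map_tensor I A I A I (I \<times> I) id \<Delta> (\<Delta> a))"

definition haar_state :: "'i qgrp \<Rightarrow> ('i oper \<Rightarrow> complex) \<Rightarrow> bool" where
  "haar_state Q \<phi> \<longleftrightarrow> (let I = index Q; A = alg Q; \<Delta> = comult Q in
     faithful_normal_state I A \<phi> \<and>
     (\<forall>a\<in>A. slice_right I A \<phi> (\<Delta> a) = op_scale (\<phi> a) (op_id I) \<and>
            slice_left I A \<phi> (\<Delta> a) = op_scale (\<phi> a) (op_id I)))"

definition compact_quantum_group :: "'i qgrp \<Rightarrow> bool" where
  "compact_quantum_group Q \<longleftrightarrow> (let I = index Q; A = alg Q; \<Delta> = comult Q in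
     von_neumann_algebra I A \<and>
     star_hom I A (I \<times> I) (qg_square Q) \<Delta> \<and> \<Delta> (op_id I) = op_id (I \<times> I) \<and>
     inj_on \<Delta> A \<and> normal_linear_map I A (I \<times> I) \<Delta> \<and>
     coassociative Q \<and> (\<exists>\<phi>. haar_state Q \<phi>))"

definition kac_type :: "'i qgrp \<Rightarrow> bool" where
  "kac_type Q \<longleftrightarrow> compact_quantum_group Q \<and>
     (\<exists>\<phi>. haar_state Q \<phi> \<and> (\<forall>a\<in>alg Q. \<forall>b\<in>alg Q. \<phi> (a \<circ> b) = \<phi> (b \<circ> a)))"

definition qg_iso :: "'i qgrp \<Rightarrow> 'j qgrp \<Rightarrow> ('i oper \<Rightarrow> 'j oper) \<Rightarrow> bool" where
  "qg_iso P Q f \<longleftrightarrow>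
     vn_iso (index P) (alg P) (index Q) (alg Q) f \<and>
     (\<forall>a\<in>alg P. comult Q (f a) =
        map_tensor (index P) (alg P) (index P) (alg P) (index Q) (index Q) f f (comult P a))"

definition qg_action :: "('g, 'm) monoid_scheme \<Rightarrow> 'i qgrp \<Rightarrow> ('g \<Rightarrow> 'i oper \<Rightarrow> 'i oper) \<Rightarrow> bool" where
  "qg_action \<G> Q \<alpha> \<longleftrightarrow> group \<G> \<and>
     (\<forall>g\<in>carrier \<G>. qg_iso Q Q (\<alpha> g)) \<and>
     (\<forall>a\<in>alg Q. \<alpha> \<one>\<^bsub>\<G>\<^esub> a = a) \<and>
     (\<forall>g\<in>carrier \<G>. \<forall>h\<in>carrier \<G>. \<forall>a\<in>alg Q. \<alpha> (g \<otimes>\<^bsub>\<G>\<^esub> h) a = \<alpha> g (\<alpha> h a))"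

definition haar_preserving :: "'i qgrp \<Rightarrow> 'j qgrp \<Rightarrow> ('i oper \<Rightarrow> 'j oper) \<Rightarrow> bool" where
  "haar_preserving P Q f \<longleftrightarrow>
     (\<forall>\<phi> \<psi>. haar_state P \<phi> \<and> haar_state Q \<psi> \<longrightarrow> (\<forall>a\<in>alg P. \<psi> (f a) = \<phi> a))"

text \<open>The \<open>itself\<close> argument fixes the type from which the Hilbert space index set of the competing
  quantum group is taken.  Rigidity in the usual sense is rigidity for all such types, i.e.\ with
  a type variable as argument in a theorem.\<close>

definition rigid_relative ::
  "'j itself \<Rightarrow> ('g, 'm) monoid_scheme \<Rightarrow> 'i qgrp \<Rightarrow> ('g \<Rightarrow> 'i oper \<Rightarrow> 'i oper) \<Rightarrow> bool" where
  "rigid_relative TJ \<G> P \<alpha> \<longleftrightarrow> kac_type P \<and> qg_action \<G> P \<alpha> \<and>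
     (\<forall>(Q :: 'j qgrp) \<beta> \<pi>.
        kac_type Q \<and> qg_action \<G> Q \<beta> \<and>
        vn_iso (index P) (alg P) (index Q) (alg Q) \<pi> \<and> haar_preserving P Q \<pi> \<and>
        (\<forall>g\<in>carrier \<G>. \<forall>a\<in>alg P. \<beta> g (\<pi> a) = \<pi> (\<alpha> g a))
        \<longrightarrow> (\<exists>\<pi>\<^sub>0 \<zeta>. qg_iso P Q \<pi>\<^sub>0 \<and> \<zeta> \<in> auto \<G> \<and>
              (\<forall>g\<in>carrier \<G>. \<forall>a\<in>alg P. \<beta> (\<zeta> g) (\<pi>\<^sub>0 a) = \<pi>\<^sub>0 (\<alpha> g a))))"


section \<open>Finite groups as compact quantum groups\<close>

definition mult_op :: "'k set \<Rightarrow> ('k \<Rightarrow> complex) \<Rightarrow> 'k oper" where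
  "mult_op X F = (\<lambda>x. if x \<in> ell2 X then (\<lambda>k. F k * x k) else (\<lambda>k. 0))"

text \<open>Recovers the function \<open>F\<close> on \<open>X\<close> from the operator \<open>mult_op X F\<close>.\<close>

definition op_symbol :: "'k oper \<Rightarrow> 'k \<Rightarrow> complex" where
  "op_symbol T k = T (delta k) k"

text \<open>\<open>L\<^sup>\<infinity>(K)\<close> acting on \<open>\<ell>\<^sup>2(K)\<close> by multiplication; meaningful for finite \<open>K\<close>, where
  all functions are bounded.\<close>

definition linf_qg :: "('k, 'm) monoid_scheme \<Rightarrow> 'k qgrp" where
  "linf_qg K = \<lparr>
     index = carrier K,
     alg = range (mult_op (carrier K)),
     comult = (\<lambda>T. mult_op (carrier K \<times> carrier K) (\<lambda>(k, l). op_symbol T (k \<otimes>\<^bsub>K\<^esub> l)))\<rparr>"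

definition aut_action :: "('k, 'm) monoid_scheme \<Rightarrow> ('k \<Rightarrow> 'k) \<Rightarrow> 'k oper \<Rightarrow> 'k oper" where
  "aut_action K \<alpha> T = mult_op (carrier K) (\<lambda>k. op_symbol T (inv_into (carrier K) \<alpha> k))"

definition rigid_relative_Aut :: "'j itself \<Rightarrow> ('k, 'm) monoid_scheme \<Rightarrow> bool" where
  "rigid_relative_Aut TJ K \<longleftrightarrow> rigid_relative TJ (AutoGroup K) (linf_qg K) (aut_action K)"


section \<open>The double covers of the symmetric and alternating groups\<close>

text \<open>Groups given by generators \<open>X\<close> and relations \<open>R\<close>.  A letter \<open>(True, x)\<close> stands for \<open>x\<close> and
  \<open>(False, x)\<close> for its inverse; a pair \<open>(u, v) \<in> R\<close> stands for the relation \<open>u = v\<close>.\<close>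

type_synonym 'x gword = "(bool \<times> 'x) list"

inductive pres_eq :: "'x set \<Rightarrow> ('x gword \<times> 'x gword) set \<Rightarrow> 'x gword \<Rightarrow> 'x gword \<Rightarrow> bool"
  for X R where
  refl: "w \<in> lists (UNIV \<times> X) \<Longrightarrow> pres_eq X R w w"
| sym: "pres_eq X R u v \<Longrightarrow> pres_eq X R v u"
| trans: "pres_eq X R u v \<Longrightarrow> pres_eq X R v w \<Longrightarrow> pres_eq X R u w"
| append: "pres_eq X R u v \<Longrightarrow> pres_eq X R u' v' \<Longrightarrow> pres_eq X R (u @ u') (v @ v')"
| cancel: "x \<in> X \<Longrightarrow> pres_eq X R [(e, x), (\<not> e, x)] []"
| rel: "(u, v) \<in> R \<Longrightarrow> u \<in> lists (UNIV \<times> X) \<Longrightarrow> v \<in> lists (UNIV \<times> X) \<Longrightarrow> pres_eq X R u v"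

definition presented_group ::
  "'x set \<Rightarrow> ('x gword \<times> 'x gword) set \<Rightarrow> 'x gword set monoid" where
  "presented_group X R = \<lparr>
     carrier = lists (UNIV \<times> X) // {(u, v). pres_eq X R u v},
     mult = (\<lambda>U V. {w. \<exists>u\<in>U. \<exists>v\<in>V. pres_eq X R (u @ v) w}),
     one = {w. pres_eq X R [] w}\<rparr>"

definition word_eval :: "('g, 'm) monoid_scheme \<Rightarrow> ('x \<Rightarrow> 'g) \<Rightarrow> 'x gword \<Rightarrow> 'g" where
  "word_eval G f w =
     foldr (\<lambda>(e, x) g. (if e then f x else inv\<^bsub>G\<^esub> f x) \<otimes>\<^bsub>G\<^esub> g) w \<one>\<^bsub>G\<^esub>"

datatype cover_gen = Z | Tr nat nat

abbreviation lz :: "bool \<times> cover_gen" where "lz \<equiv> (True, Z)"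
abbreviation lt :: "nat \<Rightarrow> nat \<Rightarrow> bool \<times> cover_gen" where "lt a b \<equiv> (True, Tr a b)"

definition cover_gens :: "nat \<Rightarrow> cover_gen set" where
  "cover_gens n = insert Z {Tr a b | a b. a \<in> {1..n} \<and> b \<in> {1..n} \<and> a \<noteq> b}"

definition cover_rels :: "nat \<Rightarrow> (cover_gen gword \<times> cover_gen gword) set" where
  "cover_rels n =
     {([lz, lz], [])}
     \<union> {([lz, lt a b], [lt a b, lz]) | a b. a \<in> {1..n} \<and> b \<in> {1..n} \<and> a \<noteq> b}
     \<union> {([lt a b], [lz, lt b a]) | a b. a \<in> {1..n} \<and> b \<in> {1..n} \<and> a \<noteq> b}
     \<union> {([lt a b, lt a b], []) | a b. a \<in> {1..n} \<and> b \<in> {1..n} \<and> a \<noteq> b}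
     \<union> {([lt a b, lt b c, lt a b], [lz, lt a c]) | a b c.
          a \<in> {1..n} \<and> b \<in> {1..n} \<and> c \<in> {1..n} \<and> a \<noteq> b \<and> b \<noteq> c \<and> a \<noteq> c}"

definition sym_cover :: "nat \<Rightarrow> cover_gen gword set monoid" where
  "sym_cover n = presented_group (cover_gens n) (cover_rels n)"

fun cover_gen_perm :: "cover_gen \<Rightarrow> nat \<Rightarrow> nat" where
  "cover_gen_perm Z = id"
| "cover_gen_perm (Tr a b) = Transposition.transpose a b"

text \<open>The value of \<open>\<theta>\<close> on a class of words; it does not depend on the representing word.\<close>

definition cover_theta :: "nat \<Rightarrow> cover_gen gword set \<Rightarrow> nat \<Rightarrow> nat" where
  "cover_theta n U = the_elem (word_eval (sym_group n) cover_gen_perm ` U)"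

definition alt_cover :: "nat \<Rightarrow> cover_gen gword set monoid" where
  "alt_cover n = (sym_cover n)
     \<lparr>carrier := {U \<in> carrier (sym_cover n). cover_theta n U \<in> carrier (alt_group n)}\<rparr>"

end

(*
A Haar state preserving isomorphism from L^infinity(K) onto a Kac type quantum group (B, Delta)
makes B commutative, hence the function algebra of a finite group, whose multiplication can be
transported to a second group law on the set K.  Equivariance means that every automorphism of K is
an automorphism of the second law, so it suffices to show that the second law is isomorphic to
the first one.

For the alternating groups and their covers (and for S_4), conjugation by G acts by
automorphisms of the second law L.  Fixed point sets of conjugations are subgroups for both laws,
and Cauchy's theorem, applied alternately to the two laws, shows that the elements of order three
of L with small support are the lifts al(a,b,c) of three-cycles (up to one central factor).
Invariance leaves only two values for the L-conjugate of al(1,2,4) by al(1,2,3).  They are exchanged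
by passing to the opposite law; with the right orientation, the al(a,b,c) satisfy the
multiplication rules of three-cycles up to a central element w, and the subgroup of G x L generated
by all pairs of a lifted three-cycle in G and its counterpart al(a,b,c) is the graph of an
isomorphism.  The kernel is controlled by descent along the point stabilizers.

For S_n with n different from 4, the elements fixed by the conjugations with permutations of
{4..n} form a subgroup for the second law *, in which those commuting with (1 2 3) have index two;
this forces (1 2) * (1 3) = (2 3) * (1 2), and transpositions take over the role of three-cycles.
*)

theory Submission
  imports Defs "HOL-Algebra.Sylow" "HOL-Algebra.Multiplicative_Group"
begin

section \<open>Hilbert space preliminaries: operators on square-summable functions and
  finite-dimensional commutative algebras\<close>

section \<open>Bounded operators on \<open>\<ell>\<^sup>2(I)\<close>\<close>

text \<open>A competing algebra may act on any Hilbert space, with any multiplicity. The images of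
  the point projections of \<open>K\<close> form a finite resolution of its identity; over such a
  resolution every linear map is normal, tensor products are algebraic, and a comultiplication has
  coefficients 0 or 1, so it is a multiplication table. The automorphism of
  \<open>AutoGroup K\<close> is conjugation by the isomorphism found: \<open>auto K\<close> lies in
  the automorphism group of the second law, and finiteness makes the two equal.

  Two three-cycles are compared on four points, among elements fixed by conjugation with
  transpositions of {5..n}. Such elements fix {5..n} pointwise if n \<ge> 7; n = 5 and n = 6 need
  parity. For n = 6 parity does not exclude (1 3)(5 6) when the sign \<open>w\<close> is to be shown
  nontrivial; there the covers lose n = 6. The argument with transpositions needs two points in
  {4..n} or none, so S_4 goes with the three-cycles. The unit of the second law is only known to be
  \<open>\<one>\<close> or \<open>z\<close>, so lifts of three-cycles and their products carry
  central signs.\<close>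

definition nsq :: "'i vec \<Rightarrow> real" where
  "nsq x = (\<Sum>\<^sub>\<infinity>i. (cmod (x i))\<^sup>2)"

lemma ell2_iff: "x \<in> ell2 I \<longleftrightarrow> (\<forall>i. i \<notin> I \<longrightarrow> x i = 0) \<and> (\<lambda>i. (cmod (x i))\<^sup>2) summable_on UNIV"
proof -
  have "(\<lambda>i. (cmod (x i))\<^sup>2) summable_on I \<longleftrightarrow> (\<lambda>i. (cmod (x i))\<^sup>2) summable_on UNIV"
    if "\<forall>i. i \<notin> I \<longrightarrow> x i = 0"
    by (rule summable_on_cong_neutral) (use that in auto)
  then show ?thesis unfolding ell2_def by auto
qed

lemma l2_norm_nsq: "l2_norm x = sqrt (nsq x)"
  by (simp add: l2_norm_def nsq_def)

lemma nsq_nonneg [simp]: "nsq x \<ge> 0"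
  unfolding nsq_def by (rule infsum_nonneg) auto

lemma l2_norm_sq: "(l2_norm x)\<^sup>2 = nsq x"
  by (simp add: l2_norm_nsq)

lemma ell2_outside: "x \<in> ell2 I \<Longrightarrow> i \<notin> I \<Longrightarrow> x i = 0"
  by (simp add: ell2_iff)

lemma ell2_summable: "x \<in> ell2 I \<Longrightarrow> (\<lambda>i. (cmod (x i))\<^sup>2) summable_on UNIV"
  by (simp add: ell2_iff)

lemma zero_ell2 [simp]: "(\<lambda>i. 0) \<in> ell2 I"
  by (simp add: ell2_iff)

lemma cmod_add_sq: "(cmod (a + b))\<^sup>2 \<le> 2 * (cmod a)\<^sup>2 + 2 * (cmod b)\<^sup>2"
proof -
  have "(cmod (a + b))\<^sup>2 \<le> (cmod a + cmod b)\<^sup>2"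
    by (simp add: norm_triangle_ineq power_mono)
  also have "\<dots> \<le> 2 * (cmod a)\<^sup>2 + 2 * (cmod b)\<^sup>2"
    using zero_le_power2[of "cmod a - cmod b"] by (simp add: power2_eq_square algebra_simps)
  finally show ?thesis .
qed

lemma ell2_add:
  assumes "x \<in> ell2 I" "y \<in> ell2 I"
  shows "(\<lambda>i. x i + y i) \<in> ell2 I" "nsq (\<lambda>i. x i + y i) \<le> 2 * nsq x + 2 * nsq y"
proof -
  have s: "(\<lambda>i. 2 * (cmod (x i))\<^sup>2 + 2 * (cmod (y i))\<^sup>2) summable_on UNIV"
    using assms by (intro summable_on_add summable_on_cmult_right) (auto simp: ell2_iff)
  have s': "(\<lambda>i. (cmod (x i + y i))\<^sup>2) summable_on UNIV"
    by (rule summable_on_comparison_test[OF s]) (auto simp: cmod_add_sq)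
  then show "(\<lambda>i. x i + y i) \<in> ell2 I" using assms by (simp add: ell2_iff)
  have "nsq (\<lambda>i. x i + y i) \<le> (\<Sum>\<^sub>\<infinity>i. 2 * (cmod (x i))\<^sup>2 + 2 * (cmod (y i))\<^sup>2)"
    unfolding nsq_def by (rule infsum_mono[OF s' s]) (auto simp: cmod_add_sq)
  also have "\<dots> = 2 * nsq x + 2 * nsq y"
    unfolding nsq_def using assms
    by (subst infsum_add) (auto intro!: summable_on_cmult_right simp: ell2_iff infsum_cmult_right)
  finally show "nsq (\<lambda>i. x i + y i) \<le> 2 * nsq x + 2 * nsq y" .
qed

lemma nsq_scale: "nsq (\<lambda>i. c * x i) = (cmod c)\<^sup>2 * nsq x"
  unfolding nsq_def by (simp add: norm_mult power_mult_distrib infsum_cmult_right')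

lemma ell2_scale: "x \<in> ell2 I \<Longrightarrow> (\<lambda>i. c * x i) \<in> ell2 I"
  by (auto simp: ell2_iff norm_mult power_mult_distrib intro!: summable_on_cmult_right)

lemma ell2_sum:
  assumes "finite A" "\<And>k. k \<in> A \<Longrightarrow> u k \<in> ell2 I"
  shows "(\<lambda>i. \<Sum>k\<in>A. u k i) \<in> ell2 I"
  using assms by (induction A) (auto intro: ell2_add)

lemma ell2_coord:
  assumes "x \<in> ell2 I" shows "(cmod (x i))\<^sup>2 \<le> nsq x"
  using finite_sum_le_infsum[OF ell2_summable[OF assms], of "{i}"] by (simp add: nsq_def)

lemma nsq_finite:
  assumes "finite A" "\<And>i. i \<notin> A \<Longrightarrow> x i = 0"
  shows "nsq x = (\<Sum>i\<in>A. (cmod (x i))\<^sup>2)"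
proof -
  have "nsq x = infsum (\<lambda>i. (cmod (x i))\<^sup>2) A"
    unfolding nsq_def by (rule infsum_cong_neutral) (use assms in auto)
  then show ?thesis using assms by simp
qed

lemma finite_support_ell2:
  assumes "finite A" "A \<subseteq> I" "\<And>i. i \<notin> A \<Longrightarrow> x i = 0"
  shows "x \<in> ell2 I"
proof -
  have "(\<lambda>i. (cmod (x i))\<^sup>2) summable_on UNIV \<longleftrightarrow> (\<lambda>i. (cmod (x i))\<^sup>2) summable_on A"
    by (rule summable_on_cong_neutral) (use assms in auto)
  then show ?thesis using assms by (auto simp: ell2_iff)
qed

lemma delta_ell2: "i \<in> I \<Longrightarrow> delta i \<in> ell2 I"
  by (rule finite_support_ell2[of "{i}"]) (auto simp: delta_def)

lemma bop_ell2: "T \<in> bop I \<Longrightarrow> x \<in> ell2 I \<Longrightarrow> T x \<in> ell2 I"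
  and bop_out: "T \<in> bop I \<Longrightarrow> x \<notin> ell2 I \<Longrightarrow> T x = (\<lambda>i. 0)"
  and bop_add: "T \<in> bop I \<Longrightarrow> x \<in> ell2 I \<Longrightarrow> y \<in> ell2 I \<Longrightarrow> T (\<lambda>i. x i + y i) = (\<lambda>i. T x i + T y i)"
  and bop_scale: "T \<in> bop I \<Longrightarrow> x \<in> ell2 I \<Longrightarrow> T (\<lambda>i. c * x i) = (\<lambda>i. c * T x i)"
  by (auto simp: bop_def)

lemma bop_zero: "T \<in> bop I \<Longrightarrow> T (\<lambda>i. 0) = (\<lambda>i. 0)"
  using bop_scale[of T I "\<lambda>i. 0" 0] by simp

lemma bop_in: "T \<in> bop I \<Longrightarrow> T x \<in> ell2 I"
  by (cases "x \<in> ell2 I") (auto simp: bop_ell2 bop_out)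

lemma bop_sum:
  assumes "T \<in> bop I" "finite A" "\<And>k. k \<in> A \<Longrightarrow> u k \<in> ell2 I"
  shows "T (\<lambda>i. \<Sum>k\<in>A. c k * u k i) = (\<lambda>i. \<Sum>k\<in>A. c k * T (u k) i)"
  using assms(2,3)
proof (induction A)
  case (insert k A)
  then show ?case
    using bop_add[OF assms(1) ell2_scale[of "u k" I "c k"], of "\<lambda>i. \<Sum>k\<in>A. c k * u k i"]
    by (auto simp: ell2_sum ell2_scale bop_scale[OF assms(1)])
qed (simp add: bop_zero[OF assms(1)])

text \<open>The constant in \<open>bop\<close> may have any sign; its square is a nonnegative bound
  for squared norms, the form in which all estimates below are made.\<close>

lemma bop_bound:
  assumes "T \<in> bop I"
  obtains C where "C \<ge> 0" "\<And>x. x \<in> ell2 I \<Longrightarrow> nsq (T x) \<le> C * nsq x"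
proof -
  obtain C where C: "\<forall>x\<in>ell2 I. l2_norm (T x) \<le> C * l2_norm x" using assms by (auto simp: bop_def)
  have "nsq (T x) \<le> C\<^sup>2 * nsq x" if "x \<in> ell2 I" for x
  proof -
    have "(l2_norm (T x))\<^sup>2 \<le> (C * l2_norm x)\<^sup>2"
      using C that by (intro power_mono) (auto simp: l2_norm_nsq)
    then show ?thesis by (simp add: power_mult_distrib l2_norm_sq)
  qed
  then show ?thesis using that[of "C\<^sup>2"] by simp
qed

lemma bopI:
  assumes "\<And>x. x \<in> ell2 I \<Longrightarrow> T x \<in> ell2 I"
    and "\<And>x. x \<notin> ell2 I \<Longrightarrow> T x = (\<lambda>i. 0)"
    and "\<And>x y. x \<in> ell2 I \<Longrightarrow> y \<in> ell2 I \<Longrightarrow> T (\<lambda>i. x i + y i) = (\<lambda>i. T x i + T y i)"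
    and "\<And>c x. x \<in> ell2 I \<Longrightarrow> T (\<lambda>i. c * x i) = (\<lambda>i. c * T x i)"
    and "\<And>x. x \<in> ell2 I \<Longrightarrow> nsq (T x) \<le> C * nsq x"
  shows "T \<in> bop I"
proof -
  have "l2_norm (T x) \<le> sqrt C * l2_norm x" if "x \<in> ell2 I" for x
    using assms(5)[OF that] by (simp add: l2_norm_nsq flip: real_sqrt_mult)
  then show ?thesis using assms(1-4) by (auto simp: bop_def)
qed

lemma op_id_bop: "op_id I \<in> bop I"
  by (rule bopI[where C = 1]) (auto simp: op_id_def ell2_add ell2_scale)

lemma op_zero_bop: "op_zero \<in> bop I"
  by (rule bopI[where C = 0]) (auto simp: op_zero_def nsq_def)

lemma op_add_bop:
  assumes "S \<in> bop I" "T \<in> bop I" shows "op_add S T \<in> bop I"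
proof -
  obtain C where C: "C \<ge> 0" "\<And>x. x \<in> ell2 I \<Longrightarrow> nsq (S x) \<le> C * nsq x" using bop_bound assms(1) by blast
  obtain D where D: "D \<ge> 0" "\<And>x. x \<in> ell2 I \<Longrightarrow> nsq (T x) \<le> D * nsq x" using bop_bound assms(2) by blast
  show ?thesis
  proof (rule bopI[where C = "2 * C + 2 * D"])
    fix x assume x: "x \<in> ell2 I"
    show "nsq (op_add S T x) \<le> (2 * C + 2 * D) * nsq x"
      using ell2_add(2)[OF bop_ell2[OF assms(1) x] bop_ell2[OF assms(2) x]] C(2)[OF x] D(2)[OF x]
      by (simp add: op_add_def algebra_simps)
  qed (use assms in \<open>auto simp: op_add_def bop_ell2 ell2_add bop_out bop_add bop_scale algebra_simps\<close>)
qed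

lemma op_scale_bop:
  assumes "T \<in> bop I" shows "op_scale c T \<in> bop I"
proof -
  obtain D where D: "D \<ge> 0" "\<And>x. x \<in> ell2 I \<Longrightarrow> nsq (T x) \<le> D * nsq x" using bop_bound assms(1) by blast
  show ?thesis
  proof (rule bopI[where C = "(cmod c)\<^sup>2 * D"])
    fix x assume x: "x \<in> ell2 I"
    show "nsq (op_scale c T x) \<le> (cmod c)\<^sup>2 * D * nsq x"
      using mult_left_mono[OF D(2)[OF x], of "(cmod c)\<^sup>2"]
      by (simp add: op_scale_def nsq_scale mult.assoc)
  qed (use assms in \<open>auto simp: op_scale_def bop_ell2 ell2_scale bop_out bop_add bop_scale algebra_simps\<close>)
qed

lemma comp_bop:
  assumes "S \<in> bop I" "T \<in> bop I" shows "S \<circ> T \<in> bop I"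
proof -
  obtain C where C: "C \<ge> 0" "\<And>x. x \<in> ell2 I \<Longrightarrow> nsq (S x) \<le> C * nsq x" using bop_bound assms(1) by blast
  obtain D where D: "D \<ge> 0" "\<And>x. x \<in> ell2 I \<Longrightarrow> nsq (T x) \<le> D * nsq x" using bop_bound assms(2) by blast
  show ?thesis
  proof (rule bopI[where C = "C * D"])
    fix x assume x: "x \<in> ell2 I"
    show "nsq ((S \<circ> T) x) \<le> C * D * nsq x"
      using C(2)[OF bop_ell2[OF assms(2) x]] mult_left_mono[OF D(2)[OF x] C(1)]
      by (simp add: mult.assoc)
  qed (use assms in \<open>auto simp: bop_ell2 bop_out bop_add bop_scale bop_zero\<close>)
qed

text \<open>Finitely supported vectors are dense, so bounded operators agree as soon as they agree on the
  canonical basis.\<close>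

lemma bop_eqI:
  assumes S: "S \<in> bop I" and T: "T \<in> bop I" and eq: "\<And>i. i \<in> I \<Longrightarrow> S (delta i) = T (delta i)"
  shows "S = T"
proof
  fix x
  define D where "D = op_add S (op_scale (-1) T)"
  have D: "D \<in> bop I" using S T by (simp add: D_def op_add_bop op_scale_bop)
  have D0: "D (delta i) = (\<lambda>_. 0)" if "i \<in> I" for i
    using eq[OF that] by (simp add: D_def op_add_def op_scale_def)
  obtain C where C: "C \<ge> 0" "\<And>x. x \<in> ell2 I \<Longrightarrow> nsq (D x) \<le> C * nsq x" using bop_bound D by blast
  show "S x = T x"
  proof (cases "x \<in> ell2 I")
    case x: True
    \<comment> \<open>Cut \<open>x\<close> into a finite part \<open>y\<close> and a remainder
      \<open>r\<close> with \<open>nsq r \<le> e\<close>. The difference \<open>D\<close> kills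
      \<open>y\<close>, so \<open>D x = D r\<close> is small in every coordinate.\<close>
    have small: "(cmod (D x j))\<^sup>2 \<le> C * e" if e: "e > 0" for j e
    proof -
      have "((\<lambda>i. (cmod (x i))\<^sup>2) has_sum nsq x) UNIV"
        using ell2_summable[OF x] by (simp add: nsq_def)
      then have "\<forall>\<^sub>F F in finite_subsets_at_top UNIV. dist (\<Sum>i\<in>F. (cmod (x i))\<^sup>2) (nsq x) < e"
        using e unfolding has_sum_def by (rule tendstoD)
      then obtain F where F: "finite F" "dist (\<Sum>i\<in>F. (cmod (x i))\<^sup>2) (nsq x) < e"
        unfolding eventually_finite_subsets_at_top by blast
      define F' where "F' = F \<inter> I"
      have fF': "finite F'" "F' \<subseteq> I" using F by (auto simp: F'_def)
      have sumF: "(\<Sum>i\<in>F'. (cmod (x i))\<^sup>2) = (\<Sum>i\<in>F. (cmod (x i))\<^sup>2)"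
        unfolding F'_def by (rule sum.mono_neutral_left) (use F ell2_outside[OF x] in auto)
      define y where "y = (\<lambda>i. if i \<in> F' then x i else 0)"
      define r where "r = (\<lambda>i. if i \<in> F' then 0 else x i)"
      have y: "y \<in> ell2 I" by (rule finite_support_ell2[OF fF']) (auto simp: y_def)
      have xyr: "x = (\<lambda>i. y i + r i)" by (auto simp: y_def r_def)
      have r: "r \<in> ell2 I"
      proof -
        have "(\<lambda>i. (cmod (r i))\<^sup>2) summable_on UNIV"
          by (rule summable_on_comparison_test[OF ell2_summable[OF x]]) (auto simp: r_def)
        then show ?thesis using ell2_outside[OF x] by (auto simp: ell2_iff r_def)
      qed
      have "nsq x = nsq y + nsq r"
      proof -
        have "nsq x = (\<Sum>\<^sub>\<infinity>i. (cmod (y i))\<^sup>2 + (cmod (r i))\<^sup>2)"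
          unfolding nsq_def by (rule infsum_cong) (auto simp: y_def r_def)
        then show ?thesis using infsum_add[OF ell2_summable[OF y] ell2_summable[OF r]]
          by (simp add: nsq_def)
      qed
      moreover have "nsq y = (\<Sum>i\<in>F'. (cmod (x i))\<^sup>2)"
        by (subst nsq_finite[OF fF'(1)]) (auto simp: y_def intro!: sum.cong)
      ultimately have nr: "nsq r \<le> e" using F(2) sumF by (auto simp: dist_real_def)
      have ysum: "y = (\<lambda>i. \<Sum>k\<in>F'. x k * delta k i)"
      proof
        fix i show "y i = (\<Sum>k\<in>F'. x k * delta k i)"
          using fF'(1) by (auto simp: y_def delta_def if_distrib cong: if_cong)
      qed
      have "D y = (\<lambda>i. \<Sum>k\<in>F'. x k * D (delta k) i)"
        unfolding ysum by (rule bop_sum[OF D fF'(1)]) (use fF'(2) in \<open>auto intro: delta_ell2\<close>)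
      also have "\<dots> = (\<lambda>i. 0)" by (rule ext) (use fF'(2) in \<open>auto simp: D0 subset_iff intro!: sum.neutral\<close>)
      finally have "D x = D r" using bop_add[OF D y r] xyr by simp
      then have "(cmod (D x j))\<^sup>2 \<le> nsq (D r)" using ell2_coord[OF bop_in[OF D]] by metis
      also have "\<dots> \<le> C * nsq r" using C r by blast
      also have "\<dots> \<le> C * e" using nr C by (simp add: mult_left_mono)
      finally show ?thesis .
    qed
    have sq0: "(cmod (D x j))\<^sup>2 \<le> 0" for j
    proof (rule field_le_epsilon)
      fix e :: real assume e: "e > 0"
      \<comment> \<open>\<open>C\<close> may be 0, hence the division by
        \<open>C + 1\<close>.\<close>
      have "C * (e / (C + 1)) \<le> e" using C(1) e by (simp add: field_simps)
      then show "(cmod (D x j))\<^sup>2 \<le> 0 + e" using small[of "e / (C + 1)" j] e C(1) by simp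
    qed
    then have "D x j = 0" for j using sq0[of j] by simp
    then show ?thesis by (auto simp: D_def op_add_def op_scale_def fun_eq_iff)
  qed (use S T in \<open>simp add: bop_out\<close>)
qed

subsection \<open>Tensor products of operators\<close>

text \<open>Tonelli for the squared moduli, in both orders of summation: rows serve the second
  tensor factor, columns the first.\<close>

lemma ell2_slices:
  assumes "x \<in> ell2 (I \<times> J)"
  shows "(\<lambda>l. x (k, l)) \<in> ell2 J" "(\<lambda>k. x (k, l)) \<in> ell2 I"
    and "(\<lambda>k. nsq (\<lambda>l. x (k, l))) summable_on UNIV"
    and "(\<Sum>\<^sub>\<infinity>k. nsq (\<lambda>l. x (k, l))) = nsq x"
    and "(\<lambda>l. nsq (\<lambda>k. x (k, l))) summable_on UNIV"
    and "(\<Sum>\<^sub>\<infinity>l. nsq (\<lambda>k. x (k, l))) = nsq x"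
proof -
  have s: "(\<lambda>(k, l). (cmod (x (k, l)))\<^sup>2) summable_on UNIV \<times> UNIV"
    using ell2_summable[OF assms] by (simp add: case_prod_unfold)
  have s': "(\<lambda>(l, k). (cmod (x (k, l)))\<^sup>2) summable_on UNIV \<times> UNIV"
    using summable_on_swap[THEN iffD1, OF s] by (simp add: case_prod_unfold)
  have 1: "(\<lambda>l. (cmod (x (k, l)))\<^sup>2) summable_on UNIV" for k
    using summable_on_SigmaD1[OF s, of k] by simp
  have 2: "(\<lambda>k. (cmod (x (k, l)))\<^sup>2) summable_on UNIV" for l
    using summable_on_SigmaD1[OF s', of l] by simp
  show "(\<lambda>l. x (k, l)) \<in> ell2 J" "(\<lambda>k. x (k, l)) \<in> ell2 I"
    using assms 1 2 by (auto simp: ell2_iff)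
  show "(\<lambda>k. nsq (\<lambda>l. x (k, l))) summable_on UNIV"
    unfolding nsq_def using summable_on_SigmaD[OF s] 1 by simp
  show "(\<lambda>l. nsq (\<lambda>k. x (k, l))) summable_on UNIV"
    unfolding nsq_def using summable_on_SigmaD[OF s'] 2 by simp
  show "(\<Sum>\<^sub>\<infinity>k. nsq (\<lambda>l. x (k, l))) = nsq x"
    unfolding nsq_def using infsum_Sigma'_banach[OF s] by (simp add: case_prod_unfold)
  have "(\<Sum>\<^sub>\<infinity>l. nsq (\<lambda>k. x (k, l))) = (\<Sum>\<^sub>\<infinity>k. nsq (\<lambda>l. x (k, l)))"
    unfolding nsq_def by (rule infsum_swap_banach[symmetric]) (rule s)
  then show "(\<Sum>\<^sub>\<infinity>l. nsq (\<lambda>k. x (k, l))) = nsq x"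
    using \<open>(\<Sum>\<^sub>\<infinity>k. nsq (\<lambda>l. x (k, l))) = nsq x\<close> by simp
qed

text \<open>A converse of \<open>ell2_slices\<close>. It works with a majorant \<open>g\<close> of
  the squared row norms, because after an operator has been applied to every row only an upper bound
  for these norms is at hand.\<close>

lemma ell2_from_rows:
  assumes "\<And>k. (\<lambda>l. x (k, l)) \<in> ell2 J" "\<And>k. k \<notin> I \<Longrightarrow> (\<lambda>l. x (k, l)) = (\<lambda>l. 0)"
    and "\<And>k. nsq (\<lambda>l. x (k, l)) \<le> g k" "g summable_on UNIV"
  shows "x \<in> ell2 (I \<times> J)" "nsq x \<le> infsum g UNIV"
proof -
  have g: "(\<lambda>k. nsq (\<lambda>l. x (k, l))) summable_on UNIV"
    by (rule summable_on_comparison_test[OF assms(4)]) (use assms(3) in auto)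
  have "(\<lambda>p. (cmod (x p))\<^sup>2) summable_on UNIV \<times> UNIV"
  proof (rule summable_on_SigmaI[OF _ g])
    show "((\<lambda>l. (cmod (x (k, l)))\<^sup>2) has_sum nsq (\<lambda>l. x (k, l))) UNIV" for k
      unfolding nsq_def using ell2_summable[OF assms(1)] by simp
  qed auto
  moreover have "x p = 0" if "p \<notin> I \<times> J" for p
    using that ell2_outside[OF assms(1)[of "fst p"], of "snd p"] fun_cong[OF assms(2)[of "fst p"], of "snd p"]
    by (cases p) auto
  ultimately show x: "x \<in> ell2 (I \<times> J)" by (auto simp: ell2_iff)
  show "nsq x \<le> infsum g UNIV"
    unfolding ell2_slices(4)[OF x, symmetric] by (rule infsum_mono[OF g assms(4)]) (rule assms(3))
qed

lemma ell2_from_columns: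
  assumes "\<And>l. (\<lambda>k. x (k, l)) \<in> ell2 I" "\<And>l. l \<notin> J \<Longrightarrow> (\<lambda>k. x (k, l)) = (\<lambda>k. 0)"
    and "\<And>l. nsq (\<lambda>k. x (k, l)) \<le> g l" "g summable_on UNIV"
  shows "x \<in> ell2 (I \<times> J)" "nsq x \<le> infsum g UNIV"
proof -
  let ?y = "\<lambda>(l, k). x (k, l)"
  have y: "?y \<in> ell2 (J \<times> I)" "nsq ?y \<le> infsum g UNIV"
    using ell2_from_rows[of ?y I J g] assms by auto
  have s: "(\<lambda>(l, k). (cmod (x (k, l)))\<^sup>2) summable_on UNIV \<times> UNIV"
    using ell2_summable[OF y(1)] by (simp add: case_prod_unfold)
  have "(\<lambda>(k, l). (cmod (x (k, l)))\<^sup>2) summable_on UNIV \<times> UNIV"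
    using summable_on_swap[THEN iffD1, OF s] by (simp add: case_prod_unfold)
  moreover have "x p = 0" if "p \<notin> I \<times> J" for p
    using ell2_outside[OF y(1), of "(snd p, fst p)"] that by (cases p) auto
  ultimately show x: "x \<in> ell2 (I \<times> J)" by (auto simp: ell2_iff case_prod_unfold)
  have "nsq x = nsq ?y"
    using ell2_slices(6)[OF x] ell2_slices(4)[OF y(1)] by simp
  then show "nsq x \<le> infsum g UNIV" using y(2) by simp
qed

text \<open>The tensor product acts on the rows by \<open>T\<close> and then on the columns by
  \<open>S\<close>; each action is bounded slice by slice, and the constants multiply. The second
  claim records the vector between the two actions, which \<open>op_tensor_assoc\<close>
  needs.\<close>

lemma op_tensor_bop:
  assumes S: "S \<in> bop I" and T: "T \<in> bop J"
  shows "op_tensor I J S T \<in> bop (I \<times> J)"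
    and "x \<in> ell2 (I \<times> J) \<Longrightarrow> (\<lambda>(k, j). T (\<lambda>l. x (k, l)) j) \<in> ell2 (I \<times> J)"
proof -
  obtain C where C: "C \<ge> 0" "\<And>x. x \<in> ell2 I \<Longrightarrow> nsq (S x) \<le> C * nsq x" using bop_bound S by blast
  obtain D where D: "D \<ge> 0" "\<And>x. x \<in> ell2 J \<Longrightarrow> nsq (T x) \<le> D * nsq x" using bop_bound T by blast
  have 1: "(\<lambda>(k, j). T (\<lambda>l. x (k, l)) j) \<in> ell2 (I \<times> J)" (is "?y \<in> _")
     "nsq (\<lambda>(k, j). T (\<lambda>l. x (k, l)) j) \<le> D * nsq x" if x: "x \<in> ell2 (I \<times> J)" for x
  proof -
    have g: "(\<lambda>k. D * nsq (\<lambda>l. x (k, l))) summable_on UNIV"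
      using ell2_slices(3)[OF x] by (rule summable_on_cmult_right)
    have "(\<lambda>l. x (k, l)) = (\<lambda>l. 0)" if "k \<notin> I" for k
      using ell2_outside[OF x] that by auto
    then have *: "(\<lambda>j. ?y (k, j)) = (\<lambda>l. 0)" if "k \<notin> I" for k
      using that by (simp add: bop_zero[OF T])
    show "?y \<in> ell2 (I \<times> J)"
      by (rule ell2_from_rows(1)[OF _ * _ g]) (use bop_in[OF T] D ell2_slices(1)[OF x] in auto)
    have "nsq ?y \<le> infsum (\<lambda>k. D * nsq (\<lambda>l. x (k, l))) UNIV"
      by (rule ell2_from_rows(2)[OF _ * _ g]) (use bop_in[OF T] D ell2_slices(1)[OF x] in auto)
    then show "nsq ?y \<le> D * nsq x" by (simp add: infsum_cmult_right' ell2_slices(4)[OF x])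
  qed
  show "x \<in> ell2 (I \<times> J) \<Longrightarrow> (\<lambda>(k, j). T (\<lambda>l. x (k, l)) j) \<in> ell2 (I \<times> J)" by (rule 1)
  have 2: "(\<lambda>(i, j). S (\<lambda>k. x (k, j)) i) \<in> ell2 (I \<times> J)" (is "?y \<in> _")
     "nsq (\<lambda>(i, j). S (\<lambda>k. x (k, j)) i) \<le> C * nsq x" if x: "x \<in> ell2 (I \<times> J)" for x
  proof -
    have g: "(\<lambda>l. C * nsq (\<lambda>k. x (k, l))) summable_on UNIV"
      using ell2_slices(5)[OF x] by (rule summable_on_cmult_right)
    have "(\<lambda>k. x (k, l)) = (\<lambda>k. 0)" if "l \<notin> J" for l
      using ell2_outside[OF x] that by auto
    then have *: "(\<lambda>i. ?y (i, l)) = (\<lambda>l. 0)" if "l \<notin> J" for l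
      using that by (simp add: bop_zero[OF S])
    show "?y \<in> ell2 (I \<times> J)"
      by (rule ell2_from_columns(1)[OF _ * _ g]) (use bop_in[OF S] C ell2_slices(2)[OF x] in auto)
    have "nsq ?y \<le> infsum (\<lambda>l. C * nsq (\<lambda>k. x (k, l))) UNIV"
      by (rule ell2_from_columns(2)[OF _ * _ g]) (use bop_in[OF S] C ell2_slices(2)[OF x] in auto)
    then show "nsq ?y \<le> C * nsq x" by (simp add: infsum_cmult_right' ell2_slices(6)[OF x])
  qed
  have eq: "op_tensor I J S T x = (\<lambda>(i, j). S (\<lambda>k. (\<lambda>(k, j). T (\<lambda>l. x (k, l)) j) (k, j)) i)"
    if "x \<in> ell2 (I \<times> J)" for x
    using that by (simp add: op_tensor_def)
  show "op_tensor I J S T \<in> bop (I \<times> J)"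
  proof (rule bopI[where C = "C * D"])
    fix x assume x: "x \<in> ell2 (I \<times> J)"
    show "op_tensor I J S T x \<in> ell2 (I \<times> J)"
      unfolding eq[OF x] using 2(1)[OF 1(1)[OF x]] by simp
    show "nsq (op_tensor I J S T x) \<le> C * D * nsq x"
      unfolding eq[OF x] mult.assoc
      by (rule order_trans[OF 2(2)[OF 1(1)[OF x]] mult_left_mono[OF 1(2)[OF x] C(1)]])
    have sl: "(\<lambda>k. T (\<lambda>l. x (k, l)) j) \<in> ell2 I" for j
      using ell2_slices(2)[OF 1(1)[OF x]] by simp
    show "op_tensor I J S T (\<lambda>i. c * x i) = (\<lambda>i. c * op_tensor I J S T x i)" for c
      using x by (auto simp: op_tensor_def ell2_scale bop_scale[OF T ell2_slices(1)[OF x]] bop_scale[OF S sl])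
    fix y assume y: "y \<in> ell2 (I \<times> J)"
    have sl': "(\<lambda>k. T (\<lambda>l. y (k, l)) j) \<in> ell2 I" for j
      using ell2_slices(2)[OF 1(1)[OF y]] by simp
    show "op_tensor I J S T (\<lambda>i. x i + y i) = (\<lambda>i. op_tensor I J S T x i + op_tensor I J S T y i)"
      using x y by (auto simp: op_tensor_def ell2_add bop_add[OF T ell2_slices(1)[OF x] ell2_slices(1)[OF y]]
          bop_add[OF S sl sl'])
  qed (auto simp: op_tensor_def)
qed

definition vtensor :: "'i vec \<Rightarrow> 'j vec \<Rightarrow> ('i \<times> 'j) vec" where
  "vtensor u v = (\<lambda>(i, j). u i * v j)"

lemma vtensor_ell2:
  assumes "u \<in> ell2 I" "v \<in> ell2 J" shows "vtensor u v \<in> ell2 (I \<times> J)"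
proof (rule ell2_from_rows(1))
  show "(\<lambda>k. (cmod (u k))\<^sup>2 * nsq v) summable_on UNIV"
    by (intro summable_on_cmult_left ell2_summable[OF assms(1)])
qed (use assms in \<open>auto simp: vtensor_def ell2_scale nsq_scale ell2_outside\<close>)

lemma op_tensor_vtensor:
  assumes S: "S \<in> bop I" and T: "T \<in> bop J" and u: "u \<in> ell2 I" and v: "v \<in> ell2 J"
  shows "op_tensor I J S T (vtensor u v) = vtensor (S u) (T v)"
proof -
  have "(\<lambda>k. T (\<lambda>l. u k * v l) j) = (\<lambda>k. T v j * u k)" for j
    by (auto simp: bop_scale[OF T v])
  then show ?thesis
    using vtensor_ell2[OF u v] by (auto simp: op_tensor_def vtensor_def bop_scale[OF S u])
qed

lemma delta_vtensor: "delta (i, j) = vtensor (delta i) (delta j)"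
  by (auto simp: delta_def vtensor_def fun_eq_iff)

lemma op_tensor_eqI:
  assumes "R \<in> bop (I \<times> J)" "R' \<in> bop (I \<times> J)"
    and "\<And>i j. i \<in> I \<Longrightarrow> j \<in> J \<Longrightarrow> R (vtensor (delta i) (delta j)) = R' (vtensor (delta i) (delta j))"
  shows "R = R'"
  by (rule bop_eqI[OF assms(1,2)]) (use assms(3) in \<open>auto simp: delta_vtensor\<close>)

lemma op_tensor_comp:
  assumes "S \<in> bop I" "S' \<in> bop I" "T \<in> bop J" "T' \<in> bop J"
  shows "op_tensor I J S T \<circ> op_tensor I J S' T' = op_tensor I J (S \<circ> S') (T \<circ> T')"
  by (rule op_tensor_eqI[where I = I and J = J])
     (auto simp: op_tensor_vtensor assms comp_bop op_tensor_bop delta_ell2 bop_ell2)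

lemma op_tensor_assoc:
  fixes I :: "'i set" and J :: "'j set" and K :: "'k set"
  assumes a: "a \<in> bop I" and b: "b \<in> bop J" and c: "c \<in> bop K"
  shows "op_assoc (op_tensor (I \<times> J) K (op_tensor I J a b) c) = op_tensor I (J \<times> K) a (op_tensor J K b c)"
proof
  fix x :: "('i \<times> 'j \<times> 'k) vec"
  define x' where "x' = (\<lambda>((i', j'), k'). x (i', (j', k')))"
  have bij: "bij_betw (\<lambda>((i :: 'i, j :: 'j), k :: 'k). (i, (j, k))) UNIV UNIV"
    by (rule bij_betwI[where g = "\<lambda>(i, (j, k)). ((i, j), k)"]) auto
  have "(\<lambda>p. (cmod (x (case p of ((i, j), k) \<Rightarrow> (i, (j, k)))))\<^sup>2) summable_on UNIV \<longleftrightarrow> (\<lambda>p. (cmod (x p))\<^sup>2) summable_on UNIV"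
    using summable_on_reindex_bij_betw[OF bij, of "\<lambda>p. (cmod (x p))\<^sup>2"]
    by (simp add: case_prod_unfold)
  then have x': "x' \<in> ell2 ((I \<times> J) \<times> K) \<longleftrightarrow> x \<in> ell2 (I \<times> (J \<times> K))"
    unfolding ell2_iff x'_def by (auto simp: case_prod_unfold)
  show "op_assoc (op_tensor (I \<times> J) K (op_tensor I J a b) c) x = op_tensor I (J \<times> K) a (op_tensor J K b c) x"
  proof (cases "x \<in> ell2 (I \<times> (J \<times> K))")
    case True
    \<comment> \<open>By convention \<open>op_tensor I J a b\<close> vanishes outside its Hilbert
      space, so the slice to which it is applied has to be shown to lie inside.\<close>
    have 1: "(\<lambda>q. c (\<lambda>r. x' (q, r)) k) \<in> ell2 (I \<times> J)" for k
      using ell2_slices(2)[OF op_tensor_bop(2)[OF op_id_bop c], of x' "I \<times> J" k] True x' by simp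
    show ?thesis
      using True x' 1 ell2_slices(1)[OF True]
      by (auto simp: op_assoc_def op_tensor_def x'_def[symmetric] fun_eq_iff)
        (auto simp: x'_def case_prod_unfold)
  qed (use x' in \<open>auto simp: op_assoc_def op_tensor_def x'_def[symmetric] fun_eq_iff\<close>)
qed

subsection \<open>Finite resolutions of the identity\<close>

definition lin :: "'k set \<Rightarrow> ('k \<Rightarrow> 'i oper) \<Rightarrow> ('k \<Rightarrow> complex) \<Rightarrow> 'i oper" where
  "lin X p c = (\<lambda>x i. \<Sum>k\<in>X. c k * p k x i)"

lemma lin_cong: "(\<And>k. k \<in> X \<Longrightarrow> c k = d k) \<Longrightarrow> (\<And>k. k \<in> X \<Longrightarrow> p k = q k) \<Longrightarrow> lin X p c = lin X q d"
  by (simp add: lin_def)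

lemma lin_add: "op_add (lin X p c) (lin X p d) = lin X p (\<lambda>k. c k + d k)"
  by (simp add: op_add_def lin_def sum.distrib distrib_right)

lemma lin_scale: "op_scale a (lin X p c) = lin X p (\<lambda>k. a * c k)"
  by (simp add: op_scale_def lin_def sum_distrib_left mult.assoc)

lemma lin_insert: "finite A \<Longrightarrow> k \<notin> A \<Longrightarrow> lin (insert k A) p c = op_add (op_scale (c k) (p k)) (lin A p c)"
  by (simp add: lin_def op_add_def op_scale_def)

lemma lin_mono_neutral: "finite X \<Longrightarrow> A \<subseteq> X \<Longrightarrow> lin A p c = lin X p (\<lambda>k. if k \<in> A then c k else 0)"
  unfolding lin_def by (intro ext sum.mono_neutral_cong_left) auto

lemma lin_single: "finite X \<Longrightarrow> k \<in> X \<Longrightarrow> lin X p (\<lambda>l. if l = k then 1 else 0) = p k"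
  by (auto simp: lin_def if_distrib[of "\<lambda>c. c * _"] cong: if_cong)

lemma lin_bop: "finite X \<Longrightarrow> (\<And>k. k \<in> X \<Longrightarrow> p k \<in> bop I) \<Longrightarrow> lin X p c \<in> bop I"
proof (induction X rule: finite_induct)
  case empty
  show ?case using op_zero_bop by (simp add: lin_def op_zero_def)
qed (simp add: lin_insert op_add_bop op_scale_bop)

lemma lin_comp_right: "lin X p c \<circ> T = lin X (\<lambda>k. p k \<circ> T) c"
  by (auto simp: lin_def)

lemma lin_comp_left:
  assumes "T \<in> bop I" "finite X" "\<And>k. k \<in> X \<Longrightarrow> p k \<in> bop I"
  shows "T \<circ> lin X p c = lin X (\<lambda>k. T \<circ> p k) c"
proof
  fix x show "(T \<circ> lin X p c) x = lin X (\<lambda>k. T \<circ> p k) c x"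
    using bop_sum[OF assms(1,2), of "\<lambda>k. p k x" c] bop_in[OF assms(3)] by (simp add: lin_def)
qed

text \<open>Linearity of \<open>f\<close> is available on the span only. The induction over subsets
  \<open>A\<close> of \<open>X\<close> stays inside it, since a partial sum is a full sum with some
  coefficients 0.\<close>

lemma lin_map:
  assumes "finite X"
    and add: "\<And>a b. a \<in> range (lin X p) \<Longrightarrow> b \<in> range (lin X p) \<Longrightarrow> f (op_add a b) = op_add (f a) (f b)"
    and scale: "\<And>c a. a \<in> range (lin X p) \<Longrightarrow> f (op_scale c a) = op_scale c (f a)"
  shows "f (lin X p c) = lin X (\<lambda>k. f (p k)) c"
proof -
  have "f (lin A p c) = lin A (\<lambda>k. f (p k)) c" if "finite A" "A \<subseteq> X" for A
    using that
  proof (induction A)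
    case empty
    have "lin {} p c = op_scale 0 (lin X p c)" by (simp add: lin_def op_scale_def)
    then have "f (lin {} p c) = op_scale 0 (f (lin X p c))" by (simp add: scale)
    then show ?case by (simp add: lin_def op_scale_def)
  next
    case (insert k A)
    then have p: "p k \<in> range (lin X p)" using lin_single[OF assms(1), of k p] by (metis insert_subset rangeI)
    have "f (op_add (op_scale (c k) (p k)) (lin A p c)) = op_add (f (op_scale (c k) (p k))) (f (lin A p c))"
    proof (rule add)
      show "op_scale (c k) (p k) \<in> range (lin X p)" using p by (auto simp: lin_scale)
      show "lin A p c \<in> range (lin X p)" using lin_mono_neutral[OF assms(1), of A p c] insert.prems by simp
    qed
    then show ?case using insert by (simp add: lin_insert scale[OF p])
  qed
  then show ?thesis using assms(1) by blast
qed

lemma l2_inner_delta: "l2_inner (delta i) y = y i"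
proof -
  have "l2_inner (delta i) y = infsum (\<lambda>j. cnj (delta i j) * y j) {i}"
    unfolding l2_inner_def by (rule infsum_cong_neutral) (auto simp: delta_def)
  then show ?thesis by (simp add: delta_def)
qed

text \<open>A crude substitute for Cauchy-Schwarz: termwise |ab| is at most |a|^2 + |b|^2, which
  already gives absolute convergence.\<close>

lemma l2_inner_summable:
  assumes "x \<in> ell2 I" "y \<in> ell2 I"
  shows "(\<lambda>i. cnj (x i) * y i) summable_on UNIV" "cmod (l2_inner x y) \<le> nsq x + nsq y"
proof -
  have s: "(\<lambda>i. (cmod (x i))\<^sup>2 + (cmod (y i))\<^sup>2) summable_on UNIV"
    by (intro summable_on_add ell2_summable[OF assms(1)] ell2_summable[OF assms(2)])
  have le: "norm (cnj (x i) * y i) \<le> (cmod (x i))\<^sup>2 + (cmod (y i))\<^sup>2" for i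
  proof -
    have "cmod (x i) * cmod (y i) \<le> 2 * (cmod (x i) * cmod (y i))" by simp
    also have "\<dots> \<le> (cmod (x i))\<^sup>2 + (cmod (y i))\<^sup>2"
      using sum_squares_bound[of "cmod (x i)" "cmod (y i)"] by simp
    finally show ?thesis by (simp add: norm_mult)
  qed
  have a: "(\<lambda>i. norm (cnj (x i) * y i)) summable_on UNIV"
    by (rule summable_on_comparison_test[OF s]) (use le in auto)
  then show "(\<lambda>i. cnj (x i) * y i) summable_on UNIV"
    by (rule abs_summable_summable)
  have "cmod (l2_inner x y) \<le> (\<Sum>\<^sub>\<infinity>i. norm (cnj (x i) * y i))"
    unfolding l2_inner_def by (rule norm_infsum_bound[OF a])
  also have "\<dots> \<le> (\<Sum>\<^sub>\<infinity>i. (cmod (x i))\<^sup>2 + (cmod (y i))\<^sup>2)"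
    by (rule infsum_mono[OF a s]) (rule le)
  also have "\<dots> = nsq x + nsq y"
    unfolding nsq_def by (rule infsum_add[OF ell2_summable[OF assms(1)] ell2_summable[OF assms(2)]])
  finally show "cmod (l2_inner x y) \<le> nsq x + nsq y" .
qed

lemma l2_inner_add:
  assumes "x \<in> ell2 I" "y \<in> ell2 I" "z \<in> ell2 I"
  shows "l2_inner x (\<lambda>i. y i + z i) = l2_inner x y + l2_inner x z"
  unfolding l2_inner_def
  using infsum_add[OF l2_inner_summable(1)[OF assms(1,2)] l2_inner_summable(1)[OF assms(1,3)]]
  by (simp add: distrib_left)

lemma l2_inner_scale: "l2_inner x (\<lambda>i. c * y i) = c * l2_inner x y"
  unfolding l2_inner_def by (simp add: mult.left_commute infsum_cmult_right')

text \<open>The defining series converges absolutely by \<open>l2_inner_summable\<close>, so it may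
  be added and scaled termwise.\<close>

lemma normal_functional_linear:
  assumes "normal_functional I (bop I) \<omega>"
  shows "S \<in> bop I \<Longrightarrow> T \<in> bop I \<Longrightarrow> \<omega> (op_add S T) = \<omega> S + \<omega> T"
    and "T \<in> bop I \<Longrightarrow> \<omega> (op_scale c T) = c * \<omega> T"
proof -
  obtain \<xi> \<eta> where e: "\<And>n. \<xi> n \<in> ell2 I" "\<And>n. \<eta> n \<in> ell2 I"
    and s: "summable (\<lambda>n. nsq (\<xi> n))" "summable (\<lambda>n. nsq (\<eta> n))"
    and \<omega>: "\<And>a. a \<in> bop I \<Longrightarrow> \<omega> a = (\<Sum>n. l2_inner (\<xi> n) (a (\<eta> n)))"
    using assms unfolding normal_functional_def l2_norm_sq by blast
  have summ: "summable (\<lambda>n. l2_inner (\<xi> n) (a (\<eta> n)))" if a: "a \<in> bop I" for a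
  proof -
    obtain C where C: "C \<ge> 0" "\<And>x. x \<in> ell2 I \<Longrightarrow> nsq (a x) \<le> C * nsq x" using bop_bound a by blast
    show ?thesis
    proof (rule summable_comparison_test')
      show "summable (\<lambda>n. nsq (\<xi> n) + C * nsq (\<eta> n))" by (intro summable_add summable_mult s)
      show "norm (l2_inner (\<xi> n) (a (\<eta> n))) \<le> nsq (\<xi> n) + C * nsq (\<eta> n)" if "n \<ge> 0" for n
        using l2_inner_summable(2)[OF e(1)[of n] bop_in[OF a, of "\<eta> n"]] C(2)[OF e(2)[of n]] by simp
    qed
  qed
  show "\<omega> (op_add S T) = \<omega> S + \<omega> T" if "S \<in> bop I" "T \<in> bop I"
  proof -
    have "\<omega> (op_add S T) = (\<Sum>n. l2_inner (\<xi> n) (S (\<eta> n)) + l2_inner (\<xi> n) (T (\<eta> n)))"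
      using that by (simp add: \<omega> op_add_bop) (simp add: op_add_def l2_inner_add[OF e(1) bop_in bop_in])
    then show ?thesis using that by (simp add: \<omega> suminf_add[OF summ summ])
  qed
  show "\<omega> (op_scale c T) = c * \<omega> T" if "T \<in> bop I"
  proof -
    have "\<omega> (op_scale c T) = (\<Sum>n. c * l2_inner (\<xi> n) (T (\<eta> n)))"
      using that by (simp add: \<omega> op_scale_bop) (simp add: op_scale_def l2_inner_scale)
    then show ?thesis using that by (simp add: \<omega> suminf_mult[OF summ])
  qed
qed

lemma normal_functional_lin:
  assumes "normal_functional I (bop I) \<omega>" "finite X" "\<And>k. k \<in> X \<Longrightarrow> F k \<in> bop I"
  shows "\<omega> (lin X F c) = (\<Sum>k\<in>X. c k * \<omega> (F k))"
  using assms(2,3)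
proof (induction X rule: finite_induct)
  case empty
  have "lin {} F c = op_scale 0 op_zero" by (simp add: lin_def op_scale_def op_zero_def)
  then show ?case using normal_functional_linear(2)[OF assms(1) op_zero_bop, of 0] by simp
qed (simp add: lin_insert normal_functional_linear[OF assms(1)] op_scale_bop lin_bop)

text \<open>A faithful copy of the functions on the finite set \<open>X\<close> inside the operators
  on the Hilbert space of \<open>I\<close>, with \<open>p k\<close> in the role of the indicator of
  \<open>k\<close>. The ranges of the \<open>p k\<close> may have any nonzero dimension, as required
  for competing quantum groups on arbitrary Hilbert spaces.\<close>

locale resolution =
  fixes I :: "'i set" and X :: "'k set" and p :: "'k \<Rightarrow> 'i oper"
  assumes fin: "finite X"
    and p_bop: "k \<in> X \<Longrightarrow> p k \<in> bop I"
    and p_idem: "k \<in> X \<Longrightarrow> p k \<circ> p k = p k"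
    and p_orth: "k \<in> X \<Longrightarrow> l \<in> X \<Longrightarrow> k \<noteq> l \<Longrightarrow> p k \<circ> p l = op_zero"
    and p_nonzero: "k \<in> X \<Longrightarrow> p k \<noteq> op_zero"
    and p_sum: "lin X p (\<lambda>_. 1) = op_id I"
begin

abbreviation L where "L \<equiv> lin X p"

lemma L_bop: "L c \<in> bop I"
  by (rule lin_bop[OF fin p_bop])

lemma p_in: "k \<in> X \<Longrightarrow> p k \<in> range L"
  using lin_single[OF fin, of k p] by (metis rangeI)

lemma L_p: "k \<in> X \<Longrightarrow> L c \<circ> p k = op_scale (c k) (p k)"
proof -
  assume k: "k \<in> X"
  have "(\<Sum>l\<in>X. c l * p l (p k x) i) = (\<Sum>l\<in>X. if l = k then c k * p k x i else 0)" for x i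
  proof (rule sum.cong[OF HOL.refl])
    fix l assume l: "l \<in> X"
    show "c l * p l (p k x) i = (if l = k then c k * p k x i else 0)"
      using fun_cong[OF p_idem[OF k], of x] fun_cong[OF p_orth[OF l k], of x]
      by (auto simp: op_zero_def)
  qed
  then show ?thesis using k fin by (auto simp: lin_def op_scale_def fun_eq_iff)
qed

lemma p_L: "k \<in> X \<Longrightarrow> p k \<circ> L c = op_scale (c k) (p k)"
proof -
  assume k: "k \<in> X"
  have "(\<Sum>l\<in>X. c l * p k (p l x) i) = (\<Sum>l\<in>X. if l = k then c k * p k x i else 0)" for x i
  proof (rule sum.cong[OF HOL.refl])
    fix l assume l: "l \<in> X"
    show "c l * p k (p l x) i = (if l = k then c k * p k x i else 0)"
      using fun_cong[OF p_idem[OF k], of x] fun_cong[OF p_orth[OF k l], of x]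
      by (auto simp: op_zero_def)
  qed
  then show ?thesis
    using k fin by (subst lin_comp_left[OF p_bop fin p_bop]) (auto simp: lin_def op_scale_def fun_eq_iff)
qed

lemma L_comp: "L c \<circ> L d = L (\<lambda>k. c k * d k)"
proof -
  have "L c \<circ> L d = lin X (\<lambda>k. L c \<circ> p k) d" by (rule lin_comp_left[OF L_bop fin p_bop])
  also have "\<dots> = lin X (\<lambda>k. op_scale (c k) (p k)) d" by (rule lin_cong) (auto simp: L_p)
  also have "\<dots> = L (\<lambda>k. c k * d k)" by (simp add: lin_def op_scale_def mult_ac)
  finally show ?thesis .
qed

lemma L_eq_iff: "L c = L d \<longleftrightarrow> (\<forall>k\<in>X. c k = d k)"
proof
  assume eq: "L c = L d"
  show "\<forall>k\<in>X. c k = d k"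
  proof
    fix k assume k: "k \<in> X"
    have "op_scale (c k) (p k) = op_scale (d k) (p k)" using L_p[OF k, of c] L_p[OF k, of d] eq by simp
    moreover obtain x i where "p k x i \<noteq> 0"
      using p_nonzero[OF k] by (auto simp: op_zero_def fun_eq_iff)
    ultimately show "c k = d k" by (metis mult_cancel_right op_scale_def)
  qed
next
  assume "\<forall>k\<in>X. c k = d k"
  then show "L c = L d" by (intro lin_cong) auto
qed

text \<open>The coordinate \<open>i\<close>, in which \<open>v\<close> does not vanish, serves as a
  linear functional on the range of \<open>p k\<close>, so that no vector has to be
  normalized.\<close>

lemma unit_vector:
  assumes "k \<in> X"
  obtains v i where "v \<in> ell2 I" "i \<in> I" "p k v = v" "v i \<noteq> 0"
proof -
  obtain x i where x: "p k x i \<noteq> 0"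
    using p_nonzero[OF assms] by (auto simp: op_zero_def fun_eq_iff)
  show ?thesis
  proof (rule that[of "p k x" i])
    show "p k x \<in> ell2 I" using bop_in[OF p_bop[OF assms]] .
    then show "i \<in> I" using x ell2_outside by metis
    show "p k (p k x) = p k x" using fun_cong[OF p_idem[OF assms]] by simp
  qed (rule x)
qed

text \<open>The rank one operators supported on the range of a single \<open>p k\<close> lie in the commutant, which
  forces the elements of the bicommutant to act as scalars there.\<close>

lemma bicommutant:
  assumes "p ` X \<subseteq> G" "G \<subseteq> range L"
  shows "commutant I (commutant I G) = range L"
proof
  show "range L \<subseteq> commutant I (commutant I G)"
  proof
    fix T assume "T \<in> range L"
    then obtain c where c: "T = L c" by blast
    show "T \<in> commutant I (commutant I G)"
      unfolding commutant_def
    proof (intro CollectI conjI ballI)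
      show "T \<in> bop I" using c L_bop by simp
      fix a assume "a \<in> {T \<in> bop I. \<forall>a\<in>G. T \<circ> a = a \<circ> T}"
      then have a: "a \<in> bop I" "\<And>k. k \<in> X \<Longrightarrow> a \<circ> p k = p k \<circ> a" using assms by auto
      have "a \<circ> T = lin X (\<lambda>k. a \<circ> p k) c" unfolding c by (rule lin_comp_left[OF a(1) fin p_bop])
      also have "\<dots> = T \<circ> a" unfolding c lin_comp_right by (rule lin_cong) (auto simp: a)
      finally show "T \<circ> a = a \<circ> T" by simp
    qed
  qed
  show "commutant I (commutant I G) \<subseteq> range L"
  proof
    fix T assume "T \<in> commutant I (commutant I G)"
    then have T: "T \<in> bop I" "\<And>S. S \<in> bop I \<Longrightarrow> (\<And>a. a \<in> G \<Longrightarrow> S \<circ> a = a \<circ> S) \<Longrightarrow> T \<circ> S = S \<circ> T"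
      by (auto simp: commutant_def)
    have "\<exists>c. T \<circ> p k = op_scale c (p k)" if k: "k \<in> X" for k
    proof -
      obtain v i where v: "v \<in> ell2 I" "i \<in> I" "p k v = v" "v i \<noteq> 0" using unit_vector[OF k] by blast
      have "T y = (\<lambda>j. (p k (T v) i / v i) * y j)" if y: "y \<in> ell2 I" "p k y = y" for y
      proof -
        \<comment> \<open>\<open>S\<close> has rank one, with image spanned by \<open>y\<close>. It
          commutes with the span, because an element \<open>L c\<close> acts by the same scalar
          \<open>c k\<close> on the range of \<open>p k\<close> and on \<open>y\<close>. Comparing
          \<open>T \<circ> S\<close> with \<open>S \<circ> T\<close> at \<open>v\<close> then shows
          that \<open>T\<close> scales \<open>y\<close> by a factor that does not depend on
          \<open>y\<close>.\<close>
        define S where "S = (\<lambda>x j. p k x i * y j)"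
        obtain C where C: "C \<ge> 0" "\<And>x. x \<in> ell2 I \<Longrightarrow> nsq (p k x) \<le> C * nsq x"
          using bop_bound p_bop[OF k] by blast
        have ys: "(\<lambda>j. y j * e) \<in> ell2 I" for e using ell2_scale[OF y(1), of e] by (simp add: mult.commute)
        have S: "S \<in> bop I"
        proof (rule bopI[where C = "C * nsq y"])
          fix x assume x: "x \<in> ell2 I"
          have "nsq (S x) = (cmod (p k x i))\<^sup>2 * nsq y" by (simp add: S_def nsq_scale)
          also have "\<dots> \<le> C * nsq x * nsq y"
            using ell2_coord[OF bop_in[OF p_bop[OF k]], of x i] C(2)[OF x]
            by (intro mult_right_mono) auto
          finally show "nsq (S x) \<le> C * nsq y * nsq x" by (simp add: mult_ac)
        qed (auto simp: S_def ys bop_out[OF p_bop[OF k]] bop_add[OF p_bop[OF k]]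
            bop_scale[OF p_bop[OF k]] algebra_simps)
        have "T \<circ> S = S \<circ> T"
        proof (rule T(2)[OF S])
          fix a assume "a \<in> G"
          then have "a \<in> range L" using assms(2) by (rule rev_subsetD)
          then obtain c where c: "a = L c" by (rule rangeE)
          have 1: "p k (a x) = (\<lambda>j. c k * p k x j)" for x
            using fun_cong[OF p_L[OF k, of c], of x] by (simp add: c op_scale_def)
          have 2: "a y = (\<lambda>j. c k * y j)"
            using fun_cong[OF L_p[OF k, of c], of y] y(2) by (simp add: c op_scale_def)
          have 3: "a (\<lambda>j. e * y j) = (\<lambda>j. e * a y j)" for e using bop_scale[OF L_bop y(1)] c by simp
          show "S \<circ> a = a \<circ> S"
            by (rule ext) (simp only: comp_apply S_def 1 2 3, simp add: mult_ac)
        qed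
        then have "T (S v) = S (T v)" by (metis comp_apply)
        moreover have "T (S v) = (\<lambda>j. v i * T y j)"
          using bop_scale[OF T(1) y(1)] v(3) by (simp add: S_def)
        ultimately have "v i * T y j = p k (T v) i * y j" for j by (metis S_def)
        then show ?thesis using v(4) by (auto simp: field_simps)
      qed
      from this[of "p k x" for x] have "T (p k x) = (\<lambda>j. (p k (T v) i / v i) * p k x j)" for x
        using bop_in[OF p_bop[OF k]] fun_cong[OF p_idem[OF k]] by simp
      then have "T \<circ> p k = op_scale (p k (T v) i / v i) (p k)" by (auto simp: op_scale_def)
      then show ?thesis ..
    qed
    then obtain c where c: "\<And>k. k \<in> X \<Longrightarrow> T \<circ> p k = op_scale (c k) (p k)" by metis
    have "T x = T (op_id I x)" for x
      using bop_zero[OF T(1)] bop_out[OF T(1), of x] by (simp add: op_id_def)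
    then have "T = T \<circ> op_id I" by (simp add: fun_eq_iff)
    also have "\<dots> = lin X (\<lambda>k. T \<circ> p k) (\<lambda>_. 1)"
      unfolding p_sum[symmetric] by (rule lin_comp_left[OF T(1) fin p_bop])
    also have "\<dots> = lin X (\<lambda>k. op_scale (c k) (p k)) (\<lambda>_. 1)" by (rule lin_cong) (auto simp: c)
    also have "\<dots> = L c" by (simp add: lin_def op_scale_def)
    finally show "T \<in> range L" by simp
  qed
qed

text \<open>On a finite-dimensional span every linear functional is a finite sum of vector
  functionals: \<open>\<xi>\<close> reads off the coordinate \<open>i k\<close> of a vector in the
  range of \<open>p k\<close>, and \<open>\<eta>\<close> is that vector rescaled so that the value
  becomes \<open>w k\<close>. The remaining terms of the two sequences are 0.\<close>

lemma normal_functionalI: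
  assumes "\<And>c. \<omega> (L c) = (\<Sum>k\<in>X. c k * w k)"
  shows "normal_functional I (range L) \<omega>"
proof -
  have "\<forall>k. \<exists>v i. k \<in> X \<longrightarrow> v \<in> ell2 I \<and> i \<in> I \<and> p k v = v \<and> v i \<noteq> 0"
    by (metis unit_vector)
  then obtain v i where vi: "\<And>k. k \<in> X \<Longrightarrow> v k \<in> ell2 I \<and> i k \<in> I \<and> p k (v k) = v k \<and> v k (i k) \<noteq> 0"
    by metis
  obtain h where h: "bij_betw h {..<card X} X"
    using ex_bij_betw_nat_finite[OF fin] by (auto simp: lessThan_atLeast0)
  define \<xi> where "\<xi> = (\<lambda>n. if n < card X then delta (i (h n)) else (\<lambda>_. 0))"
  define \<eta> where "\<eta> = (\<lambda>n. if n < card X then (\<lambda>j. (w (h n) / v (h n) (i (h n))) * v (h n) j) else (\<lambda>_. 0))"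
  have hX: "h n \<in> X" if "n < card X" for n using h that by (auto simp: bij_betw_def)
  have "nsq (\<lambda>_ :: 'i. 0) = 0" by (simp add: nsq_def)
  then have s: "summable (\<lambda>n. (l2_norm (\<xi> n))\<^sup>2)" "summable (\<lambda>n. (l2_norm (\<eta> n))\<^sup>2)"
    unfolding l2_norm_sq by (auto intro!: summable_finite[of "{..<card X}"] simp: \<xi>_def \<eta>_def split: if_splits)
  have e: "\<xi> n \<in> ell2 I" "\<eta> n \<in> ell2 I" for n
    using vi[OF hX, of n] ell2_scale[of "v (h n)" I "w (h n) / v (h n) (i (h n))"]
    by (auto simp: \<xi>_def \<eta>_def intro!: delta_ell2)
  have "\<omega> (L c) = (\<Sum>n. l2_inner (\<xi> n) (L c (\<eta> n)))" for c
  proof -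
    have *: "l2_inner (\<xi> n) (L c (\<eta> n)) = c (h n) * w (h n)" if n: "n < card X" for n
    proof -
      define k u where "k = h n" and "u = v k"
      have V: "k \<in> X" "u \<in> ell2 I" "p k u = u" "u (i k) \<noteq> 0" using vi[OF hX[OF n]] hX[OF n] unfolding k_def u_def by blast+
      have "L c u = (L c \<circ> p k) u" by (simp only: comp_apply V(3))
      also have "\<dots> = (\<lambda>j. c k * u j)" unfolding L_p[OF V(1)] op_scale_def V(3) ..
      finally have 1: "L c u = (\<lambda>j. c k * u j)" .
      have "\<eta> n = (\<lambda>j. (w k / u (i k)) * u j)" "\<xi> n = delta (i k)"
        unfolding \<eta>_def \<xi>_def k_def u_def by (simp_all add: n)
      then have "l2_inner (\<xi> n) (L c (\<eta> n)) = (w k / u (i k)) * (c k * u (i k))"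
        by (simp only: bop_scale[OF L_bop V(2)] 1 l2_inner_delta)
      also have "\<dots> = c k * w k" using V(4) by (simp add: field_simps)
      finally show ?thesis unfolding k_def .
    qed
    have "(\<Sum>n. l2_inner (\<xi> n) (L c (\<eta> n))) = (\<Sum>n<card X. l2_inner (\<xi> n) (L c (\<eta> n)))"
      by (rule suminf_finite) (auto simp: \<xi>_def l2_inner_def)
    also have "\<dots> = (\<Sum>n<card X. c (h n) * w (h n))" by (rule sum.cong) (auto simp: *)
    also have "\<dots> = (\<Sum>k\<in>X. c k * w k)" by (rule sum.reindex_bij_betw[OF h])
    finally show ?thesis by (simp add: assms)
  qed
  then show ?thesis unfolding normal_functional_def using s e by blast
qed

lemma normal_linear_mapI:
  assumes f: "\<And>c. f (L c) = lin X F c" and F: "\<And>k. k \<in> X \<Longrightarrow> F k \<in> bop J"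
  shows "normal_linear_map I (range L) J f"
  unfolding normal_linear_map_def
proof (intro conjI allI ballI impI)
  fix \<omega> assume "normal_functional J (bop J) \<omega>"
  then show "normal_functional I (range L) (\<lambda>a. \<omega> (f a))"
    by (intro normal_functionalI[where w = "\<lambda>k. \<omega> (F k)"]) (simp add: f normal_functional_lin fin F)
next
  show "f a \<in> bop J" if "a \<in> range L" for a using that lin_bop[OF fin F] by (auto simp: f)
  show "f (op_add a b) = op_add (f a) (f b)" if "a \<in> range L" "b \<in> range L" for a b
    using that by (auto simp: f lin_add)
  show "f (op_scale c a) = op_scale c (f a)" if "a \<in> range L" for a c
    using that by (auto simp: f lin_scale)
qed

lemma linear_L:
  assumes "normal_linear_map I (range L) J f"
  shows "f (L c) = lin X (\<lambda>k. f (p k)) c"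
proof (rule lin_map[OF fin])
  show "f (op_add a b) = op_add (f a) (f b)" if "a \<in> range L" "b \<in> range L" for a b
    using assms that unfolding normal_linear_map_def by blast
  show "f (op_scale c a) = op_scale c (f a)" if "a \<in> range L" for a c
    using assms that unfolding normal_linear_map_def by blast
qed

end

locale resolution2 = A: resolution I X p + B: resolution J Y q
  for I :: "'i set" and X :: "'k set" and p :: "'k \<Rightarrow> 'i oper"
    and J :: "'j set" and Y :: "'l set" and q :: "'l \<Rightarrow> 'j oper"
begin

definition pq :: "'k \<times> 'l \<Rightarrow> ('i \<times> 'j) oper" where
  "pq = (\<lambda>(k, l). op_tensor I J (p k) (q l))"

lemma tensor_L: "op_tensor I J (A.L c) (B.L d) = lin (X \<times> Y) pq (\<lambda>(k, l). c k * d l)"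
proof (rule op_tensor_eqI[where I = I and J = J])
  have b: "pq k \<in> bop (I \<times> J)" if "k \<in> X \<times> Y" for k
    using that by (auto simp: pq_def intro!: op_tensor_bop A.p_bop B.p_bop)
  show "lin (X \<times> Y) pq (\<lambda>(k, l). c k * d l) \<in> bop (I \<times> J)"
    by (rule lin_bop) (use A.fin B.fin b in auto)
  show "op_tensor I J (A.L c) (B.L d) \<in> bop (I \<times> J)" by (intro op_tensor_bop A.L_bop B.L_bop)
  fix i j assume ij: "i \<in> I" "j \<in> J"
  have "pq k (vtensor (delta i) (delta j)) = vtensor (p (fst k) (delta i)) (q (snd k) (delta j))"
    if "k \<in> X \<times> Y" for k
    using that ij by (auto simp: pq_def op_tensor_vtensor A.p_bop B.p_bop delta_ell2)
  then have "lin (X \<times> Y) pq (\<lambda>(k, l). c k * d l) (vtensor (delta i) (delta j))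
    = (\<lambda>r. \<Sum>k\<in>X \<times> Y. c (fst k) * d (snd k) * vtensor (p (fst k) (delta i)) (q (snd k) (delta j)) r)"
    by (simp add: lin_def case_prod_unfold)
  also have "\<dots> = vtensor (A.L c (delta i)) (B.L d (delta j))"
  proof
    fix r :: "'i \<times> 'j"
    show "(\<Sum>k\<in>X \<times> Y. c (fst k) * d (snd k) * vtensor (p (fst k) (delta i)) (q (snd k) (delta j)) r)
      = vtensor (A.L c (delta i)) (B.L d (delta j)) r"
      by (cases r) (simp add: vtensor_def lin_def sum_product sum.cartesian_product case_prod_unfold mult_ac)
  qed
  finally show "op_tensor I J (A.L c) (B.L d) (vtensor (delta i) (delta j))
      = lin (X \<times> Y) pq (\<lambda>(k, l). c k * d l) (vtensor (delta i) (delta j))"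
    using ij by (simp add: op_tensor_vtensor A.L_bop B.L_bop delta_ell2)
qed

sublocale T: resolution "I \<times> J" "X \<times> Y" pq
proof
  show "finite (X \<times> Y)" using A.fin B.fin by simp
  fix k assume k: "k \<in> X \<times> Y"
  obtain a b where ab: "k = (a, b)" "a \<in> X" "b \<in> Y" using k by auto
  show "pq k \<in> bop (I \<times> J)" using ab by (auto simp: pq_def intro!: op_tensor_bop A.p_bop B.p_bop)
  show "pq k \<circ> pq k = pq k"
    using ab by (simp add: pq_def op_tensor_comp A.p_bop B.p_bop A.p_idem B.p_idem)
  show "pq k \<noteq> op_zero"
  proof -
    obtain v i where v: "v \<in> ell2 I" "i \<in> I" "p a v = v" "v i \<noteq> 0" using A.unit_vector ab by blast
    obtain u j where u: "u \<in> ell2 J" "j \<in> J" "q b u = u" "u j \<noteq> 0" using B.unit_vector ab by blast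
    have "pq k (vtensor v u) (i, j) = v i * u j"
      using ab v u by (simp add: pq_def op_tensor_vtensor A.p_bop B.p_bop) (simp add: vtensor_def)
    then show ?thesis using v u by (auto simp: op_zero_def)
  qed
  fix l assume l: "l \<in> X \<times> Y" "k \<noteq> l"
  obtain c d where cd: "l = (c, d)" "c \<in> X" "d \<in> Y" using l by auto
  have z: "op_tensor I J op_zero R = op_zero" for R :: "'j oper"
    by (auto simp: op_tensor_def op_zero_def fun_eq_iff)
  have z': "op_tensor I J S op_zero = op_zero" if "S \<in> bop I" for S
    using bop_zero[OF that] by (auto simp: op_tensor_def op_zero_def fun_eq_iff)
  have "p a \<circ> p c = op_zero \<or> q b \<circ> q d = op_zero" using l ab cd A.p_orth B.p_orth by auto
  then show "pq k \<circ> pq l = op_zero"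
    using ab cd z z' A.p_bop B.p_bop comp_bop[OF A.p_bop A.p_bop]
    by (auto simp: pq_def op_tensor_comp)
next
  have "op_tensor I J (op_id I) (op_id J) = op_id (I \<times> J)"
    by (rule op_tensor_eqI[where I = I and J = J])
      (auto simp: op_tensor_bop op_id_bop op_tensor_vtensor delta_ell2 vtensor_ell2, auto simp: op_id_def vtensor_ell2 delta_ell2)
  then show "lin (X \<times> Y) pq (\<lambda>_. 1) = op_id (I \<times> J)"
    using tensor_L[of "\<lambda>_. 1" "\<lambda>_. 1"] by (simp add: A.p_sum B.p_sum case_prod_unfold)
qed

text \<open>The bicommutant adds nothing to the algebraic tensor product here, since the elementary
  tensors of the \<open>p k\<close> and \<open>q l\<close> are again a finite resolution.\<close>

lemma vn_tensor_eq: "vn_tensor I (range A.L) J (range B.L) = range T.L"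
  unfolding vn_tensor_def
proof (rule T.bicommutant)
  show "pq ` (X \<times> Y) \<subseteq> {op_tensor I J a b |a b. a \<in> range A.L \<and> b \<in> range B.L}"
    using A.p_in B.p_in by (fastforce simp: pq_def)
  show "{op_tensor I J a b |a b. a \<in> range A.L \<and> b \<in> range B.L} \<subseteq> range T.L"
  proof
    fix x assume "x \<in> {op_tensor I J a b |a b. a \<in> range A.L \<and> b \<in> range B.L}"
    then obtain c d where "x = op_tensor I J (A.L c) (B.L d)" by blast
    then show "x \<in> range T.L" unfolding tensor_L by blast
  qed
qed

text \<open>Resolves the definite description in \<open>normal_ext\<close>. Uniqueness: a linear map
  on the span is determined by its values on the \<open>pq (k, l)\<close>. Existence: every linear
  map defined by such values is normal.\<close>

lemma normal_ext_eq:
  assumes F: "\<And>c d. F (A.L c) (B.L d) = lin (X \<times> Y) (\<lambda>(k, l). F (p k) (q l)) (\<lambda>(k, l). c k * d l)"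
    and bop: "\<And>k l. k \<in> X \<Longrightarrow> l \<in> Y \<Longrightarrow> F (p k) (q l) \<in> bop M"
  shows "normal_ext I (range A.L) J (range B.L) M F (T.L c) = lin (X \<times> Y) (\<lambda>(k, l). F (p k) (q l)) c"
proof -
  let ?F = "\<lambda>(k, l). F (p k) (q l)"
  \<comment> \<open>The coefficients of an element of the span are unique on
    \<open>X \<times> Y\<close>, so the choice made by \<open>SOME\<close> does not affect the
    value.\<close>
  define h where "h = (\<lambda>a\<in>range T.L. lin (X \<times> Y) ?F (SOME c. a = T.L c))"
  have h: "h (T.L c) = lin (X \<times> Y) ?F c" for c
  proof -
    have "T.L c = T.L (SOME d. T.L c = T.L d)" by (rule someI[of _ c]) simp
    then have "\<forall>k\<in>X \<times> Y. c k = (SOME d. T.L c = T.L d) k" by (rule T.L_eq_iff[THEN iffD1])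
    then show ?thesis by (auto simp: h_def intro!: lin_cong)
  qed
  have "normal_ext I (range A.L) J (range B.L) M F = h"
    unfolding normal_ext_def vn_tensor_eq
  proof (rule the_equality)
    show "h \<in> extensional (range T.L) \<and> normal_linear_map (I \<times> J) (range T.L) M h \<and>
      (\<forall>a\<in>range A.L. \<forall>b\<in>range B.L. h (op_tensor I J a b) = F a b)"
    proof (intro conjI ballI)
      show "h \<in> extensional (range T.L)" by (simp add: h_def)
      show "normal_linear_map (I \<times> J) (range T.L) M h"
        by (rule T.normal_linear_mapI[OF h]) (use bop in auto)
      fix a b assume "a \<in> range A.L" "b \<in> range B.L"
      then show "h (op_tensor I J a b) = F a b" by (auto simp: tensor_L h F)
    qed
  next
    fix g assume g: "g \<in> extensional (range T.L) \<and> normal_linear_map (I \<times> J) (range T.L) M g \<and>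
      (\<forall>a\<in>range A.L. \<forall>b\<in>range B.L. g (op_tensor I J a b) = F a b)"
    have "g (pq k) = ?F k" if k: "k \<in> X \<times> Y" for k
    proof -
      obtain a b where ab: "k = (a, b)" "a \<in> X" "b \<in> Y" using k by auto
      then have "g (op_tensor I J (p a) (q b)) = F (p a) (q b)" using g A.p_in B.p_in by blast
      then show ?thesis using ab by (simp add: pq_def)
    qed
    then have "g (T.L c) = h (T.L c)" for c
      unfolding h using g by (subst T.linear_L[of M g]) (auto intro!: lin_cong)
    then show "g = h" using g by (auto intro!: extensionalityI[of _ "range T.L"] simp: h_def)
  qed
  then show ?thesis by (simp add: h)
qed

end

lemma lin_times: "lin (X \<times> Y) F c = (\<lambda>x i. \<Sum>k\<in>X. \<Sum>l\<in>Y. c (k, l) * F (k, l) x i)"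
  by (simp add: lin_def sum.cartesian_product case_prod_unfold)

subsection \<open>Normal maps in coordinates\<close>

lemma (in resolution) pullback_p:
  assumes "resolution J Y q" "\<And>c. f (L c) = lin Y q (\<lambda>y. c (s y))" "k \<in> X"
  shows "f (p k) = lin Y q (\<lambda>y. if s y = k then 1 else 0)"
  using assms(2)[of "\<lambda>l. if l = k then 1 else 0"] by (simp add: lin_single[OF fin assms(3)])

text \<open>If \<open>f\<close> and \<open>g\<close> pull functions back along \<open>s\<close> and
  \<open>s'\<close>, then their tensor product pulls back along the product map:
  \<open>f (p k)\<close> is the sum of the \<open>q y\<close> over the fibre of \<open>s\<close> at
  \<open>k\<close>, and fibres of the product map are products of fibres.\<close>

lemma map_tensor_pullback:
  fixes p :: "'k \<Rightarrow> 'i oper" and p' :: "'k2 \<Rightarrow> 'i2 oper" and q :: "'l \<Rightarrow> 'j oper" and q' :: "'l2 \<Rightarrow> 'j2 oper"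
  assumes p: "resolution I X p" and p': "resolution I' X' p'"
    and q: "resolution J Y q" and q': "resolution J' Y' q'"
    and s: "\<And>y. y \<in> Y \<Longrightarrow> s y \<in> X" and s': "\<And>y. y \<in> Y' \<Longrightarrow> s' y \<in> X'"
    and f: "\<And>c. f (lin X p c) = lin Y q (\<lambda>y. c (s y))"
    and g: "\<And>c. g (lin X' p' c) = lin Y' q' (\<lambda>y. c (s' y))"
  shows "map_tensor I (range (lin X p)) I' (range (lin X' p')) J J' f g
      (lin (X \<times> X') (resolution2.pq I p I' p') c)
    = lin (Y \<times> Y') (resolution2.pq J q J' q') (\<lambda>(y, y'). c (s y, s' y'))"
proof -
  interpret P: resolution2 I X p I' X' p' by (intro resolution2.intro p p')
  interpret Q: resolution2 J Y q J' Y' q' by (intro resolution2.intro q q')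
  let ?F = "\<lambda>a b. op_tensor J J' (f a) (g b)"
  have Fp: "?F (p k) (p' k') = Q.T.L (\<lambda>(y, y'). (if s y = k then 1 else 0) * (if s' y' = k' then 1 else 0))"
    if "k \<in> X" "k' \<in> X'" for k k'
    using that by (simp add: P.A.pullback_p[OF q f] P.B.pullback_p[OF q' g] Q.tensor_L)
  have lin: "lin (X \<times> X') (\<lambda>(k, l). ?F (p k) (p' l)) c = Q.T.L (\<lambda>(y, y'). c (s y, s' y'))" for c
  proof -
    have "lin (X \<times> X') (\<lambda>(k, l). ?F (p k) (p' l)) c
      = lin (X \<times> X') (\<lambda>(k, l). Q.T.L (\<lambda>(y, y'). (if s y = k then 1 else 0) * (if s' y' = l then 1 else 0))) c"
      by (rule lin_cong) (auto simp: Fp)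
    also have "\<dots> = Q.T.L (\<lambda>(y, y'). c (s y, s' y'))"
    proof (intro ext)
      fix x i
      have "lin (X \<times> X') (\<lambda>(k, l). Q.T.L (\<lambda>(y, y'). (if s y = k then 1 else 0) * (if s' y' = l then 1 else 0))) c x i
        = (\<Sum>k\<in>X \<times> X'. \<Sum>y\<in>Y \<times> Y'. if (s (fst y), s' (snd y)) = k then c k * Q.pq y x i else 0)"
        unfolding lin_def by (auto simp: sum_distrib_left case_prod_unfold intro!: sum.cong)
      also have "\<dots> = (\<Sum>y\<in>Y \<times> Y'. \<Sum>k\<in>X \<times> X'. if (s (fst y), s' (snd y)) = k then c k * Q.pq y x i else 0)"
        by (rule sum.swap)
      also have "\<dots> = (\<Sum>y\<in>Y \<times> Y'. c (s (fst y), s' (snd y)) * Q.pq y x i)"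
        by (rule sum.cong) (use s s' P.T.fin in auto)
      finally show "lin (X \<times> X') (\<lambda>(k, l). Q.T.L (\<lambda>(y, y'). (if s y = k then 1 else 0) * (if s' y' = l then 1 else 0))) c x i
        = Q.T.L (\<lambda>(y, y'). c (s y, s' y')) x i"
        by (simp add: lin_def case_prod_unfold)
    qed
    finally show ?thesis .
  qed
  show ?thesis unfolding map_tensor_def
  proof (subst P.normal_ext_eq)
    show "?F (lin X p c) (lin X' p' d) = lin (X \<times> X') (\<lambda>(k, l). ?F (p k) (p' l)) (\<lambda>(k, l). c k * d l)" for c d
      unfolding lin by (simp add: f g Q.tensor_L)
    show "?F (p k) (p' l) \<in> bop (J \<times> J')" if "k \<in> X" "l \<in> X'" for k l
      using Fp[OF that] Q.T.L_bop by simp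
  qed (rule lin)
qed

text \<open>The vectors that define the functional on the algebra define one on all bounded
  operators as well, where linearity is already known.\<close>

lemma normal_functional_lin':
  assumes "normal_functional I (range (lin X p)) \<omega>" "resolution I X p"
  shows "\<omega> (lin X p c) = (\<Sum>k\<in>X. c k * \<omega> (p k))"
proof -
  interpret resolution I X p by fact
  obtain \<omega>' where w: "normal_functional I (bop I) \<omega>'" "\<And>a. a \<in> range (lin X p) \<Longrightarrow> \<omega> a = \<omega>' a"
  proof -
    obtain \<xi> \<eta> :: "nat \<Rightarrow> 'a vec" where *: "\<forall>n. \<xi> n \<in> ell2 I \<and> \<eta> n \<in> ell2 I"
      "summable (\<lambda>n. (l2_norm (\<xi> n))\<^sup>2)" "summable (\<lambda>n. (l2_norm (\<eta> n))\<^sup>2)"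
      "\<forall>a\<in>range (lin X p). \<omega> a = (\<Sum>n. l2_inner (\<xi> n) (a (\<eta> n)))"
      using assms(1) unfolding normal_functional_def by blast
    have "normal_functional I (bop I) (\<lambda>a. \<Sum>n. l2_inner (\<xi> n) (a (\<eta> n)))"
      unfolding normal_functional_def using * by blast
    then show ?thesis by (rule that) (use * in auto)
  qed
  then show ?thesis using normal_functional_lin[OF w(1) fin p_bop, where c = c] w(2)[OF rangeI] w(2)[OF p_in] by simp
qed

context resolution
begin

interpretation S: resolution2 I X p I X p ..

lemma slice_eq:
  assumes \<phi>: "normal_functional I (range L) \<phi>"
  shows "slice_right I (range L) \<phi> (lin (X \<times> X) S.pq c) = L (\<lambda>x. \<Sum>y\<in>X. c (x, y) * \<phi> (p y))"
    and "slice_left I (range L) \<phi> (lin (X \<times> X) S.pq c) = L (\<lambda>y. \<Sum>x\<in>X. c (x, y) * \<phi> (p x))"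
proof -
  note lin\<phi> = normal_functional_lin'[OF \<phi> resolution_axioms]
  have 1: "lin (X \<times> X) (\<lambda>(k, l). op_scale (\<phi> (p l)) (p k)) c = L (\<lambda>x. \<Sum>y\<in>X. c (x, y) * \<phi> (p y))" for c
    by (simp add: lin_times op_scale_def mult.assoc) (simp add: lin_def sum_distrib_right mult.assoc)
  have 2: "lin (X \<times> X) (\<lambda>(k, l). op_scale (\<phi> (p k)) (p l)) c = L (\<lambda>y. \<Sum>x\<in>X. c (x, y) * \<phi> (p x))" for c
    by (simp add: lin_times op_scale_def mult.assoc)
      (simp add: lin_def sum_distrib_right mult.assoc, intro ext sum.swap)
  show "slice_right I (range L) \<phi> (lin (X \<times> X) S.pq c) = L (\<lambda>x. \<Sum>y\<in>X. c (x, y) * \<phi> (p y))"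
    unfolding slice_right_def
  proof (subst S.normal_ext_eq)
    show "op_scale (\<phi> (L d)) (L c) = lin (X \<times> X) (\<lambda>(k, l). op_scale (\<phi> (p l)) (p k)) (\<lambda>(k, l). c k * d l)" for c d
      unfolding 1 by (simp add: lin_scale lin\<phi> sum_distrib_left mult_ac)
  qed (auto simp: op_scale_bop p_bop 1)
  show "slice_left I (range L) \<phi> (lin (X \<times> X) S.pq c) = L (\<lambda>y. \<Sum>x\<in>X. c (x, y) * \<phi> (p x))"
    unfolding slice_left_def
  proof (subst S.normal_ext_eq)
    show "op_scale (\<phi> (L c)) (L d) = lin (X \<times> X) (\<lambda>(k, l). op_scale (\<phi> (p k)) (p l)) (\<lambda>(k, l). c k * d l)" for c d
      unfolding 2 by (simp add: lin_scale lin\<phi> sum_distrib_left sum_distrib_right mult_ac)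
  qed (auto simp: op_scale_bop p_bop 2)
qed

end

text \<open>Quantum groups whose algebra is spanned by a finite resolution of the identity indexed by \<open>X\<close>,
  with the comultiplication dual to a binary operation \<open>m\<close> on \<open>X\<close>.\<close>

locale finite_qg = resolution "index Q" X p for Q :: "'i qgrp" and X :: "'k set" and p +
  fixes m :: "'k \<Rightarrow> 'k \<Rightarrow> 'k"
  assumes alg: "alg Q = range L"
    and m_closed: "x \<in> X \<Longrightarrow> y \<in> X \<Longrightarrow> m x y \<in> X"
    and comult: "comult Q (L c) = lin (X \<times> X) (resolution2.pq (index Q) p (index Q) p) (\<lambda>(x, y). c (m x y))"
begin

sublocale S: resolution2 "index Q" X p "index Q" X p ..
sublocale SL: resolution2 "index Q \<times> index Q" "X \<times> X" S.pq "index Q" X p ..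
sublocale SR: resolution2 "index Q" X p "index Q \<times> index Q" "X \<times> X" S.pq ..

text \<open>The two iterated comultiplications are pullbacks along the maps sending (x, y, z) to
  (xy)z and to x(yz). Equal pullbacks of all functions mean equal maps, since indicator functions
  separate points.\<close>

lemma coassociative_iff:
  "coassociative Q \<longleftrightarrow> (\<forall>x\<in>X. \<forall>y\<in>X. \<forall>z\<in>X. m (m x y) z = m x (m y z))"
proof -
  have id: "id (L c) = L c" for c by simp
  have 1: "map_tensor (index Q) (range L) (index Q) (range L) (index Q \<times> index Q) (index Q) (comult Q) id (S.T.L c)
    = SL.T.L (\<lambda>(u, z). c (m (fst u) (snd u), z))" for c
    by (rule map_tensor_pullback[where s = "\<lambda>u. m (fst u) (snd u)" and s' = "\<lambda>z. z"])
      (auto simp: comult m_closed case_prod_unfold resolution_axioms S.T.resolution_axioms)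
  have 2: "map_tensor (index Q) (range L) (index Q) (range L) (index Q) (index Q \<times> index Q) id (comult Q) (S.T.L c)
    = SR.T.L (\<lambda>(x, u). c (x, m (fst u) (snd u)))" for c
    by (rule map_tensor_pullback[where s' = "\<lambda>u. m (fst u) (snd u)" and s = "\<lambda>z. z"])
      (auto simp: comult m_closed case_prod_unfold resolution_axioms S.T.resolution_axioms)
  have assoc: "op_assoc (SL.T.L c) = SR.T.L (\<lambda>(x, (y, z)). c ((x, y), z))" for c
  proof -
    have bij: "bij_betw (\<lambda>(x, (y, z)). ((x, y), z)) (X \<times> X \<times> X) ((X \<times> X) \<times> X)"
      by (rule bij_betwI[where g = "\<lambda>((x, y), z). (x, (y, z))"]) auto
    have "op_assoc (SL.T.L c) x (i, j, k) = SR.T.L (\<lambda>(x, (y, z)). c ((x, y), z)) x (i, j, k)" for x i j k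
    proof -
      have eq: "op_assoc (SL.pq ((a, b), d)) = SR.pq (a, (b, d))" if "a \<in> X" "b \<in> X" "d \<in> X" for a b d
        using op_tensor_assoc[OF p_bop[OF that(1)] p_bop[OF that(2)] p_bop[OF that(3)]]
        unfolding SL.pq_def SR.pq_def by (simp add: S.pq_def)
      have "op_assoc (SL.T.L c) x (i, j, k) = (\<Sum>u\<in>(X \<times> X) \<times> X. c u * op_assoc (SL.pq u) x (i, j, k))"
        by (simp add: op_assoc_def lin_def)
      also have "\<dots> = (\<Sum>v\<in>X \<times> X \<times> X. c (case v of (x, y, z) \<Rightarrow> ((x, y), z)) *
          op_assoc (SL.pq (case v of (x, y, z) \<Rightarrow> ((x, y), z))) x (i, j, k))"
        by (rule sum.reindex_bij_betw[OF bij, symmetric])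
      also have "\<dots> = (\<Sum>v\<in>X \<times> X \<times> X. (case v of (x, y, z) \<Rightarrow> c ((x, y), z)) * SR.pq v x (i, j, k))"
        by (rule sum.cong) (auto simp: eq)
      finally show ?thesis by (simp add: lin_def case_prod_unfold)
    qed
    then show ?thesis by (auto simp: fun_eq_iff)
  qed
  have "coassociative Q \<longleftrightarrow> (\<forall>c. SR.T.L (\<lambda>(x, (y, z)). c (m (m x y) z)) = SR.T.L (\<lambda>(x, (y, z)). c (m x (m y z))))"
    unfolding coassociative_def Let_def alg by (simp add: comult 1 2 assoc case_prod_unfold)
  also have "\<dots> \<longleftrightarrow> (\<forall>c :: 'k \<Rightarrow> complex. \<forall>x\<in>X. \<forall>y\<in>X. \<forall>z\<in>X. c (m (m x y) z) = c (m x (m y z)))"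
    unfolding SR.T.L_eq_iff by auto
  also have "\<dots> \<longleftrightarrow> (\<forall>x\<in>X. \<forall>y\<in>X. \<forall>z\<in>X. m (m x y) z = m x (m y z))"
  proof (intro iffI ballI)
    fix x y z assume *: "\<forall>c :: 'k \<Rightarrow> complex. \<forall>x\<in>X. \<forall>y\<in>X. \<forall>z\<in>X. c (m (m x y) z) = c (m x (m y z))"
      and xyz: "x \<in> X" "y \<in> X" "z \<in> X"
    have "(if m (m x y) z = m (m x y) z then 1 else 0 :: complex) = (if m x (m y z) = m (m x y) z then 1 else 0)"
      using *[rule_format, OF xyz, of "\<lambda>k. if k = m (m x y) z then 1 else 0"] by simp
    then show "m (m x y) z = m x (m y z)" by (auto split: if_splits)
  qed simp
  finally show ?thesis .
qed

lemma qg_square_eq: "qg_square Q = range S.T.L"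
  unfolding qg_square_def alg by (rule S.vn_tensor_eq)

lemma haar_slices:
  assumes "normal_functional (index Q) (alg Q) \<phi>"
  shows "slice_right (index Q) (alg Q) \<phi> (comult Q (L c)) = L (\<lambda>x. \<Sum>y\<in>X. c (m x y) * \<phi> (p y))"
    and "slice_left (index Q) (alg Q) \<phi> (comult Q (L c)) = L (\<lambda>y. \<Sum>x\<in>X. c (m x y) * \<phi> (p x))"
  using slice_eq[of \<phi> "\<lambda>(x, y). c (m x y)"] assms by (simp_all add: alg comult)

end

text \<open>Since \<open>f\<close> pulls functions back along \<open>s\<close>, the homomorphism on
  points runs against the direction of \<open>f\<close>. Again indicator functions separate
  points.\<close>

lemma finite_qg_pullback:
  assumes P: "finite_qg P X p m" and Q: "finite_qg Q Y q n"
    and s: "\<And>y. y \<in> Y \<Longrightarrow> s y \<in> X" and f: "\<And>c. f (lin X p c) = lin Y q (\<lambda>y. c (s y))"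
  shows "(\<forall>a\<in>alg P. comult Q (f a) = map_tensor (index P) (alg P) (index P) (alg P) (index Q) (index Q) f f (comult P a))
    \<longleftrightarrow> (\<forall>x\<in>Y. \<forall>y\<in>Y. s (n x y) = m (s x) (s y))"
proof -
  interpret P: finite_qg P X p m by fact
  interpret Q: finite_qg Q Y q n by fact
  have 1: "map_tensor (index P) (alg P) (index P) (alg P) (index Q) (index Q) f f (comult P (lin X p c))
    = Q.S.T.L (\<lambda>(x, y). c (m (s x) (s y)))" for c
    using map_tensor_pullback[OF P.resolution_axioms P.resolution_axioms Q.resolution_axioms Q.resolution_axioms
      s s f f, of "\<lambda>(x, y). c (m x y)"]
    by (simp add: P.alg P.comult)
  have "(\<forall>a\<in>alg P. comult Q (f a) = map_tensor (index P) (alg P) (index P) (alg P) (index Q) (index Q) f f (comult P a))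
    \<longleftrightarrow> (\<forall>c :: _ \<Rightarrow> complex. \<forall>x\<in>Y. \<forall>y\<in>Y. c (s (n x y)) = c (m (s x) (s y)))"
    unfolding P.alg by (simp add: 1[unfolded P.alg] f Q.comult Q.S.T.L_eq_iff)
  also have "\<dots> \<longleftrightarrow> (\<forall>x\<in>Y. \<forall>y\<in>Y. s (n x y) = m (s x) (s y))"
  proof (intro iffI ballI)
    fix x y assume *: "\<forall>c :: _ \<Rightarrow> complex. \<forall>x\<in>Y. \<forall>y\<in>Y. c (s (n x y)) = c (m (s x) (s y))"
      and xyz: "x \<in> Y" "y \<in> Y"
    have "(if s (n x y) = s (n x y) then 1 else 0 :: complex) = (if m (s x) (s y) = s (n x y) then 1 else 0)"
      using *[rule_format, OF xyz, of "\<lambda>k. if k = s (n x y) then 1 else 0"] by simp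
    then show "s (n x y) = m (s x) (s y)" by (auto split: if_splits)
  qed simp
  finally show ?thesis .
qed

subsection \<open>Finite groups as quantum groups\<close>

definition ind_op :: "'k set \<Rightarrow> 'k \<Rightarrow> 'k oper" where
  "ind_op X k = mult_op X (\<lambda>l. if l = k then 1 else 0)"

lemma mult_op_bop:
  assumes "finite X" shows "mult_op X F \<in> bop X"
proof (rule bopI[where C = "\<Sum>k\<in>X. (cmod (F k))\<^sup>2"])
  fix x assume x: "x \<in> ell2 X"
  show e: "mult_op X F x \<in> ell2 X"
    by (rule finite_support_ell2[OF assms]) (use x ell2_outside[OF x] in \<open>auto simp: mult_op_def\<close>)
  have "nsq (mult_op X F x) = (\<Sum>k\<in>X. (cmod (F k))\<^sup>2 * (cmod (x k))\<^sup>2)"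
    using x ell2_outside[OF e] by (subst nsq_finite[OF assms]) (auto simp: mult_op_def norm_mult power_mult_distrib)
  also have "\<dots> \<le> (\<Sum>k\<in>X. (cmod (F k))\<^sup>2 * nsq x)"
    by (intro sum_mono mult_left_mono ell2_coord[OF x]) auto
  finally show "nsq (mult_op X F x) \<le> (\<Sum>k\<in>X. (cmod (F k))\<^sup>2) * nsq x" by (simp add: sum_distrib_right)
qed (auto simp: mult_op_def ell2_add ell2_scale algebra_simps)

lemma mult_op_lin:
  assumes "finite X" shows "mult_op X F = lin X (ind_op X) F"
proof (intro ext)
  fix x k
  have "(\<Sum>l\<in>X. F l * (if x \<in> ell2 X then (\<lambda>k. (if k = l then 1 else 0) * x k) else (\<lambda>k. 0)) k)
    = (\<Sum>l\<in>X. if l = k then (if x \<in> ell2 X then F k * x k else 0) else 0)"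
    by (rule sum.cong) auto
  then show "mult_op X F x k = lin X (ind_op X) F x k"
    using assms ell2_outside[of x X k] by (auto simp: lin_def ind_op_def mult_op_def)
qed

lemma mult_op_comp: "finite X \<Longrightarrow> mult_op X F \<circ> mult_op X G = mult_op X (\<lambda>k. F k * G k)"
  using bop_ell2[OF mult_op_bop[of X G]] by (auto simp: mult_op_def fun_eq_iff)

lemma mult_op_one: "mult_op X (\<lambda>_. 1) = op_id X"
  by (auto simp: mult_op_def op_id_def)

lemma op_symbol_mult_op: "k \<in> X \<Longrightarrow> op_symbol (mult_op X F) k = F k"
  by (simp add: op_symbol_def mult_op_def delta_ell2) (simp add: delta_def)

lemma mult_op_cong: "(\<And>k. k \<in> X \<Longrightarrow> F k = G k) \<Longrightarrow> mult_op X F = mult_op X G"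
  using ell2_outside by (fastforce simp: mult_op_def fun_eq_iff)

lemma ind_resolution:
  assumes "finite X" shows "resolution X X (ind_op X)"
proof
  show "ind_op X k \<in> bop X" for k by (simp add: ind_op_def mult_op_bop assms)
  show "ind_op X k \<circ> ind_op X k = ind_op X k" for k
    unfolding ind_op_def mult_op_comp[OF assms] by (rule mult_op_cong) auto
  show "ind_op X k \<circ> ind_op X l = op_zero" if "k \<noteq> l" for k l
    unfolding ind_op_def mult_op_comp[OF assms] using that by (auto simp: mult_op_def op_zero_def fun_eq_iff)
  show "ind_op X k \<noteq> op_zero" if "k \<in> X" for k
    using op_symbol_mult_op[OF that, of "\<lambda>l. if l = k then 1 else 0"] 
    by (auto simp: ind_op_def op_zero_def op_symbol_def)
  show "lin X (ind_op X) (\<lambda>_. 1) = op_id X"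
    using mult_op_lin[OF assms, of "\<lambda>_. 1"] by (simp add: mult_op_one)
qed (use assms in auto)

text \<open>Resolves the definite description in \<open>op_adj\<close>: testing against basis
  vectors determines the adjoint coordinate by coordinate.\<close>

lemma op_adj_eqI:
  assumes S: "S \<in> bop I" and eq: "\<And>x y. x \<in> ell2 I \<Longrightarrow> y \<in> ell2 I \<Longrightarrow> l2_inner (T x) y = l2_inner x (S y)"
  shows "op_adj I T = S"
  unfolding op_adj_def
proof (rule the_equality)
  fix R assume R: "R \<in> bop I \<and> (\<forall>x\<in>ell2 I. \<forall>y\<in>ell2 I. l2_inner (T x) y = l2_inner x (R y))"
  show "R = S"
  proof (intro ext)
    fix y i show "R y i = S y i"
    proof (cases "i \<in> I \<and> y \<in> ell2 I")
      case True
      then have "l2_inner (delta i) (R y) = l2_inner (delta i) (S y)"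
        using R eq[of "delta i" y] delta_ell2[of i I] by metis
      then show ?thesis by (simp add: l2_inner_delta)
    next
      case False
      then show ?thesis
        using R bop_out[of R I y] bop_out[OF S, of y] ell2_outside[OF bop_in[of R I y], of i] ell2_outside[OF bop_in[OF S, of y], of i]
        by auto
    qed
  qed
qed (use S eq in auto)

lemma op_adj_mult_op:
  assumes "finite X" shows "op_adj X (mult_op X F) = mult_op X (\<lambda>k. cnj (F k))"
  by (rule op_adj_eqI[OF mult_op_bop[OF assms]]) (auto simp: mult_op_def l2_inner_def mult_ac)

context
  fixes K :: "('k, 'm) monoid_scheme" and X
  assumes grp: "group K" and fin: "finite (carrier K)" and X: "X = carrier K"
begin

interpretation K: group K by (rule grp)
interpretation R: resolution X X "ind_op X" using fin by (auto simp: X intro: ind_resolution)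
interpretation R2: resolution2 X X "ind_op X" X X "ind_op X" ..

lemma mult_op_R: "mult_op X = R.L"
  using mult_op_lin[OF R.fin] by auto

text \<open>\<open>linf_qg\<close> writes its comultiplication as a multiplication operator on
  \<open>X \<times> X\<close>, whereas \<open>finite_qg\<close> expects elementary tensors. Both
  amount to indicator operators of pairs.\<close>

lemma mult_op_R2: "mult_op (X \<times> X) c = R2.T.L c"
proof -
  have "ind_op (X \<times> X) k = R2.pq k" if k: "k \<in> X \<times> X" for k
  proof (rule op_tensor_eqI[where I = X and J = X])
    obtain a b where ab: "k = (a, b)" "a \<in> X" "b \<in> X" using k by auto
    show "ind_op (X \<times> X) k \<in> bop (X \<times> X)" using R.fin by (simp add: ind_op_def mult_op_bop)
    show "R2.pq k \<in> bop (X \<times> X)" using R2.T.p_bop k .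
    fix i j assume ij: "i \<in> X" "j \<in> X"
    show "ind_op (X \<times> X) k (vtensor (delta i) (delta j)) = R2.pq k (vtensor (delta i) (delta j))"
      using ab ij R.p_bop
      by (simp add: R2.pq_def op_tensor_vtensor delta_ell2)
        (auto simp: ind_op_def mult_op_def vtensor_ell2 delta_ell2, auto simp: vtensor_def)
  qed
  then show ?thesis using mult_op_lin[OF R2.T.fin, of c] lin_cong[of "X \<times> X" c c "ind_op (X \<times> X)" R2.pq] by simp
qed

lemma linf_finite_qg: "finite_qg (linf_qg K) X (ind_op X) (mult K)"
proof (unfold finite_qg_def finite_qg_axioms_def, intro conjI allI impI)
  show "resolution (index (linf_qg K)) X (ind_op X)"
    using R.resolution_axioms by (simp add: linf_qg_def X)
  show "alg (linf_qg K) = range R.L" by (simp add: linf_qg_def mult_op_R flip: X)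
  show "x \<in> X \<Longrightarrow> y \<in> X \<Longrightarrow> x \<otimes>\<^bsub>K\<^esub> y \<in> X" for x y by (simp add: X)
  fix c
  have "comult (linf_qg K) (R.L c) = mult_op (X \<times> X) (\<lambda>(k, l). op_symbol (mult_op X c) (k \<otimes>\<^bsub>K\<^esub> l))"
    by (simp add: linf_qg_def mult_op_R flip: X)
  also have "\<dots> = mult_op (X \<times> X) (\<lambda>(x, y). c (x \<otimes>\<^bsub>K\<^esub> y))"
    by (rule mult_op_cong) (auto simp: op_symbol_mult_op X)
  finally show "comult (linf_qg K) (R.L c) = lin (X \<times> X) (resolution2.pq (index (linf_qg K)) (ind_op X)
     (index (linf_qg K)) (ind_op X)) (\<lambda>(x, y). c (x \<otimes>\<^bsub>K\<^esub> y))"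
    by (simp add: mult_op_R2) (simp add: linf_qg_def X)
qed

interpretation Q: finite_qg "linf_qg K" X "ind_op X" "mult K" by (rule linf_finite_qg)

lemma linf_index: "index (linf_qg K) = X"
  by (simp add: linf_qg_def X)

definition counting_state :: "'k oper \<Rightarrow> complex" where
  "counting_state T = (\<Sum>k\<in>X. op_symbol T k) / of_nat (card X)"

lemma counting_state_L: "counting_state (R.L c) = (\<Sum>k\<in>X. c k) / of_nat (card X)"
  by (simp add: counting_state_def op_symbol_mult_op flip: mult_op_R)

lemma card_X: "card X > 0"
  using K.one_closed fin card_gt_0_iff unfolding X by blast

lemma linf_haar: "haar_state (linf_qg K) counting_state"
proof -
  have norm: "normal_functional (index (linf_qg K)) (alg (linf_qg K)) counting_state"
    unfolding linf_index Q.alg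
    by (rule R.normal_functionalI[where w = "\<lambda>_. 1 / of_nat (card X)"]) (simp add: counting_state_L sum_divide_distrib)
  have sq: "counting_state (op_adj X (R.L c) \<circ> R.L c) = of_real ((\<Sum>k\<in>X. (cmod (c k))\<^sup>2) / card X)" for c
  proof -
    have "op_adj X (R.L c) = R.L (\<lambda>k. cnj (c k))"
      using op_adj_mult_op[OF R.fin, of c] by (simp add: mult_op_R)
    then have "counting_state (op_adj X (R.L c) \<circ> R.L c) = (\<Sum>k\<in>X. cnj (c k) * c k) / of_nat (card X)"
      by (simp only: R.L_comp counting_state_L)
    then show ?thesis by (simp add: complex_norm_square[unfolded of_real_power] mult.commute)
  qed
  have cp: "counting_state (ind_op X y) = 1 / of_nat (card X)" if "y \<in> X" for y
    using counting_state_L[of "\<lambda>l. if l = y then 1 else 0"] that R.fin by (simp add: lin_single)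
  have tr: "(\<Sum>y\<in>X. c (x \<otimes>\<^bsub>K\<^esub> y)) = (\<Sum>y\<in>X. c y)" "(\<Sum>y\<in>X. c (y \<otimes>\<^bsub>K\<^esub> x)) = (\<Sum>y\<in>X. c y)"
    if "x \<in> X" for x and c :: "'k \<Rightarrow> complex"
  proof -
    have "bij_betw (\<lambda>y. x \<otimes>\<^bsub>K\<^esub> y) X X"
      using that by (intro bij_betwI[where g = "\<lambda>y. inv\<^bsub>K\<^esub> x \<otimes>\<^bsub>K\<^esub> y"]) (auto simp: X simp flip: K.m_assoc)
    moreover have "bij_betw (\<lambda>y. y \<otimes>\<^bsub>K\<^esub> x) X X"
      using that by (intro bij_betwI[where g = "\<lambda>y. y \<otimes>\<^bsub>K\<^esub> inv\<^bsub>K\<^esub> x"]) (auto simp: X K.m_assoc)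
    ultimately show "(\<Sum>y\<in>X. c (x \<otimes>\<^bsub>K\<^esub> y)) = (\<Sum>y\<in>X. c y)" "(\<Sum>y\<in>X. c (y \<otimes>\<^bsub>K\<^esub> x)) = (\<Sum>y\<in>X. c y)"
      by (auto intro: sum.reindex_bij_betw)
  qed
  have "faithful_normal_state (index (linf_qg K)) (alg (linf_qg K)) counting_state"
    unfolding faithful_normal_state_def
  proof (intro conjI ballI impI)
    show "counting_state (op_id (index (linf_qg K))) = 1"
      using counting_state_L[of "\<lambda>_. 1"] card_X by (simp add: linf_index R.p_sum)
    fix a assume "a \<in> alg (linf_qg K)"
    then obtain c where c: "a = R.L c" by (auto simp: Q.alg)
    show "counting_state (op_adj (index (linf_qg K)) a \<circ> a) \<in> \<real>\<^sub>\<ge>\<^sub>0"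
      unfolding c linf_index sq by (subst nonneg_Reals_of_real_iff) (auto intro!: divide_nonneg_nonneg sum_nonneg)
    assume "counting_state (op_adj (index (linf_qg K)) a \<circ> a) = 0"
    then have "(\<Sum>k\<in>X. (cmod (c k))\<^sup>2) = 0"
      using card_X unfolding c linf_index sq of_real_eq_0_iff by simp
    then have "\<forall>k\<in>X. c k = 0" using R.fin by (simp add: sum_nonneg_eq_0_iff)
    then show "a = op_zero" by (simp add: c lin_def op_zero_def)
  qed (rule norm)
  moreover have "slice_right (index (linf_qg K)) (alg (linf_qg K)) counting_state (comult (linf_qg K) (R.L c)) =
      op_scale (counting_state (R.L c)) (op_id (index (linf_qg K)))" for c
    unfolding Q.haar_slices(1)[OF norm] unfolding linf_index R.p_sum[symmetric] lin_scale R.L_eq_iff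
    by (auto simp: cp counting_state_L tr simp flip: sum_divide_distrib)
  moreover have "slice_left (index (linf_qg K)) (alg (linf_qg K)) counting_state (comult (linf_qg K) (R.L c)) =
      op_scale (counting_state (R.L c)) (op_id (index (linf_qg K)))" for c
    unfolding Q.haar_slices(2)[OF norm] unfolding linf_index R.p_sum[symmetric] lin_scale R.L_eq_iff
    by (auto simp: cp counting_state_L tr simp flip: sum_divide_distrib)
  ultimately show ?thesis unfolding haar_state_def Let_def Q.alg by auto
qed

lemma linf_kac: "kac_type (linf_qg K)"
proof -
  have adj: "op_adj X (R.L c) = R.L (\<lambda>k. cnj (c k))" for c
    using op_adj_mult_op[OF R.fin, of c] by (simp add: mult_op_R)
  have adj2: "op_adj (X \<times> X) (R2.T.L c) = R2.T.L (\<lambda>k. cnj (c k))" for c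
    using op_adj_mult_op[OF R2.T.fin, of c] by (simp add: mult_op_R2)
  have com: "comult (linf_qg K) (R.L c) = R2.T.L (\<lambda>(x, y). c (x \<otimes>\<^bsub>K\<^esub> y))" for c
    using Q.comult by (simp add: linf_index)
  have sq: "qg_square (linf_qg K) = range R2.T.L" using Q.qg_square_eq by (simp add: linf_index)
  have "von_neumann_algebra X (range R.L)"
    unfolding von_neumann_algebra_def
  proof (intro conjI ballI)
    show "commutant X (commutant X (range R.L)) = range R.L"
      by (rule R.bicommutant) (use R.p_in in auto)
  qed (use R.L_bop adj in auto)
  moreover have "star_hom X (range R.L) (X \<times> X) (range R2.T.L) (comult (linf_qg K))"
    unfolding star_hom_def
    by (auto simp: com adj adj2 lin_add lin_scale R.L_comp R2.T.L_comp case_prod_unfold)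
  moreover have "comult (linf_qg K) (op_id X) = op_id (X \<times> X)"
    using com[of "\<lambda>_. 1"] R2.T.p_sum by (simp add: R.p_sum case_prod_unfold)
  moreover have "inj_on (comult (linf_qg K)) (range R.L)"
  proof (rule inj_onI)
    fix a b assume "a \<in> range R.L" "b \<in> range R.L" and eq: "comult (linf_qg K) a = comult (linf_qg K) b"
    then obtain c d where cd: "a = R.L c" "b = R.L d" by auto
    have *: "\<forall>u\<in>X \<times> X. (case u of (x, y) \<Rightarrow> c (x \<otimes>\<^bsub>K\<^esub> y)) = (case u of (x, y) \<Rightarrow> d (x \<otimes>\<^bsub>K\<^esub> y))"
      using eq unfolding cd com R2.T.L_eq_iff .
    have "c y = d y" if "y \<in> X" for y
      using bspec[OF *, of "(\<one>\<^bsub>K\<^esub>, y)"] that by (simp add: X)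
    then show "a = b" unfolding cd R.L_eq_iff by simp
  qed
  moreover have "normal_linear_map X (range R.L) (X \<times> X) (comult (linf_qg K))"
  proof (rule R.normal_linear_mapI)
    show "comult (linf_qg K) (R.L c) = lin X (\<lambda>k. comult (linf_qg K) (ind_op X k)) c" for c
      by (rule lin_map[OF R.fin]) (auto simp: com lin_add lin_scale case_prod_unfold)
    show "comult (linf_qg K) (ind_op X k) \<in> bop (X \<times> X)" if "k \<in> X" for k
      using R.p_in[OF that] R2.T.L_bop by (auto simp: com)
  qed
  moreover have "coassociative (linf_qg K)"
    unfolding Q.coassociative_iff by (simp add: X K.m_assoc)
  ultimately have "compact_quantum_group (linf_qg K)"
    unfolding compact_quantum_group_def Let_def linf_index Q.alg sq using linf_haar by blast
  moreover have "a \<circ> b = b \<circ> a" if "a \<in> range R.L" "b \<in> range R.L" for a b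
    using that by (auto simp: R.L_comp mult.commute)
  ultimately show ?thesis unfolding kac_type_def Q.alg using linf_haar by (metis (no_types, lifting))
qed

lemma mult_op_pullback_iso:
  assumes s: "bij_betw s X X"
  shows "vn_iso X (range R.L) X (range R.L) (\<lambda>T. mult_op X (\<lambda>k. op_symbol T (s k)))"
    and "(\<lambda>T. mult_op X (\<lambda>k. op_symbol T (s k))) (R.L c) = R.L (\<lambda>k. c (s k))"
proof -
  let ?f = "\<lambda>T. mult_op X (\<lambda>k. op_symbol T (s k))"
  show f: "?f (R.L c) = R.L (\<lambda>k. c (s k))" for c
    unfolding mult_op_R[symmetric]
    using bij_betwE[OF s] by (intro mult_op_cong) (auto simp: op_symbol_mult_op)
  have adj: "op_adj X (R.L c) = R.L (\<lambda>k. cnj (c k))" for c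
    using op_adj_mult_op[OF R.fin, of c] by (simp add: mult_op_R)
  have "bij_betw ?f (range R.L) (range R.L)"
    unfolding bij_betw_def
  proof
    show "inj_on ?f (range R.L)"
    proof (rule inj_onI)
      fix a b assume "a \<in> range R.L" "b \<in> range R.L" and eq: "?f a = ?f b"
      then obtain c d where cd: "a = R.L c" "b = R.L d" by auto
      have "\<forall>k\<in>X. c (s k) = d (s k)" using eq unfolding cd f R.L_eq_iff .
      moreover have "s ` X = X" using s by (simp add: bij_betw_def)
      ultimately have "\<forall>k\<in>X. c k = d k" by (metis imageE)
      then show "a = b" unfolding cd R.L_eq_iff .
    qed
    show "?f ` range R.L = range R.L"
    proof (intro equalityI subsetI)
      fix a assume "a \<in> range R.L"
      then obtain c where c: "a = R.L c" by auto
      have "R.L c = R.L (\<lambda>k. c (inv_into X s (s k)))"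
        unfolding R.L_eq_iff using s by (simp add: bij_betw_def)
      then have "a = ?f (R.L (\<lambda>k. c (inv_into X s k)))" unfolding c f .
      then show "a \<in> ?f ` range R.L" by blast
    qed (auto simp: f)
  qed
  then show "vn_iso X (range R.L) X (range R.L) ?f"
    unfolding vn_iso_def star_hom_def by (auto simp: f lin_add lin_scale R.L_comp adj)
qed

lemma auto_bij: "g \<in> auto K \<Longrightarrow> bij_betw g X X"
  and auto_hom: "g \<in> auto K \<Longrightarrow> x \<in> X \<Longrightarrow> y \<in> X \<Longrightarrow> g (x \<otimes>\<^bsub>K\<^esub> y) = g x \<otimes>\<^bsub>K\<^esub> g y"
  by (auto simp: auto_def Bij_def hom_def X)

lemma aut_action_L: "g \<in> auto K \<Longrightarrow> aut_action K g (R.L c) = R.L (\<lambda>k. c (inv_into X g k))"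
  using mult_op_pullback_iso(2)[OF bij_betw_inv_into[OF auto_bij], of g c]
  by (simp add: aut_action_def flip: X)

lemma AutoGroup_simps: "carrier (AutoGroup K) = auto K" "\<one>\<^bsub>AutoGroup K\<^esub> = (\<lambda>x\<in>X. x)"
  "g \<in> auto K \<Longrightarrow> h \<in> auto K \<Longrightarrow> g \<otimes>\<^bsub>AutoGroup K\<^esub> h = compose X g h"
  by (auto simp: AutoGroup_def BijGroup_def auto_def X)

lemma linf_action: "qg_action (AutoGroup K) (linf_qg K) (aut_action K)"
  unfolding qg_action_def AutoGroup_simps
proof (intro conjI ballI)
  show "group (AutoGroup K)" by (rule K.AutoGroup)
  fix g assume g: "g \<in> auto K"
  let ?s = "inv_into X g"
  have s: "bij_betw ?s X X" by (rule bij_betw_inv_into[OF auto_bij[OF g]])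
  have "vn_iso X (range R.L) X (range R.L) (aut_action K g)"
    using mult_op_pullback_iso(1)[OF s] unfolding aut_action_def[abs_def] by (simp flip: X)
  moreover have "\<forall>x\<in>X. \<forall>y\<in>X. ?s (x \<otimes>\<^bsub>K\<^esub> y) = ?s x \<otimes>\<^bsub>K\<^esub> ?s y"
    by (intro ballI Bij_inv_into_lemma[where S = X and h = g and g = "mult K"])
      (use auto_hom[OF g] g in \<open>auto simp: auto_def X\<close>)
  then have "\<forall>a\<in>alg (linf_qg K). comult (linf_qg K) (aut_action K g a) =
    map_tensor (index (linf_qg K)) (alg (linf_qg K)) (index (linf_qg K)) (alg (linf_qg K)) (index (linf_qg K)) (index (linf_qg K))
      (aut_action K g) (aut_action K g) (comult (linf_qg K) a)"
    by (subst finite_qg_pullback[OF linf_finite_qg linf_finite_qg])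
      (use bij_betwE[OF s] aut_action_L[OF g] in auto)
  ultimately show "qg_iso (linf_qg K) (linf_qg K) (aut_action K g)"
    unfolding qg_iso_def linf_index Q.alg by blast
next
  fix a assume "a \<in> alg (linf_qg K)"
  then obtain c where c: "a = R.L c" by (auto simp: Q.alg)
  have id: "(\<lambda>x\<in>X. x) \<in> auto K" using K.id_in_auto by (simp add: X)
  have "inv_into X (\<lambda>x\<in>X. x) k = k" if "k \<in> X" for k
    using that bij_betw_inv_into_right[OF auto_bij[OF id], of k] inv_into_into[of k "\<lambda>x\<in>X. x" X] by auto
  then show "aut_action K (\<lambda>x\<in>X. x) a = a"
    unfolding c aut_action_L[OF id] R.L_eq_iff by simp
  fix g h assume gh: "g \<in> auto K" "h \<in> auto K"
  have comp: "compose X g h \<in> auto K"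
    using group.subgroup_self[OF K.AutoGroup] monoid.m_closed[OF group.is_monoid[OF K.AutoGroup], of g h] gh
    by (simp add: AutoGroup_simps)
  have "inv_into X (compose X g h) k = inv_into X h (inv_into X g k)" if "k \<in> X" for k
  proof (rule inv_into_f_eq)
    show "inj_on (compose X g h) X" using auto_bij[OF comp] by (simp add: bij_betw_def)
    show "inv_into X h (inv_into X g k) \<in> X"
      using that bij_betwE[OF bij_betw_inv_into[OF auto_bij]] gh by blast
    then show "compose X g h (inv_into X h (inv_into X g k)) = k"
      using that bij_betwE[OF bij_betw_inv_into[OF auto_bij]] gh
        bij_betw_inv_into_right[OF auto_bij[OF gh(1)] that]
        bij_betw_inv_into_right[OF auto_bij[OF gh(2)], of "inv_into X g k"]
      by (simp add: compose_eq)
  qed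
  then show "aut_action K (g \<otimes>\<^bsub>AutoGroup K\<^esub> h) a = aut_action K g (aut_action K h a)"
    unfolding c AutoGroup_simps(3)[OF gh] aut_action_L[OF comp] aut_action_L[OF gh(2)] aut_action_L[OF gh(1)] R.L_eq_iff
    by simp
qed

end

section \<open>From isomorphisms of quantum groups to group laws on a finite set\<close>

subsection \<open>Reduction to a rigidity property of the automorphism group\<close>

text \<open>The combinatorial form of rigidity: the law of a competing group is transported along
  the bijection to the set of \<open>K\<close>, so that the bijection becomes the identity and
  equivariance becomes an inclusion of automorphisms.\<close>

definition aut_rigid :: "('k, 'm) monoid_scheme \<Rightarrow> bool" where
  "aut_rigid K \<longleftrightarrow> (\<forall>\<Lambda> :: 'k monoid. group \<Lambda> \<longrightarrow> carrier \<Lambda> = carrier K \<longrightarrow> auto K \<subseteq> hom \<Lambda> \<Lambda> \<longrightarrow> K \<cong> \<Lambda>)"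

lemma comp_op_id: "T \<in> bop I \<Longrightarrow> T \<circ> op_id I = T"
  by (auto simp: op_id_def bop_zero bop_out fun_eq_iff)

lemma star_hom_comp: "star_hom I A J B f \<Longrightarrow> star_hom J B K C g \<Longrightarrow> star_hom I A K C (\<lambda>T. g (f T))"
  unfolding star_hom_def by simp

text \<open>A left unit \<open>e\<close> of one element \<open>x0\<close> is a left unit of every
  element, because each \<open>y\<close> has the form \<open>m x0 z\<close>. Solving
  \<open>m y x = e\<close> then provides left inverses.\<close>

lemma finite_semigroup_group:
  assumes m: "\<And>x y. x \<in> X \<Longrightarrow> y \<in> X \<Longrightarrow> m x y \<in> X"
    and assoc: "\<And>x y z. x \<in> X \<Longrightarrow> y \<in> X \<Longrightarrow> z \<in> X \<Longrightarrow> m (m x y) z = m x (m y z)"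
    and surj: "\<And>x k. x \<in> X \<Longrightarrow> k \<in> X \<Longrightarrow> \<exists>y\<in>X. m x y = k" "\<And>x k. x \<in> X \<Longrightarrow> k \<in> X \<Longrightarrow> \<exists>y\<in>X. m y x = k"
    and "X \<noteq> {}"
  obtains e where "group \<lparr>carrier = X, mult = m, one = e\<rparr>"
proof -
  obtain x0 where x0: "x0 \<in> X" using assms(5) by blast
  then obtain e where e: "e \<in> X" "m e x0 = x0" using surj(2) by blast
  have l_one: "m e y = y" if "y \<in> X" for y
  proof -
    obtain z where "z \<in> X" "m x0 z = y" using surj(1)[OF x0 \<open>y \<in> X\<close>] by blast
    then show ?thesis using assoc[OF e(1) x0, of z] e by simp
  qed
  have "group \<lparr>carrier = X, mult = m, one = e\<rparr>"
    by (rule groupI) (use m assoc l_one e surj(2)[OF _ e(1)] in auto)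
  then show ?thesis by (rule that)
qed

lemma finite_Bij: "finite S \<Longrightarrow> finite (Bij S)"
proof -
  assume "finite S"
  then have "finite (S \<rightarrow>\<^sub>E S)" by (simp add: finite_PiE)
  then show ?thesis by (rule finite_subset[rotated]) (auto simp: Bij_def PiE_def bij_betw_def)
qed

lemma auto_transport:
  assumes K: "group K" and L: "group \<Lambda>" and X: "carrier K = X" "carrier \<Lambda> = X"
    and \<sigma>: "\<sigma> \<in> iso K \<Lambda>" and g: "g \<in> auto K"
  shows "(\<lambda>x\<in>X. \<sigma> (g (inv_into X \<sigma> x))) \<in> auto \<Lambda>"
proof -
  have b: "bij_betw \<sigma> X X" "bij_betw g X X" and gE: "g \<in> extensional X"
    using \<sigma> g X by (auto simp: iso_def auto_def Bij_def)
  have b': "bij_betw (inv_into X \<sigma>) X X" by (rule bij_betw_inv_into[OF b(1)])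
  have h: "\<sigma> \<in> hom K \<Lambda>" "g \<in> hom K K" "inv_into X \<sigma> \<in> hom \<Lambda> K"
    using \<sigma> g X group.iso_set_sym[OF K \<sigma>] by (auto simp: iso_def auto_def)
  note mem = bij_betwE[OF b(1), rule_format] bij_betwE[OF b(2), rule_format] bij_betwE[OF b', rule_format]
  have "bij_betw (\<sigma> \<circ> (g \<circ> inv_into X \<sigma>)) X X"
    by (rule bij_betw_trans[OF bij_betw_trans[OF b' b(2)] b(1)])
  then have "bij_betw (\<lambda>x\<in>X. \<sigma> (g (inv_into X \<sigma> x))) X X"
    by (rule bij_betw_cong[THEN iffD1, rotated]) auto
  moreover have "(\<lambda>x\<in>X. \<sigma> (g (inv_into X \<sigma> x))) \<in> hom \<Lambda> \<Lambda>"
  proof (rule homI)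
    fix x y assume "x \<in> carrier \<Lambda>" "y \<in> carrier \<Lambda>"
    then have xy: "x \<in> X" "y \<in> X" using X by auto
    then have "x \<otimes>\<^bsub>\<Lambda>\<^esub> y \<in> X" using monoid.m_closed[OF group.is_monoid[OF L]] X by metis
    then show "(\<lambda>x\<in>X. \<sigma> (g (inv_into X \<sigma> x))) (x \<otimes>\<^bsub>\<Lambda>\<^esub> y) =
      (\<lambda>x\<in>X. \<sigma> (g (inv_into X \<sigma> x))) x \<otimes>\<^bsub>\<Lambda>\<^esub> (\<lambda>x\<in>X. \<sigma> (g (inv_into X \<sigma> x))) y"
      using xy X mem by (simp add: hom_mult[OF h(1)] hom_mult[OF h(2)] hom_mult[OF h(3)])
  qed (use mem X in simp)
  ultimately show ?thesis by (simp add: auto_def Bij_def X)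
qed

text \<open>One inclusion is the hypothesis. Transport along the inverse of \<open>\<sigma>\<close>
  embeds \<open>auto \<Lambda>\<close> into \<open>auto K\<close>, so the two finite sets have equal
  size.\<close>

lemma auto_eq_of_subset:
  assumes K: "group K" and L: "group \<Lambda>" and X: "carrier K = X" "carrier \<Lambda> = X" and fin: "finite X"
    and \<sigma>: "\<sigma> \<in> iso K \<Lambda>" and sub: "auto K \<subseteq> hom \<Lambda> \<Lambda>"
  shows "auto \<Lambda> = auto K"
proof -
  have sub': "auto K \<subseteq> auto \<Lambda>" using sub X by (auto simp: auto_def)
  have fin': "finite (auto \<Lambda>)" "finite (auto K)" using finite_Bij[OF fin] X by (auto simp: auto_def)
  let ?\<tau> = "inv_into X \<sigma>"
  have \<tau>: "?\<tau> \<in> iso \<Lambda> K" using group.iso_set_sym[OF K \<sigma>] X by simp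
  have b: "bij_betw ?\<tau> X X" using \<tau> X by (simp add: iso_def)
  let ?f = "\<lambda>g. \<lambda>x\<in>X. ?\<tau> (g (inv_into X ?\<tau> x))"
  have "?f ` auto \<Lambda> \<subseteq> auto K" using auto_transport[OF L K X(2,1) \<tau>] by blast
  moreover have "inj_on ?f (auto \<Lambda>)"
  proof (rule inj_onI)
    fix g h assume g: "g \<in> auto \<Lambda>" and h: "h \<in> auto \<Lambda>" and eq: "?f g = ?f h"
    have ext: "g \<in> extensional X" "h \<in> extensional X" and gX: "\<And>x. x \<in> X \<Longrightarrow> g x \<in> X \<and> h x \<in> X"
      using g h X by (auto simp: auto_def Bij_def bij_betw_def)
    show "g = h"
    proof (rule extensionalityI[OF ext])
      fix x assume x: "x \<in> X"
      then have y: "?\<tau> x \<in> X" using bij_betwE[OF b] by blast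
      have "?\<tau> (g x) = ?\<tau> (h x)"
        using fun_cong[OF eq, of "?\<tau> x"] y x b by (simp add: bij_betw_def inv_into_f_f)
      then show "g x = h x" using gX[OF x] b by (auto simp: bij_betw_def inj_on_def)
    qed
  qed
  ultimately have "card (auto \<Lambda>) \<le> card (auto K)" using card_inj_on_le fin' by blast
  then show ?thesis using card_seteq[OF fin'(1) sub'] by simp
qed

text \<open>The images \<open>p k\<close> of the point indicators are orthogonal idempotents with
  sum 1. A multiplicative unital comultiplication sends each of them to a sum of elementary tensors
  with coefficients 0 or 1, which is the table of a binary operation \<open>m\<close>.
  Coassociativity makes \<open>m\<close> associative, and invariance of the faithful Haar state
  makes its equations solvable.\<close>

theorem aut_rigid_imp_rigid:
  fixes K :: "('k, 'm) monoid_scheme"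
  assumes K: "group K" and fin: "finite (carrier K)" and rigid: "aut_rigid K"
  shows "rigid_relative_Aut TYPE('j) K"
proof -
  define X where "X = carrier K"
  interpret K: group K by (rule K)
  let ?P = "linf_qg K" and ?\<alpha> = "aut_action K"
  interpret P: finite_qg ?P X "ind_op X" "mult K" by (rule linf_finite_qg[OF K fin X_def])
  note idx = linf_index[OF K fin X_def]
  note act = aut_action_L[OF K fin X_def]
  note multR = mult_op_R[OF K fin X_def]
  have Xfin: "finite X" and X0: "X \<noteq> {}" using fin K.one_closed by (auto simp: X_def)
  have "\<exists>\<pi>\<^sub>0 \<zeta>. qg_iso ?P Q \<pi>\<^sub>0 \<and> \<zeta> \<in> auto (AutoGroup K) \<and>
      (\<forall>g\<in>carrier (AutoGroup K). \<forall>a\<in>alg ?P. \<beta> (\<zeta> g) (\<pi>\<^sub>0 a) = \<pi>\<^sub>0 (?\<alpha> g a))"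
    if Qk: "kac_type Q" and Qact: "qg_action (AutoGroup K) Q \<beta>"
      and \<pi>: "vn_iso (index ?P) (alg ?P) (index Q) (alg Q) \<pi>"
      and eqv: "\<forall>g\<in>carrier (AutoGroup K). \<forall>a\<in>alg ?P. \<beta> g (\<pi> a) = \<pi> (?\<alpha> g a)"
    for Q :: "'j qgrp" and \<beta> \<pi>
  proof -
    define J where "J = index Q"
    define p where "p = (\<lambda>k. \<pi> (ind_op X k))"
    have bij: "bij_betw \<pi> (range P.L) (alg Q)"
      and hom: "star_hom X (range P.L) J (alg Q) \<pi>"
      using \<pi> by (auto simp: vn_iso_def idx P.alg J_def)
    have cq: "von_neumann_algebra J (alg Q)" "star_hom J (alg Q) (J \<times> J) (qg_square Q) (comult Q)"
      "comult Q (op_id J) = op_id (J \<times> J)" "coassociative Q" and "\<exists>\<phi>. haar_state Q \<phi>"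
      using Qk by (auto simp: kac_type_def compact_quantum_group_def Let_def J_def)
    then obtain \<phi> where \<phi>: "haar_state Q \<phi>" by blast
    have \<pi>L: "\<pi> (P.L c) = lin X p c" for c
      unfolding p_def by (rule lin_map[OF Xfin]) (use hom in \<open>auto simp: star_hom_def\<close>)
    have algQ: "alg Q = range (lin X p)"
    proof -
      have "alg Q = \<pi> ` range P.L" using bij by (simp add: bij_betw_def)
      then show ?thesis by (simp add: image_image \<pi>L)
    qed
    have algbop: "alg Q \<subseteq> bop J" using cq(1) by (simp add: von_neumann_algebra_def)
    have comp: "\<pi> (a \<circ> b) = \<pi> a \<circ> \<pi> b" if "a \<in> range P.L" "b \<in> range P.L" for a b
      using hom that unfolding star_hom_def by blast
    have zero: "\<pi> op_zero = op_zero" "op_zero \<in> range P.L"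
    proof -
      have z: "op_zero = P.L (\<lambda>_. 0)" by (simp add: lin_def op_zero_def)
      then show "op_zero \<in> range P.L" by blast
      show "\<pi> op_zero = op_zero" unfolding z \<pi>L by (simp add: lin_def op_zero_def)
    qed
    \<comment> \<open>\<open>star_hom\<close> does not ask for units to be preserved; this follows
      from surjectivity, since the identity lies in its own bicommutant algebra and hence has a
      preimage.\<close>
    have one: "\<pi> (op_id X) = op_id J"
    proof -
      have "op_id J \<in> commutant J (commutant J (alg Q))"
        using op_id_bop[of J] by (auto simp: commutant_def op_id_def fun_eq_iff bop_zero bop_out bop_ell2)
      then have "op_id J \<in> alg Q" using cq(1) by (simp add: von_neumann_algebra_def)
      then obtain c where c: "op_id J = \<pi> (P.L c)" using algQ \<pi>L by auto
      have i: "op_id X \<in> range P.L" using P.p_sum idx by (metis rangeI)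
      have "\<pi> (op_id X) \<circ> op_id J = \<pi> (op_id X)"
        using i algbop bij_betwE[OF bij] by (intro comp_op_id) blast
      moreover have "op_id X \<circ> P.L c = P.L c"
        using bop_in[OF P.L_bop] idx by (auto simp: op_id_def)
      ultimately show ?thesis using comp[OF i rangeI, of c] c by simp
    qed
    interpret p: resolution J X p
    proof
      show "finite X" by (rule Xfin)
      fix k assume k: "k \<in> X"
      note kin = P.p_in[OF k]
      show "p k \<in> bop J" using bij_betwE[OF bij] kin algbop by (auto simp: p_def)
      show "p k \<circ> p k = p k" using comp[OF kin kin] P.p_idem[OF k] by (simp add: p_def)
      show "p k \<noteq> op_zero"
        using bij kin zero P.p_nonzero[OF k] by (metis p_def bij_betw_def inj_on_def)
      show "p k \<circ> p l = op_zero" if "l \<in> X" "k \<noteq> l" for l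
        using comp[OF kin P.p_in[OF that(1)]] P.p_orth[OF k that] zero(1) by (simp add: p_def)
    next
      show "lin X p (\<lambda>_. 1) = op_id J" using \<pi>L[of "\<lambda>_. 1"] one P.p_sum idx by simp
    qed
    interpret pp: resolution2 J X p J X p ..
    have sq: "qg_square Q = range pp.T.L" unfolding qg_square_def algQ J_def[symmetric] by (rule pp.vn_tensor_eq)
    have "\<exists>c. comult Q (p k) = pp.T.L c" if "k \<in> X" for k
      using cq(2) p.p_in[OF that] unfolding star_hom_def sq algQ by blast
    then obtain \<kappa> where \<kappa>: "\<And>k. k \<in> X \<Longrightarrow> comult Q (p k) = pp.T.L (\<kappa> k)" by metis
    have comL: "comult Q (p.L c) = pp.T.L (\<lambda>u. \<Sum>k\<in>X. c k * \<kappa> k u)" for c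
    proof -
      have "comult Q (p.L c) = lin X (\<lambda>k. comult Q (p k)) c"
        by (rule lin_map[OF Xfin]) (use cq(2) in \<open>auto simp: star_hom_def algQ\<close>)
      also have "\<dots> = lin X (\<lambda>k. pp.T.L (\<kappa> k)) c" by (rule lin_cong) (auto simp: \<kappa>)
      also have "\<dots> = pp.T.L (\<lambda>u. \<Sum>k\<in>X. c k * \<kappa> k u)"
        unfolding lin_def by (simp only: sum_distrib_left sum_distrib_right mult.assoc) (intro ext sum.swap)
      finally show ?thesis .
    qed
    \<comment> \<open>Idempotence and orthogonality of the \<open>p k\<close> pass to the
      coefficients: at each pair \<open>u\<close> they are 0 or 1, and at most one is nonzero. By
      \<open>\<kappa>_sum\<close> exactly one is nonzero, and its index \<open>\<mu> u\<close> is
      the product of the two entries of \<open>u\<close>.\<close>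
    have \<kappa>_mult: "\<kappa> k u * \<kappa> l u = (if k = l then \<kappa> k u else 0)" if "k \<in> X" "l \<in> X" "u \<in> X \<times> X" for k l u
    proof -
      have "comult Q (p k \<circ> p l) = comult Q (p k) \<circ> comult Q (p l)"
        using cq(2) p.p_in[OF that(1)] p.p_in[OF that(2)] unfolding star_hom_def algQ by blast
      then have *: "comult Q (p k \<circ> p l) = pp.T.L (\<lambda>u. \<kappa> k u * \<kappa> l u)"
        using that by (simp add: \<kappa> pp.T.L_comp)
      have "op_zero = p.L (\<lambda>_. 0)" by (simp add: lin_def op_zero_def)
      then have "comult Q op_zero = pp.T.L (\<lambda>_. 0)" using comL[of "\<lambda>_. 0"] by simp
      then have "comult Q (p k \<circ> p l) = pp.T.L (if k = l then \<kappa> k else (\<lambda>_. 0))"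
        using that \<kappa> p.p_idem p.p_orth by simp
      then have "pp.T.L (\<lambda>u. \<kappa> k u * \<kappa> l u) = pp.T.L (if k = l then \<kappa> k else (\<lambda>_. 0))" using * by simp
      then show ?thesis unfolding pp.T.L_eq_iff using that(3) by (auto split: if_splits)
    qed
    have \<kappa>_sum: "(\<Sum>k\<in>X. \<kappa> k u) = 1" if "u \<in> X \<times> X" for u
    proof -
      have "pp.T.L (\<lambda>u. \<Sum>k\<in>X. 1 * \<kappa> k u) = pp.T.L (\<lambda>_. 1)"
        using comL[of "\<lambda>_. 1"] cq(3) p.p_sum pp.T.p_sum by simp
      then show ?thesis unfolding pp.T.L_eq_iff using that by (cases u) auto
    qed
    have "\<exists>k\<in>X. \<kappa> k u \<noteq> 0" if "u \<in> X \<times> X" for u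
      using \<kappa>_sum[OF that] by (metis sum.neutral zero_neq_one)
    then obtain \<mu> where \<mu>: "\<And>u. u \<in> X \<times> X \<Longrightarrow> \<mu> u \<in> X \<and> \<kappa> (\<mu> u) u \<noteq> 0" by metis
    have \<kappa>_eq: "\<kappa> k u = (if k = \<mu> u then 1 else 0)" if "k \<in> X" "u \<in> X \<times> X" for k u
      using \<kappa>_mult[OF that(1) _ that(2), of "\<mu> u"] \<kappa>_mult[OF that(1,1,2)] \<mu>[OF that(2)] by auto
    define m where "m = (\<lambda>x y. \<mu> (x, y))"
    interpret Q: finite_qg Q X p m
    proof (unfold finite_qg_def finite_qg_axioms_def, intro conjI allI impI)
      show "resolution (index Q) X p" using p.resolution_axioms by (simp add: J_def)
      show "alg Q = range p.L" by (rule algQ)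
      show "x \<in> X \<Longrightarrow> y \<in> X \<Longrightarrow> m x y \<in> X" for x y using \<mu> by (simp add: m_def)
      fix c
      have "comult Q (p.L c) = pp.T.L (\<lambda>(x, y). c (m x y))"
        unfolding comL pp.T.L_eq_iff
      proof
        fix u assume u: "u \<in> X \<times> X"
        have "(\<Sum>k\<in>X. c k * \<kappa> k u) = (\<Sum>k\<in>X. if k = \<mu> u then c k else 0)"
          by (rule sum.cong) (auto simp: \<kappa>_eq u)
        then show "(\<Sum>k\<in>X. c k * \<kappa> k u) = (case u of (x, y) \<Rightarrow> c (m x y))"
          using \<mu>[OF u] Xfin by (cases u) (simp add: m_def)
      qed
      then show "comult Q (p.L c) = lin (X \<times> X) (resolution2.pq (index Q) p (index Q) p) (\<lambda>(x, y). c (m x y))"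
        by (simp add: J_def)
    qed
    have assoc: "m (m x y) z = m x (m y z)" if "x \<in> X" "y \<in> X" "z \<in> X" for x y z
      using cq(4) that unfolding Q.coassociative_iff by blast
    have fns: "faithful_normal_state J (alg Q) \<phi>" using \<phi> by (simp add: haar_state_def Let_def J_def)
    then have norm: "normal_functional J (alg Q) \<phi>" by (simp add: faithful_normal_state_def)
    have \<phi>0: "\<phi> (p k) \<noteq> 0" if k: "k \<in> X" for k
    proof
      assume 0: "\<phi> (p k) = 0"
      have "op_adj X (ind_op X k) = ind_op X k"
        unfolding ind_op_def op_adj_mult_op[OF Xfin] by (rule mult_op_cong) auto
      then have "op_adj J (p k) = p k"
        using hom P.p_in[OF k] unfolding star_hom_def p_def by metis
      then have "\<phi> (op_adj J (p k) \<circ> p k) = 0" using 0 p.p_idem[OF k] by simp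
      then have "p k = op_zero"
        using fns p.p_in[OF k] unfolding faithful_normal_state_def algQ by blast
      then show False using p.p_nonzero[OF k] by simp
    qed
    \<comment> \<open>Invariance applied to \<open>p k\<close> says that the sum of
      \<open>\<phi> (p y)\<close> over all \<open>y\<close> with \<open>m x y = k\<close> equals
      \<open>\<phi> (p k)\<close>. The latter is nonzero, so such a \<open>y\<close> exists.\<close>
    have surj: "\<exists>y\<in>X. m x y = k" "\<exists>y\<in>X. m y x = k" if "x \<in> X" "k \<in> X" for x k
    proof -
      define c :: "'k \<Rightarrow> complex" where "c = (\<lambda>l. if l = k then 1 else 0)"
      have pk: "p k = p.L c" using lin_single[OF Xfin that(2), of p] by (simp add: c_def)
      have h: "slice_right J (alg Q) \<phi> (comult Q (p k)) = op_scale (\<phi> (p k)) (op_id J)"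
        "slice_left J (alg Q) \<phi> (comult Q (p k)) = op_scale (\<phi> (p k)) (op_id J)"
        using \<phi> p.p_in[OF that(2)] by (auto simp: haar_state_def Let_def J_def algQ)
      have sc: "op_scale (\<phi> (p k)) (op_id J) = p.L (\<lambda>_. \<phi> (p k))"
        unfolding p.p_sum[symmetric] lin_scale by simp
      have "p.L (\<lambda>x. \<Sum>y\<in>X. c (m x y) * \<phi> (p y)) = p.L (\<lambda>_. \<phi> (p k))"
        using h(1) Q.haar_slices(1)[OF norm[unfolded J_def], of c] sc unfolding pk J_def by simp
      then have "(\<Sum>y\<in>X. c (m x y) * \<phi> (p y)) \<noteq> 0" unfolding p.L_eq_iff using that \<phi>0 by simp
      then have "\<exists>y\<in>X. c (m x y) * \<phi> (p y) \<noteq> 0" by (rule contrapos_np) (auto intro: sum.neutral)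
      then show "\<exists>y\<in>X. m x y = k" by (auto simp: c_def split: if_splits)
      have "p.L (\<lambda>y. \<Sum>x\<in>X. c (m x y) * \<phi> (p x)) = p.L (\<lambda>_. \<phi> (p k))"
        using h(2) Q.haar_slices(2)[OF norm[unfolded J_def], of c] sc unfolding pk J_def by simp
      then have "(\<Sum>y\<in>X. c (m y x) * \<phi> (p y)) \<noteq> 0" unfolding p.L_eq_iff using that \<phi>0 by simp
      then have "\<exists>y\<in>X. c (m y x) * \<phi> (p y) \<noteq> 0" by (rule contrapos_np) (auto intro: sum.neutral)
      then show "\<exists>y\<in>X. m y x = k" by (auto simp: c_def split: if_splits)
    qed
    obtain e where L: "group \<lparr>carrier = X, mult = m, one = e\<rparr>"
      using finite_semigroup_group[of X m] Q.m_closed assoc surj X0 by blast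
    define \<Lambda> where "\<Lambda> = \<lparr>carrier = X, mult = m, one = e\<rparr>"
    have \<Lambda>: "group \<Lambda>" "carrier \<Lambda> = X" "mult \<Lambda> = m" using L by (simp_all add: \<Lambda>_def)
    have gX: "bij_betw g X X" if "g \<in> auto K" for g by (rule auto_bij[OF K fin X_def that])
    have \<beta>L: "\<beta> g (p.L c) = p.L (\<lambda>k. c (inv_into X g k))" if g: "g \<in> auto K" for g c
    proof -
      have "\<beta> g (\<pi> (P.L c)) = \<pi> (?\<alpha> g (P.L c))"
        using eqv g AutoGroup_simps(1)[OF K fin X_def] P.alg by blast
      then show ?thesis unfolding \<pi>L act[OF g] .
    qed
    have sub: "auto K \<subseteq> hom \<Lambda> \<Lambda>"
    proof
      fix g assume g: "g \<in> auto K"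
      let ?s = "inv_into X g"
      have s: "bij_betw ?s X X" by (rule bij_betw_inv_into[OF gX[OF g]])
      have "qg_iso Q Q (\<beta> g)"
        using Qact g AutoGroup_simps(1)[OF K fin X_def] by (simp add: qg_action_def)
      then have "\<forall>x\<in>X. \<forall>y\<in>X. ?s (m x y) = m (?s x) (?s y)"
        using finite_qg_pullback[OF Q.finite_qg_axioms Q.finite_qg_axioms, of ?s "\<beta> g"] bij_betwE[OF s] \<beta>L[OF g]
        by (simp add: qg_iso_def)
      then have hs: "?s (m (g x) (g y)) = m x y" if "x \<in> X" "y \<in> X" for x y
        using that gX[OF g] bij_betwE[OF gX[OF g]] by (simp add: bij_betw_def inv_into_f_f)
      show "g \<in> hom \<Lambda> \<Lambda>"
      proof (rule homI)
        fix x y assume "x \<in> carrier \<Lambda>" "y \<in> carrier \<Lambda>"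
        then have xy: "x \<in> X" "y \<in> X" by (auto simp: \<Lambda>)
        then have "m (g x) (g y) \<in> X" using Q.m_closed bij_betwE[OF gX[OF g]] by blast
        then show "g (x \<otimes>\<^bsub>\<Lambda>\<^esub> y) = g x \<otimes>\<^bsub>\<Lambda>\<^esub> g y"
          using hs[OF xy] bij_betw_inv_into_right[OF gX[OF g]] by (metis \<Lambda>(3))
      qed (use bij_betwE[OF gX[OF g]] \<Lambda> in auto)
    qed
    have "K \<cong> \<Lambda>" using rigid \<Lambda> sub unfolding aut_rigid_def X_def by blast
    then obtain \<sigma> where \<sigma>: "\<sigma> \<in> iso K \<Lambda>" by (auto simp: is_iso_def)
    let ?\<tau> = "inv_into X \<sigma>"
    have \<sigma>b: "bij_betw \<sigma> X X" using \<sigma> \<Lambda> by (simp add: iso_def X_def)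
    have \<tau>: "bij_betw ?\<tau> X X" by (rule bij_betw_inv_into[OF \<sigma>b])
    have \<tau>h: "?\<tau> (m x y) = ?\<tau> x \<otimes>\<^bsub>K\<^esub> ?\<tau> y" if "x \<in> X" "y \<in> X" for x y
    proof -
      have "?\<tau> \<in> hom \<Lambda> K" using group.iso_set_sym[OF K \<sigma>] by (simp add: iso_def X_def)
      then show ?thesis using that \<Lambda> hom_mult by fastforce
    qed
    \<comment> \<open>Functions are pulled back along the inverse of \<open>\<sigma>\<close>, which
      is a homomorphism from \<open>\<Lambda>\<close> to \<open>K\<close>; after
      \<open>\<pi>\<close> has been applied, this intertwines the comultiplications.\<close>
    define t where "t = (\<lambda>T. mult_op X (\<lambda>k. op_symbol T (?\<tau> k)))"
    have t: "vn_iso X (range P.L) X (range P.L) t" "t (P.L c) = P.L (\<lambda>k. c (?\<tau> k))" for c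
      unfolding t_def by (rule mult_op_pullback_iso[OF K fin X_def \<tau>])+
    define \<pi>0 where "\<pi>0 = (\<lambda>T. \<pi> (t T))"
    have \<pi>0L: "\<pi>0 (P.L c) = p.L (\<lambda>k. c (?\<tau> k))" for c by (simp add: \<pi>0_def t \<pi>L)
    have "vn_iso X (range P.L) J (alg Q) \<pi>0"
    proof -
      have "bij_betw (\<pi> \<circ> t) (range P.L) (alg Q)"
        using t(1) bij by (intro bij_betw_trans) (auto simp: vn_iso_def)
      moreover have "star_hom X (range P.L) J (alg Q) \<pi>0"
        unfolding \<pi>0_def by (rule star_hom_comp[OF _ hom]) (use t(1) in \<open>simp only: vn_iso_def\<close>)
      ultimately show ?thesis unfolding vn_iso_def \<pi>0_def comp_def by blast
    qed
    then have iso: "qg_iso ?P Q \<pi>0"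
      unfolding qg_iso_def idx P.alg J_def
      using finite_qg_pullback[OF P.finite_qg_axioms Q.finite_qg_axioms, of ?\<tau> \<pi>0] bij_betwE[OF \<tau>] \<pi>0L \<tau>h
      by (simp add: idx P.alg)
    have eq: "auto \<Lambda> = auto K"
      by (rule auto_eq_of_subset[OF K \<Lambda>(1) _ \<Lambda>(2) Xfin \<sigma> sub]) (simp add: X_def)
    \<comment> \<open>Conjugation by \<open>\<sigma>\<close> maps \<open>auto K\<close> into
      \<open>auto \<Lambda>\<close>, which is \<open>auto K\<close> again, so it permutes
      \<open>auto K\<close>.\<close>
    define c\<sigma> where "c\<sigma> = (\<lambda>g. \<lambda>x\<in>X. \<sigma> (g (?\<tau> x)))"
    define \<zeta> where "\<zeta> = (\<lambda>g\<in>auto K. c\<sigma> g)"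
    have \<zeta>K: "c\<sigma> g \<in> auto K" if "g \<in> auto K" for g
      using auto_transport[OF K \<Lambda>(1) _ \<Lambda>(2) \<sigma> that] unfolding eq c\<sigma>_def by (simp add: X_def)
    have inj: "inj_on c\<sigma> (auto K)"
    proof (rule inj_onI)
      fix g h assume g: "g \<in> auto K" and h: "h \<in> auto K" and gh: "c\<sigma> g = c\<sigma> h"
      have ext: "g \<in> extensional X" "h \<in> extensional X"
        using g h by (auto simp: auto_def Bij_def X_def)
      show "g = h"
      proof (rule extensionalityI[OF ext])
        fix x assume x: "x \<in> X"
        then have y: "\<sigma> x \<in> X" using bij_betwE[OF \<sigma>b] by blast
        have "\<sigma> (g x) = \<sigma> (h x)"
          using fun_cong[OF gh, of "\<sigma> x"] y x \<sigma>b by (simp add: c\<sigma>_def bij_betw_def inv_into_f_f)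
        then show "g x = h x"
          using bij_betwE[OF gX[OF g]] bij_betwE[OF gX[OF h]] x \<sigma>b by (auto simp: bij_betw_def inj_on_def)
      qed
    qed
    have finA: "finite (auto K)" using finite_Bij[OF Xfin] by (auto simp: auto_def X_def)
    have "bij_betw \<zeta> (auto K) (auto K)"
    proof -
      have "c\<sigma> ` auto K = auto K" using endo_inj_surj[OF finA _ inj] \<zeta>K by blast
      then have "bij_betw c\<sigma> (auto K) (auto K)" using inj by (simp add: bij_betw_def)
      then show ?thesis by (rule bij_betw_cong[THEN iffD1, rotated]) (simp add: \<zeta>_def)
    qed
    moreover have "\<zeta> \<in> hom (AutoGroup K) (AutoGroup K)"
    proof (rule homI)
      note [simp] = AutoGroup_simps[OF K fin X_def]
      fix g h assume "g \<in> carrier (AutoGroup K)" "h \<in> carrier (AutoGroup K)"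
      then have gh: "g \<in> auto K" "h \<in> auto K" by auto
      have comp: "compose X g h \<in> auto K"
        using monoid.m_closed[OF group.is_monoid[OF K.AutoGroup], of g h] gh by simp
      have "c\<sigma> (compose X g h) = compose X (c\<sigma> g) (c\<sigma> h)"
        using bij_betwE[OF \<tau>] bij_betwE[OF \<sigma>b] bij_betwE[OF gX[OF gh(1)]] bij_betwE[OF gX[OF gh(2)]] \<sigma>b
        by (auto simp: c\<sigma>_def compose_def fun_eq_iff bij_betw_def inv_into_f_f)
      then show "\<zeta> (g \<otimes>\<^bsub>AutoGroup K\<^esub> h) = \<zeta> g \<otimes>\<^bsub>AutoGroup K\<^esub> \<zeta> h"
        using gh comp \<zeta>K by (simp add: \<zeta>_def)
    qed (use \<zeta>K in \<open>auto simp: \<zeta>_def AutoGroup_simps[OF K fin X_def]\<close>)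
    ultimately have \<zeta>: "\<zeta> \<in> auto (AutoGroup K)"
      by (auto simp: auto_def[of "AutoGroup K"] Bij_def AutoGroup_simps[OF K fin X_def] \<zeta>_def)
    have "\<beta> (\<zeta> g) (\<pi>0 a) = \<pi>0 (?\<alpha> g a)" if gK: "g \<in> auto K" and a: "a \<in> range P.L" for g a
    proof -
      obtain c where c: "a = P.L c" using a by blast
      have "?\<tau> (inv_into X (c\<sigma> g) k) = inv_into X g (?\<tau> k)" if k: "k \<in> X" for k
      proof -
        let ?u = "inv_into X g (?\<tau> k)"
        have u: "?u \<in> X" using k bij_betwE[OF \<tau>] bij_betwE[OF bij_betw_inv_into[OF gX[OF gK]]] by blast
        have gu: "g ?u = ?\<tau> k" using bij_betw_inv_into_right[OF gX[OF gK]] k bij_betwE[OF \<tau>] by blast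
        have "inv_into X (c\<sigma> g) k = \<sigma> ?u"
        proof (rule inv_into_f_eq)
          show "inj_on (c\<sigma> g) X" using gX[OF \<zeta>K[OF gK]] by (simp add: bij_betw_def)
          show "\<sigma> ?u \<in> X" using u bij_betwE[OF \<sigma>b] by blast
          then show "c\<sigma> g (\<sigma> ?u) = k"
            using u gu k \<sigma>b bij_betw_inv_into_right[OF \<sigma>b k] by (simp add: c\<sigma>_def bij_betw_def inv_into_f_f)
        qed
        then show ?thesis using u \<sigma>b by (simp add: bij_betw_def inv_into_f_f)
      qed
      then show ?thesis
        using gK \<zeta>K by (simp add: c act \<pi>0L \<beta>L \<zeta>_def p.L_eq_iff)
    qed
    then show ?thesis using iso \<zeta> unfolding AutoGroup_simps(1)[OF K fin X_def] P.alg by blast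
  qed
  then show ?thesis
    unfolding rigid_relative_Aut_def rigid_relative_def
    using linf_kac[OF K fin X_def] linf_action[OF K fin X_def] by blast
qed

section \<open>Coset enumeration in groups generated by elements that multiply like
  three-cycles\<close>

section \<open>Families of three-cycles\<close>

abbreviation transp :: "nat \<Rightarrow> nat \<Rightarrow> nat \<Rightarrow> nat" where
  "transp \<equiv> Transposition.transpose"

definition cyc3 :: "nat \<Rightarrow> nat \<Rightarrow> nat \<Rightarrow> nat \<Rightarrow> nat" where
  "cyc3 a b c = transp a b \<circ> transp b c"

definition triple :: "nat \<Rightarrow> nat \<Rightarrow> nat \<Rightarrow> nat \<Rightarrow> bool" where
  "triple n a b c \<longleftrightarrow> a \<in> {1..n} \<and> b \<in> {1..n} \<and> c \<in> {1..n} \<and> a \<noteq> b \<and> b \<noteq> c \<and> a \<noteq> c"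

lemma cyc3_apply:
  assumes "a \<noteq> b" "b \<noteq> c" "a \<noteq> c"
  shows "cyc3 a b c x = (if x = a then b else if x = b then c else if x = c then a else x)"
  using assms by (auto simp: cyc3_def Transposition.transpose_def)

lemma tripleD: "triple n a b c \<Longrightarrow> triple n b c a" "triple n a b c \<Longrightarrow> triple n c b a"
  "triple n a b c \<Longrightarrow> triple (Suc n) a b c"
  by (auto simp: triple_def)

lemma cyc3_permutes: "triple n a b c \<Longrightarrow> cyc3 a b c permutes {1..n}"
  unfolding cyc3_def triple_def by (intro permutes_compose permutes_swap_id) auto

text \<open>The induction shows that left multiplication by a generated element preserves
  \<open>S\<close>; applied to the unit this gives membership. Hence \<open>S\<close> may be a mere
  union of cosets, as in the coset enumerations below.\<close>

lemma (in group) generate_subset_of_closed: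
  assumes "H \<subseteq> carrier G" "\<And>h. h \<in> H \<Longrightarrow> inv h \<in> H" "\<one> \<in> S" "S \<subseteq> carrier G"
    and "\<And>h s. h \<in> H \<Longrightarrow> s \<in> S \<Longrightarrow> h \<otimes> s \<in> S"
  shows "generate G H \<subseteq> S"
proof
  fix x assume x: "x \<in> generate G H"
  then have "x \<in> carrier G \<and> (\<forall>s\<in>S. x \<otimes> s \<in> S)"
  proof induction
    case one
    then show ?case using assms(4) by auto
  next
    case (incl h)
    then show ?case using assms by blast
  next
    case (inv h)
    then show ?case using assms by blast
  next
    case (eng h1 h2)
    then have "h1 \<otimes> h2 \<otimes> s = h1 \<otimes> (h2 \<otimes> s)" if "s \<in> S" for s
      using that assms(4) by (intro m_assoc) auto
    then show ?case using eng by auto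
  qed
  then show "x \<in> S" using assms(3) by force
qed

text \<open>Used for the lifts \<open>cyc\<close> in \<open>G\<close> with sign \<open>z\<close>,
  and for pairs of lifts in \<open>G \<times>\<times> L\<close> with a pair of signs. The rules
  suffice to bound the kernel of \<open>\<theta>\<close> on the generated group by the sign
  \<open>w\<close>, which is what the second use is for: the generated group is then a graph up to
  that sign.\<close>

locale three_cycle_family = group G for G (structure) +
  fixes n :: nat and f :: "nat \<Rightarrow> nat \<Rightarrow> nat \<Rightarrow> 'a" and w :: 'a and \<theta> :: "'a \<Rightarrow> nat \<Rightarrow> nat"
  assumes f_closed [simp]: "triple n a b c \<Longrightarrow> f a b c \<in> carrier G"
    and w_closed [simp]: "w \<in> carrier G"
    and w_sq: "w \<otimes> w = \<one>"
    and w_comm: "triple n a b c \<Longrightarrow> w \<otimes> f a b c = f a b c \<otimes> w"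
    and f_rot: "triple n a b c \<Longrightarrow> f a b c = f b c a"
    and f_inv: "triple n a b c \<Longrightarrow> f a b c \<otimes> f c b a = \<one>"
    and f_sq: "triple n a b c \<Longrightarrow> f a b c \<otimes> f a b c = f c b a"
    and f_prod: "triple n q m p \<Longrightarrow> triple n p m x \<Longrightarrow> q \<noteq> x \<Longrightarrow> f q m p \<otimes> f p m x = w \<otimes> f q m x"
    and f_conj: "triple n a b c \<Longrightarrow> triple n p q r \<Longrightarrow>
        f a b c \<otimes> f p q r = f (cyc3 a b c p) (cyc3 a b c q) (cyc3 a b c r) \<otimes> f a b c"
    and \<theta>_mult: "g \<in> carrier G \<Longrightarrow> h \<in> carrier G \<Longrightarrow> \<theta> (g \<otimes> h) = \<theta> g \<circ> \<theta> h"
    and \<theta>_one: "\<theta> \<one> = id"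
    and \<theta>_w: "\<theta> w = id"
    and \<theta>_f: "triple n a b c \<Longrightarrow> \<theta> (f a b c) = cyc3 a b c"
begin

definition fam :: "nat \<Rightarrow> 'a set" where
  "fam k = insert w {f a b c | a b c. triple k a b c}"

lemma famI: "triple k a b c \<Longrightarrow> f a b c \<in> fam k"
  by (auto simp: fam_def)

lemma triple_mono: "triple k a b c \<Longrightarrow> k \<le> n \<Longrightarrow> triple n a b c"
  by (auto simp: triple_def)

lemma fam_closed: "k \<le> n \<Longrightarrow> fam k \<subseteq> carrier G"
  by (auto simp: fam_def dest: triple_mono)

lemma fam_inv: "k \<le> n \<Longrightarrow> x \<in> fam k \<Longrightarrow> inv x \<in> fam k"
proof -
  assume k: "k \<le> n" and x: "x \<in> fam k"
  have "inv w = w" using w_sq by (simp add: inv_equality)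
  moreover have "inv (f a b c) = f c b a" if "triple k a b c" for a b c
    using f_inv[OF tripleD(2)[OF triple_mono[OF that k]]] triple_mono[OF that k] tripleD(2)
    by (intro inv_equality) auto
  moreover have "w \<in> fam k" by (simp add: fam_def)
  moreover have "f c b a \<in> fam k" if "triple k a b c" for a b c using famI tripleD(2) that by blast
  moreover consider "x = w" | a b c where "triple k a b c" "x = f a b c" using x by (auto simp: fam_def)
  ultimately show ?thesis by metis
qed

lemma generate_fam_subset:
  assumes "k \<le> n" "\<one> \<in> S" "S \<subseteq> carrier G" "\<And>x s. x \<in> fam k \<Longrightarrow> s \<in> S \<Longrightarrow> x \<otimes> s \<in> S"
  shows "generate G (fam k) \<subseteq> S"
  by (rule generate_subset_of_closed[OF fam_closed[OF assms(1)] fam_inv[OF assms(1)] assms(2-4)])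

lemma \<theta>_fix:
  assumes "k \<le> n" "x \<in> generate G (fam k)" "k < i"
  shows "\<theta> x i = i"
proof -
  have "generate G (fam k) \<subseteq> {x \<in> carrier G. \<theta> x i = i}"
  proof (rule generate_fam_subset[OF assms(1)])
    fix x s assume "x \<in> fam k" and s: "s \<in> {x \<in> carrier G. \<theta> x i = i}"
    then consider "x = w" | a b c where "triple k a b c" "x = f a b c" by (auto simp: fam_def)
    then show "x \<otimes> s \<in> {x \<in> carrier G. \<theta> x i = i}"
    proof cases
      case 1
      then show ?thesis using s by (simp add: \<theta>_mult \<theta>_w)
    next
      case 2
      then show ?thesis
        using s assms triple_mono[OF 2(1) assms(1)]
        by (auto simp: \<theta>_mult \<theta>_f cyc3_apply triple_def)
    qed
  qed (auto simp: \<theta>_one)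
  then show ?thesis using assms(2) by auto
qed

text \<open>Coset enumeration: with \<open>H\<close> generated by the three-cycles on \<open>{1..k}\<close> and \<open>N = k + 1\<close>, the cosets
  \<open>H\<close> and \<open>f a N x H\<close> (independent of \<open>a\<close>) exhaust the group generated by the three-cycles on \<open>{1..N}\<close>,
  and \<open>\<theta>\<close> sends the elements of the latter to permutations with \<open>N \<mapsto> x\<close>.\<close>

lemma generate_fam_step:
  assumes N: "N = Suc k" "N \<le> n" and x: "x \<in> generate G (fam N)" and fixN: "\<theta> x N = N"
  shows "x \<in> generate G (fam k)"
proof -
  define H where "H = generate G (fam k)"
  define A where "A = {f a N x \<otimes> h | a x h. a \<in> {1..k} \<and> x \<in> {1..k} \<and> a \<noteq> x \<and> h \<in> H}"
  have kn: "k \<le> n" using N by simp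
  have HG: "H \<subseteq> carrier G" unfolding H_def by (rule generate_incl[OF fam_closed[OF kn]])
  have H1: "\<one> \<in> H" and Hm: "\<And>x y. x \<in> H \<Longrightarrow> y \<in> H \<Longrightarrow> x \<otimes> y \<in> H"
    and Hw: "w \<in> H" and Hf: "\<And>a b c. triple k a b c \<Longrightarrow> f a b c \<in> H"
    unfolding H_def by (auto intro: generate.one generate.eng generate.incl simp: fam_def)
  have tr: "triple n a N x" "triple n N a x" "triple n a x N" if "a \<in> {1..k}" "x \<in> {1..k}" "a \<noteq> x" for a x
    using that N by (auto simp: triple_def)
  have AI: "f a N x \<otimes> h \<in> A" if "a \<in> {1..k}" "x \<in> {1..k}" "a \<noteq> x" "h \<in> H" for a x h
    using that unfolding A_def by blast
  \<comment> \<open>The coset of \<open>f a N x\<close> does not depend on \<open>a\<close>: the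
    quotient of two representatives is \<open>f x N a \<otimes> f b N x\<close>. Rotating both
    factors brings \<open>N\<close> to the place where \<open>f_prod\<close> cancels it, and what
    remains is \<open>w \<otimes> f a x b\<close>, an element of \<open>H\<close>.\<close>
  have change: "\<exists>h'\<in>H. f b N x \<otimes> h = f a N x \<otimes> h'"
    if "a \<in> {1..k}" "b \<in> {1..k}" "x \<in> {1..k}" "a \<noteq> x" "b \<noteq> x" "h \<in> H" for a b x h
  proof (cases "a = b")
    case False
    note t = tr[OF that(1,3,4)] tr[OF that(2,3,5)]
    have c: "f a N x \<in> carrier G" "f x N a \<in> carrier G" "f b N x \<in> carrier G"
      using t(1,4) tripleD(2)[OF t(1)] by simp_all
    have "f x N a \<otimes> f b N x = f a x N \<otimes> f N x b"
      using f_rot[OF tripleD(2)[OF t(1)]] f_rot[OF t(2)] f_rot[OF t(3)] f_rot[OF t(4)] f_rot[OF tripleD(1)[OF t(4)]]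
      by simp
    also have "\<dots> = w \<otimes> f a x b"
      using t False that N by (intro f_prod) (auto simp: triple_def)
    finally have e: "f x N a \<otimes> f b N x = w \<otimes> f a x b" .
    have "f b N x = f a N x \<otimes> (f x N a \<otimes> f b N x)"
      using f_inv[OF t(1)] c by (simp flip: m_assoc)
    then have "f b N x \<otimes> h = f a N x \<otimes> (w \<otimes> f a x b \<otimes> h)"
      unfolding e using c that HG Hf[of a x b] False by (simp add: m_assoc triple_def subset_iff)
    moreover have "w \<otimes> f a x b \<otimes> h \<in> H"
      using that False by (intro Hm Hw Hf) (auto simp: triple_def)
    ultimately show ?thesis by blast
  qed (use that in auto)
  have "generate G (fam N) \<subseteq> H \<union> A"
  proof (rule generate_fam_subset[OF N(2)])
    show "\<one> \<in> H \<union> A" using H1 by simp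
    show "H \<union> A \<subseteq> carrier G" using HG tr by (auto simp: A_def)
    fix y s assume y: "y \<in> fam N" and s: "s \<in> H \<union> A"
    show "y \<otimes> s \<in> H \<union> A"
    proof (cases "y \<in> fam k")
      case True
      then have yH: "y \<in> H" unfolding H_def by (rule generate.incl)
      show ?thesis
      proof (cases "s \<in> H")
        case False
        then obtain a x h where s': "s = f a N x \<otimes> h" "a \<in> {1..k}" "x \<in> {1..k}" "a \<noteq> x" "h \<in> H"
          using s by (auto simp: A_def)
        note t = tr[OF s'(2-4)]
        have cl: "f a N x \<in> carrier G" "h \<in> carrier G" using t s' HG by auto
        consider "y = w" | p q r where "triple k p q r" "y = f p q r" using True by (auto simp: fam_def)
        then show ?thesis
        proof cases
          case 1
          have "y \<otimes> s = f a N x \<otimes> (w \<otimes> h)"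
            using w_comm[OF t(1)] cl unfolding 1 s'(1) by (simp flip: m_assoc)
          then show ?thesis using AI s' Hm Hw by auto
        next
          case 2
          note t2 = triple_mono[OF 2(1) kn]
          let ?c = "cyc3 p q r"
          have cN: "?c N = N" using 2 N by (auto simp: cyc3_apply triple_def)
          have mem: "?c a \<in> {1..k}" "?c x \<in> {1..k}" "?c a \<noteq> ?c x"
            using permutes_in_image[OF cyc3_permutes[OF 2(1)]] permutes_inj[OF cyc3_permutes[OF 2(1)]] s'
            by (auto simp: inj_eq)
          have "y \<otimes> s = f p q r \<otimes> f a N x \<otimes> h"
            using cl t2 unfolding 2 s'(1) by (simp add: m_assoc)
          also have "\<dots> = f (?c a) N (?c x) \<otimes> (f p q r \<otimes> h)"
            using f_conj[OF t2 t(1)] cl t2 tr(1)[OF mem] cN by (simp add: m_assoc)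
          finally show ?thesis using AI[OF mem] Hm Hf[OF 2(1)] s' by auto
        qed
      qed (use yH Hm in auto)
    next
      case False
      obtain p q where pq: "p \<in> {1..k}" "q \<in> {1..k}" "p \<noteq> q" "y = f q N p"
      proof -
        obtain a b c where abc: "triple N a b c" "y = f a b c" using y False by (auto simp: fam_def)
        note t = triple_mono[OF abc(1) N(2)]
        have "a = N \<or> b = N \<or> c = N"
        proof (rule ccontr)
          assume "\<not> ?thesis"
          then have "triple k a b c" using abc(1) N(1) by (auto simp: triple_def)
          then show False using False abc(2) by (auto simp: fam_def)
        qed
        then show ?thesis
        proof (elim disjE)
          assume "a = N"
          then show ?thesis using that[of b c] abc f_rot[OF t] f_rot[OF tripleD(1)[OF t]] N(1)
            by (auto simp: triple_def)
        next
          assume "b = N"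
          then show ?thesis using that[of c a] abc N(1) by (auto simp: triple_def)
        next
          assume "c = N"
          then show ?thesis using that[of a b] abc f_rot[OF t] N(1) by (auto simp: triple_def)
        qed
      qed
      note tpq = tr[OF pq(2,1) pq(3)[symmetric]] tr[OF pq(1-3)]
      show ?thesis
      proof (cases "s \<in> H")
        case True
        then show ?thesis using AI[OF pq(2,1) pq(3)[symmetric]] pq by auto
      next
        case False
        then obtain a x h where s': "s = f a N x \<otimes> h" "a \<in> {1..k}" "x \<in> {1..k}" "a \<noteq> x" "h \<in> H"
          using s by (auto simp: A_def)
        \<comment> \<open>By \<open>change\<close> the first point of the representative of
          \<open>s\<close> is at choice. It is taken so that the product with \<open>f q N p\<close>
          falls under \<open>f_inv\<close>, \<open>f_sq\<close> or \<open>f_prod\<close>.\<close>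
        consider "x = q" | "x = p" | "x \<noteq> p" "x \<noteq> q" by blast
        then show ?thesis
        proof cases
          case 1
          then obtain h' where h': "h' \<in> H" "s = f p N q \<otimes> h'" using change[of p a x h] s' pq by auto
          have "y \<otimes> s = f q N p \<otimes> f p N q \<otimes> h'"
            using h' HG tpq unfolding pq(4) h'(2) by (simp add: m_assoc subset_iff)
          then show ?thesis using f_inv[OF tpq(1)] h' HG by auto
        next
          case 2
          then obtain h' where h': "h' \<in> H" "s = f q N p \<otimes> h'" using change[of q a x h] s' pq by auto
          have "y \<otimes> s = f q N p \<otimes> f q N p \<otimes> h'"
            using h' HG tpq unfolding pq(4) h'(2) by (simp add: m_assoc subset_iff)
          then show ?thesis using f_sq[OF tpq(1)] h' AI[OF pq(1-3)] by auto
        next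
          case 3
          then obtain h' where h': "h' \<in> H" "s = f p N x \<otimes> h'" using change[of p a x h] s' pq by auto
          have t3: "triple n p N x" "triple n q N x" using tr s' pq 3 by auto
          have "y \<otimes> s = f q N p \<otimes> f p N x \<otimes> h'"
            using h' HG tpq t3 unfolding pq(4) h'(2) by (simp add: m_assoc subset_iff)
          also have "\<dots> = w \<otimes> f q N x \<otimes> h'"
            using f_prod[OF tpq(1) t3(1)] 3 by simp
          also have "\<dots> = f q N x \<otimes> (w \<otimes> h')"
            using w_comm[OF t3(2)] h' HG t3 by (simp add: m_assoc subset_iff)
          finally show ?thesis using AI[of q x "w \<otimes> h'"] h' Hm Hw pq s' 3 by auto
        qed
      qed
    qed
  qed
  then have "x \<in> H \<union> A" using x by blast
  \<comment> \<open>An element \<open>f a N y \<otimes> h\<close> sends \<open>N\<close> to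
    \<open>y\<close>, because \<open>h\<close> fixes \<open>N\<close>.\<close>
  moreover have "x \<notin> A"
  proof
    assume "x \<in> A"
    then obtain a y h where *: "x = f a N y \<otimes> h" "a \<in> {1..k}" "y \<in> {1..k}" "a \<noteq> y" "h \<in> H"
      by (auto simp: A_def)
    note t = tr[OF *(2-4)]
    have "\<theta> h N = N" using \<theta>_fix[OF kn, of h N] * N by (simp add: H_def)
    then have "\<theta> x N = y"
      using * HG t by (auto simp: \<theta>_mult \<theta>_f cyc3_apply triple_def subset_iff)
    then show False using fixN * N by auto
  qed
  ultimately show ?thesis by (simp add: H_def)
qed

text \<open>On three points there are, up to rotation, only \<open>f 1 2 3\<close> and its inverse,
  which is also its square. With the sign they generate at most six elements, listed in
  \<open>?S\<close>, and the image of the point 1 tells the cosets of the sign apart.\<close>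

lemma kernel_three:
  assumes n: "3 \<le> n" and x: "x \<in> generate G (fam 3)" and id: "\<theta> x = id"
  shows "x \<in> {\<one>, w}"
proof -
  let ?S = "{u \<otimes> v | u v. u \<in> {\<one>, w} \<and> v \<in> {\<one>, f 1 2 3, f 3 2 1}}"
  have t: "triple n 1 2 3" "triple n 3 2 1" using n by (auto simp: triple_def)
  have cl: "f 1 2 3 \<in> carrier G" "f 3 2 1 \<in> carrier G" using t by auto
  note e = f_inv[OF t(1)] f_inv[OF t(2)] f_sq[OF t(1)] f_sq[OF t(2)] w_comm[OF t(1)] w_comm[OF t(2)]
  have "generate G (fam 3) \<subseteq> ?S"
  proof (rule generate_fam_subset[OF n])
    show "\<one> \<in> ?S" by force
    show "?S \<subseteq> carrier G" using cl by auto
    fix y s assume y: "y \<in> fam 3" and s: "s \<in> ?S"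
    obtain u v where uv: "s = u \<otimes> v" "u \<in> {\<one>, w}" "v \<in> {\<one>, f 1 2 3, f 3 2 1}" using s by blast
    have cuv: "u \<in> carrier G" "v \<in> carrier G" using uv cl by auto
    have "y \<in> {w, f 1 2 3, f 3 2 1}"
    proof -
      have r: "f 2 3 1 = f 1 2 3" "f 3 1 2 = f 1 2 3" "f 2 1 3 = f 3 2 1" "f 1 3 2 = f 3 2 1"
        using f_rot[OF t(1)] f_rot[OF tripleD(1)[OF t(1)]] f_rot[OF t(2)] f_rot[OF tripleD(1)[OF t(2)]] by auto
      have "y = f a b c \<Longrightarrow> triple 3 a b c \<Longrightarrow> y \<in> {f 1 2 3, f 3 2 1}" for a b c
      proof -
        assume y: "y = f a b c" and "triple 3 a b c"
        then have "(a = 1 \<or> a = 2 \<or> a = 3) \<and> (b = 1 \<or> b = 2 \<or> b = 3) \<and> (c = 1 \<or> c = 2 \<or> c = 3) \<and> a \<noteq> b \<and> b \<noteq> c \<and> a \<noteq> c"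
          by (auto simp: triple_def)
        then show ?thesis unfolding y using r by auto
      qed
      then show ?thesis using y by (auto simp: fam_def)
    qed
    then consider "y = w" | "y \<in> {f 1 2 3, f 3 2 1}" by blast
    then show "y \<otimes> s \<in> ?S"
    proof cases
      case 1
      have "w \<otimes> u \<in> {\<one>, w}" using uv(2) w_sq by auto
      moreover have "y \<otimes> s = (w \<otimes> u) \<otimes> v" using cuv by (simp add: 1 uv(1) m_assoc)
      ultimately show ?thesis using uv(3) by blast
    next
      case 2
      have "y \<otimes> v \<in> {\<one>, f 1 2 3, f 3 2 1}" using uv(3) 2 e cl by auto
      moreover have "y \<otimes> u = u \<otimes> y" "y \<in> carrier G" using 2 e uv(2) cl by auto
      then have "y \<otimes> s = u \<otimes> (y \<otimes> v)" using cuv by (simp add: uv(1) flip: m_assoc)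
      ultimately show ?thesis using uv(2) by blast
    qed
  qed
  then obtain u v where uv: "x = u \<otimes> v" "u \<in> {\<one>, w}" "v \<in> {\<one>, f 1 2 3, f 3 2 1}" using x by blast
  have "\<theta> x = \<theta> v" using uv cl by (auto simp: \<theta>_mult \<theta>_one \<theta>_w)
  then have "\<theta> v 1 = 1" using id by simp
  then have "v = \<one>" using uv(3) t by (auto simp: \<theta>_f cyc3_apply)
  then show ?thesis using uv by auto
qed

lemma kernel_trivial:
  assumes "3 \<le> k" "k \<le> n" "x \<in> generate G (fam k)" "\<theta> x = id"
  shows "x \<in> {\<one>, w}"
  using assms
proof (induction k rule: dec_induct)
  case base
  then show ?case using kernel_three by blast
next
  case (step k)
  then have "\<theta> x (Suc k) = Suc k" by simp
  then show ?case using generate_fam_step[of "Suc k" k x] step by (meson Suc_leD)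
qed

end

section \<open>Lifts of transpositions and three-cycles in a cover\<close>

section \<open>Covers of the symmetric group\<close>

definition pair :: "nat \<Rightarrow> nat \<Rightarrow> nat \<Rightarrow> bool" where
  "pair n a b \<longleftrightarrow> a \<in> {1..n} \<and> b \<in> {1..n} \<and> a \<noteq> b"

text \<open>The relations of the double cover.  The central element \<open>z\<close> may be trivial, so that the symmetric
  group itself is also an instance.\<close>

locale sym_cover_like = group G for G (structure) +
  fixes n :: nat and z :: 'a and \<tau> :: "nat \<Rightarrow> nat \<Rightarrow> 'a" and \<theta> :: "'a \<Rightarrow> nat \<Rightarrow> nat"
  assumes z_closed [simp]: "z \<in> carrier G"
    and z_sq [simp]: "z \<otimes> z = \<one>"
    and \<tau>_closed [simp]: "pair n a b \<Longrightarrow> \<tau> a b \<in> carrier G"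
    and z_\<tau>: "pair n a b \<Longrightarrow> z \<otimes> \<tau> a b = \<tau> a b \<otimes> z"
    and \<tau>_swap: "pair n a b \<Longrightarrow> \<tau> a b = z \<otimes> \<tau> b a"
    and \<tau>_sq: "pair n a b \<Longrightarrow> \<tau> a b \<otimes> \<tau> a b = \<one>"
    and \<tau>_braid: "triple n a b c \<Longrightarrow> \<tau> a b \<otimes> \<tau> b c \<otimes> \<tau> a b = z \<otimes> \<tau> a c"
    and generated: "carrier G = generate G (insert z {\<tau> a b | a b. pair n a b})"
    and \<theta>_mult: "g \<in> carrier G \<Longrightarrow> h \<in> carrier G \<Longrightarrow> \<theta> (g \<otimes> h) = \<theta> g \<circ> \<theta> h"
    and \<theta>_z: "\<theta> z = id"
    and \<theta>_\<tau>: "pair n a b \<Longrightarrow> \<theta> (\<tau> a b) = transp a b"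
begin

lemma pair_sym: "pair n a b \<Longrightarrow> pair n b a"
  by (auto simp: pair_def)

lemma triple_pairs: "triple n a b c \<Longrightarrow> pair n a b \<and> pair n b a \<and> pair n b c \<and> pair n c b \<and> pair n a c \<and> pair n c a"
  by (auto simp: pair_def triple_def)

lemma \<theta>_one [simp]: "\<theta> \<one> = id"
  using \<theta>_mult[of z z] by (simp add: \<theta>_z)

lemma inv_z: "inv z = z" and inv_\<tau>: "pair n a b \<Longrightarrow> inv (\<tau> a b) = \<tau> a b"
  by (simp_all add: inv_equality \<tau>_sq)

lemma carrier_induct [consumes 1, case_names one z \<tau>]:
  assumes "g \<in> carrier G" "P \<one>" "\<And>x. x \<in> carrier G \<Longrightarrow> P x \<Longrightarrow> P (z \<otimes> x)"
    and "\<And>a b x. pair n a b \<Longrightarrow> x \<in> carrier G \<Longrightarrow> P x \<Longrightarrow> P (\<tau> a b \<otimes> x)"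
  shows "P g"
proof -
  have "generate G (insert z {\<tau> a b | a b. pair n a b}) \<subseteq> {x \<in> carrier G. P x}"
    by (rule generate_subset_of_closed) (use assms in \<open>auto simp: inv_z inv_\<tau>\<close>)
  then show ?thesis using assms(1) generated by auto
qed

lemma z_comm: "g \<in> carrier G \<Longrightarrow> z \<otimes> g = g \<otimes> z"
proof (induction g rule: carrier_induct)
  case (z x)
  then show ?case by (simp add: m_assoc z(2)[symmetric])
next
  case (\<tau> a b x)
  have "z \<otimes> (\<tau> a b \<otimes> x) = \<tau> a b \<otimes> (z \<otimes> x)" using \<tau>(1,2) by (simp add: z_\<tau> flip: m_assoc)
  then show ?case using \<tau> by (simp add: m_assoc)
qed simp

lemma z_left: "x \<in> carrier G \<Longrightarrow> z \<otimes> (z \<otimes> x) = x"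
  by (simp flip: m_assoc)

lemma \<tau>_z: "pair n a b \<Longrightarrow> \<tau> a b \<otimes> z = z \<otimes> \<tau> a b"
  and \<tau>_z_left: "pair n a b \<Longrightarrow> x \<in> carrier G \<Longrightarrow> \<tau> a b \<otimes> (z \<otimes> x) = z \<otimes> (\<tau> a b \<otimes> x)"
  by (simp_all add: z_\<tau> flip: m_assoc)

lemma \<tau>_left: "pair n a b \<Longrightarrow> x \<in> carrier G \<Longrightarrow> \<tau> a b \<otimes> (\<tau> a b \<otimes> x) = x"
  by (simp add: \<tau>_sq flip: m_assoc)

lemmas z_normalize = m_assoc z_left \<tau>_z \<tau>_z_left \<tau>_left \<tau>_sq

lemma \<tau>_conj_meet:
  assumes "triple n p q b"
  shows "\<tau> p q \<otimes> \<tau> q b \<otimes> \<tau> p q = z \<otimes> \<tau> p b" "\<tau> p q \<otimes> \<tau> b q \<otimes> \<tau> p q = z \<otimes> \<tau> b p"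
    "\<tau> p q \<otimes> \<tau> p b \<otimes> \<tau> p q = z \<otimes> \<tau> q b" "\<tau> p q \<otimes> \<tau> b p \<otimes> \<tau> p q = z \<otimes> \<tau> b q"
proof -
  have t: "triple n q p b" using assms by (auto simp: triple_def)
  note P = triple_pairs[OF assms]
  show 1: "\<tau> p q \<otimes> \<tau> q b \<otimes> \<tau> p q = z \<otimes> \<tau> p b" by (rule \<tau>_braid[OF assms])
  show 3: "\<tau> p q \<otimes> \<tau> p b \<otimes> \<tau> p q = z \<otimes> \<tau> q b"
    using \<tau>_braid[OF t] P by (simp add: \<tau>_swap[of p q] z_normalize)
  show "\<tau> p q \<otimes> \<tau> b q \<otimes> \<tau> p q = z \<otimes> \<tau> b p"
    using 1 P by (simp add: \<tau>_swap[of b q] \<tau>_swap[of b p] z_normalize)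
  show "\<tau> p q \<otimes> \<tau> b p \<otimes> \<tau> p q = z \<otimes> \<tau> b q"
    using 3 P by (simp add: \<tau>_swap[of b q] \<tau>_swap[of b p] z_normalize)
qed

text \<open>No relation speaks of disjoint transpositions directly. The braid relation writes
  \<open>\<tau> a b\<close> through \<open>\<tau> a p\<close> and \<open>\<tau> p b\<close>, which
  both meet {p, q}; conjugating the three factors produces three signs, hence one.\<close>

lemma \<tau>_conj_disjoint:
  assumes "pair n p q" "pair n a b" "{a, b} \<inter> {p, q} = {}"
  shows "\<tau> p q \<otimes> \<tau> a b \<otimes> \<tau> p q = z \<otimes> \<tau> a b"
proof -
  have t: "triple n a p b" "triple n p q a" "triple n p q b" "triple n a q b"
    using assms by (auto simp: triple_def pair_def)
  note P = triple_pairs[OF t(1)] triple_pairs[OF t(2)] triple_pairs[OF t(3)]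
  define c where "c = (\<lambda>x. \<tau> p q \<otimes> x \<otimes> \<tau> p q)"
  have c: "c (x \<otimes> y) = c x \<otimes> c y" if "x \<in> carrier G" "y \<in> carrier G" for x y
    using that P by (simp add: c_def z_normalize)
  have "c (z \<otimes> \<tau> a b) = c (\<tau> a p \<otimes> \<tau> p b \<otimes> \<tau> a p)" using \<tau>_braid[OF t(1)] by simp
  also have "\<dots> = c (\<tau> a p) \<otimes> c (\<tau> p b) \<otimes> c (\<tau> a p)" using P by (simp add: c)
  also have "\<dots> = (z \<otimes> \<tau> a q) \<otimes> (z \<otimes> \<tau> q b) \<otimes> (z \<otimes> \<tau> a q)"
    unfolding c_def using \<tau>_conj_meet[OF t(2)] \<tau>_conj_meet[OF t(3)] by simp
  also have "\<dots> = z \<otimes> (\<tau> a q \<otimes> \<tau> q b \<otimes> \<tau> a q)" using P by (simp add: z_normalize)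
  also have "\<dots> = \<tau> a b" using \<tau>_braid[OF t(4)] assms by (simp add: z_left)
  finally have "z \<otimes> c (\<tau> a b) = \<tau> a b" using P assms by (simp add: c_def z_normalize)
  then have "z \<otimes> (z \<otimes> c (\<tau> a b)) = z \<otimes> \<tau> a b" by simp
  then show ?thesis using assms P by (simp add: c_def z_normalize)
qed

lemma \<tau>_conj:
  assumes pq: "pair n p q" and ab: "pair n a b"
  shows "\<tau> p q \<otimes> \<tau> a b \<otimes> \<tau> p q = z \<otimes> \<tau> (transp p q a) (transp p q b)"
proof -
  have qp: "pair n q p" by (rule pair_sym[OF pq])
  consider "{a, b} \<inter> {p, q} = {}" | "a = p" "b = q" | "a = q" "b = p"
    | "a = p" "b \<noteq> q" | "a = q" "b \<noteq> p" | "b = p" "a \<noteq> q" | "b = q" "a \<noteq> p"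
    by auto
  then show ?thesis
  proof cases
    case 1
    then show ?thesis using \<tau>_conj_disjoint[OF pq ab] by (auto simp: Transposition.transpose_def)
  next
    case 2
    then show ?thesis using pq qp \<tau>_swap[OF pq] by (simp add: z_normalize)
  next
    case 3
    then show ?thesis using pq qp \<tau>_swap[OF qp] by (simp add: z_normalize)
  next
    case 4
    then have "triple n p q b" using pq ab by (auto simp: pair_def triple_def)
    then show ?thesis using \<tau>_conj_meet(3) 4 by (auto simp: Transposition.transpose_def triple_def)
  next
    case 5
    then have "triple n p q b" using pq ab by (auto simp: pair_def triple_def)
    then show ?thesis using \<tau>_conj_meet(1) 5 by (auto simp: Transposition.transpose_def triple_def)
  next
    case 6
    then have "triple n p q a" using pq ab by (auto simp: pair_def triple_def)
    then show ?thesis using \<tau>_conj_meet(4) 6 by (auto simp: Transposition.transpose_def triple_def)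
  next
    case 7
    then have "triple n p q a" using pq ab by (auto simp: pair_def triple_def)
    then show ?thesis using \<tau>_conj_meet(2) 7 by (auto simp: Transposition.transpose_def triple_def)
  qed
qed

lemma \<theta>_permutes: "g \<in> carrier G \<Longrightarrow> \<theta> g permutes {1..n}"
proof (induction g rule: carrier_induct)
  case (z x)
  then show ?case by (simp add: \<theta>_mult \<theta>_z)
next
  case (\<tau> a b x)
  have "\<theta> (\<tau> a b \<otimes> x) = transp a b \<circ> \<theta> x" using \<tau> by (simp add: \<theta>_mult \<theta>_\<tau>)
  moreover have "transp a b permutes {1..n}" using \<tau> by (intro permutes_swap_id) (auto simp: pair_def)
  ultimately show ?case using permutes_compose[OF \<tau>(3)] by metis
qed (simp only: \<theta>_one permutes_id)

lemma \<theta>_surj: "p permutes {1..n} \<Longrightarrow> \<exists>g\<in>carrier G. \<theta> g = p"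
proof (induction p rule: permutes_induct[OF _ finite_atLeastAtMost, consumes 1, case_names id swap])
  case id
  then show ?case using \<theta>_one one_closed by blast
next
  case (swap a b p)
  then obtain g where "g \<in> carrier G" "\<theta> g = p" by blast
  moreover have "pair n a b" using swap by (auto simp: pair_def)
  ultimately show ?case using \<theta>_mult[of "\<tau> a b" g] \<theta>_\<tau> by (metis \<tau>_closed m_closed)
qed

subsection \<open>Lifts of three-cycles\<close>

definition act :: "'a \<Rightarrow> 'a \<Rightarrow> 'a" where
  "act g x = g \<otimes> x \<otimes> inv g"

lemma act_closed [simp]: "g \<in> carrier G \<Longrightarrow> x \<in> carrier G \<Longrightarrow> act g x \<in> carrier G"
  by (simp add: act_def)

lemma act_mult: "g \<in> carrier G \<Longrightarrow> x \<in> carrier G \<Longrightarrow> y \<in> carrier G \<Longrightarrow> act g (x \<otimes> y) = act g x \<otimes> act g y"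
  by (simp add: act_def m_assoc inv_solve_left)

lemma act_act: "g \<in> carrier G \<Longrightarrow> h \<in> carrier G \<Longrightarrow> x \<in> carrier G \<Longrightarrow> act (g \<otimes> h) x = act g (act h x)"
  by (simp add: act_def m_assoc inv_mult_group)

lemma act_one [simp]: "x \<in> carrier G \<Longrightarrow> act \<one> x = x"
  by (simp add: act_def)

lemma act_inv: "g \<in> carrier G \<Longrightarrow> x \<in> carrier G \<Longrightarrow> act (inv g) (act g x) = x"
  "g \<in> carrier G \<Longrightarrow> x \<in> carrier G \<Longrightarrow> act g (act (inv g) x) = x"
  by (simp_all flip: act_act)

lemma act_fix_iff: "g \<in> carrier G \<Longrightarrow> x \<in> carrier G \<Longrightarrow> act g x = x \<longleftrightarrow> g \<otimes> x = x \<otimes> g"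
  by (simp add: act_def inv_solve_right')

lemma act_z [simp]: "x \<in> carrier G \<Longrightarrow> act z x = x" "g \<in> carrier G \<Longrightarrow> act g z = z"
  by (simp_all add: act_fix_iff z_comm)

lemma \<theta>_inv: "g \<in> carrier G \<Longrightarrow> \<theta> (inv g) \<circ> \<theta> g = id"
  using \<theta>_mult[of "inv g" g] by simp

lemma \<theta>_act: "g \<in> carrier G \<Longrightarrow> x \<in> carrier G \<Longrightarrow> \<theta> (act g x) \<circ> \<theta> g = \<theta> g \<circ> \<theta> x"
  using \<theta>_mult[of "act g x" g] \<theta>_mult[of g x] by (simp add: act_def m_assoc)

definition cyc :: "nat \<Rightarrow> nat \<Rightarrow> nat \<Rightarrow> 'a" where
  "cyc a b c = \<tau> a b \<otimes> \<tau> b c"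

lemma cyc_closed [simp]: "triple n a b c \<Longrightarrow> cyc a b c \<in> carrier G"
  using triple_pairs[of a b c] by (simp add: cyc_def)

lemma \<theta>_cyc: "triple n a b c \<Longrightarrow> \<theta> (cyc a b c) = cyc3 a b c"
  using triple_pairs[of a b c] by (simp add: cyc_def cyc3_def \<theta>_mult \<theta>_\<tau>)

lemma cyc_rot:
  assumes "triple n a b c" shows "cyc a b c = cyc b c a"
proof -
  note P = triple_pairs[OF assms]
  have "\<tau> b c \<otimes> \<tau> a b \<otimes> \<tau> b c = z \<otimes> \<tau> a c"
    by (rule \<tau>_conj_meet(4)[OF tripleD(1)[OF assms]])
  then have "\<tau> b c \<otimes> (\<tau> b c \<otimes> \<tau> a b \<otimes> \<tau> b c) = \<tau> b c \<otimes> \<tau> c a"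
    using \<tau>_swap[of c a] P by simp
  then show ?thesis using P by (simp add: cyc_def z_normalize)
qed

lemma cyc_inv: "triple n a b c \<Longrightarrow> cyc a b c \<otimes> cyc c b a = \<one>"
  using triple_pairs[of a b c] \<tau>_swap[of c b] \<tau>_swap[of b a] by (simp add: cyc_def z_normalize)

text \<open>Each of the two transpositions in \<open>cyc\<close> acquires a factor \<open>z\<close>,
  and these cancel. This is why lifted three-cycles, unlike lifted transpositions, are moved by
  conjugation without signs.\<close>

lemma act_\<tau>_cyc:
  assumes "pair n p q" "triple n a b c"
  shows "act (\<tau> p q) (cyc a b c) = cyc (transp p q a) (transp p q b) (transp p q c)"
proof -
  note P = triple_pairs[OF assms(2)]
  have c: "act (\<tau> p q) (\<tau> x y) = z \<otimes> \<tau> (transp p q x) (transp p q y)" if "pair n x y" for x y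
    using \<tau>_conj[OF assms(1) that] assms by (simp add: act_def inv_\<tau>)
  have pp: "pair n (transp p q x) (transp p q y)" if "pair n x y" for x y
    using that assms(1) by (auto simp: pair_def Transposition.transpose_def)
  show ?thesis
    unfolding cyc_def using P assms pp[of a b] pp[of b c] by (simp add: act_mult c z_normalize)
qed

lemma triple_permutes: "p permutes {1..n} \<Longrightarrow> triple n a b c \<Longrightarrow> triple n (p a) (p b) (p c)"
  using permutes_in_image[of p "{1..n}"] permutes_inj[of p "{1..n}"] by (auto simp: triple_def inj_eq)

lemma act_cyc: "g \<in> carrier G \<Longrightarrow> triple n a b c \<Longrightarrow> act g (cyc a b c) = cyc (\<theta> g a) (\<theta> g b) (\<theta> g c)"
proof (induction g arbitrary: a b c rule: carrier_induct)
  case (z x)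
  have "triple n (\<theta> x a) (\<theta> x b) (\<theta> x c)" by (rule triple_permutes[OF \<theta>_permutes[OF z(1)] z(3)])
  then show ?case using z by (simp add: act_act \<theta>_mult \<theta>_z)
next
  case (\<tau> p q x)
  have "triple n (\<theta> x a) (\<theta> x b) (\<theta> x c)" by (rule triple_permutes[OF \<theta>_permutes[OF \<tau>(2)] \<tau>(4)])
  then show ?case using \<tau> by (simp add: act_act act_\<tau>_cyc \<theta>_mult \<theta>_\<tau>)
qed simp

lemma cyc_prod:
  assumes "triple n q m p" "triple n p m x" "q \<noteq> x"
  shows "cyc q m p \<otimes> cyc p m x = z \<otimes> cyc q m x"
  using triple_pairs[OF assms(1)] triple_pairs[OF assms(2)] \<tau>_swap[of m p] by (simp add: cyc_def z_normalize)

lemma cyc_sq: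
  assumes "triple n a b c" shows "cyc a b c \<otimes> cyc a b c = cyc c b a"
proof -
  have t: "triple n c b a" "triple n b a c" using assms by (auto simp: triple_def)
  note P = triple_pairs[OF assms]
  have "cyc a b c \<otimes> cyc a b c = (\<tau> a b \<otimes> \<tau> b c \<otimes> \<tau> a b) \<otimes> \<tau> b c" using P by (simp add: cyc_def z_normalize)
  also have "\<dots> = \<tau> a c \<otimes> \<tau> c b" using \<tau>_braid[OF assms] \<tau>_swap[of c b] P by (simp add: z_normalize)
  also have "\<dots> = cyc c b a" using cyc_rot[OF t(1)] cyc_rot[OF t(2)] by (simp add: cyc_def)
  finally show ?thesis .
qed

sublocale C: three_cycle_family G n cyc z \<theta>
proof
  show "cyc a b c \<otimes> cyc p q r = cyc (cyc3 a b c p) (cyc3 a b c q) (cyc3 a b c r) \<otimes> cyc a b c"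
    if "triple n a b c" "triple n p q r" for a b c p q r
  proof -
    have "act (cyc a b c) (cyc p q r) \<otimes> cyc a b c = cyc a b c \<otimes> cyc p q r"
      using that by (simp add: act_def m_assoc)
    then show ?thesis using act_cyc[of "cyc a b c" p q r] that by (simp add: \<theta>_cyc)
  qed
  show "z \<otimes> cyc a b c = cyc a b c \<otimes> z" if "triple n a b c" for a b c by (rule z_comm[OF cyc_closed[OF that]])
  show "cyc a b c \<in> carrier G" if "triple n a b c" for a b c using that by (rule cyc_closed)
  show "cyc a b c = cyc b c a" if "triple n a b c" for a b c using that by (rule cyc_rot)
  show "cyc a b c \<otimes> cyc c b a = \<one>" if "triple n a b c" for a b c using that by (rule cyc_inv)
  show "cyc a b c \<otimes> cyc a b c = cyc c b a" if "triple n a b c" for a b c using that by (rule cyc_sq)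
  show "cyc q m p \<otimes> cyc p m x = z \<otimes> cyc q m x" if "triple n q m p" "triple n p m x" "q \<noteq> x" for q m p x
    using that by (rule cyc_prod)
  show "\<theta> (g \<otimes> h) = \<theta> g \<circ> \<theta> h" if "g \<in> carrier G" "h \<in> carrier G" for g h
    using that by (rule \<theta>_mult)
  show "\<theta> (cyc a b c) = cyc3 a b c" if "triple n a b c" for a b c using that by (rule \<theta>_cyc)
qed (rule z_closed z_sq \<theta>_one \<theta>_z)+

lemma permutation_\<theta>: "g \<in> carrier G \<Longrightarrow> permutation (\<theta> g)"
  using \<theta>_permutes permutation_permutes by blast

lemma even_mult: "g \<in> carrier G \<Longrightarrow> h \<in> carrier G \<Longrightarrow> evenperm (\<theta> (g \<otimes> h)) = (evenperm (\<theta> g) = evenperm (\<theta> h))"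
  by (simp add: \<theta>_mult evenperm_comp permutation_\<theta>)

lemma even_\<tau>: "pair n a b \<Longrightarrow> \<not> evenperm (\<theta> (\<tau> a b))"
  by (simp add: \<theta>_\<tau> evenperm_swap pair_def)

lemma even_cyc: "triple n a b c \<Longrightarrow> evenperm (\<theta> (cyc a b c))"
  using triple_pairs[of a b c] by (simp add: cyc_def even_mult even_\<tau>)

definition even_part :: "'a set" where
  "even_part = {x \<in> carrier G. evenperm (\<theta> x)}"

text \<open>Between two transpositions without a common middle point one inserts the trivial product
  \<open>\<tau> b c \<otimes> \<tau> b c\<close>, which leaves two pairs of meeting
  transpositions.\<close>

lemma \<tau>_\<tau>_generate:
  assumes "pair n a b" "pair n c d"
  shows "\<tau> a b \<otimes> \<tau> c d \<in> generate G (C.fam n)" (is "_ \<in> ?E")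
proof -
  have z: "z \<in> ?E" and cE: "\<And>a b c. triple n a b c \<Longrightarrow> cyc a b c \<in> ?E" and one: "\<one> \<in> ?E"
    by (auto intro: generate.incl generate.one simp: C.fam_def)
  have mE: "\<And>x y. x \<in> ?E \<Longrightarrow> y \<in> ?E \<Longrightarrow> x \<otimes> y \<in> ?E" by (rule generate.eng)
  have meet: "\<tau> x y \<otimes> \<tau> y w \<in> ?E" if "pair n x y" "pair n y w" for x y w
  proof (cases "w = x")
    case True
    then show ?thesis using that z \<tau>_swap[of y x] by (simp add: z_normalize)
  next
    case False
    then show ?thesis using cE[of x y w] that by (auto simp: cyc_def pair_def triple_def)
  qed
  show ?thesis
  proof (cases "b = c")
    case True
    then show ?thesis using meet assms by blast
  next
    case False
    then have bc: "pair n b c" using assms by (auto simp: pair_def)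
    have "\<tau> a b \<otimes> \<tau> c d = (\<tau> a b \<otimes> \<tau> b c) \<otimes> (\<tau> b c \<otimes> \<tau> c d)"
      using assms bc by (simp add: z_normalize)
    then show ?thesis using mE meet assms bc by simp
  qed
qed

text \<open>Induction over words shows that \<open>x\<close> or
  \<open>\<tau> 1 2 \<otimes> x\<close> is generated by three-cycles; parity decides which of the
  two holds.\<close>

lemma even_part_eq:
  assumes "2 \<le> n" shows "even_part = generate G (C.fam n)"
proof
  let ?E = "generate G (C.fam n)"
  have EG: "?E \<subseteq> carrier G" by (rule generate_incl[OF C.fam_closed[OF order_refl]])
  have z: "z \<in> ?E" and one: "\<one> \<in> ?E"
    by (auto intro: generate.incl generate.one simp: C.fam_def)
  have mE: "\<And>x y. x \<in> ?E \<Longrightarrow> y \<in> ?E \<Longrightarrow> x \<otimes> y \<in> ?E" by (rule generate.eng)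
  have "?E \<subseteq> {x \<in> carrier G. evenperm (\<theta> x)}"
    by (rule C.generate_fam_subset[OF order_refl]) (auto simp: C.fam_def even_mult \<theta>_z even_cyc)
  then show evE: "?E \<subseteq> even_part" by (simp add: even_part_def)
  have p12: "pair n 1 2" using assms by (auto simp: pair_def)
  have "x \<in> ?E \<or> \<tau> 1 2 \<otimes> x \<in> ?E" if "x \<in> carrier G" for x
    using that
  proof (induction x rule: carrier_induct)
    case (z x)
    have "\<tau> 1 2 \<otimes> (z \<otimes> x) = z \<otimes> (\<tau> 1 2 \<otimes> x)" using p12 z by (simp add: z_normalize)
    then show ?case using z mE \<open>z \<in> ?E\<close> by auto
  next
    case (\<tau> a b x)
    show ?case
    proof (cases "x \<in> ?E")
      case True
      have "\<tau> 1 2 \<otimes> (\<tau> a b \<otimes> x) = (\<tau> 1 2 \<otimes> \<tau> a b) \<otimes> x" using \<tau> p12 by (simp add: m_assoc)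
      then show ?thesis using mE[OF \<tau>_\<tau>_generate[OF p12 \<tau>(1)] True] by simp
    next
      case False
      then have "\<tau> 1 2 \<otimes> x \<in> ?E" using \<tau> by blast
      moreover have "\<tau> a b \<otimes> x = (\<tau> a b \<otimes> \<tau> 1 2) \<otimes> (\<tau> 1 2 \<otimes> x)" using \<tau> p12 by (simp add: z_normalize)
      ultimately show ?thesis using mE[OF \<tau>_\<tau>_generate[OF \<tau>(1) p12]] by simp
    qed
  qed (use one in simp)
  moreover have "\<not> evenperm (\<theta> x)" if "\<tau> 1 2 \<otimes> x \<in> ?E" "x \<in> carrier G" for x
    using that evE p12 even_mult[of "\<tau> 1 2" x] even_\<tau>[OF p12] by (auto simp: even_part_def)
  ultimately show "even_part \<subseteq> ?E" by (auto simp: even_part_def)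
qed

text \<open>The identity is even, so \<open>x\<close> is a product of lifted three-cycles, and for
  these the coset enumeration bounds the kernel. In particular \<open>\<theta>\<close> is at most
  two-to-one.\<close>

lemma kernel_\<theta>:
  assumes "3 \<le> n" "x \<in> carrier G" "\<theta> x = id" shows "x \<in> {\<one>, z}"
proof -
  have "evenperm (\<theta> x)" using assms(3) evenperm_id by metis
  then have "x \<in> even_part" using assms(2) by (simp add: even_part_def)
  then have "x \<in> generate G (C.fam n)" using even_part_eq assms(1) by simp
  then show ?thesis using C.kernel_trivial[OF assms(1) order_refl] assms by simp
qed

lemma \<theta>_eq:
  assumes "3 \<le> n" "x \<in> carrier G" "y \<in> carrier G" "\<theta> x = \<theta> y" shows "x = y \<or> x = z \<otimes> y"
proof -
  have "\<theta> (inv y) \<circ> \<theta> y = id" by (rule \<theta>_inv[OF assms(3)])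
  then have "\<theta> (inv y \<otimes> x) = id" using assms by (simp add: \<theta>_mult)
  then have "inv y \<otimes> x \<in> {\<one>, z}" using kernel_\<theta>[OF assms(1), of "inv y \<otimes> x"] assms by simp
  then have "y \<otimes> (inv y \<otimes> x) \<in> {y, y \<otimes> z}" using assms by auto
  then show ?thesis using assms z_comm[of y] by (simp flip: m_assoc)
qed

lemma finite_carrier:
  assumes "3 \<le> n" shows "finite (carrier G)"
proof -
  have "finite {p. p permutes {1..n}}" by (rule finite_permutations) simp
  moreover have "\<theta> ` carrier G \<subseteq> {p. p permutes {1..n}}" using \<theta>_permutes by blast
  ultimately have f: "finite (\<theta> ` carrier G)" by (rule rev_finite_subset)
  have "finite {x \<in> carrier G. \<theta> x = p}" for p
  proof (cases "\<exists>y\<in>carrier G. \<theta> y = p")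
    case True
    then obtain y where y: "y \<in> carrier G" "\<theta> y = p" by blast
    have "{x \<in> carrier G. \<theta> x = p} \<subseteq> {y, z \<otimes> y}"
    proof
      fix x assume "x \<in> {x \<in> carrier G. \<theta> x = p}"
      then show "x \<in> {y, z \<otimes> y}" using \<theta>_eq[OF assms, of x y] y by simp
    qed
    then show ?thesis by (rule finite_subset) simp
  next
    case False
    then have "{x \<in> carrier G. \<theta> x = p} = {}" by blast
    then show ?thesis by (simp only: finite.emptyI)
  qed
  then have "finite (\<Union>p\<in>\<theta> ` carrier G. {x \<in> carrier G. \<theta> x = p})" using f by blast
  moreover have "carrier G \<subseteq> (\<Union>p\<in>\<theta> ` carrier G. {x \<in> carrier G. \<theta> x = p})" by blast
  ultimately show ?thesis by (rule rev_finite_subset)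
qed

end

section \<open>Small centralizers in symmetric groups\<close>

section \<open>Permutations commuting with transpositions\<close>

lemma commute_transp_mem:
  assumes "inj p" "p \<circ> transp i j = transp i j \<circ> p" "i \<noteq> j"
  shows "p i \<in> {i, j}"
proof (rule ccontr)
  assume "\<not> ?thesis"
  then have "p j = p i" using fun_cong[OF assms(2), of i] by (simp add: Transposition.transpose_def split: if_splits)
  then show False using assms(1,3) by (simp add: inj_eq)
qed

text \<open>The points 1 to 4 are kept free, enough for the pair of three-cycles (1 2 3) and (1 2
  4); all other points are to look alike. For \<open>n = 5\<close> the condition is void, which
  causes the separate treatment of that degree.\<close>

definition tail_commuting :: "nat \<Rightarrow> (nat \<Rightarrow> nat) \<Rightarrow> bool" where
  "tail_commuting n p \<longleftrightarrow> (\<forall>i\<in>{5..n}. \<forall>j\<in>{5..n}. p \<circ> transp i j = transp i j \<circ> p)"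

text \<open>The largest point that a three-cycle commuting with all transpositions of \<open>{5..n}\<close> can move.\<close>

definition reach :: "nat \<Rightarrow> nat" where
  "reach n = (if n = 5 then 5 else 4)"

lemma tail_commuting_comp: "tail_commuting n p \<Longrightarrow> tail_commuting n q \<Longrightarrow> tail_commuting n (p \<circ> q)"
proof -
  assume *: "tail_commuting n p" "tail_commuting n q"
  have "(p \<circ> q) \<circ> transp i j = transp i j \<circ> (p \<circ> q)" if "i \<in> {5..n}" "j \<in> {5..n}" for i j
  proof -
    have "(p \<circ> q) \<circ> transp i j = p \<circ> (q \<circ> transp i j)" by (rule comp_assoc)
    also have "\<dots> = p \<circ> (transp i j \<circ> q)" using * that by (simp add: tail_commuting_def)
    also have "\<dots> = (p \<circ> transp i j) \<circ> q" by (rule comp_assoc[symmetric])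
    also have "\<dots> = transp i j \<circ> (p \<circ> q)" using * that by (simp add: tail_commuting_def comp_assoc)
    finally show ?thesis .
  qed
  then show ?thesis by (simp add: tail_commuting_def)
qed

lemma tail_commuting_cyc3:
  assumes "triple (reach n) a b c" shows "tail_commuting n (cyc3 a b c)"
proof -
  have "cyc3 a b c \<circ> transp i j = transp i j \<circ> cyc3 a b c" if "i \<in> {5..n}" "j \<in> {5..n}" for i j
  proof (cases "i = j")
    case False
    then have "reach n = 4" using that by (auto simp: reach_def)
    then have *: "i \<notin> {a, b, c}" "j \<notin> {a, b, c}" using assms that by (auto simp: triple_def)
    have d: "a \<noteq> b" "b \<noteq> c" "a \<noteq> c" using assms by (simp_all add: triple_def)
    have "cyc3 a b c (transp i j x) = transp i j (cyc3 a b c x)" for x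
      using * unfolding cyc3_apply[OF d] Transposition.transpose_def by auto
    then show ?thesis by (simp add: fun_eq_iff)
  qed simp
  then show ?thesis by (simp add: tail_commuting_def)
qed

lemma tail_commuting_mem:
  assumes "p permutes S" "tail_commuting n p" "i \<in> {5..n}" "j \<in> {5..n}" "i \<noteq> j"
  shows "p i \<in> {i, j}"
  using commute_transp_mem[of p i j] permutes_inj[OF assms(1)] assms by (auto simp: tail_commuting_def)

text \<open>With three points \<open>i\<close>, \<open>j\<close>, \<open>k\<close> in the tail, the
  image of \<open>i\<close> lies in both {i, j} and {i, k}. For \<open>n = 6\<close> the
  transposition of 5 and 6 is a counterexample.\<close>

lemma tail_commuting_fix:
  assumes "p permutes S" "tail_commuting n p" "7 \<le> n" "i \<in> {5..n}"
  shows "p i = i"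
proof -
  obtain j k where "j \<in> {5..n}" "k \<in> {5..n}" "j \<noteq> i" "k \<noteq> i" "j \<noteq> k"
  proof -
    consider "i = 5" | "i = 6" | "i > 6" using assms(4) by fastforce
    then show ?thesis
    proof cases
      case 1 then show ?thesis using that[of 6 7] assms by auto
    next
      case 2 then show ?thesis using that[of 5 7] assms by auto
    next
      case 3 then show ?thesis using that[of 5 6] assms by auto
    qed
  qed
  then show ?thesis using tail_commuting_mem[OF assms(1,2,4)] by (metis insertE singletonD)
qed

lemma two_points_fix:
  fixes q :: "nat \<Rightarrow> nat"
  assumes "q permutes S" "\<And>v. v \<notin> {x, y} \<Longrightarrow> q v = v" "evenperm q"
  shows "q = id"
proof -
  have "q permutes {x, y}" using assms(1,2) by (auto simp: permutes_def)
  then have "q = id \<or> q = transp x y"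
  proof -
    note inj = permutes_inj[OF \<open>q permutes {x, y}\<close>]
    have "q x \<in> {x, y}" "q y \<in> {x, y}"
      using permutes_in_image[OF \<open>q permutes {x, y}\<close>, of x] permutes_in_image[OF \<open>q permutes {x, y}\<close>, of y]
      by simp_all
    moreover have "q x = q y \<Longrightarrow> x = y" using inj by (simp add: inj_eq)
    ultimately consider "q x = x" "q y = y" | "q x = y" "q y = x" by auto
    then show ?thesis
    proof cases
      case 1
      then have "q v = v" for v using assms(2)[of v] by (cases "v \<in> {x, y}") auto
      then show ?thesis by (auto simp: fun_eq_iff)
    next
      case 2
      then have "q v = transp x y v" for v
        using assms(2)[of v] by (cases "v \<in> {x, y}") (auto simp: Transposition.transpose_def)
      then show ?thesis by (auto simp: fun_eq_iff)
    qed
  qed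
  then show ?thesis using assms(3) by (metis evenperm_swap transpose_same)
qed

text \<open>For \<open>n = 4\<close> or \<open>n \<ge> 7\<close> at most one point is left that
  could move. For \<open>n = 5\<close> two points remain, and for \<open>n = 6\<close> the points 5
  and 6 may be exchanged; there parity decides. At \<open>n = 4\<close> parity must not be used,
  since the second law may live on all of S_4.\<close>

lemma fixed_triple_imp_id:
  assumes q: "q permutes {1..n}" and n: "4 \<le> n" and t: "triple (reach n) a b c"
    and fx: "q a = a" "q b = b" "q c = c" and tail: "tail_commuting n q" and ev: "evenperm q \<or> n = 4"
  shows "q = id"
proof -
  have out: "q v = v" if "v \<notin> {1..n}" for v using q that by (simp add: permutes_def)
  consider "n = 4 \<or> 7 \<le> n" | "n = 5" | "n = 6" using n by linarith
  then show ?thesis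
  proof cases
    case 1
    then have "reach n = 4" by (auto simp: reach_def)
    then obtain r where r: "{1..4} \<subseteq> {a, b, c, r}"
    proof -
      have "card ({1..4} - {a, b, c}) = 1" using t \<open>reach n = 4\<close> by (subst card_Diff_subset) (auto simp: triple_def)
      then obtain r where "{1..4} - {a, b, c} = {r}" by (auto simp: card_1_singleton_iff)
      then show ?thesis by (intro that[of r]) auto
    qed
    have "q v = v" if "v \<noteq> r" for v
    proof (cases "v \<in> {5..n}")
      case True
      then show ?thesis using 1 tail_commuting_fix[OF q tail] by auto
    next
      case False
      then have "v \<in> {a, b, c} \<or> v \<notin> {1..n}" using r that by fastforce
      then show ?thesis using fx out by auto
    qed
    then have "q permutes {r}" using q by (auto simp: permutes_def)
    then show ?thesis by (simp only: permutes_sing)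
  next
    case 2
    then have "reach n = 5" by (auto simp: reach_def)
    then obtain x y where r: "{1..5} \<subseteq> {a, b, c, x, y}"
    proof -
      have "card ({1..5} - {a, b, c}) = 2" using t \<open>reach n = 5\<close> by (subst card_Diff_subset) (auto simp: triple_def)
      then obtain x y where "{1..5} - {a, b, c} = {x, y}" by (auto simp: card_2_iff)
      then show ?thesis by (intro that[of x y]) auto
    qed
    show ?thesis
    proof (rule two_points_fix[OF q])
      show "q v = v" if "v \<notin> {x, y}" for v
      proof -
        have "v \<in> {a, b, c} \<or> v \<notin> {1..n}" using r that 2 by fastforce
        then show ?thesis using fx out by auto
      qed
      show "evenperm q" using ev 2 by simp
    qed
  next
    case 3
    then have "reach n = 4" by (auto simp: reach_def)
    have q56: "q 5 \<in> {5, 6}" "q 6 \<in> {5, 6}"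
      using tail_commuting_mem[OF q tail, of 5 6] tail_commuting_mem[OF q tail, of 6 5] 3 by auto
    have inj: "inj q" using permutes_inj[OF q] .
    show ?thesis
    proof (rule two_points_fix[OF q])
      show "q v = v" if v: "v \<notin> {5, 6}" for v
      proof (rule ccontr)
        assume ne: "q v \<noteq> v"
        then have "v \<in> {1..6}" "v \<notin> {a, b, c}" "v \<noteq> 5" "v \<noteq> 6" using out[of v] fx 3 v by auto
        then have v4: "v \<in> {1..4}" by auto
        have "q v \<in> {1..6}" using permutes_in_image[OF q, of v] v4 3 by simp
        moreover have "q v \<noteq> a" "q v \<noteq> b" "q v \<noteq> c"
          using \<open>v \<notin> {a, b, c}\<close> fx inj by (metis inj_eq insertCI)+
        moreover have "q v \<noteq> 5" "q v \<noteq> 6"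
        proof -
          have "{q 5, q 6} = {5, 6}"
            using q56 inj_eq[OF inj, of 5 6] by auto
          then show "q v \<noteq> 5" "q v \<noteq> 6" using v inj_eq[OF inj] by (metis insert_iff singletonD)+
        qed
        ultimately have "{a, b, c, v, q v} \<subseteq> {1..4}" using t \<open>reach n = 4\<close> v4 by (auto simp: triple_def)
        then have "card {a, b, c, v, q v} \<le> 4" using card_mono[of "{1..4::nat}"] by fastforce
        moreover have "card {a, b, c, v, q v} = 5"
          using t ne \<open>v \<notin> {a, b, c}\<close> \<open>q v \<noteq> a\<close> \<open>q v \<noteq> b\<close> \<open>q v \<noteq> c\<close> by (auto simp: triple_def)
        ultimately show False by simp
      qed
      show "evenperm q" using ev 3 by simp
    qed
  qed
qed

lemma triple_top: "4 \<le> n \<Longrightarrow> triple (reach n) a b c \<Longrightarrow> triple n a b c"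
  by (auto simp: triple_def reach_def split: if_splits)

lemma evenperm_cyc3: "triple n a b c \<Longrightarrow> evenperm (cyc3 a b c)"
  unfolding cyc3_def by (subst evenperm_comp) (auto simp: permutation_swap_id evenperm_swap triple_def)

lemma cyc3_inverse: "triple n a b c \<Longrightarrow> cyc3 a b c \<circ> cyc3 c b a = id"
  by (auto simp: fun_eq_iff cyc3_apply triple_def)

text \<open>A permutation commuting with a three-cycle permutes its support cyclically. Composed
  with a suitable power of the three-cycle it fixes all three points, and
  \<open>fixed_triple_imp_id\<close> applies.\<close>

lemma commuting_with_cyc3:
  assumes p: "p permutes {1..n}" and n: "4 \<le> n" and t: "triple (reach n) a b c"
    and comm: "p \<circ> cyc3 a b c = cyc3 a b c \<circ> p" and tail: "tail_commuting n p" and ev: "evenperm p \<or> n = 4"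
  shows "p \<in> {id, cyc3 a b c, cyc3 c b a}"
proof -
  have d: "a \<noteq> b" "b \<noteq> c" "a \<noteq> c" using t by (auto simp: triple_def)
  note tn = triple_top[OF n t]
  note t' = tripleD(2)[OF t] 
  have e: "p b = cyc3 a b c (p a)" "p c = cyc3 a b c (p b)"
    using fun_cong[OF comm, of a] fun_cong[OF comm, of b] d by (auto simp: cyc3_apply)
  have "p a \<noteq> p b" using permutes_inj[OF p] d by (simp add: inj_eq)
  then have "p a \<in> {a, b, c}" using e(1) cyc3_apply[OF d, of "p a"] by (auto split: if_splits)
  have main: "r \<circ> p = id" if r: "r \<in> {id, cyc3 a b c, cyc3 c b a}" "r (p a) = a" "r (p b) = b" "r (p c) = c" for r
  proof (rule fixed_triple_imp_id[OF _ n t])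
    have rp: "r permutes {1..n}"
      using r(1) cyc3_permutes[OF tn] cyc3_permutes[OF tripleD(2)[OF tn]] permutes_id by blast
    then show "r \<circ> p permutes {1..n}" using p by (rule permutes_compose[rotated])
    have "tail_commuting n r"
      using r(1) tail_commuting_cyc3[OF t] tail_commuting_cyc3[OF t'] by (auto simp: tail_commuting_def)
    then show "tail_commuting n (r \<circ> p)" using tail by (rule tail_commuting_comp)
    have "evenperm r" using r(1) evenperm_cyc3[OF tn] evenperm_cyc3[OF tripleD(2)[OF tn]] evenperm_id by blast
    then show "evenperm (r \<circ> p) \<or> n = 4"
      using ev evenperm_comp[of r p] rp p permutation_permutes by blast
  qed (use r in auto)
  from \<open>p a \<in> {a, b, c}\<close> consider "p a = a" | "p a = b" | "p a = c" by blast
  then show ?thesis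
  proof cases
    case 1
    have "id \<circ> p = id" by (rule main) (use 1 e d in \<open>auto simp: cyc3_apply\<close>)
    then show ?thesis by simp
  next
    case 2
    have "cyc3 c b a \<circ> p = id" by (rule main) (use 2 e d in \<open>auto simp: cyc3_apply\<close>)
    then have "cyc3 a b c \<circ> (cyc3 c b a \<circ> p) = cyc3 a b c" by simp
    then show ?thesis using cyc3_inverse[OF tn] by (simp add: comp_assoc[symmetric])
  next
    case 3
    have "cyc3 a b c \<circ> p = id" by (rule main) (use 3 e d in \<open>auto simp: cyc3_apply\<close>)
    then have "cyc3 c b a \<circ> (cyc3 a b c \<circ> p) = cyc3 c b a" by simp
    then show ?thesis using cyc3_inverse[OF tripleD(2)[OF tn]] by (simp add: comp_assoc[symmetric])
  qed
qed

text \<open>All moved points lie in {1..reach n}, hence among five points, whereas a second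
  three-cycle would need a sixth. Points of the tail cannot move: they could only be exchanged in
  pairs, which is incompatible with order three.\<close>

lemma cube_id_imp_cyc3:
  assumes p: "p permutes {1..n}" and n: "4 \<le> n" and cube: "p \<circ> p \<circ> p = id" and ne: "p \<noteq> id"
    and tail: "tail_commuting n p"
  shows "\<exists>a b c. triple (reach n) a b c \<and> p = cyc3 a b c"
proof -
  have inj: "inj p" by (rule permutes_inj[OF p])
  have cb: "p (p (p x)) = x" for x using fun_cong[OF cube, of x] by simp
  have moved: "x \<in> {1..reach n}" if "p x \<noteq> x" for x
  proof (rule ccontr)
    assume x: "x \<notin> {1..reach n}"
    have "x \<in> {1..n}" using p that by (auto simp: permutes_def)
    then have x5: "x \<in> {5..n}" "n \<noteq> 5" using x by (auto simp: reach_def split: if_splits)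
    show False
    proof (cases "7 \<le> n")
      case True
      then show ?thesis using tail_commuting_fix[OF p tail _ x5(1)] that by simp
    next
      case False
      then have n6: "n = 6" using x5 by auto
      then obtain y where y: "{x, y} = {5, 6}" "y \<in> {5..n}" "x \<noteq> y"
        using x5 by (cases "x = 5") (fastforce, fastforce)
      then have "p x = y" "p y \<in> {x, y}"
        using tail_commuting_mem[OF p tail x5(1), of y] tail_commuting_mem[OF p tail, of y x] x5 that by auto
      moreover have "p y \<noteq> y" using \<open>p x = y\<close> inj y(3) by (metis inj_eq)
      ultimately have "p (p (p x)) = y" by auto
      then show False using cb y(3) by metis
    qed
  qed
  obtain a where a: "p a \<noteq> a" using ne by (auto simp: fun_eq_iff)
  define b c where "b = p a" and "c = p b"
  have pc: "p c = a" using cb by (simp add: b_def c_def)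
  have d: "a \<noteq> b" "b \<noteq> c" "a \<noteq> c"
    using a inj_eq[OF inj, of a b] pc b_def c_def by metis+
  have t: "triple (reach n) a b c"
    using moved[of a] moved[of b] moved[of c] d pc by (auto simp: triple_def b_def c_def)
  have rest: "p x = x" if x: "x \<notin> {a, b, c}" for x
  proof (rule ccontr)
    assume m: "p x \<noteq> x"
    define y w where "y = p x" and "w = p y"
    have pw: "p w = x" using cb by (simp add: y_def w_def)
    have dy: "y \<noteq> x" "w \<noteq> y" "w \<noteq> x" using m inj_eq[OF inj, of x y] pw y_def w_def by metis+
    have o: "y \<notin> {a, b, c}" using x pc inj_eq[OF inj] unfolding y_def b_def c_def by (metis insert_iff singletonD)
    have o': "w \<notin> {a, b, c}" using o pc inj_eq[OF inj] unfolding w_def b_def c_def by (metis insert_iff singletonD)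
    have "{a, b, c, x, y, w} \<subseteq> {1..5}"
    proof -
      have "reach n \<le> 5" by (simp add: reach_def)
      moreover have "x \<in> {1..reach n}" "y \<in> {1..reach n}" "w \<in> {1..reach n}"
        using moved[of x] moved[of y] moved[of w] dy pw by (auto simp: y_def w_def)
      ultimately show ?thesis using t by (auto simp: triple_def)
    qed
    then have "card {a, b, c, x, y, w} \<le> 5" using card_mono[of "{1..5::nat}"] by fastforce
    moreover have "card {a, b, c, x, y, w} = 6" using d dy o o' x by auto
    ultimately show False by simp
  qed
  have "p x = cyc3 a b c x" for x
  proof -
    have "p a = b" "p b = c" by (simp_all only: b_def c_def)
    then show ?thesis
      using rest[of x] pc unfolding cyc3_apply[OF d] by (cases "x \<in> {a, b, c}") auto
  qed
  then have "p = cyc3 a b c" by (rule ext)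
  then show ?thesis using t by blast
qed

lemma permutes_extend:
  fixes S :: "nat set"
  assumes "finite S" "distinct xs" "distinct ys" "length xs = length ys" "set xs \<subseteq> S" "set ys \<subseteq> S"
  shows "\<exists>p. p permutes S \<and> map p xs = ys"
  using assms(4,2,3,5,6)
proof (induction xs ys rule: rev_induct2)
  case 1
  show ?case by (rule exI[of _ id]) (simp only: permutes_id list.map)
next
  case (4 x xs y ys)
  then obtain p where p: "p permutes S" "map p xs = ys" by auto
  define r where "r = transp (p x) y \<circ> p"
  have "r permutes S"
    unfolding r_def using p 4 permutes_in_image[OF p(1)] by (intro permutes_compose permutes_swap_id) auto
  moreover have "r v = p v" if "v \<in> set xs" for v
  proof -
    have "p v \<in> set ys" using p(2) that by auto
    then have "p v \<noteq> y" using 4 by auto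
    moreover have "p v \<noteq> p x" using that 4 permutes_inj[OF p(1)] by (auto simp: inj_eq)
    ultimately show ?thesis by (simp add: r_def Transposition.transpose_def)
  qed
  then have "map r xs = map p xs" by simp
  moreover have "r x = y" by (simp add: r_def)
  ultimately show ?case using p(2) by (intro exI[of _ r]) simp
qed auto

section \<open>Elements of order three for two laws on the same set\<close>

section \<open>A second group law\<close>

context group
begin

lemma cube_dvd_order:
  assumes "finite (carrier G)" "x \<in> carrier G" "x \<noteq> \<one>" "x \<otimes> x \<otimes> x = \<one>"
  shows "3 dvd order G"
proof -
  have "x [^] (3::nat) = \<one>" using assms by (simp add: numeral_3_eq_3)
  then have "ord x dvd 3" using pow_eq_id assms(2) by blast
  moreover have "prime (3::nat)" by simp
  ultimately have "ord x = 1 \<or> ord x = 3" using prime_nat_iff by blast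
  then have "ord x = 3" using ord_eq_1[OF assms(2)] assms(3) by blast
  then show ?thesis using ord_dvd_group_order[OF assms(2)] by metis
qed

lemma exists_cube_one:
  assumes "finite (carrier G)" "3 dvd order G"
  shows "\<exists>x\<in>carrier G. x \<noteq> \<one> \<and> x \<otimes> x \<otimes> x = \<one>"
proof -
  obtain m where "order G = 3 ^ 1 * m" using assms(2) by (auto simp: dvd_def)
  then obtain H where H: "subgroup H G" "card H = 3"
    using sylow_thm[of 3 G 1 m] group_axioms assms(1) by auto
  interpret H: group "G\<lparr>carrier := H\<rparr>" using subgroup_imp_group[OF H(1)] .
  have fin: "finite H" using H(2) card.infinite by fastforce
  have "\<not> H \<subseteq> {\<one>}"
  proof
    assume "H \<subseteq> {\<one>}"
    then have "card H \<le> card {\<one>}" by (rule card_mono[rotated]) simp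
    then show False using H(2) by simp
  qed
  then obtain x where x: "x \<in> H" "x \<noteq> \<one>" by blast
  have "x [^]\<^bsub>G\<lparr>carrier := H\<rparr>\<^esub> (3::nat) = \<one>"
    using H.pow_order_eq_1[of x] x H(2) fin by (simp add: order_def)
  then have "x \<otimes> x \<otimes> x = \<one>"
    using x subgroup.mem_carrier[OF H(1)] by (simp add: numeral_3_eq_3)
  then show ?thesis using x subgroup.mem_carrier[OF H(1)] by blast
qed

end

text \<open>Divisibility of the order by 3 depends only on the underlying set. This is the bridge by
  which an element of order three passes from one law to the other.\<close>

lemma cube_one_transfer:
  assumes A: "group A" "subgroup H A" and B: "group B" "subgroup H B" and fin: "finite H"
    and x: "x \<in> H" "x \<noteq> \<one>\<^bsub>A\<^esub>" "x \<otimes>\<^bsub>A\<^esub> x \<otimes>\<^bsub>A\<^esub> x = \<one>\<^bsub>A\<^esub>"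
  shows "\<exists>y\<in>H. y \<noteq> \<one>\<^bsub>B\<^esub> \<and> y \<otimes>\<^bsub>B\<^esub> y \<otimes>\<^bsub>B\<^esub> y = \<one>\<^bsub>B\<^esub>"
proof -
  have "3 dvd order (A\<lparr>carrier := H\<rparr>)"
    using group.cube_dvd_order[OF group.subgroup_imp_group[OF A], of x] fin x by simp
  then have "3 dvd order (B\<lparr>carrier := H\<rparr>)" by (simp add: order_def)
  then show ?thesis
    using group.exists_cube_one[OF group.subgroup_imp_group[OF B]] fin by simp
qed

text \<open>\<open>L\<close> is another group law on the even part of \<open>G\<close> (or on all of \<open>S\<^sub>4\<close>), such that the inner
  automorphisms of \<open>G\<close> are automorphisms of \<open>L\<close>.\<close>

locale twisted = sym_cover_like G n z \<tau> \<theta> + L: group L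
  for G :: "('a, 'c) monoid_scheme" (structure) and n z \<tau> \<theta> and L :: "'a monoid" +
  assumes n4: "4 \<le> n"
    and carrier_L: "carrier L = even_part \<or> n = 4 \<and> z = \<one> \<and> carrier L = carrier G"
    and n6: "n = 6 \<Longrightarrow> z = \<one>"
    and act_hom: "g \<in> carrier G \<Longrightarrow> x \<in> carrier L \<Longrightarrow> y \<in> carrier L \<Longrightarrow>
        act g (x \<otimes>\<^bsub>L\<^esub> y) = act g x \<otimes>\<^bsub>L\<^esub> act g y"
begin

abbreviation star (infixl "\<star>" 70) where "x \<star> y \<equiv> x \<otimes>\<^bsub>L\<^esub> y"
abbreviation e where "e \<equiv> \<one>\<^bsub>L\<^esub>"
abbreviation X where "X \<equiv> carrier L"

lemma n3: "3 \<le> n" using n4 by simp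

definition all_of_S4 :: bool where
  "all_of_S4 \<longleftrightarrow> carrier L \<noteq> even_part"

lemma all_of_S4: "all_of_S4 \<Longrightarrow> n = 4 \<and> z = \<one>"
  using carrier_L by (auto simp: all_of_S4_def)

lemma X_iff: "x \<in> X \<longleftrightarrow> x \<in> carrier G \<and> (evenperm (\<theta> x) \<or> all_of_S4)"
  using carrier_L by (auto simp: all_of_S4_def even_part_def)

lemma X_G [simp]: "x \<in> X \<Longrightarrow> x \<in> carrier G"
  by (simp only: X_iff)

lemma X_even: "x \<in> X \<Longrightarrow> evenperm (\<theta> x) \<or> n = 4"
  using all_of_S4 by (auto simp only: X_iff)

lemma even_X: "x \<in> carrier G \<Longrightarrow> evenperm (\<theta> x) \<Longrightarrow> x \<in> X"
  unfolding X_iff by blast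

lemma X_mult: "x \<in> X \<Longrightarrow> y \<in> X \<Longrightarrow> x \<otimes> y \<in> X"
  unfolding X_iff using even_mult by auto

lemma even_inv: "g \<in> carrier G \<Longrightarrow> evenperm (\<theta> (inv g)) = evenperm (\<theta> g)"
proof -
  assume g: "g \<in> carrier G"
  have "evenperm (\<theta> (inv g \<otimes> g))" using evenperm_id g by (metis \<theta>_one l_inv)
  then show ?thesis using even_mult[of "inv g" g] g by simp
qed

lemma X_inv: "x \<in> X \<Longrightarrow> inv x \<in> X"
  unfolding X_iff using even_inv by auto

lemma X_act [simp]: "g \<in> carrier G \<Longrightarrow> x \<in> X \<Longrightarrow> act g x \<in> X"
  unfolding X_iff act_def using even_inv even_mult by auto

lemma X_cyc: "triple n a b c \<Longrightarrow> cyc a b c \<in> X"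
  by (simp add: even_X even_cyc)

lemma X_z: "z \<in> X"
  using even_X[OF z_closed] evenperm_id by (metis \<theta>_z)

lemma X_one: "\<one> \<in> X"
  using even_X[OF one_closed] evenperm_id by (metis \<theta>_one)

lemma finite_X: "finite X"
  using finite_carrier[OF n3] X_G by (meson rev_finite_subset subsetI)

lemma act_e [simp]: "g \<in> carrier G \<Longrightarrow> act g e = e"
  using act_hom[of g e e] L.l_cancel_one'[of "act g e" "act g e"] by simp

lemma act_inv_L: "g \<in> carrier G \<Longrightarrow> x \<in> X \<Longrightarrow> act g (inv\<^bsub>L\<^esub> x) = inv\<^bsub>L\<^esub> (act g x)"
  using act_hom[of g "inv\<^bsub>L\<^esub> x" x] by (intro L.inv_equality[symmetric]) auto

definition fixed :: "'a set \<Rightarrow> 'a set" where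
  "fixed H = {x \<in> X. \<forall>g\<in>H. act g x = x}"

lemma fixed_subgroup_L: "H \<subseteq> carrier G \<Longrightarrow> subgroup (fixed H) L"
  by (rule L.subgroupI) (auto simp: fixed_def subset_iff act_hom act_inv_L)

lemma fixed_subgroup_G: "H \<subseteq> carrier G \<Longrightarrow> subgroup (fixed H) G"
proof (rule subgroupI)
  assume H: "H \<subseteq> carrier G"
  have "\<one> \<in> fixed H" using X_one H by (simp add: fixed_def act_def subset_iff)
  then show "fixed H \<noteq> {}" by blast
  show "inv x \<in> fixed H" if "x \<in> fixed H" for x
  proof -
    have "act g (inv x) = inv x" if "g \<in> H" for g
    proof -
      have g: "g \<in> carrier G" "act g x = x" "x \<in> carrier G" using that \<open>x \<in> fixed H\<close> H by (auto simp: fixed_def)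
      have "act g \<one> = \<one>" using g by (simp add: act_def)
      then have "act g (inv x) = inv (act g x)"
        using g act_mult[of g "inv x" x] by (intro inv_equality[symmetric]) auto
      then show ?thesis using g by simp
    qed
    then show ?thesis using that by (simp add: fixed_def X_inv)
  qed
qed (auto simp: fixed_def subset_iff act_mult X_mult)

text \<open>The permutation \<open>\<theta> x\<close> commutes with all transpositions, so each
  point \<open>a\<close> is sent into both {a, b} and {a, c}. Elements defined canonically from the
  second law are located with this.\<close>

lemma central:
  assumes "x \<in> X" "\<And>g. g \<in> carrier G \<Longrightarrow> act g x = x" shows "x \<in> {\<one>, z}"
proof -
  have "\<theta> x a = a" for a
  proof (cases "a \<in> {1..n}")
    case True
    obtain b c where bc: "pair n a b" "pair n a c" "b \<noteq> c"
    proof -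
      consider "a = 1" | "a = 2" | "a > 2" using True by fastforce
      then show ?thesis
        using that[of 2 3] that[of 1 3] that[of 1 2] n4 True by cases (auto simp: pair_def)
    qed
    have "\<theta> x a \<in> {a, d}" if "pair n a d" for d
    proof (rule commute_transp_mem)
      show "inj (\<theta> x)" by (rule permutes_inj[OF \<theta>_permutes[OF X_G[OF assms(1)]]])
      show "\<theta> x \<circ> transp a d = transp a d \<circ> \<theta> x"
        using \<theta>_act[of "\<tau> a d" x] assms that by (simp add: \<theta>_\<tau>)
      show "a \<noteq> d" using that by (simp add: pair_def)
    qed
    then show ?thesis using bc by blast
  next
    case False
    then show ?thesis using \<theta>_permutes[of x] assms(1) by (auto simp: permutes_def)
  qed
  then have "\<theta> x = id" by (auto simp: fun_eq_iff)
  then show ?thesis using kernel_\<theta>[OF n3] assms(1) by simp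
qed

text \<open>The unit of \<open>L\<close> is fixed by every automorphism of \<open>L\<close>, in
  particular by all \<open>act g\<close>.\<close>

lemma e_central: "e \<in> {\<one>, z}"
  by (rule central) auto

lemma act_center: "u \<in> {\<one>, z} \<Longrightarrow> g \<in> carrier G \<Longrightarrow> act g u = u"
  using act_z(2)[of g] by (cases "u = z") (auto simp: act_def)

lemma center_X: "u \<in> {\<one>, z} \<Longrightarrow> u \<in> X"
  using X_z X_one by auto

text \<open>Invariance keeps \<open>u \<star> u\<close> inside a set of at most two elements that
  contains \<open>e\<close>; for \<open>u\<close> other than \<open>e\<close> the value
  \<open>u\<close> itself is impossible.\<close>

lemma center_sq: "u \<in> {\<one>, z} \<Longrightarrow> u \<star> u = e"
proof (cases "u = e")
  case False
  assume u: "u \<in> {\<one>, z}"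
  have "u \<star> u \<in> {\<one>, z}"
    by (rule central) (use u center_X[OF u] act_center[OF u] in \<open>auto simp: act_hom\<close>)
  moreover have "u \<star> u \<noteq> u" using False center_X[OF u] by simp
  ultimately show ?thesis using u e_central False by auto
qed simp

definition tail :: "'a \<Rightarrow> bool" where
  "tail x \<longleftrightarrow> (\<forall>i j. pair n i j \<longrightarrow> 5 \<le> i \<longrightarrow> 5 \<le> j \<longrightarrow> act (\<tau> i j) x = x)"

lemma tail_\<theta>: "x \<in> carrier G \<Longrightarrow> tail x \<Longrightarrow> tail_commuting n (\<theta> x)"
  unfolding tail_commuting_def
proof (intro ballI)
  fix i j assume x: "x \<in> carrier G" "tail x" and ij: "i \<in> {5..n}" "j \<in> {5..n}"
  show "\<theta> x \<circ> transp i j = transp i j \<circ> \<theta> x"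
  proof (cases "i = j")
    case False
    then have "pair n i j" using ij by (auto simp: pair_def)
    then show ?thesis using \<theta>_act[of "\<tau> i j" x] x ij by (simp add: \<theta>_\<tau> tail_def)
  qed simp
qed

lemma tail_mult: "x \<in> X \<Longrightarrow> y \<in> X \<Longrightarrow> tail x \<Longrightarrow> tail y \<Longrightarrow> tail (x \<star> y)"
  by (simp add: tail_def act_hom)

lemma tail_inv: "x \<in> X \<Longrightarrow> tail x \<Longrightarrow> tail (inv\<^bsub>L\<^esub> x)"
  by (simp add: tail_def act_inv_L)

lemma act_\<tau>_cyc_disjoint:
  "pair n i j \<Longrightarrow> triple n a b c \<Longrightarrow> {i, j} \<inter> {a, b, c} = {} \<Longrightarrow> act (\<tau> i j) (cyc a b c) = cyc a b c"
  by (simp add: act_\<tau>_cyc)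

lemma tail_cyc:
  assumes t: "triple (reach n) a b c" shows "tail (cyc a b c)"
  unfolding tail_def
proof (intro allI impI)
  fix i j assume ij: "pair n i j" "5 \<le> i" "5 \<le> j"
  have "reach n = 4" using ij by (auto simp: reach_def pair_def)
  then have "{i, j} \<inter> {a, b, c} = {}" using t ij by (auto simp: triple_def)
  then show "act (\<tau> i j) (cyc a b c) = cyc a b c" by (rule act_\<tau>_cyc_disjoint[OF ij(1) triple_top[OF n4 t]])
qed

definition F :: "nat \<Rightarrow> nat \<Rightarrow> nat \<Rightarrow> 'a set" where
  "F a b c = {x \<in> X. \<theta> x \<in> {id, cyc3 a b c, cyc3 c b a}}"

lemma F_list:
  assumes "triple n a b c"
  shows "F a b c = {\<one>, z, cyc a b c, z \<otimes> cyc a b c, cyc c b a, z \<otimes> cyc c b a}"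
proof
  note t = assms tripleD(2)[OF assms]
  show "F a b c \<subseteq> {\<one>, z, cyc a b c, z \<otimes> cyc a b c, cyc c b a, z \<otimes> cyc c b a}"
  proof
    fix x assume x: "x \<in> F a b c"
    then have xG: "x \<in> carrier G" by (simp add: F_def)
    from x consider "\<theta> x = id" | "\<theta> x = cyc3 a b c" | "\<theta> x = cyc3 c b a" by (auto simp: F_def)
    then show "x \<in> {\<one>, z, cyc a b c, z \<otimes> cyc a b c, cyc c b a, z \<otimes> cyc c b a}"
    proof cases
      case 1 then show ?thesis using kernel_\<theta>[OF n3 xG] by blast
    next
      case 2 then show ?thesis using \<theta>_eq[OF n3 xG, of "cyc a b c"] t by (auto simp: \<theta>_cyc)
    next
      case 3 then show ?thesis using \<theta>_eq[OF n3 xG, of "cyc c b a"] t by (auto simp: \<theta>_cyc)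
    qed
  qed
  show "{\<one>, z, cyc a b c, z \<otimes> cyc a b c, cyc c b a, z \<otimes> cyc c b a} \<subseteq> F a b c"
    using t X_cyc[OF t(1)] X_cyc[OF t(2)] X_z X_one X_mult
    by (auto simp: F_def \<theta>_mult \<theta>_z \<theta>_cyc)
qed

text \<open>As a set of fixed points, the set of at most six lifts of powers of one three-cycle
  becomes a subgroup for both laws. It is the smallest set on which the laws are compared.\<close>

lemma F_fixed:
  assumes t: "triple (reach n) a b c"
  shows "F a b c = fixed (insert (cyc a b c) {\<tau> i j | i j. pair n i j \<and> 5 \<le> i \<and> 5 \<le> j})" (is "_ = fixed ?H")
proof
  note tn = triple_top[OF n4 t]
  show "F a b c \<subseteq> fixed ?H"
  proof
    fix x assume x: "x \<in> F a b c"
    have t': "tail (cyc a b c)" "tail (cyc c b a)" using tail_cyc t tripleD(2) by blast+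
    have "act (cyc a b c) (cyc c b a) = cyc c b a" "act (cyc a b c) (cyc a b c) = cyc a b c"
      using cyc_inv[OF tn] cyc_inv[OF tripleD(2)[OF tn]] tn tripleD(2)[OF tn] by (simp_all add: act_fix_iff)
    then have c: "act g (cyc a b c) = cyc a b c" "act g (cyc c b a) = cyc c b a" if "g \<in> ?H" for g
      using that t' by (auto simp: tail_def)
    have g: "g \<in> carrier G" if "g \<in> ?H" for g using that tn by auto
    have "act g x = x" if "g \<in> ?H" for g
      using x g[OF that] c[OF that] act_center[OF _ g[OF that]] tn tripleD(2)[OF tn]
      unfolding F_list[OF tn] by (auto simp: act_mult)
    moreover have "x \<in> X" using x by (simp add: F_def)
    ultimately show "x \<in> fixed ?H" by (simp only: fixed_def mem_Collect_eq) blast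
  qed
  show "fixed ?H \<subseteq> F a b c"
  proof
    fix x assume x: "x \<in> fixed ?H"
    then have xX: "x \<in> X" "act (cyc a b c) x = x" "tail x" by (auto simp: fixed_def tail_def)
    have "\<theta> x \<circ> cyc3 a b c = cyc3 a b c \<circ> \<theta> x"
      using \<theta>_act[of "cyc a b c" x] xX tn by (simp add: \<theta>_cyc)
    then have "\<theta> x \<in> {id, cyc3 a b c, cyc3 c b a}"
      using xX tail_\<theta> X_even by (intro commuting_with_cyc3[OF \<theta>_permutes n4 t]) auto
    then show "x \<in> F a b c" using xX by (simp add: F_def)
  qed
qed

lemma F_subgroup:
  assumes t: "triple (reach n) a b c"
  shows "subgroup (F a b c) L" "subgroup (F a b c) G"
proof -
  have "insert (cyc a b c) {\<tau> i j | i j. pair n i j \<and> 5 \<le> i \<and> 5 \<le> j} \<subseteq> carrier G"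
    using triple_top[OF n4 t] by auto
  then show "subgroup (F a b c) L" "subgroup (F a b c) G"
    unfolding F_fixed[OF t] by (rule fixed_subgroup_L, rule fixed_subgroup_G)
qed

definition order3 :: "'a \<Rightarrow> bool" where
  "order3 x \<longleftrightarrow> x \<in> X \<and> x \<noteq> e \<and> x \<star> x \<star> x = e"

lemma order3_X: "order3 x \<Longrightarrow> x \<in> X"
  by (simp add: order3_def)

lemma order3_act: "g \<in> carrier G \<Longrightarrow> order3 x \<Longrightarrow> order3 (act g x)"
proof -
  assume g: "g \<in> carrier G" and x: "order3 x"
  have xX: "x \<in> X" by (rule order3_X[OF x])
  have "act g x \<star> act g x \<star> act g x = act g (x \<star> x \<star> x)" using g xX by (simp add: act_hom)
  then have "act g x \<star> act g x \<star> act g x = e" using x g by (simp add: order3_def)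
  moreover have "act g x \<noteq> e"
  proof
    assume "act g x = e"
    then have "act (inv g) (act g x) = e" using g by simp
    then show False using x xX g by (simp add: act_inv order3_def)
  qed
  ultimately show ?thesis using g xX by (simp add: order3_def)
qed

lemma not_order3_center: "u \<in> {\<one>, z} \<Longrightarrow> \<not> order3 u"
  using center_sq[of u] center_X[of u] by (auto simp: order3_def)

lemma triple123: "triple (reach n) 1 2 3" "triple n 1 2 3"
  using n4 by (auto simp: triple_def reach_def)

text \<open>\<open>F 1 2 3\<close> contains an element of order three for \<open>G\<close>, hence
  one for \<open>L\<close>. The latter is not central, so it lifts (1 2 3) or its inverse, and
  conjugation by \<open>\<tau> 1 2\<close> exchanges these two cases.\<close>

lemma exists_lift:
  "\<exists>\<zeta>\<in>{\<one>, z}. order3 (\<zeta> \<otimes> cyc 1 2 3)"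
proof -
  note t = triple123
  have "cyc 1 2 3 \<noteq> \<one>" 
  proof
    assume "cyc 1 2 3 = \<one>"
    then have "cyc3 1 2 3 1 = id 1" using \<theta>_cyc[OF t(2)] by simp
    then show False by (simp add: cyc3_apply)
  qed
  moreover have "cyc 1 2 3 \<otimes> cyc 1 2 3 \<otimes> cyc 1 2 3 = \<one>"
    using cyc_sq[OF t(2)] cyc_inv[OF tripleD(2)[OF t(2)]] by simp
  moreover have "cyc 1 2 3 \<in> F 1 2 3" using F_list[OF t(2)] by simp
  moreover have "finite (F 1 2 3)" unfolding F_list[OF t(2)] by simp
  ultimately obtain u where u: "u \<in> F 1 2 3" "u \<noteq> e" "u \<star> u \<star> u = e"
    using cube_one_transfer[OF group_axioms F_subgroup(2)[OF t(1)] L.group_axioms F_subgroup(1)[OF t(1)]] by blast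
  then have u3: "order3 u" by (simp add: order3_def F_def)
  have p12: "pair n 1 2" using n4 by (auto simp: pair_def)
  have tr: "triple n 3 2 1" by (rule tripleD(2)[OF t(2)])
  have a: "act (\<tau> 1 2) (cyc 3 2 1) = cyc 1 2 3"
    using act_\<tau>_cyc[OF p12 tr] cyc_rot[OF t(2)] cyc_rot[OF tripleD(1)[OF t(2)]]
    by (simp add: Transposition.transpose_def)
  have "u \<notin> {\<one>, z}" using u3 not_order3_center by blast
  then consider "u = cyc 1 2 3" | "u = z \<otimes> cyc 1 2 3" | "u = cyc 3 2 1" | "u = z \<otimes> cyc 3 2 1"
    using u(1) unfolding F_list[OF t(2)] by blast
  then show ?thesis
  proof cases
    case 1
    then show ?thesis using u3 t by (intro bexI[of _ \<one>]) auto
  next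
    case 2
    then show ?thesis using u3 t by (intro bexI[of _ z]) auto
  next
    case 3
    then show ?thesis using order3_act[OF _ u3, of "\<tau> 1 2"] a p12 t by (intro bexI[of _ \<one>]) auto
  next
    case 4
    then show ?thesis using order3_act[OF _ u3, of "\<tau> 1 2"] a p12 t tr
      by (intro bexI[of _ z]) (auto simp: act_mult)
  qed
qed

end

text \<open>Since \<open>L\<close> need not have the same unit as \<open>G\<close>, the lifts of three-cycles of order three in \<open>L\<close>
  may differ from those in \<open>G\<close> by a central factor \<open>\<zeta>\<close>.\<close>

locale twisted_lift = twisted +
  fixes \<zeta>
  assumes \<zeta>: "\<zeta> \<in> {\<one>, z}" and \<zeta>_order3: "order3 (\<zeta> \<otimes> cyc 1 2 3)"
begin

definition al :: "nat \<Rightarrow> nat \<Rightarrow> nat \<Rightarrow> 'a" where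
  "al a b c = \<zeta> \<otimes> cyc a b c"

lemma \<zeta>_G [simp]: "\<zeta> \<in> carrier G"
  using \<zeta> by auto

lemma \<theta>_al: "triple n a b c \<Longrightarrow> \<theta> (al a b c) = cyc3 a b c"
  using \<zeta> by (auto simp: al_def \<theta>_mult \<theta>_z \<theta>_cyc)

lemma act_al: "g \<in> carrier G \<Longrightarrow> triple n a b c \<Longrightarrow> act g (al a b c) = al (\<theta> g a) (\<theta> g b) (\<theta> g c)"
  by (simp add: al_def act_mult act_center[OF \<zeta>] act_cyc)

lemma al_rot: "triple n a b c \<Longrightarrow> al a b c = al b c a"
  by (simp add: al_def cyc_rot[of a b c])

lemma al_X [simp]: "triple n a b c \<Longrightarrow> al a b c \<in> X"
  unfolding al_def using \<zeta> X_z X_one by (intro X_mult X_cyc) auto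

lemma al_F:
  assumes "triple n a b c" shows "al a b c \<in> F a b c" "al c b a \<in> F a b c"
  using \<theta>_al[OF assms] \<theta>_al[OF tripleD(2)[OF assms]] al_X[OF assms] al_X[OF tripleD(2)[OF assms]]
  by (simp_all add: F_def)

lemma move4:
  assumes "triple n a b c" "d \<in> {1..n}" "d \<notin> {a, b, c}"
  obtains g where "g \<in> carrier G" "\<theta> g 1 = a" "\<theta> g 2 = b" "\<theta> g 3 = c" "\<theta> g 4 = d"
proof -
  have "\<exists>p. p permutes {1..n} \<and> map p [1, 2, 3, 4] = [a, b, c, d]"
    by (rule permutes_extend) (use assms n4 in \<open>auto simp: triple_def\<close>)
  then show ?thesis using \<theta>_surj that by auto
qed

lemma fourth_point:
  assumes "triple n a b c"
  obtains d where "d \<in> {1..n}" "d \<notin> {a, b, c}"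
proof -
  have "\<not> {1..n} \<subseteq> {a, b, c}"
  proof
    assume "{1..n} \<subseteq> {a, b, c}"
    then have "card {1..n} \<le> card {a, b, c}" by (rule card_mono[rotated]) simp
    also have "card {a, b, c} \<le> 3" by (auto simp: card_insert_if)
    finally show False using n4 by simp
  qed
  then show ?thesis using that by blast
qed

lemma move3:
  assumes "triple n a b c"
  obtains g where "g \<in> carrier G" "\<theta> g 1 = a" "\<theta> g 2 = b" "\<theta> g 3 = c"
  using fourth_point[OF assms] move4[OF assms] by metis

lemma al_order3: "triple n a b c \<Longrightarrow> order3 (al a b c)"
proof -
  assume t: "triple n a b c"
  obtain g where g: "g \<in> carrier G" "\<theta> g 1 = a" "\<theta> g 2 = b" "\<theta> g 3 = c" by (rule move3[OF t])
  have "order3 (act g (al 1 2 3))" using order3_act[OF g(1)] \<zeta>_order3 by (simp add: al_def)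
  then show ?thesis using act_al[OF g(1) triple123(2)] g by simp
qed

lemma al_inj:
  assumes "triple n a b c" "triple n p q r" "al a b c = al p q r"
  shows "cyc3 a b c = cyc3 p q r"
  using \<theta>_al[OF assms(1)] \<theta>_al[OF assms(2)] assms(3) by simp

text \<open>If \<open>x\<close> were not a power of \<open>u\<close>, then e, u, u^2, x, x^2, ux,
  ux^2, formed in \<open>L\<close>, would be seven different elements of \<open>F a b c\<close>,
  which has at most six.\<close>

lemma F_unique_order3:
  assumes t: "triple (reach n) a b c" and x: "x \<in> F a b c" "order3 x"
  shows "x \<in> {al a b c, al a b c \<star> al a b c}"
proof (rule ccontr)
  assume nx: "\<not> ?thesis"
  note tn = triple_top[OF n4 t]
  define u where "u = al a b c"
  have u: "u \<in> F a b c" "order3 u" unfolding u_def using al_F[OF tn] al_order3[OF tn] by auto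
  interpret FL: subgroup "F a b c" L by (rule F_subgroup[OF t])
  have uX: "u \<in> X" and xX: "x \<in> X" using u x order3_X by auto
  have uuu: "u \<star> (u \<star> u) = e" "u \<star> u \<star> u = e" "u \<noteq> e"
    using u uX by (auto simp: order3_def L.m_assoc)
  have xxx: "x \<star> (x \<star> x) = e" "x \<star> x \<star> x = e" "x \<noteq> e"
    using x xX by (auto simp: order3_def L.m_assoc)
  have ne: "x \<noteq> u" "x \<noteq> u \<star> u" using nx by (auto simp: u_def)
  have uu: "u \<star> u \<noteq> e" "u \<star> u \<noteq> u" using uuu uX by auto
  have xx: "x \<star> x \<noteq> e" "x \<star> x \<noteq> x" using xxx xX by auto
  have inv_u: "inv\<^bsub>L\<^esub> u = u \<star> u" and inv_x: "inv\<^bsub>L\<^esub> x = x \<star> x"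
    using uuu xxx uX xX by (simp_all add: L.inv_equality L.m_assoc)
  have xxu: "x \<star> x \<noteq> u" "x \<star> x \<noteq> u \<star> u"
    using ne inv_u inv_x uX xX by (metis L.inv_inv L.inv_inv)+
  have ux: "u \<star> x \<noteq> e" "u \<star> x \<noteq> u" "u \<star> x \<noteq> x" "u \<star> x \<noteq> u \<star> u" "u \<star> x \<noteq> x \<star> x"
  proof -
    show "u \<star> x \<noteq> e" using ne inv_u uX xX by (metis L.inv_equality L.inv_inv L.m_closed)
    show "u \<star> x \<noteq> u" "u \<star> x \<noteq> x" "u \<star> x \<noteq> u \<star> u" "u \<star> x \<noteq> x \<star> x"
      using ne uX xX uuu xxx by auto
  qed
  have uxx: "u \<star> (x \<star> x) \<noteq> e" "u \<star> (x \<star> x) \<noteq> u" "u \<star> (x \<star> x) \<noteq> x" "u \<star> (x \<star> x) \<noteq> u \<star> u"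
    "u \<star> (x \<star> x) \<noteq> x \<star> x" "u \<star> (x \<star> x) \<noteq> u \<star> x"
  proof -
    show "u \<star> (x \<star> x) \<noteq> e"
      using xxu inv_u uX xX by (metis L.inv_equality L.inv_inv L.m_closed)
    show "u \<star> (x \<star> x) \<noteq> u" "u \<star> (x \<star> x) \<noteq> u \<star> u" "u \<star> (x \<star> x) \<noteq> x \<star> x" "u \<star> (x \<star> x) \<noteq> u \<star> x"
      using ne uX xX uuu xxx xx xxu by auto
    show "u \<star> (x \<star> x) \<noteq> x"
    proof
      assume "u \<star> (x \<star> x) = x"
      then have "u \<star> x \<star> x = e \<star> x" using uX xX by (simp add: L.m_assoc)
      then have "u \<star> x = e" using L.right_cancel[of x "u \<star> x" e] uX xX by simp
      then show False using ux by simp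
    qed
  qed
  define xs where "xs = [u \<star> (x \<star> x), u \<star> x, x \<star> x, x, u \<star> u, u, e]"
  have "set xs \<subseteq> F a b c"
    using u(1) x(1) FL.m_closed FL.one_closed by (simp add: xs_def)
  then have "card (set xs) \<le> card (F a b c)"
    by (rule card_mono[rotated]) (simp add: F_list[OF tn])
  also have "F a b c = set [\<one>, z, cyc a b c, z \<otimes> cyc a b c, cyc c b a, z \<otimes> cyc c b a]"
    by (simp add: F_list[OF tn])
  also have "card \<dots> \<le> 6" by (rule order_trans[OF card_length]) simp
  finally have "card (set xs) \<le> 6" .
  moreover have "distinct xs"
    unfolding xs_def using uuu(3) xxx(3) ne uu xx xxu ux uxx by simp
  then have "card (set xs) = 7" by (simp add: distinct_card xs_def)
  ultimately show False by simp
qed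

text \<open>The element \<open>al 3 2 1\<close> lies in \<open>F 1 2 3\<close> and has order three,
  so it is a power of \<open>al 1 2 3\<close>; being different from it, it is the square. Other
  triples follow by conjugation.\<close>

lemma al_sq: 
  assumes "triple n a b c" shows "al a b c \<star> al a b c = al c b a"
proof -
  note t = triple123
  have "al 3 2 1 \<in> {al 1 2 3, al 1 2 3 \<star> al 1 2 3}"
    by (rule F_unique_order3[OF t(1)]) (use al_F[OF t(2)] al_order3[OF tripleD(2)[OF t(2)]] in auto)
  moreover have "al 3 2 1 \<noteq> al 1 2 3"
  proof
    assume "al 3 2 1 = al 1 2 3"
    then have "cyc3 3 2 1 1 = cyc3 1 2 3 1" using al_inj[OF tripleD(2)[OF t(2)] t(2)] by simp
    then show False by (simp add: cyc3_apply)
  qed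
  ultimately have 1: "al 1 2 3 \<star> al 1 2 3 = al 3 2 1" by simp
  obtain g where g: "g \<in> carrier G" "\<theta> g 1 = a" "\<theta> g 2 = b" "\<theta> g 3 = c" by (rule move3[OF assms])
  have "act g (al 1 2 3 \<star> al 1 2 3) = act g (al 3 2 1)" using 1 by simp
  then show ?thesis using g act_al[OF g(1) t(2)] act_al[OF g(1) tripleD(2)[OF t(2)]] t(2) by (simp add: act_hom)
qed

lemma al_inv: "triple n a b c \<Longrightarrow> al a b c \<star> al c b a = e"
proof -
  assume t: "triple n a b c"
  have "al a b c \<star> (al a b c \<star> al a b c) = e"
    using al_order3[OF t] al_X[OF t] by (simp add: order3_def L.m_assoc)
  then show ?thesis by (simp only: al_sq[OF t])
qed

lemma inv_al: "triple n a b c \<Longrightarrow> inv\<^bsub>L\<^esub> (al a b c) = al c b a"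
  by (rule L.inv_equality[OF al_inv[OF tripleD(2)]]) (simp_all add: tripleD(2)[of n a b c])

lemma F_order3:
  assumes t: "triple (reach n) a b c" and x: "x \<in> F a b c" "order3 x"
  shows "x = al a b c \<or> x = al c b a"
  using F_unique_order3[OF assms] al_sq[OF triple_top[OF n4 t]] by auto

text \<open>The points fixed by the stabilizer of \<open>y\<close> form a subgroup for both group laws.  By Cauchy's theorem
  it contains an element of order three with respect to \<open>G\<close>, i.e. a lift of a three-cycle.\<close>

lemma order3_is_al:
  assumes y: "order3 y" "tail y"
  shows "\<exists>a b c. triple (reach n) a b c \<and> y = al a b c"
proof -
  define H where "H = {g \<in> carrier G. act g y = y}"
  have HG: "H \<subseteq> carrier G" by (auto simp: H_def)
  have yX: "y \<in> X" using y order3_X by simp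
  have "y \<in> fixed H" using yX by (simp add: fixed_def H_def)
  moreover have "finite (fixed H)" using finite_X by (simp add: fixed_def)
  ultimately obtain f where f: "f \<in> fixed H" "f \<noteq> \<one>" "f \<otimes> f \<otimes> f = \<one>"
    using cube_one_transfer[OF L.group_axioms fixed_subgroup_L[OF HG] group_axioms fixed_subgroup_G[OF HG], of y] y
    by (auto simp: order3_def)
  have fX: "f \<in> X" using f(1) by (simp add: fixed_def)
  have "\<theta> (f \<otimes> f \<otimes> f) = \<theta> f \<circ> \<theta> f \<circ> \<theta> f" using fX by (simp add: \<theta>_mult)
  then have cube: "\<theta> f \<circ> \<theta> f \<circ> \<theta> f = id" using f(3) by simp
  have "\<theta> f \<noteq> id"
  proof
    assume "\<theta> f = id"
    then have "f = z" using kernel_\<theta>[OF n3 X_G[OF fX]] f(2) by blast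
    then show False using f by simp
  qed
  \<comment> \<open>Conjugation by the transpositions of the tail fixes \<open>y\<close>, so these
    transpositions belong to \<open>H\<close> and therefore fix \<open>f\<close>.\<close>
  moreover have "tail f" using y(2) f(1) by (auto simp: tail_def fixed_def H_def)
  ultimately obtain a b c where t: "triple (reach n) a b c" "\<theta> f = cyc3 a b c"
    using cube_id_imp_cyc3[OF \<theta>_permutes n4 cube] tail_\<theta> fX by (meson X_G)
  \<comment> \<open>Under the law of \<open>G\<close> the element \<open>y\<close> commutes with
    itself, so it belongs to its own stabilizer and fixes \<open>f\<close>. Thus \<open>y\<close>
    centralizes a three-cycle.\<close>
  have "y \<in> H" using yX by (simp add: H_def act_fix_iff)
  then have "act y f = f" using f(1) by (simp add: fixed_def)
  then have "\<theta> y \<circ> cyc3 a b c = cyc3 a b c \<circ> \<theta> y"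
    using \<theta>_act[of y f] yX fX t(2) by simp
  then have "\<theta> y \<in> {id, cyc3 a b c, cyc3 c b a}"
    using yX y tail_\<theta> X_even by (intro commuting_with_cyc3[OF \<theta>_permutes n4 t(1)]) auto
  then have "y \<in> F a b c" using yX by (simp add: F_def)
  then show ?thesis using F_order3[OF t(1) _ y(1)] t(1) tripleD(2) by blast
qed

end

context twisted
begin

definition Ad :: "'a \<Rightarrow> 'a \<Rightarrow> 'a" where
  "Ad x y = x \<star> y \<star> inv\<^bsub>L\<^esub> x"

lemma Ad_closed [simp]: "x \<in> X \<Longrightarrow> y \<in> X \<Longrightarrow> Ad x y \<in> X"
  by (simp add: Ad_def)

lemma Ad_mult: "x \<in> X \<Longrightarrow> y \<in> X \<Longrightarrow> w \<in> X \<Longrightarrow> Ad x (y \<star> w) = Ad x y \<star> Ad x w"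
  by (simp add: Ad_def L.m_assoc L.inv_solve_left)

lemma Ad_Ad: "x \<in> X \<Longrightarrow> y \<in> X \<Longrightarrow> w \<in> X \<Longrightarrow> Ad (x \<star> y) w = Ad x (Ad y w)"
  by (simp add: Ad_def L.m_assoc L.inv_mult_group)

lemma Ad_e [simp]: "y \<in> X \<Longrightarrow> Ad e y = y"
  by (simp add: Ad_def)

lemma Ad_fix_iff: "x \<in> X \<Longrightarrow> y \<in> X \<Longrightarrow> Ad x y = y \<longleftrightarrow> x \<star> y = y \<star> x"
  by (simp add: Ad_def L.inv_solve_right')

lemma Ad_inv: "x \<in> X \<Longrightarrow> y \<in> X \<Longrightarrow> Ad x (inv\<^bsub>L\<^esub> y) = inv\<^bsub>L\<^esub> (Ad x y)"
  by (simp add: Ad_def L.m_assoc L.inv_mult_group)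

lemma Ad_e_right: "x \<in> X \<Longrightarrow> Ad x e = e"
  by (simp add: Ad_def)

lemma Ad_inj: "x \<in> X \<Longrightarrow> y \<in> X \<Longrightarrow> w \<in> X \<Longrightarrow> Ad x y = Ad x w \<Longrightarrow> y = w"
  by (simp add: Ad_def)

lemma act_Ad: "g \<in> carrier G \<Longrightarrow> x \<in> X \<Longrightarrow> y \<in> X \<Longrightarrow> act g (Ad x y) = Ad (act g x) (act g y)"
  by (simp add: Ad_def act_hom act_inv_L)

lemma order3_Ad:
  assumes x: "x \<in> X" and y: "order3 y" shows "order3 (Ad x y)"
proof -
  have yX: "y \<in> X" by (rule order3_X[OF y])
  have "Ad x y \<star> Ad x y \<star> Ad x y = Ad x (y \<star> y \<star> y)" using x yX by (simp add: Ad_mult)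
  then have "Ad x y \<star> Ad x y \<star> Ad x y = e" using x y by (simp add: Ad_e_right order3_def)
  moreover have "Ad x y \<noteq> e"
    using Ad_inj[OF x yX L.one_closed] Ad_e_right[OF x] y by (auto simp: order3_def)
  ultimately show ?thesis using x yX by (simp add: order3_def)
qed

lemma tail_Ad: "x \<in> X \<Longrightarrow> y \<in> X \<Longrightarrow> tail x \<Longrightarrow> tail y \<Longrightarrow> tail (Ad x y)"
  by (simp add: Ad_def tail_mult tail_inv)

end

section \<open>Locating the conjugate of one lifted three-cycle by another\<close>

declare One_nat_def [simp del]

lemma five_points: "x \<in> {1..5 :: nat} \<Longrightarrow> x \<in> {1, 2, 3, 4, 5}"
proof -
  assume "x \<in> {1..5}"
  then have "1 \<le> x" "x \<le> 5" by simp_all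
  then have "x = 1 \<or> x = 2 \<or> x = 3 \<or> x = 4 \<or> x = 5" by presburger
  then show ?thesis by simp
qed

text \<open>A permutation commuting with the three-cycle and meeting its support cyclically acts
  there as a power of it; an involution must then fix all three points, but (1 2)(3 4) fixes only
  the point 5 among the first five.\<close>

lemma double_transposition_not_commuting_cyc3:
  assumes t: "triple 5 a b c" and comm: "(transp 1 2 \<circ> transp 3 4) \<circ> cyc3 a b c = cyc3 a b c \<circ> (transp 1 2 \<circ> transp 3 4)"
  shows False
proof -
  define \<gamma> where "\<gamma> = transp 1 2 \<circ> transp 3 4"
  have \<gamma>: "\<gamma> x = (if x = 1 then 2 else if x = 2 then 1 else if x = 3 then 4 else if x = 4 then 3 else x)" for x
    by (auto simp: \<gamma>_def Transposition.transpose_def)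
  have fix5: "x = 5" if "\<gamma> x = x" "x \<in> {1..5}" for x
    using five_points[OF that(2)] that(1) unfolding \<gamma> by (auto split: if_splits)
  have d: "a \<noteq> b" "b \<noteq> c" "a \<noteq> c" using t by (auto simp: triple_def)
  have cm: "\<gamma> (cyc3 a b c x) = cyc3 a b c (\<gamma> x)" for x
    using fun_cong[OF comm, of x] by (simp add: \<gamma>_def)
  have gg: "\<gamma> (\<gamma> x) = x" for x by (simp add: \<gamma>)
  have e: "\<gamma> b = cyc3 a b c (\<gamma> a)" "\<gamma> c = cyc3 a b c (\<gamma> b)"
    using cm[of a] cm[of b] d by (simp_all add: cyc3_apply)
  have "\<gamma> a \<in> {a, b, c}"
  proof (rule ccontr)
    assume "\<gamma> a \<notin> {a, b, c}"
    then have "\<gamma> b = \<gamma> a" using e(1) by (simp add: cyc3_apply[OF d])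
    then show False using gg[of a] gg[of b] d by metis
  qed
  then consider "\<gamma> a = a" | "\<gamma> a = b" | "\<gamma> a = c" by blast
  then show False
  proof cases
    case 1
    then have "\<gamma> b = b" "\<gamma> c = c" using e d by (simp_all add: cyc3_apply)
    then have "a = 5" "b = 5"
      using 1 fix5 t by (auto simp: triple_def)
    then show False using d by simp
  next
    case 2
    then show False using e(1) d gg[of a] by (simp add: cyc3_apply)
  next
    case 3
    then have "\<gamma> b = a" "\<gamma> c = b" using e d by (simp_all add: cyc3_apply)
    then show False using 3 gg[of a] d by simp
  qed
qed

context twisted_lift
begin

lemma tail_al: "triple (reach n) a b c \<Longrightarrow> tail (al a b c)"
  using act_al triple_top[OF n4] tail_cyc \<zeta>
  by (simp add: tail_def al_def act_mult act_center[OF \<zeta>])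

lemma al_neq:
  assumes "triple n a b c" "triple n p q r" "cyc3 a b c i \<noteq> cyc3 p q r i" shows "al a b c \<noteq> al p q r"
  using al_inj assms by metis

lemma triple4: "a \<in> {1..4} \<Longrightarrow> b \<in> {1..4} \<Longrightarrow> c \<in> {1..4} \<Longrightarrow> a \<noteq> b \<Longrightarrow> b \<noteq> c \<Longrightarrow> a \<noteq> c \<Longrightarrow> triple n a b c"
  using n4 by (auto simp: triple_def)

lemma triple4': "a \<in> {1..4} \<Longrightarrow> b \<in> {1..4} \<Longrightarrow> c \<in> {1..4} \<Longrightarrow> a \<noteq> b \<Longrightarrow> b \<noteq> c \<Longrightarrow> a \<noteq> c \<Longrightarrow> triple (reach n) a b c"
  by (auto simp: triple_def reach_def)

text \<open>Were the two elements to commute, \<open>al 1 2 3 \<star> al 4 2 1\<close> would have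
  order three and hence be a lifted three-cycle. Conjugation by (1 2)(3 4) exchanges its two
  commuting factors, so that three-cycle would commute with a double transposition.\<close>

lemma not_commuting: "al 1 2 3 \<star> al 1 2 4 \<noteq> al 1 2 4 \<star> al 1 2 3"
proof
  assume comm: "al 1 2 3 \<star> al 1 2 4 = al 1 2 4 \<star> al 1 2 3"
  have t: "triple n 1 2 3" "triple n 1 2 4" "triple n 3 2 1" "triple n 4 2 1" "triple n 2 1 4" "triple n 1 4 2" "triple n 3 1 2"
    by (rule triple4; simp)+
  have tt: "triple (reach n) 1 2 3" "triple (reach n) 4 2 1" by (rule triple4'; simp)+
  have p: "pair n 1 2" "pair n 3 4" using n4 by (auto simp: pair_def)
  note X = t[THEN al_X]
  define y where "y = al 1 2 3 \<star> al 4 2 1"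
  have comm': "al 1 2 3 \<star> al 4 2 1 = al 4 2 1 \<star> al 1 2 3"
  proof -
    have "Ad (al 1 2 3) (al 1 2 4) = al 1 2 4" using comm X by (simp add: Ad_fix_iff)
    then have "Ad (al 1 2 3) (al 4 2 1) = al 4 2 1"
      using Ad_inv[of "al 1 2 3" "al 1 2 4"] inv_al[OF t(2)] X by simp
    then show ?thesis using X by (simp add: Ad_fix_iff)
  qed
  have yX: "y \<in> X" using X by (simp add: y_def)
  have c1: "al 1 2 3 \<star> (al 1 2 3 \<star> al 1 2 3) = e" "al 4 2 1 \<star> (al 4 2 1 \<star> al 4 2 1) = e"
    using al_sq[OF t(1)] al_sq[OF t(4)] al_inv[OF t(1)] al_inv[OF t(4)] by simp_all
  have sw: "al 4 2 1 \<star> (al 1 2 3 \<star> u) = al 1 2 3 \<star> (al 4 2 1 \<star> u)" if "u \<in> X" for u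
    using that X comm' by (simp flip: L.m_assoc)
  have "y \<star> y \<star> y = (al 1 2 3 \<star> (al 1 2 3 \<star> al 1 2 3)) \<star> (al 4 2 1 \<star> (al 4 2 1 \<star> al 4 2 1))"
    using X by (simp add: y_def L.m_assoc sw)
  then have "y \<star> y \<star> y = e" using c1 by simp
  moreover have "y \<noteq> e"
  proof
    assume "y = e"
    then have "al 4 2 1 \<star> al 1 2 3 = al 4 2 1 \<star> al 1 2 4"
      using comm' al_inv[OF t(4)] by (simp add: y_def)
    then have "al 1 2 3 = al 1 2 4" using X by simp
    then show False using al_neq[OF t(1,2), of 2] by (simp add: cyc3_apply)
  qed
  ultimately have o: "order3 y" using yX by (simp add: order3_def)
  have "tail y" unfolding y_def using X tail_al tt by (intro tail_mult) auto
  then obtain a b c where abc: "triple (reach n) a b c" "y = al a b c" using order3_is_al[OF o] by blast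
  define g where "g = \<tau> 1 2 \<otimes> \<tau> 3 4"
  have g: "g \<in> carrier G" "\<theta> g = transp 1 2 \<circ> transp 3 4" using p by (auto simp: g_def \<theta>_mult \<theta>_\<tau>)
  have "act g (al 1 2 3) = al 2 1 4" "act g (al 4 2 1) = al 3 1 2"
    using act_al[OF g(1) t(1)] act_al[OF g(1) t(4)] by (simp_all add: g(2) Transposition.transpose_def)
  then have "act g y = al 4 2 1 \<star> al 1 2 3"
    using g X al_rot[OF t(5)] al_rot[OF t(6)] al_rot[OF t(7)] by (simp add: y_def act_hom)
  then have "act g y = y" using comm' by (simp add: y_def)
  then have "\<theta> y \<circ> \<theta> g = \<theta> g \<circ> \<theta> y" using \<theta>_act[of g y] g yX by simp
  then have "(transp 1 2 \<circ> transp 3 4) \<circ> cyc3 a b c = cyc3 a b c \<circ> (transp 1 2 \<circ> transp 3 4)"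
    using \<theta>_al[OF triple_top[OF n4 abc(1)]] g abc(2) by simp
  moreover have "triple 5 a b c" using abc(1) by (auto simp: triple_def reach_def split: if_splits)
  ultimately show False by (rule double_transposition_not_commuting_cyc3[rotated])
qed

text \<open>Representatives of the three-cycles up to rotation: eight on the points 1 to 4, and for
  \<open>n = 5\<close> twelve more through the point 5. Six of these twelve contain only one of the
  points 4 and 5, the other six contain both.\<close>

lemma al_canonical:
  assumes t: "triple (reach n) p q r"
  shows "al p q r \<in> {al 1 2 3, al 3 2 1, al 1 2 4, al 2 3 4, al 3 1 4, al 4 2 1, al 4 3 2, al 4 1 3} \<or>
    n = 5 \<and> al p q r \<in> {al 1 2 5, al 2 3 5, al 3 1 5, al 5 2 1, al 5 3 2, al 5 1 3,
      al 1 4 5, al 2 4 5, al 3 4 5, al 1 5 4, al 2 5 4, al 3 5 4}"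
proof -
  define S where "S = {al 1 2 3, al 3 2 1, al 1 2 4, al 2 3 4, al 3 1 4, al 4 2 1, al 4 3 2, al 4 1 3}"
  define S' where "S' = {al 1 2 5, al 2 3 5, al 3 1 5, al 5 2 1, al 5 3 2, al 5 1 3,
      al 1 4 5, al 2 4 5, al 3 4 5, al 1 5 4, al 2 5 4, al 3 5 4}"
  have rot: "al p q r = al q r p" "al p q r = al r p q"
    using al_rot triple_top[OF n4 t] tripleD(1) by metis+
  have d: "p \<noteq> q" "q \<noteq> r" "p \<noteq> r" using t by (auto simp: triple_def)
  have in4: "al a b c \<in> S" if "a \<in> {1, 2, 3, 4}" "b \<in> {1, 2, 3, 4}" "c \<in> {1, 2, 3, 4}"
    "a \<noteq> b" "b \<noteq> c" "a \<noteq> c" "al a b c = al b c a" "al a b c = al c a b" for a b c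
    using that unfolding S_def by (elim insertE emptyE) (simp_all; metis)+
  show ?thesis
  proof (cases "5 \<in> {p, q, r}")
    case False
    have "p \<in> {1, 2, 3, 4}" "q \<in> {1, 2, 3, 4}" "r \<in> {1, 2, 3, 4}"
      using t False five_points[of p] five_points[of q] five_points[of r]
      by (auto simp: triple_def reach_def split: if_splits)
    then have "al p q r \<in> S" using in4 d rot by blast
    then show ?thesis unfolding S_def by blast
  next
    case True
    then have n5: "n = 5" using t by (auto simp: triple_def reach_def split: if_splits)
    have in5: "al 5 a b \<in> S'" if ab: "a \<in> {1, 2, 3, 4}" "b \<in> {1, 2, 3, 4}" "a \<noteq> b"
      "al 5 a b = al a b 5" "al 5 a b = al b 5 a" for a b
      using that unfolding S'_def by (elim insertE emptyE) (simp_all; metis)+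
    have m: "p \<in> {1, 2, 3, 4, 5}" "q \<in> {1, 2, 3, 4, 5}" "r \<in> {1, 2, 3, 4, 5}"
      using t n5 five_points by (simp_all add: triple_def reach_def)
    from True consider "p = 5" | "q = 5" | "r = 5" by blast
    then have "al p q r \<in> S'"
    proof cases
      case 1
      have "q \<in> {1, 2, 3, 4}" "r \<in> {1, 2, 3, 4}" using m d 1 by auto
      moreover have "al 5 q r = al q r 5" "al 5 q r = al r 5 q" using rot 1 by metis+
      ultimately have "al 5 q r \<in> S'" using d(2) by (intro in5)
      then show ?thesis using 1 by simp
    next
      case 2
      have "r \<in> {1, 2, 3, 4}" "p \<in> {1, 2, 3, 4}" using m d 2 by auto
      moreover have "al 5 r p = al r p 5" "al 5 r p = al p 5 r" using rot 2 by metis+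
      ultimately have "al 5 r p \<in> S'" using d(3)[symmetric] by (intro in5)
      then show ?thesis using 2 rot(1) by simp
    next
      case 3
      have "p \<in> {1, 2, 3, 4}" "q \<in> {1, 2, 3, 4}" using m d 3 by auto
      moreover have "al 5 p q = al p q 5" "al 5 p q = al q 5 p" using rot 3 by metis+
      ultimately have "al 5 p q \<in> S'" using d(1) by (intro in5)
      then show ?thesis using 3 rot(2) by simp
    qed
    then show ?thesis using n5 unfolding S'_def by blast
  qed
qed

text \<open>\<open>\<alpha>\<close> has third power the identity and commutes with every conjugation
  of \<open>G\<close> that fixes \<open>al 1 2 3\<close>. The image of \<open>al 1 2 4\<close> is
  again a lifted three-cycle, and these two symmetries exclude all candidates except its images
  under (1 2 3) and (1 3 2).\<close>

lemma Ad_al_124: "Ad (al 1 2 3) (al 1 2 4) \<in> {al 2 3 4, al 3 1 4}"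
proof -
  have t: "triple n 1 2 3" "triple n 1 2 4" "triple n 4 2 1" by (rule triple4; simp)+
  have tt: "triple (reach n) 1 2 3" "triple (reach n) 1 2 4" by (rule triple4'; simp)+
  note X = t[THEN al_X]
  define \<alpha> where "\<alpha> = Ad (al 1 2 3)"
  have \<alpha>X: "\<alpha> y \<in> X" if "y \<in> X" for y using that X by (simp add: \<alpha>_def)
  have \<alpha>3: "\<alpha> (\<alpha> (\<alpha> y)) = y" if "y \<in> X" for y
  proof -
    have "\<alpha> (\<alpha> (\<alpha> y)) = Ad (al 1 2 3 \<star> al 1 2 3 \<star> al 1 2 3) y" using that X by (simp add: \<alpha>_def Ad_Ad)
    then show ?thesis using al_order3[OF t(1)] that by (simp add: order3_def)
  qed
  have \<alpha>_inj: "y = w" if "\<alpha> y = \<alpha> w" "y \<in> X" "w \<in> X" for y w using that \<alpha>3 by metis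
  have \<alpha>_act: "\<alpha> (act g y) = act g (\<alpha> y)" if "g \<in> carrier G" "act g (al 1 2 3) = al 1 2 3" "y \<in> X" for g y
    using that X by (simp add: \<alpha>_def act_Ad)
  have \<alpha>_rev: "\<alpha> (al c b a) = al r q p" if "triple n a b c" "triple n p q r" "\<alpha> (al a b c) = al p q r" for a b c p q r
    using Ad_inv[of "al 1 2 3" "al a b c"] that X by (simp add: \<alpha>_def inv_al)
  \<comment> \<open>If \<open>\<alpha>\<close> moves \<open>al 1 2 4\<close> as \<open>g\<close>
    does, then its third power moves it as the third power of \<open>g\<close> does. This excludes
    \<open>g\<close> when that power moves \<open>al 1 2 4\<close>.\<close>
  have shift: "act g (act g (act g (al 1 2 4))) = al 1 2 4"
    if g: "g \<in> carrier G" "act g (al 1 2 3) = al 1 2 3" and eq: "\<alpha> (al 1 2 4) = act g (al 1 2 4)" for g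
    using \<alpha>3[OF X(2)] g X eq by (simp add: \<alpha>_act)
  \<comment> \<open>If \<open>\<alpha>\<close> inverts and applies \<open>g\<close>, its third power
    inverts once more than an even number of times, so the third power of \<open>g\<close> would
    have to send \<open>al 4 2 1\<close> to \<open>al 1 2 4\<close>.\<close>
  have flip: "act g (act g (act g (al 4 2 1))) = al 1 2 4"
    if g: "g \<in> carrier G" "act g (al 1 2 3) = al 1 2 3" and eq: "\<alpha> (al 1 2 4) = act g (al 4 2 1)" for g
  proof -
    have tg: "triple n (\<theta> g 4) (\<theta> g 2) (\<theta> g 1)" by (rule triple_permutes[OF \<theta>_permutes[OF g(1)] t(3)])
    have "\<alpha> (al 4 2 1) = act g (al 1 2 4)"
      using \<alpha>_rev[OF t(2) tg] eq act_al[OF g(1) t(3)] act_al[OF g(1) t(2)] by simp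
    then show ?thesis using \<alpha>3[OF X(2)] g X eq by (simp add: \<alpha>_act)
  qed
  define c where "c = cyc 1 2 3"
  have c: "c \<in> carrier G" "\<theta> c = cyc3 1 2 3" using t by (simp_all add: c_def \<theta>_cyc)
  have actc: "act c (al i j k) = al (cyc3 1 2 3 i) (cyc3 1 2 3 j) (cyc3 1 2 3 k)" if "triple n i j k" for i j k
    using act_al[OF c(1) that] c by simp
  have c3: "cyc3 1 2 3 1 = 2" "cyc3 1 2 3 2 = 3" "cyc3 1 2 3 3 = 1" "cyc3 1 2 3 4 = 4" "cyc3 1 2 3 5 = 5"
    by (simp_all add: cyc3_apply)
  have T: "triple n 2 3 4" "triple n 3 1 4" "triple n 4 3 2" "triple n 4 1 3" "triple n 2 3 1" by (rule triple4; simp)+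
  have cfix: "act c (al 1 2 3) = al 1 2 3" using actc[OF t(1)] al_rot[OF t(1)] by (simp add: c3)
  have cc: "c \<otimes> c \<in> carrier G" "act (c \<otimes> c) (al 1 2 3) = al 1 2 3" using c cfix X by (simp_all add: act_act)
  have "order3 (\<alpha> (al 1 2 4))" unfolding \<alpha>_def by (rule order3_Ad[OF X(1) al_order3[OF t(2)]])
  moreover have "tail (\<alpha> (al 1 2 4))" unfolding \<alpha>_def using tail_Ad X tail_al tt by blast
  ultimately obtain p q r where pqr: "triple (reach n) p q r" "\<alpha> (al 1 2 4) = al p q r"
    using order3_is_al by blast
  have "\<alpha> (al 1 2 3) = al 1 2 3" using X by (simp add: \<alpha>_def Ad_fix_iff)
  then have n1: "\<alpha> (al 1 2 4) \<noteq> al 1 2 3"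
    using \<alpha>_inj[of "al 1 2 4" "al 1 2 3"] X al_neq[OF t(2,1), of 2] by (auto simp: cyc3_apply)
  have t321: "triple n 3 2 1" by (rule triple4; simp)
  have "\<alpha> (al 3 2 1) = al 3 2 1" using \<alpha>_rev[OF t(1) t(1)] \<open>\<alpha> (al 1 2 3) = al 1 2 3\<close> by simp
  then have n2: "\<alpha> (al 1 2 4) \<noteq> al 3 2 1"
    using \<alpha>_inj[of "al 1 2 4" "al 3 2 1"] X al_X[OF t321] al_neq[OF t(2) t321, of 3] by (auto simp: cyc3_apply)
  have n3: "\<alpha> (al 1 2 4) \<noteq> al 1 2 4"
    using not_commuting X by (simp add: \<alpha>_def Ad_fix_iff)
  have ne: "al 4 2 1 \<noteq> al 1 2 4" using al_neq[OF t(3,2), of 1] by (simp add: cyc3_apply)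
  have n4': "\<alpha> (al 1 2 4) \<noteq> al 4 2 1" using flip[of \<one>] X ne by auto
  have n5: "\<alpha> (al 1 2 4) \<noteq> al 4 3 2" using flip[of c] c cfix actc t T ne by (auto simp: c3)
  have n6: "\<alpha> (al 1 2 4) \<noteq> al 4 1 3" using flip[of "c \<otimes> c"] cc c actc t T ne al_X by (auto simp: c3 act_act)
  have big: False if n: "n = 5" and S: "\<alpha> (al 1 2 4) \<in> {al 1 2 5, al 2 3 5, al 3 1 5, al 5 2 1, al 5 3 2, al 5 1 3,
      al 1 4 5, al 2 4 5, al 3 4 5, al 1 5 4, al 2 5 4, al 3 5 4}"
  proof -
    \<comment> \<open>For \<open>n = 5\<close> the tail imposes no condition and three-cycles
      through 5 are candidates too; the transposition of 4 and 5 is the additional symmetry that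
      excludes them.\<close>
    define s where "s = \<tau> 4 5"
    have tr: "triple n i j k" if "i \<in> {1..5}" "j \<in> {1..5}" "k \<in> {1..5}" "i \<noteq> j" "j \<noteq> k" "i \<noteq> k" for i j k
      using that n by (simp add: triple_def)
    have s: "s \<in> carrier G" "\<theta> s = transp 4 5" using n by (simp_all add: s_def \<theta>_\<tau> pair_def)
    have acts: "act s (al i j k) = al (transp 4 5 i) (transp 4 5 j) (transp 4 5 k)" if "triple n i j k" for i j k
      using act_al[OF s(1) that] s by simp
    have s45: "transp 4 5 1 = 1" "transp 4 5 2 = 2" "transp 4 5 3 = 3" "transp 4 5 4 = 5" "transp 4 5 5 = 4"
      by (simp_all add: Transposition.transpose_def)
    have sfix: "act s (al 1 2 3) = al 1 2 3" using acts[OF t(1)] by (simp add: s45)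
    note ac = actc[OF tr] acts[OF tr]
    have X5: "al i j k \<in> X" if "i \<in> {1..5}" "j \<in> {1..5}" "k \<in> {1..5}" "i \<noteq> j" "j \<noteq> k" "i \<noteq> k" for i j k
      using al_X[OF tr[OF that]] .
    have cs: "c \<otimes> s \<in> carrier G" "act (c \<otimes> s) (al 1 2 3) = al 1 2 3"
      "c \<otimes> c \<otimes> s \<in> carrier G" "act (c \<otimes> c \<otimes> s) (al 1 2 3) = al 1 2 3"
      using c s cfix sfix cc X by (simp_all add: act_act)
    have ne5: "al 1 2 5 \<noteq> al 1 2 4" "al 5 2 1 \<noteq> al 1 2 4"
      using al_neq[OF tr tr, of 1 2 5 1 2 4 2] al_neq[OF tr tr, of 5 2 1 1 2 4 1] by (simp_all add: cyc3_apply)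
    note ev = act_act c s ac X5 c3 s45
    have "\<alpha> (al 1 2 4) \<noteq> al 1 2 5" using shift[OF s(1) sfix] ne5 by (auto simp: ev)
    moreover have "\<alpha> (al 1 2 4) \<noteq> al 2 3 5" using shift[OF cs(1,2)] ne5 by (auto simp: ev)
    moreover have "\<alpha> (al 1 2 4) \<noteq> al 3 1 5" using shift[OF cs(3,4)] ne5 by (auto simp: ev)
    moreover have "\<alpha> (al 1 2 4) \<noteq> al 5 2 1" using flip[OF s(1) sfix] ne5 by (auto simp: ev)
    moreover have "\<alpha> (al 1 2 4) \<noteq> al 5 3 2" using flip[OF cs(1,2)] ne5 by (auto simp: ev)
    moreover have "\<alpha> (al 1 2 4) \<noteq> al 5 1 3" using flip[OF cs(3,4)] ne5 by (auto simp: ev)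
    \<comment> \<open>A three-cycle through 4 and 5 is inverted by \<open>s\<close>. Comparing with
      the image of the inverse \<open>al 4 2 1\<close> gives two preimages, \<open>al 1 2 5\<close>
      and \<open>al 4 2 1\<close>, of one element.\<close>
    moreover have "\<alpha> (al 1 2 4) \<noteq> al i j k" if ijk: "i \<in> {1, 2, 3}" "(j, k) \<in> {(4, 5), (5, 4)}" for i j k
    proof
      assume eq: "\<alpha> (al 1 2 4) = al i j k"
      have tijk: "triple n i j k" by (rule tr) (use ijk in auto)
      have "\<alpha> (al 1 2 5) = act s (al i j k)"
        using \<alpha>_act[OF s(1) sfix X(2)] acts[OF t(2)] by (simp add: eq s45)
      also have "\<dots> = al i k j" using acts[OF tijk] ijk by (auto simp: s45)
      also have "\<dots> = al k j i" using al_rot[of i k j] tr[of i k j] ijk by auto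
      also have "\<dots> = \<alpha> (al 4 2 1)" using \<alpha>_rev[OF t(2) tijk eq] by simp
      finally have "al 1 2 5 = al 4 2 1" by (rule \<alpha>_inj) (use X5[of 1 2 5] X in auto)
      then show False using al_neq[OF tr t(3), of 1 2 5 1] by (auto simp: cyc3_apply)
    qed
    then have "\<alpha> (al 1 2 4) \<noteq> al 1 4 5" "\<alpha> (al 1 2 4) \<noteq> al 2 4 5" "\<alpha> (al 1 2 4) \<noteq> al 3 4 5"
      "\<alpha> (al 1 2 4) \<noteq> al 1 5 4" "\<alpha> (al 1 2 4) \<noteq> al 2 5 4" "\<alpha> (al 1 2 4) \<noteq> al 3 5 4"
      by simp_all
    ultimately show False using S by blast
  qed
  have "\<alpha> (al 1 2 4) \<in> {al 2 3 4, al 3 1 4}"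
    using al_canonical[OF pqr(1)] n1 n2 n3 n4' n5 n6 big unfolding pqr(2)[symmetric] by blast
  then show ?thesis by (simp only: \<alpha>_def)
qed

end

section \<open>From an orientation to an isomorphism\<close>

lemma graph_iso:
  assumes A: "group A" and B: "group B" and fin: "finite (carrier B)"
    and card: "card (carrier A) = card (carrier B)"
    and sub: "R \<subseteq> carrier A \<times> carrier B"
    and mult: "\<And>a b a' b'. (a, b) \<in> R \<Longrightarrow> (a', b') \<in> R \<Longrightarrow> (a \<otimes>\<^bsub>A\<^esub> a', b \<otimes>\<^bsub>B\<^esub> b') \<in> R"
    and total: "\<And>a. a \<in> carrier A \<Longrightarrow> \<exists>b. (a, b) \<in> R"
    and inj: "\<And>a a' b. (a, b) \<in> R \<Longrightarrow> (a', b) \<in> R \<Longrightarrow> a = a'"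
  shows "A \<cong> B"
proof -
  interpret A: group A by (rule A)
  interpret B: group B by (rule B)
  \<comment> \<open>Any choice of partners is injective by \<open>inj\<close>, hence bijective by
    counting, and the multiplicativity of \<open>R\<close> makes it a homomorphism.\<close>
  obtain s where s: "\<And>a. a \<in> carrier A \<Longrightarrow> (a, s a) \<in> R" using total by metis
  have sB: "s a \<in> carrier B" if "a \<in> carrier A" for a using s[OF that] sub by blast
  have injs: "inj_on s (carrier A)"
  proof (rule inj_onI)
    fix a a' assume "a \<in> carrier A" "a' \<in> carrier A" "s a = s a'"
    then show "a = a'" using s[of a] s[of a'] inj by metis
  qed
  have "s ` carrier A \<subseteq> carrier B" using sB by blast
  then have surj: "s ` carrier A = carrier B"
    using card_image[OF injs] card card_subset_eq[OF fin] by simp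
  have "s \<in> hom A B"
  proof (rule homI)
    fix a a' assume a: "a \<in> carrier A" "a' \<in> carrier A"
    then have "s a \<otimes>\<^bsub>B\<^esub> s a' \<in> s ` carrier A" using sB surj by simp
    then obtain x where x: "x \<in> carrier A" "s a \<otimes>\<^bsub>B\<^esub> s a' = s x" by auto
    have "x = a \<otimes>\<^bsub>A\<^esub> a'" using inj[OF s[OF x(1)]] mult[OF s[OF a(1)] s[OF a(2)]] x(2) by simp
    then show "s (a \<otimes>\<^bsub>A\<^esub> a') = s a \<otimes>\<^bsub>B\<^esub> s a'" using x by simp
  qed (rule sB)
  then have "s \<in> iso A B" using injs surj by (simp add: iso_def bij_betw_def)
  then show ?thesis by (auto simp: is_iso_def)
qed

text \<open>The value prescribed is the conjugate of \<open>al 1 2 4\<close> by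
  \<open>cyc 1 2 3\<close> in \<open>G\<close>; the other possible value is the conjugate by the
  inverse of \<open>cyc 1 2 3\<close>. So conjugation in \<open>L\<close> agrees with conjugation in
  \<open>G\<close> in one instance, from which all others are derived.\<close>

locale twisted_oriented = twisted_lift +
  assumes orient: "Ad (al 1 2 3) (al 1 2 4) = al 2 3 4"
begin

text \<open>For fixed \<open>p\<close>, \<open>q\<close>, \<open>r\<close> the elements
  \<open>y\<close> satisfying this are closed under the operations of \<open>L\<close>, so it
  suffices to check it on elements from which all lifted three-cycles can be built.\<close>

definition agree :: "nat \<Rightarrow> nat \<Rightarrow> nat \<Rightarrow> 'a \<Rightarrow> bool" where
  "agree p q r y \<longleftrightarrow> Ad (al p q r) y = act (cyc p q r) y"

lemma agree_rot: "triple n p q r \<Longrightarrow> agree p q r y = agree q r p y"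
  using al_rot[of p q r] cyc_rot[of p q r] by (simp add: agree_def)

lemma agree_mult:
  "triple n p q r \<Longrightarrow> x \<in> X \<Longrightarrow> y \<in> X \<Longrightarrow> agree p q r x \<Longrightarrow> agree p q r y \<Longrightarrow> agree p q r (x \<star> y)"
  by (simp add: agree_def Ad_mult act_hom)

lemma agree_inv: "triple n p q r \<Longrightarrow> x \<in> X \<Longrightarrow> agree p q r x \<Longrightarrow> agree p q r (inv\<^bsub>L\<^esub> x)"
  by (simp add: agree_def Ad_inv act_inv_L)

lemma agree_self: "triple n p q r \<Longrightarrow> agree p q r (al p q r)"
  using al_rot[of p q r] act_al[of "cyc p q r" p q r]
  by (simp add: agree_def Ad_fix_iff \<theta>_cyc cyc3_apply triple_def)

lemma triple_outside:
  "triple n p q r \<Longrightarrow> s \<in> {1..n} \<Longrightarrow> s \<notin> {p, q, r} \<Longrightarrow> triple n p q s"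
  by (auto simp: triple_def)

lemma agree_outside:
  assumes t: "triple n p q r" and s: "s \<in> {1..n}" "s \<notin> {p, q, r}"
  shows "agree p q r (al p q s)"
proof -
  obtain g where g: "g \<in> carrier G" "\<theta> g 1 = p" "\<theta> g 2 = q" "\<theta> g 3 = r" "\<theta> g 4 = s"
    by (rule move4[OF t s])
  have tt: "triple n 1 2 3" "triple n 1 2 4" "triple n 2 3 4" by (rule triple4; simp)+
  have "act g (Ad (al 1 2 3) (al 1 2 4)) = act g (al 2 3 4)" using orient by simp
  then have "Ad (al p q r) (al p q s) = al q r s"
    using tt g act_al[OF g(1) tt(1)] act_al[OF g(1) tt(2)] act_al[OF g(1) tt(3)] by (simp add: act_Ad)
  moreover have "act (cyc p q r) (al p q s) = al q r s"
    using act_al[of "cyc p q r" p q s] triple_outside[OF t s] t s by (simp add: \<theta>_cyc cyc3_apply triple_def)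
  ultimately show ?thesis by (simp add: agree_def)
qed

lemma agree_reverse:
  assumes "triple n p q r" "triple n x y k" "agree p q r (al x y k)" shows "agree p q r (al k y x)"
  using agree_inv[OF assms(1) al_X[OF assms(2)] assms(3)] inv_al[OF assms(2)] by simp

lemma agree_consecutive:
  assumes t: "triple n p q r" and s: "triple n p q s"
  shows "agree p q r (al p q s)" "agree p q r (al q p s)"
proof -
  show 1: "agree p q r (al p q s)"
    using agree_self[OF t] agree_outside[OF t, of s] s by (cases "s = r") (auto simp: triple_def)
  have "al q p s = al s q p" using al_rot[of s q p] s by (auto simp: triple_def)
  then show "agree p q r (al q p s)" using agree_reverse[OF t s 1] by simp
qed

lemma agree_meet:
  assumes t: "triple n p q r" and s: "triple n x y k" and xy: "x \<in> {p, q, r}" "y \<in> {p, q, r}"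
  shows "agree p q r (al x y k)"
proof -
  have t': "triple n q r p" "triple n r p q" using t by (auto simp: triple_def)
  have xy': "x \<noteq> y" using s by (simp add: triple_def)
  consider "x = p \<and> y = q \<or> x = q \<and> y = p" | "x = q \<and> y = r \<or> x = r \<and> y = q"
    | "x = r \<and> y = p \<or> x = p \<and> y = r"
    using xy xy' by blast
  then show ?thesis
  proof cases
    case 1
    then have "triple n p q k" using s t by (auto simp: triple_def)
    from agree_consecutive[OF t this] show ?thesis using 1 by (elim disjE conjE) simp_all
  next
    case 2
    then have "triple n q r k" using s t by (auto simp: triple_def)
    note agree_consecutive[OF t'(1) this, THEN agree_rot[OF t, THEN iffD2]]
    then show ?thesis using 2 by (elim disjE conjE) simp_all
  next
    case 3
    then have "triple n r p k" using s t by (auto simp: triple_def)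
    note agree_consecutive[OF t'(2) this, THEN agree_rot[OF t'(2), THEN iffD1]]
    then show ?thesis using 3 by (elim disjE conjE) simp_all
  qed
qed

lemma Ad_al_eq:
  assumes t: "triple n p q r" and s: "triple n x y k" and a: "agree p q r (al x y k)"
  shows "Ad (al p q r) (al x y k) = al (cyc3 p q r x) (cyc3 p q r y) (cyc3 p q r k)"
  using a act_al[of "cyc p q r" x y k] t s by (simp add: agree_def \<theta>_cyc)

lemma agree_two:
  assumes t: "triple n p q r" and s: "triple n x y k"
    and m: "x \<in> {p, q, r} \<and> y \<in> {p, q, r} \<or> y \<in> {p, q, r} \<and> k \<in> {p, q, r} \<or> k \<in> {p, q, r} \<and> x \<in> {p, q, r}"
  shows "agree p q r (al x y k)"
proof -
  have s': "triple n y k x" "triple n k x y" using s by (auto simp: triple_def)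
  have "al x y k = al y k x" "al x y k = al k x y" using al_rot[OF s] al_rot[OF s'(2)] by simp_all
  then show ?thesis
    using m agree_meet[OF t s] agree_meet[OF t s'(1)] agree_meet[OF t s'(2)] by metis
qed

lemma Ad_al:
  assumes "triple n p q r" "triple n x y k"
    and "x \<in> {p, q, r} \<and> y \<in> {p, q, r} \<or> y \<in> {p, q, r} \<and> k \<in> {p, q, r} \<or> k \<in> {p, q, r} \<and> x \<in> {p, q, r}"
  shows "Ad (al p q r) (al x y k) = al (cyc3 p q r x) (cyc3 p q r y) (cyc3 p q r k)"
  by (rule Ad_al_eq[OF assms(1,2) agree_two[OF assms]])

text \<open>The counterpart of the sign \<open>z\<close>: since \<open>al 4 2 1\<close> inverts
  \<open>al 1 2 4\<close> in \<open>L\<close>, this element measures how far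
  \<open>al 1 2 3 \<star> al 3 2 4\<close> is from \<open>al 1 2 4\<close>. The analogous product of
  the \<open>cyc\<close> in \<open>G\<close> is \<open>z\<close>.\<close>

definition w :: 'a where
  "w = al 1 2 3 \<star> al 3 2 4 \<star> al 4 2 1"

lemma t4:
  "triple n 1 2 3" "triple n 3 2 4" "triple n 4 2 1" "triple n 1 2 4" "triple n 2 1 4" "triple n 2 1 3"
  "triple n 2 4 3" "triple n 4 1 3" "triple n 3 4 1" "triple n 3 1 2" "triple n 4 1 2" "triple n 2 4 1"
  "triple n 4 3 1" "triple n 3 1 4" "triple n 3 2 1" "triple n 2 3 4" "triple n 1 3 4" "triple n 3 4 2"
  "triple n 2 3 1" "triple n 1 4 3" "triple n 4 3 2" "triple n 1 4 2"
  by (rule triple4; simp)+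

lemmas X4 = t4[THEN al_X]

lemma w_X [simp]: "w \<in> X"
  using X4 by (simp add: w_def)

lemma Ad_w: "y \<in> X \<Longrightarrow> Ad w y = Ad (al 1 2 3) (Ad (al 3 2 4) (Ad (al 4 2 1) y))"
  using X4 by (simp add: w_def Ad_Ad)

lemma Ad_w_al: "Ad w (al 1 2 3) = al 1 2 3" "Ad w (al 1 2 4) = al 1 2 4"
proof -
  have "Ad (al 4 2 1) (al 1 2 3) = al 4 1 3"
    using Ad_al[OF t4(3) t4(1)] by (simp add: cyc3_apply)
  moreover have "Ad (al 3 2 4) (al 4 1 3) = al 3 1 2"
    using Ad_al[OF t4(2) t4(8)] by (simp add: cyc3_apply)
  moreover have "Ad (al 1 2 3) (al 3 1 2) = al 1 2 3"
    using Ad_al[OF t4(1) t4(10)] by (simp add: cyc3_apply)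
  ultimately show "Ad w (al 1 2 3) = al 1 2 3" using Ad_w[OF X4(1)] by simp
  have "Ad (al 4 2 1) (al 1 2 4) = al 4 1 2"
    using Ad_al[OF t4(3) t4(4)] by (simp add: cyc3_apply)
  moreover have "Ad (al 3 2 4) (al 4 1 2) = al 3 1 4"
    using Ad_al[OF t4(2) t4(11)] by (simp add: cyc3_apply)
  moreover have "Ad (al 1 2 3) (al 3 1 4) = al 1 2 4"
    using Ad_al[OF t4(1) t4(14)] by (simp add: cyc3_apply)
  ultimately show "Ad w (al 1 2 4) = al 1 2 4" using Ad_w[OF X4(4)] by simp
qed

lemma agree_w: "agree 1 2 3 w" "agree 1 2 4 w"
proof -
  have "agree 1 2 3 (al 1 2 3)" "agree 1 2 3 (al 3 2 4)" "agree 1 2 3 (al 4 2 1)"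
    by (rule agree_two[OF t4(1) t4(1)], simp, rule agree_two[OF t4(1) t4(2)], simp, rule agree_two[OF t4(1) t4(3)], simp)
  then show "agree 1 2 3 w" unfolding w_def using X4 t4 by (intro agree_mult) auto
  have "agree 1 2 4 (al 1 2 3)" "agree 1 2 4 (al 3 2 4)" "agree 1 2 4 (al 4 2 1)"
    by (rule agree_two[OF t4(4) t4(1)], simp, rule agree_two[OF t4(4) t4(2)], simp, rule agree_two[OF t4(4) t4(3)], simp)
  then show "agree 1 2 4 w" unfolding w_def using X4 t4 by (intro agree_mult) auto
qed

text \<open>In \<open>L\<close> the element commutes with \<open>al 1 2 3\<close> and
  \<open>al 1 2 4\<close>. As conjugation by these agrees on \<open>w\<close> with conjugation in
  \<open>G\<close>, its permutation centralizes both three-cycles and is trivial.\<close>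

lemma w_center: "w \<in> {\<one>, z}"
proof -
  have c: "w \<star> al 1 2 3 = al 1 2 3 \<star> w" "w \<star> al 1 2 4 = al 1 2 4 \<star> w"
    using Ad_w_al X4 by (simp_all add: Ad_fix_iff)
  then have "Ad (al 1 2 3) w = w" "Ad (al 1 2 4) w = w" using X4 by (simp_all add: Ad_fix_iff)
  then have a: "act (cyc 1 2 3) w = w" "act (cyc 1 2 4) w = w"
    using agree_w by (simp_all add: agree_def)
  have tl: "tail w"
    unfolding w_def using X4 by (intro tail_mult tail_al triple4') auto
  have cm: "\<theta> w \<circ> cyc3 1 2 3 = cyc3 1 2 3 \<circ> \<theta> w" "\<theta> w \<circ> cyc3 1 2 4 = cyc3 1 2 4 \<circ> \<theta> w"
    using \<theta>_act[of "cyc 1 2 3" w] \<theta>_act[of "cyc 1 2 4" w] a t4(1,4) by (simp_all add: \<theta>_cyc)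
  have "\<theta> w \<in> {id, cyc3 1 2 3, cyc3 3 2 1}"
    using tail_\<theta>[OF _ tl] X_even[OF w_X] cm(1)
    by (intro commuting_with_cyc3[OF \<theta>_permutes n4 triple123(1)]) auto
  moreover have "\<theta> w \<noteq> cyc3 1 2 3" "\<theta> w \<noteq> cyc3 3 2 1"
    using fun_cong[OF cm(2), of 1] by (auto simp: cyc3_apply)
  ultimately have "\<theta> w = id" by blast
  then show ?thesis using kernel_\<theta>[OF n3 X_G[OF w_X]] by blast
qed

lemma act_w [simp]: "g \<in> carrier G \<Longrightarrow> act g w = w"
  by (rule act_center[OF w_center])

lemma w_sq: "w \<star> w = e"
  by (rule center_sq[OF w_center])

lemma w_al: "triple n a b c \<Longrightarrow> w \<star> al a b c = al a b c \<star> w"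
proof -
  assume t: "triple n a b c"
  obtain g where g: "g \<in> carrier G" "\<theta> g 1 = a" "\<theta> g 2 = b" "\<theta> g 3 = c" by (rule move3[OF t])
  have "w \<star> al 1 2 3 = al 1 2 3 \<star> w" using Ad_w_al(1) X4 by (simp add: Ad_fix_iff)
  then have "act g (w \<star> al 1 2 3) = act g (al 1 2 3 \<star> w)" by simp
  then show ?thesis using g X4 act_al[OF g(1) t4(1)] by (simp add: act_hom)
qed

lemma al_prod:
  assumes "triple n q m p" "triple n p m x" "q \<noteq> x"
  shows "al q m p \<star> al p m x = w \<star> al q m x"
proof -
  have t: "triple n q m p" "x \<in> {1..n}" "x \<notin> {q, m, p}" using assms by (auto simp: triple_def)
  obtain g where g: "g \<in> carrier G" "\<theta> g 1 = q" "\<theta> g 2 = m" "\<theta> g 3 = p" "\<theta> g 4 = x"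
    by (rule move4[OF t])
  have "w \<star> al 1 2 4 = al 1 2 3 \<star> al 3 2 4 \<star> (al 4 2 1 \<star> al 1 2 4)"
    using X4 by (simp add: w_def L.m_assoc)
  then have "al 1 2 3 \<star> al 3 2 4 = w \<star> al 1 2 4"
    using al_inv[OF t4(3)] X4 by simp
  then have "act g (al 1 2 3 \<star> al 3 2 4) = act g (w \<star> al 1 2 4)" by simp
  then show ?thesis
    using g X4 act_al[OF g(1) t4(1)] act_al[OF g(1) t4(2)] act_al[OF g(1) t4(4)] by (simp add: act_hom)
qed

lemma agree_all_w: "triple n p q r \<Longrightarrow> agree p q r w"
  using w_al[of p q r] by (simp add: agree_def Ad_fix_iff)

lemma agree_prod:
  assumes t: "triple n p q r" and "triple n a m b" "triple n b m x" "a \<noteq> x"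
    and "agree p q r (al a m b)" "agree p q r (al b m x)"
  shows "agree p q r (al a m x)"
proof -
  have tx: "triple n a m x" using assms by (auto simp: triple_def)
  have "al a m x = w \<star> w \<star> al a m x" using w_sq tx by simp
  also have "\<dots> = w \<star> (w \<star> al a m x)" using tx by (simp only: L.m_assoc w_X al_X)
  also have "\<dots> = w \<star> (al a m b \<star> al b m x)" using al_prod[OF assms(2-4)] by simp
  finally show ?thesis
    using assms agree_all_w[OF t] by (simp add: agree_mult)
qed

text \<open>Any three-cycle is a product of three-cycles meeting \<open>{p, q, r}\<close> in two points.\<close>

lemma agree_all:
  assumes t: "triple n p q r" and s: "triple n x y k"
  shows "agree p q r (al x y k)"
proof -
  have mid: "agree p q r (al a q b)" if ab: "triple n a q b" for a b
  proof (cases "a = p \<or> b = p")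
    case True
    then show ?thesis using agree_two[OF t ab] by auto
  next
    case False
    have 1: "triple n a q p" "triple n p q b" using ab False t by (auto simp: triple_def)
    show ?thesis
      by (rule agree_prod[OF t 1]) (use ab agree_two[OF t 1(1)] agree_two[OF t 1(2)] in \<open>auto simp: triple_def\<close>)
  qed
  consider "x = q" | "y = q" | "k = q" | "q \<notin> {x, y, k}" by blast
  then show ?thesis
  proof cases
    case 1
    have "triple n k q y" "triple n k x y" using s 1 by (auto simp: triple_def)
    then have "agree p q r (al k x y)" using mid 1 by simp
    then show ?thesis by (simp only: al_rot[OF \<open>triple n k x y\<close>])
  next
    case 2
    then show ?thesis using mid s by simp
  next
    case 3
    have "triple n y q x" using s 3 by (auto simp: triple_def)
    then have "agree p q r (al y k x)" using mid 3 by simp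
    then show ?thesis by (simp only: al_rot[OF s])
  next
    case 4
    have 1: "triple n x y q" "triple n q y k" "triple n y q x" "triple n k q y"
    proof -
      have q: "q \<in> {1..n}" "q \<noteq> x" "q \<noteq> y" "q \<noteq> k" using t 4 unfolding triple_def by blast+
      show "triple n x y q" "triple n q y k" "triple n y q x" "triple n k q y"
        using s q unfolding triple_def by blast+
    qed
    have "agree p q r (al x y q)" "agree p q r (al q y k)"
      using mid[OF 1(3)] mid[OF 1(4)] al_rot[OF 1(1)] al_rot[OF 1(4)] by simp_all
    then show ?thesis using s unfolding triple_def by (intro agree_prod[OF t 1(1,2)]) blast+
  qed
qed

text \<open>If \<open>w\<close> were trivial, \<open>v\<close> would be fixed by conjugation with
  \<open>\<tau> 1 3\<close> and with \<open>\<tau> 2 4\<close>, so its permutation would be the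
  identity or (1 3)(2 4). The first is impossible because \<open>v\<close> moves
  \<open>al 1 2 3\<close>; the second because lifts of disjoint transpositions commute only up to
  \<open>z\<close>.\<close>

lemma w_nontrivial:
  assumes z: "z \<noteq> \<one>" shows "w \<noteq> e"
proof
  assume w1: "w = e"
  have n6: "n \<noteq> 6" using n6 z by blast
  have ev: "evenperm (\<theta> x)" if "x \<in> X" for x
    using that z all_of_S4 unfolding X_iff by blast
  have p: "pair n 1 3" "pair n 2 4" using n4 by (auto simp: pair_def)
  define v where "v = al 1 2 3 \<star> al 1 2 4"
  have vX: "v \<in> X" using X4 by (simp add: v_def)
  have a13: "act (\<tau> 1 3) v = v"
  proof -
    have "al 3 2 4 = (al 3 2 4 \<star> al 4 2 1) \<star> al 1 2 4"
      using al_inv[OF t4(3)] X4 by (simp add: L.m_assoc)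
    also have "\<dots> = al 3 2 1 \<star> al 1 2 4" using al_prod[OF t4(2) t4(3)] w1 X4 by simp
    finally have "al 3 2 1 \<star> al 3 2 4 = (al 3 2 1 \<star> al 3 2 1) \<star> al 1 2 4" using X4 by (simp add: L.m_assoc)
    then have "al 3 2 1 \<star> al 3 2 4 = v" using al_sq[OF t4(15)] by (simp add: v_def)
    then show ?thesis
      using p X4 act_al[of "\<tau> 1 3" 1 2 3] act_al[of "\<tau> 1 3" 1 2 4] t4(1,4)
      by (simp add: v_def act_hom \<theta>_\<tau> Transposition.transpose_def)
  qed
  have Adv: "Ad v (al 1 2 3) = al 3 4 1" "Ad v (al 1 2 4) = al 3 4 2"
  proof -
    have "Ad (al 1 2 4) (al 1 2 3) = al 2 4 3"
      using Ad_al[OF t4(4) t4(1)] by (simp add: cyc3_apply)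
    moreover have "Ad (al 1 2 3) (al 2 4 3) = al 3 4 1"
      using Ad_al[OF t4(1) t4(7)] by (simp add: cyc3_apply)
    ultimately show "Ad v (al 1 2 3) = al 3 4 1" using X4 by (simp add: v_def Ad_Ad)
    have "Ad (al 1 2 4) (al 1 2 4) = al 1 2 4" using X4 by (simp add: Ad_fix_iff)
    moreover have "Ad (al 1 2 3) (al 1 2 4) = al 3 4 2" using orient al_rot[OF t4(16)] by simp
    ultimately show "Ad v (al 1 2 4) = al 3 4 2" using X4 by (simp add: v_def Ad_Ad)
  qed
  \<comment> \<open>The conjugate of \<open>v\<close> by both transpositions is computed to be the
    conjugate of \<open>v\<close> by itself in \<open>L\<close>, hence \<open>v\<close>; combined
    with \<open>a13\<close> this isolates \<open>\<tau> 2 4\<close>.\<close>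
  have "act (\<tau> 1 3) (act (\<tau> 2 4) v) = al 3 4 1 \<star> al 3 4 2"
    using p X4 act_al[of "\<tau> 1 3 \<otimes> \<tau> 2 4" 1 2 3] act_al[of "\<tau> 1 3 \<otimes> \<tau> 2 4" 1 2 4] t4(1,4)
    by (simp add: v_def act_hom \<theta>_mult \<theta>_\<tau> Transposition.transpose_def flip: act_act)
  also have "\<dots> = Ad v v" using Adv X4 vX by (simp add: v_def Ad_mult)
  also have "\<dots> = v" using vX by (simp add: Ad_fix_iff)
  finally have "act (\<tau> 1 3) (act (\<tau> 2 4) v) = act (\<tau> 1 3) v" using a13 by simp
  then have "act (inv (\<tau> 1 3)) (act (\<tau> 1 3) (act (\<tau> 2 4) v)) = act (inv (\<tau> 1 3)) (act (\<tau> 1 3) v)" by simp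
  then have a24: "act (\<tau> 2 4) v = v" using p vX by (simp add: act_inv)
  define \<pi> where "\<pi> = \<theta> v"
  have \<pi>: "\<pi> permutes {1..n}" "evenperm \<pi>" using \<theta>_permutes ev vX by (auto simp: \<pi>_def)
  have inj: "inj \<pi>" by (rule permutes_inj[OF \<pi>(1)])
  have cm: "\<pi> \<circ> transp 1 3 = transp 1 3 \<circ> \<pi>" "\<pi> \<circ> transp 2 4 = transp 2 4 \<circ> \<pi>"
    using \<theta>_act[of "\<tau> 1 3" v] \<theta>_act[of "\<tau> 2 4" v] a13 a24 p vX by (simp_all add: \<pi>_def \<theta>_\<tau>)
  have m: "\<pi> 1 \<in> {1, 3}" "\<pi> 3 \<in> {1, 3}" "\<pi> 2 \<in> {2, 4}" "\<pi> 4 \<in> {2, 4}"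
    using commute_transp_mem[OF inj cm(1)] commute_transp_mem[OF inj cm(2)]
      commute_transp_mem[OF inj, of 3 1] commute_transp_mem[OF inj, of 4 2] cm
    by (auto simp: transpose_commute)
  have tlv: "tail_commuting n \<pi>"
    unfolding \<pi>_def v_def using X4 by (intro tail_\<theta> tail_mult tail_al triple4') auto
  \<comment> \<open>For \<open>n = 5\<close> the remaining point is fixed because the other four are
    permuted among themselves. For \<open>n = 6\<close> the points 5 and 6 could be exchanged, and
    evenness would then allow further permutations such as (1 3)(5 6).\<close>
  have out: "\<pi> i = i" if "i \<notin> {1, 2, 3, 4}" for i
  proof (cases "i \<in> {1..n}")
    case True
    then have i5: "i \<in> {5..n}" using that by auto
    show ?thesis
    proof (cases "7 \<le> n")
      case True
      then show ?thesis using tail_commuting_fix[OF \<pi>(1) tlv _ i5] by simp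
    next
      case False
      then have "i = 5" "n = 5" using i5 n6 by auto
      have "\<pi> 5 \<in> {1..5}" using permutes_in_image[OF \<pi>(1)] \<open>n = 5\<close> by simp
      have "{\<pi> 1, \<pi> 3} = {1, 3}" "{\<pi> 2, \<pi> 4} = {2, 4}"
        using m inj_eq[OF inj, of 1 3] inj_eq[OF inj, of 2 4] by auto
      then have "{\<pi> 1, \<pi> 3} \<union> {\<pi> 2, \<pi> 4} = {1, 3} \<union> {2, 4}" by simp
      then have "{1, 2, 3, 4} = {\<pi> 1, \<pi> 2, \<pi> 3, \<pi> 4}" by (simp add: insert_commute)
      moreover have "\<pi> 5 \<noteq> \<pi> 1" "\<pi> 5 \<noteq> \<pi> 2" "\<pi> 5 \<noteq> \<pi> 3" "\<pi> 5 \<noteq> \<pi> 4"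
        by (simp_all add: inj_eq[OF inj])
      ultimately have "\<pi> 5 \<notin> {1, 2, 3, 4}" by simp
      then show ?thesis using five_points[of "\<pi> 5"] \<open>\<pi> 5 \<in> {1..5}\<close> \<open>i = 5\<close> by blast
    qed
  next
    case False
    then show ?thesis using \<pi>(1) by (simp add: permutes_def)
  qed
  have odd: "\<not> evenperm (transp 1 3)" "\<not> evenperm (transp 2 4)" by (simp_all add: evenperm_swap)
  have ne: "\<pi> 1 \<noteq> \<pi> 3" "\<pi> 2 \<noteq> \<pi> 4" using inj_eq[OF inj] by auto
  have cases: "\<pi> = id \<or> \<pi> = transp 1 3 \<circ> transp 2 4"
  proof -
    have "\<pi> \<noteq> transp 1 3" "\<pi> \<noteq> transp 2 4" using odd \<pi>(2) by auto
    then obtain i j where i: "\<pi> i \<noteq> transp 1 3 i" and j: "\<pi> j \<noteq> transp 2 4 j" by (auto simp: fun_eq_iff)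
    have "i \<in> {1, 2, 3, 4}" "j \<in> {1, 2, 3, 4}"
      using i j out by (auto simp: Transposition.transpose_def split: if_splits)
    then have "(\<pi> 1 = 1 \<and> \<pi> 2 = 2) \<or> (\<pi> 1 = 3 \<and> \<pi> 2 = 4)"
      using i j m ne by (auto simp: Transposition.transpose_def split: if_splits)
    then show ?thesis
    proof
      assume "\<pi> 1 = 1 \<and> \<pi> 2 = 2"
      then have "\<pi> x = id x" for x
        using m ne out[of x] by (cases "x \<in> {1, 2, 3, 4}") auto
      then show ?thesis by (auto simp: fun_eq_iff)
    next
      assume "\<pi> 1 = 3 \<and> \<pi> 2 = 4"
      then have "\<pi> x = (transp 1 3 \<circ> transp 2 4) x" for x
        using m ne out[of x] by (cases "x \<in> {1, 2, 3, 4}") (auto simp: Transposition.transpose_def)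
      then show ?thesis by (auto simp: fun_eq_iff)
    qed
  qed
  then show False
  proof
    assume "\<pi> = id"
    then have "v \<in> {\<one>, z}" using kernel_\<theta>[OF n3 X_G[OF vX]] by (simp only: \<pi>_def)
    then have "act (cyc 1 2 3) v = v" using act_center t4(1) by simp
    moreover have "agree 1 2 3 v" unfolding v_def using agree_all t4 X4 by (intro agree_mult) auto
    ultimately have "Ad (al 1 2 3) v = v" by (simp add: agree_def)
    then have "Ad v (al 1 2 3) = al 1 2 3" using vX X4 by (simp add: Ad_fix_iff)
    then show False using Adv(1) al_neq[OF t4(9) t4(1), of 1] by (simp add: cyc3_apply)
  next
    assume "\<pi> = transp 1 3 \<circ> transp 2 4"
    then have "\<theta> v = \<theta> (\<tau> 1 3 \<otimes> \<tau> 2 4)" using p by (simp add: \<pi>_def \<theta>_mult \<theta>_\<tau>)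
    then have "v = \<tau> 1 3 \<otimes> \<tau> 2 4 \<or> v = z \<otimes> (\<tau> 1 3 \<otimes> \<tau> 2 4)"
      using \<theta>_eq[OF n3 X_G[OF vX]] p by simp
    then have "act (\<tau> 1 3) (\<tau> 1 3 \<otimes> \<tau> 2 4) = \<tau> 1 3 \<otimes> \<tau> 2 4"
      using a13 p by (auto simp: act_mult)
    moreover have "act (\<tau> 1 3) (\<tau> 1 3) = \<tau> 1 3" "act (\<tau> 1 3) (\<tau> 2 4) = z \<otimes> \<tau> 2 4"
      using \<tau>_conj_disjoint[OF p] p by (simp_all add: act_fix_iff) (simp add: act_def inv_\<tau>)
    ultimately have "z \<otimes> (\<tau> 1 3 \<otimes> \<tau> 2 4) = \<one> \<otimes> (\<tau> 1 3 \<otimes> \<tau> 2 4)"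
      using p by (simp add: act_mult z_normalize)
    then have "z = \<one>" using right_cancel[of "\<tau> 1 3 \<otimes> \<tau> 2 4" z \<one>] p by simp
    then show False using z by simp
  qed
qed

end

context twisted_lift
begin

text \<open>Pairs whose members move the lifted three-cycles in the same way, \<open>l\<close> by
  conjugation in \<open>L\<close> and \<open>k\<close> through its permutation. Unlike the group
  generated by pairs of three-cycles, this relation can also contain odd elements, as S_4
  requires.\<close>

definition follows :: "'a \<Rightarrow> 'a \<Rightarrow> bool" where
  "follows k l \<longleftrightarrow> k \<in> carrier G \<and> l \<in> X \<and>
    (\<forall>a b c. triple n a b c \<longrightarrow> Ad l (al a b c) = al (\<theta> k a) (\<theta> k b) (\<theta> k c))"

lemma followsD:
  assumes "follows k l"
  shows "k \<in> carrier G" "l \<in> X" "triple n a b c \<Longrightarrow> Ad l (al a b c) = al (\<theta> k a) (\<theta> k b) (\<theta> k c)"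
  using assms unfolding follows_def by blast+

lemma triple_\<theta>: "k \<in> carrier G \<Longrightarrow> triple n a b c \<Longrightarrow> triple n (\<theta> k a) (\<theta> k b) (\<theta> k c)"
  by (rule triple_permutes[OF \<theta>_permutes])

lemma follows_mult:
  assumes "follows k l" "follows k' l'" shows "follows (k \<otimes> k') (l \<star> l')"
proof -
  note c = followsD(1,2)[OF assms(1)] followsD(1,2)[OF assms(2)]
  have "Ad (l \<star> l') (al p q r) = al (\<theta> (k \<otimes> k') p) (\<theta> (k \<otimes> k') q) (\<theta> (k \<otimes> k') r)"
    if t: "triple n p q r" for p q r
    using c t followsD(3)[OF assms(1) triple_\<theta>[OF c(3) t]] followsD(3)[OF assms(2) t]
    by (simp add: Ad_Ad \<theta>_mult)
  then show ?thesis using c by (simp add: follows_def)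
qed

text \<open>Supports recover the image of {i, b} as the intersection of the images of {i, b, c} and
  {i, b, d}; the direction of the three-cycle then distinguishes \<open>i\<close> from
  \<open>b\<close>.\<close>

lemma follows_\<theta>_eq:
  assumes "follows k l" "follows k' l" shows "\<theta> k = \<theta> k'"
proof -
  have p: "\<theta> k permutes {1..n}" "\<theta> k' permutes {1..n}"
    using followsD(1)[OF assms(1)] followsD(1)[OF assms(2)] \<theta>_permutes by blast+
  have "\<theta> k i = \<theta> k' i" for i
  proof (cases "i \<in> {1..n}")
    case False
    then show ?thesis using p by (simp add: permutes_def)
  next
    case True
    obtain b c d where bcd: "triple n i b c" "triple n i b d" "c \<noteq> d"
    proof -
      have "4 \<le> card {1..n}" using n4 by simp
      then have "3 \<le> card ({1..n} - {i})" using True by simp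
      then obtain B where "B \<subseteq> {1..n} - {i}" "card B = 3" by (meson obtain_subset_with_card_n)
      then obtain x y w where "B = {x, y, w}" "x \<noteq> y" "y \<noteq> w" "x \<noteq> w" by (auto simp: card_3_iff)
      then show ?thesis using that[of x y w] \<open>B \<subseteq> _\<close> True by (auto simp: triple_def)
    qed
    have eq: "cyc3 (\<theta> k i) (\<theta> k b) (\<theta> k x) = cyc3 (\<theta> k' i) (\<theta> k' b) (\<theta> k' x)" if t: "triple n i b x" for x
      using followsD(3)[OF assms(1) t] followsD(3)[OF assms(2) t]
        al_inj triple_\<theta>[OF followsD(1)[OF assms(1)] t] triple_\<theta>[OF followsD(1)[OF assms(2)] t] by metis
    have supp: "{v. cyc3 (\<theta> h i) (\<theta> h b) (\<theta> h x) v \<noteq> v} = {\<theta> h i, \<theta> h b, \<theta> h x}" 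
      if "h \<in> carrier G" "triple n i b x" for h x
      using triple_\<theta>[OF that] by (auto simp: cyc3_apply triple_def)
    have inj: "inj (\<theta> k)" "inj (\<theta> k')" using p permutes_inj by blast+
    have nb: "c \<noteq> i" "c \<noteq> b" "d \<noteq> i" "d \<noteq> b" "i \<noteq> b" using bcd by (auto simp: triple_def)
    have s: "{\<theta> k i, \<theta> k b, \<theta> k x} = {\<theta> k' i, \<theta> k' b, \<theta> k' x}" if "triple n i b x" for x
      using supp[OF followsD(1)[OF assms(1)] that] supp[OF followsD(1)[OF assms(2)] that] eq[OF that] by simp
    have I: "{u, v, x} \<inter> {u, v, y} = {u, v}" if "x \<noteq> y" for u v x y :: nat using that by auto
    have "{\<theta> k i, \<theta> k b} = {\<theta> k' i, \<theta> k' b}"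
      using I[of "\<theta> k c" "\<theta> k d" "\<theta> k i" "\<theta> k b"] I[of "\<theta> k' c" "\<theta> k' d" "\<theta> k' i" "\<theta> k' b"]
        s[OF bcd(1)] s[OF bcd(2)] bcd(3) by (simp add: inj_eq[OF inj(1)] inj_eq[OF inj(2)])
    moreover have "\<theta> k i \<noteq> \<theta> k' b"
    proof
      assume a: "\<theta> k i = \<theta> k' b"
      then have b: "\<theta> k b = \<theta> k' i" using calculation nb(5) by (auto simp: doubleton_eq_iff inj_eq[OF inj(1)])
      have t: "triple n (\<theta> k i) (\<theta> k b) (\<theta> k c)" "triple n (\<theta> k' i) (\<theta> k' b) (\<theta> k' c)"
        using triple_\<theta> followsD(1) assms bcd(1) by blast+
      have "cyc3 (\<theta> k i) (\<theta> k b) (\<theta> k c) (\<theta> k i) = \<theta> k b" using t(1) by (simp add: cyc3_apply triple_def)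
      moreover have "cyc3 (\<theta> k' i) (\<theta> k' b) (\<theta> k' c) (\<theta> k i) = \<theta> k' c"
        using t(2) by (simp add: a cyc3_apply triple_def)
      ultimately show False using eq[OF bcd(1)] b t(2) by (simp add: triple_def)
    qed
    ultimately show ?thesis by (auto simp: doubleton_eq_iff)
  qed
  then show ?thesis by (simp add: fun_eq_iff)
qed

lemma follows_act:
  assumes "follows k l" and h: "h \<in> carrier G" shows "follows (act h k) (act h l)"
proof -
  note c = followsD(1,2)[OF assms(1)]
  have "Ad (act h l) (al p q r) = al (\<theta> (act h k) p) (\<theta> (act h k) q) (\<theta> (act h k) r)"
    if t: "triple n p q r" for p q r
  proof -
    have ih: "inv h \<in> carrier G" using h by simp
    have t': "triple n (\<theta> (inv h) p) (\<theta> (inv h) q) (\<theta> (inv h) r)" using triple_\<theta>[OF ih t] .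
    have tk: "triple n (\<theta> k (\<theta> (inv h) p)) (\<theta> k (\<theta> (inv h) q)) (\<theta> k (\<theta> (inv h) r))"
      using triple_\<theta>[OF c(1) t'] .
    have "Ad (act h l) (al p q r) = Ad (act h l) (act h (act (inv h) (al p q r)))"
      using h t by (simp add: act_inv)
    also have "\<dots> = act h (Ad l (act (inv h) (al p q r)))"
      using h t c by (simp add: act_Ad)
    also have "\<dots> = act h (Ad l (al (\<theta> (inv h) p) (\<theta> (inv h) q) (\<theta> (inv h) r)))"
      by (simp only: act_al[OF ih t])
    also have "\<dots> = al (\<theta> h (\<theta> k (\<theta> (inv h) p))) (\<theta> h (\<theta> k (\<theta> (inv h) q))) (\<theta> h (\<theta> k (\<theta> (inv h) r)))"
      by (simp only: followsD(3)[OF assms(1) t'] act_al[OF h tk])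
    finally show ?thesis using h c by (simp add: act_def \<theta>_mult)
  qed
  then show ?thesis using c h by (simp add: follows_def)
qed

lemma follows_inv_left:
  assumes "follows k l" "follows k l'" shows "follows \<one> (inv\<^bsub>L\<^esub> l' \<star> l)"
proof -
  note c = followsD(1,2)[OF assms(1)] followsD(2)[OF assms(2)]
  have "Ad (inv\<^bsub>L\<^esub> l' \<star> l) (al p q r) = al p q r" if t: "triple n p q r" for p q r
  proof -
    have "Ad (inv\<^bsub>L\<^esub> l' \<star> l) (al p q r) = Ad (inv\<^bsub>L\<^esub> l') (Ad l' (al p q r))"
      using c t followsD(3)[OF assms(1) t] followsD(3)[OF assms(2) t] by (simp add: Ad_Ad)
    then show ?thesis using c t by (simp flip: Ad_Ad)
  qed
  then show ?thesis using c by (simp add: follows_def)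
qed

end

context twisted_oriented
begin

lemma follows_cyc: "triple n p q r \<Longrightarrow> follows (cyc p q r) (al p q r)"
  using Ad_al_eq[OF _ _ agree_all] by (simp add: follows_def \<theta>_cyc)

lemma follows_z: "follows z w"
  using w_al by (simp add: follows_def \<theta>_z Ad_fix_iff)

text \<open>Applying the kernel bound to pairs shows that over the identity permutation there are
  only the unit and \<open>(z, w)\<close>. This is what makes the generated group a graph.\<close>

sublocale P: three_cycle_family "G \<times>\<times> L" n "\<lambda>a b c. (cyc a b c, al a b c)" "(z, w)" "\<theta> \<circ> fst"
proof (intro three_cycle_family.intro three_cycle_family_axioms.intro)
  show "group (G \<times>\<times> L)" by (rule DirProd_group[OF group_axioms L.group_axioms])
  fix a b c p q r
  assume t: "triple n a b c" "triple n p q r"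
  have "al a b c \<star> al p q r = Ad (al a b c) (al p q r) \<star> al a b c"
    using t by (simp add: Ad_def L.m_assoc)
  then show "(cyc a b c, al a b c) \<otimes>\<^bsub>G \<times>\<times> L\<^esub> (cyc p q r, al p q r) =
      (cyc (cyc3 a b c p) (cyc3 a b c q) (cyc3 a b c r), al (cyc3 a b c p) (cyc3 a b c q) (cyc3 a b c r))
      \<otimes>\<^bsub>G \<times>\<times> L\<^esub> (cyc a b c, al a b c)"
    using C.f_conj[OF t] Ad_al_eq[OF t agree_all[OF t]] by simp
next
  fix a b c assume t: "triple n a b c"
  show "(cyc a b c, al a b c) = (cyc b c a, al b c a)" by (simp only: cyc_rot[OF t] al_rot[OF t])
next
  fix q m p x assume "triple n q m p" "triple n p m x" "q \<noteq> x"
  then show "(cyc q m p, al q m p) \<otimes>\<^bsub>G \<times>\<times> L\<^esub> (cyc p m x, al p m x) =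
    (z, w) \<otimes>\<^bsub>G \<times>\<times> L\<^esub> (cyc q m x, al q m x)" by (simp add: cyc_prod al_prod)
qed (auto simp: w_sq w_al C.w_comm cyc_inv al_inv cyc_sq al_sq \<theta>_mult \<theta>_z \<theta>_cyc)

definition D :: "('a \<times> 'a) set" where
  "D = generate (G \<times>\<times> L) (P.fam n)"

lemma D_subgroup: "subgroup D (G \<times>\<times> L)"
  unfolding D_def by (rule P.generate_is_subgroup[OF P.fam_closed]) simp

lemma D_fam: "triple n a b c \<Longrightarrow> (cyc a b c, al a b c) \<in> D" "(z, w) \<in> D"
  unfolding D_def by (auto intro!: generate.incl simp: P.fam_def)

lemma D_follows:
  assumes "(k, l) \<in> D" shows "follows k l" "evenperm (\<theta> k)"
proof -
  define S where "S = {x. follows (fst x) (snd x) \<and> evenperm (\<theta> (fst x))}"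
  have one: "follows \<one> e" by (simp add: follows_def)
  have "D \<subseteq> S"
    unfolding D_def
  proof (rule P.generate_fam_subset)
    show "n \<le> n" by simp
    show "\<one>\<^bsub>G \<times>\<times> L\<^esub> \<in> S" using one evenperm_id by (simp add: S_def)
    show "S \<subseteq> carrier (G \<times>\<times> L)" using followsD(1,2) by (auto simp: S_def)
    show "x \<otimes>\<^bsub>G \<times>\<times> L\<^esub> s \<in> S" if x: "x \<in> P.fam n" and s: "s \<in> S" for x s
    proof -
      have "x \<in> S" using x follows_cyc follows_z even_cyc evenperm_id by (auto simp: P.fam_def S_def \<theta>_z)
      then show ?thesis
        using s follows_mult followsD(1) even_mult by (cases x, cases s) (auto simp: S_def)
    qed
  qed
  then show "follows k l" "evenperm (\<theta> k)" using assms by (auto simp: S_def)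
qed

lemma D_kernel: "(k, l) \<in> D \<Longrightarrow> \<theta> k = id \<Longrightarrow> (k, l) = (\<one>, e) \<or> (k, l) = (z, w)"
  using P.kernel_trivial[OF n3, of "(k, l)"] by (auto simp: D_def)

lemma D_mult: "(k, l) \<in> D \<Longrightarrow> (k', l') \<in> D \<Longrightarrow> (k \<otimes> k', l \<star> l') \<in> D"
  using subgroup.m_closed[OF D_subgroup, of "(k, l)" "(k', l')"] by simp

lemma D_inv: "(k, l) \<in> D \<Longrightarrow> (inv k, inv\<^bsub>L\<^esub> l) \<in> D"
  using subgroup.m_inv_closed[OF D_subgroup, of "(k, l)"] followsD(1,2)[OF D_follows(1)]
  by (simp add: inv_DirProd[OF group_axioms L.group_axioms])

lemma D_total: "even_part \<subseteq> fst ` D"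
proof -
  have "even_part = generate G (C.fam n)" using n4 by (simp add: even_part_eq)
  also have "\<dots> \<subseteq> fst ` D"
  proof (rule C.generate_fam_subset)
    have "(\<one>, e) \<in> D" using subgroup.one_closed[OF D_subgroup] by simp
    then show "\<one> \<in> fst ` D" by force
    show "fst ` D \<subseteq> carrier G" using D_follows(1)[THEN followsD(1)] by auto
    show "x \<otimes> s \<in> fst ` D" if "x \<in> C.fam n" "s \<in> fst ` D" for x s
    proof -
      have "\<exists>l. (x, l) \<in> D" using that(1) D_fam by (auto simp: C.fam_def)
      then show ?thesis using that(2) D_mult by force
    qed
  qed simp
  finally show ?thesis .
qed

lemma even_iso:
  assumes even: "X = even_part"
  shows "G\<lparr>carrier := X\<rparr> \<cong> L"
proof (rule graph_iso)
  have "subgroup X G"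
    using X_one X_mult X_inv by (intro subgroupI) auto
  then show "group (G\<lparr>carrier := X\<rparr>)" by (rule subgroup_imp_group)
  show "group L" by (rule L.group_axioms)
  show "finite X" by (rule finite_X)
  show "card (carrier (G\<lparr>carrier := X\<rparr>)) = card X" by simp
  show "D \<subseteq> carrier (G\<lparr>carrier := X\<rparr>) \<times> X"
    using D_follows(1)[THEN followsD(2)] even_X[OF D_follows(1)[THEN followsD(1)] D_follows(2)] by auto
  show "\<exists>b. (a, b) \<in> D" if "a \<in> carrier (G\<lparr>carrier := X\<rparr>)" for a
    using that D_total even by force
  show "(a \<otimes>\<^bsub>G\<lparr>carrier := X\<rparr>\<^esub> a', b \<star> b') \<in> D" if "(a, b) \<in> D" "(a', b') \<in> D" for a b a' b'
    using D_mult[OF that] by simp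
  show "a = a'" if "(a, b) \<in> D" "(a', b) \<in> D" for a a' b
  proof -
    note f = D_follows(1)[OF that(1)] D_follows(1)[OF that(2)]
    note c = followsD(1,2)[OF f(1)] followsD(1)[OF f(2)]
    have "(a \<otimes> inv a', e) \<in> D" using D_mult[OF that(1) D_inv[OF that(2)]] c by simp
    moreover have "\<theta> (a \<otimes> inv a') = id"
    proof -
      have "\<theta> (a \<otimes> inv a') = \<theta> a' \<circ> \<theta> (inv a')" using follows_\<theta>_eq[OF f] c by (simp add: \<theta>_mult)
      also have "\<dots> = \<theta> (a' \<otimes> inv a')" using c by (simp only: \<theta>_mult inv_closed)
      also have "\<dots> = id" by (simp only: r_inv[OF c(3)] \<theta>_one)
      finally show ?thesis .
    qed
    ultimately have "a \<otimes> inv a' = \<one> \<or> a \<otimes> inv a' = z \<and> w = e"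
      by (metis D_kernel prod.inject)
    \<comment> \<open>Either \<open>z = \<one>\<close> and the two alternatives coincide, or
      \<open>w \<noteq> e\<close> rules out the second.\<close>
    then have "a \<otimes> inv a' = \<one>" using w_nontrivial by blast
    then have "inv (inv a') = a" using c by (intro inv_equality) simp_all
    then show "a = a'" using c by simp
  qed
qed

end

section \<open>The second law on all of S_4\<close>

lemma (in sym_cover_like) act_\<tau>:
  assumes z: "z = \<one>" and h: "h \<in> carrier G" and "pair n a b"
  shows "act h (\<tau> a b) = \<tau> (\<theta> h a) (\<theta> h b) \<and> pair n (\<theta> h a) (\<theta> h b)"
  using h
proof (induction h rule: carrier_induct)
  case one
  then show ?case using assms(3) by simp
next
  case (z x)
  then show ?case using assms by simp
next
  case (\<tau> p q x)
  have pr: "pair n (transp p q (\<theta> x a)) (transp p q (\<theta> x b))"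
    using \<tau> by (auto simp: pair_def Transposition.transpose_def)
  then have "act (\<tau> p q) (\<tau> (\<theta> x a) (\<theta> x b)) = \<tau> (transp p q (\<theta> x a)) (transp p q (\<theta> x b))"
    using \<tau>_conj[OF \<tau>(1), of "\<theta> x a" "\<theta> x b"] z \<tau> by (simp add: act_def inv_\<tau>)
  then show ?case using pr \<tau> assms(3) by (simp add: act_act \<theta>_mult \<theta>_\<tau>)
qed

context twisted_oriented
begin

lemma follows_inv:
  assumes "follows k l" shows "follows (inv k) (inv\<^bsub>L\<^esub> l)"
proof -
  note c = followsD(1,2)[OF assms]
  have "Ad (inv\<^bsub>L\<^esub> l) (al p q r) = al (\<theta> (inv k) p) (\<theta> (inv k) q) (\<theta> (inv k) r)"
    if t: "triple n p q r" for p q r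
  proof -
    have "\<theta> k \<circ> \<theta> (inv k) = \<theta> (k \<otimes> inv k)" using c by (simp only: \<theta>_mult inv_closed)
    then have "\<theta> k \<circ> \<theta> (inv k) = id" by (simp only: r_inv[OF c(1)] \<theta>_one)
    then have kk: "\<theta> k (\<theta> (inv k) i) = i" for i by (metis comp_apply id_apply)
    have t': "triple n (\<theta> (inv k) p) (\<theta> (inv k) q) (\<theta> (inv k) r)"
      by (rule triple_\<theta>[OF inv_closed[OF c(1)] t])
    have "al p q r = Ad l (al (\<theta> (inv k) p) (\<theta> (inv k) q) (\<theta> (inv k) r))"
      using followsD(3)[OF assms t'] by (simp only: kk)
    then show ?thesis using c t' by (simp flip: Ad_Ad)
  qed
  then show ?thesis using c by (simp add: follows_def)
qed

context
  assumes S4: all_of_S4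
begin

lemma n_4: "n = 4" and z_one: "z = \<one>" and X_all: "x \<in> carrier G \<Longrightarrow> x \<in> X" and e_one: "e = \<one>"
  using all_of_S4[OF S4] S4 e_central by (auto simp only: X_iff)

lemma tail_all: "tail x"
  unfolding tail_def pair_def using n_4 by auto

lemma reach_n: "reach n = n"
  using n_4 unfolding reach_def by simp

lemma pairs4: "pair n 1 2" "pair n 3 4" "pair n 1 3" "pair n 1 4" "pair n 2 3" "pair n 2 4"
  unfolding pair_def using n_4 by auto

lemma al_eight:
  assumes "triple n p q r"
  shows "al p q r \<in> {al 1 2 3, al 3 2 1, al 1 2 4, al 2 3 4, al 3 1 4, al 4 2 1, al 4 3 2, al 4 1 3}"
proof -
  have "triple (reach n) p q r" using assms unfolding reach_n .
  moreover have "n \<noteq> 5" using n_4 by simp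
  ultimately show ?thesis using al_canonical by blast
qed

lemma card_X_le: "card X \<le> 24"
proof -
  have "inj_on \<theta> X" using \<theta>_eq[OF n3] z_one by (auto intro!: inj_onI)
  moreover have "\<theta> ` X \<subseteq> {p. p permutes {1..n}}" using \<theta>_permutes by auto
  ultimately have "card X \<le> card {p. p permutes {1..n}}"
    by (rule card_inj_on_le) (simp add: finite_permutations)
  also have "\<dots> = fact n" by (rule card_permutations) simp_all
  also have "\<dots> = 24" by (simp only: n_4) (simp add: fact_numeral)
  finally show ?thesis .
qed

text \<open>The elements moved alike by \<open>l\<close> and by \<open>g\<close> are closed under
  the operations of \<open>L\<close>, and \<open>al 1 2 3\<close>, \<open>al 1 2 4\<close> yield all
  eight lifted three-cycles by conjugating and inverting in \<open>L\<close>.\<close>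

lemma follows_of_two:
  assumes g: "g \<in> carrier G" and l: "l \<in> X"
    and 1: "Ad l (al 1 2 3) = act g (al 1 2 3)" and 2: "Ad l (al 1 2 4) = act g (al 1 2 4)"
  shows "follows g l"
proof -
  define S where "S = {y \<in> X. Ad l y = act g y}"
  have mult: "x \<star> y \<in> S" if "x \<in> S" "y \<in> S" for x y
    using that g l by (simp add: S_def Ad_mult act_hom)
  have inv: "inv\<^bsub>L\<^esub> x \<in> S" if "x \<in> S" for x
    using that g l by (simp add: S_def Ad_inv act_inv_L)
  have Ad: "Ad x y \<in> S" if "x \<in> S" "y \<in> S" for x y
    unfolding Ad_def using that mult inv by blast
  have a: "al 1 2 3 \<in> S" "al 1 2 4 \<in> S" using 1 2 X4 by (simp_all add: S_def)
  have b: "al 2 3 4 \<in> S" using Ad[OF a] orient by simp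
  have "Ad (al 1 2 3) (al 2 3 4) = al 3 1 4" using Ad_al[OF t4(1) t4(16)] by (simp add: cyc3_apply)
  then have c: "al 3 1 4 \<in> S" using Ad[OF a(1) b] by simp
  have "al 3 2 1 \<in> S" "al 4 2 1 \<in> S" "al 4 3 2 \<in> S" "al 4 1 3 \<in> S"
    using inv[OF a(1)] inv[OF a(2)] inv[OF b] inv[OF c] t4 by (simp_all only: inv_al)
  then have "al p q r \<in> S" if "triple n p q r" for p q r
    using al_eight[OF that] a b c \<open>al 3 2 1 \<in> S\<close> \<open>al 4 2 1 \<in> S\<close> \<open>al 4 3 2 \<in> S\<close> \<open>al 4 1 3 \<in> S\<close>
    by (elim insertE emptyE) (simp_all only:)
  then show ?thesis using g l act_al[OF g] by (simp add: follows_def S_def)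
qed

text \<open>Conjugation in \<open>L\<close> by \<open>\<tau> 1 2\<close> commutes with conjugation
  in \<open>G\<close> by \<open>\<tau> 1 2\<close> and \<open>\<tau> 3 4\<close>, so the image of
  \<open>al 1 2 3\<close> determines that of \<open>al 1 2 4\<close>. The images inverted by
  \<open>\<tau> 3 4\<close> would force \<open>al 1 2 4 = al 3 2 1\<close>; the other four come from
  elements \<open>g\<close> generated by the two transpositions. Which \<open>g\<close> occurs does
  not matter.\<close>

lemma follows_transposition:
  obtains (obt) g where "follows g (\<tau> 1 2)"
proof -
  note p = pairs4(1,2)
  define l where "l = \<tau> 1 2"
  have l: "l \<in> X" using p by (simp add: l_def X_all)
  have fx: "act (\<tau> 1 2) l = l" "act (\<tau> 3 4) l = l"
    using act_\<tau>[OF z_one \<tau>_closed[OF p(2)] p(1)] p by (simp_all add: l_def \<theta>_\<tau> act_fix_iff)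
  have equi: "Ad l (act h y) = act h (Ad l y)" if "h \<in> carrier G" "act h l = l" "y \<in> X" for h y
    using that l by (simp add: act_Ad)
  have acts: "act (\<tau> 3 4) (al i j k) = al (transp 3 4 i) (transp 3 4 j) (transp 3 4 k)"
    "act (\<tau> 1 2) (al i j k) = al (transp 1 2 i) (transp 1 2 j) (transp 1 2 k)" if "triple n i j k" for i j k
    using act_al[OF _ that] p by (simp_all add: \<theta>_\<tau>)
  note tr = Transposition.transpose_def
  have "order3 (Ad l (al 1 2 3))" by (rule order3_Ad[OF l al_order3[OF t4(1)]])
  then obtain a b c where abc: "triple n a b c" "Ad l (al 1 2 3) = al a b c"
    using order3_is_al tail_all unfolding reach_n by blast
  have A34: "Ad l (al 1 2 4) = act (\<tau> 3 4) (al a b c)"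
    using equi[OF _ fx(2) X4(1)] acts[OF t4(1)] p abc by (simp add: tr)
  have bad: False if "triple n i j k" "al a b c = al i j k" "act (\<tau> 3 4) (al i j k) = al k j i" for i j k
  proof -
    have "Ad l (al 1 2 4) = Ad l (inv\<^bsub>L\<^esub> (al 1 2 3))"
      using A34 abc that l X4 inv_al[OF that(1)] by (simp add: Ad_inv)
    then have "al 1 2 4 = al 3 2 1"
      using Ad_inj[OF l] X4 inv_al[OF t4(1)] by (metis L.inv_closed)
    then show False using al_neq[OF t4(4) t4(15), of 3] by (simp add: cyc3_apply)
  qed
  have rot: "al 4 2 1 = al 2 1 4" "al 3 2 1 = al 2 1 3" "al 2 4 3 = al 4 3 2" "al 3 4 2 = al 2 3 4"
    by (rule al_rot[OF t4(3)] al_rot[OF t4(15)] al_rot[OF t4(7)] al_rot[OF t4(16), symmetric])+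
  have fin: thesis if g: "g \<in> carrier G" "al a b c = act g (al 1 2 3)" "act (\<tau> 3 4) (act g (al 1 2 3)) = act g (al 1 2 4)" for g
    using follows_of_two[OF g(1) l] g abc A34 by (intro obt) (simp add: l_def)
  consider "al a b c = al 1 2 3" | "al a b c = al 3 2 1" | "al a b c = al 1 2 4" | "al a b c = al 4 2 1"
    | "al a b c \<in> {al 2 3 4, al 4 3 2, al 3 1 4, al 4 1 3}"
    using al_eight[OF abc(1)] by blast
  then show thesis
  proof cases
    case 1
    show thesis by (rule fin[of \<one>]) (use 1 X4 acts t4 in \<open>simp_all add: tr\<close>)
  next
    case 2
    show thesis by (rule fin[of "\<tau> 1 2"]) (use 2 p acts t4 rot in \<open>simp_all add: tr\<close>)
  next
    case 3
    show thesis by (rule fin[of "\<tau> 3 4"]) (use 3 p acts t4 rot in \<open>simp_all add: tr\<close>)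
  next
    case 4
    show thesis by (rule fin[of "\<tau> 3 4 \<otimes> \<tau> 1 2"]) (use 4 p acts t4 rot X4 in \<open>simp_all add: tr act_act\<close>)
  next
    case 5
    then show thesis
      using bad[OF t4(16)] bad[OF t4(21)] bad[OF t4(14)] bad[OF t4(8)] acts t4 rot by (auto simp: tr)
  qed
qed

text \<open>The elements of \<open>L\<close> with a partner form a subgroup, invariant under
  conjugation in \<open>G\<close>. It contains the unit, eight three-cycles and more than enough
  transpositions to exceed half of 24.\<close>

lemma follows_total:
  assumes "l \<in> X" shows "\<exists>k. follows k l"
proof -
  define T where "T = {l. \<exists>k. follows k l}"
  have TX: "T \<subseteq> X" by (auto simp: T_def followsD(2))
  have T_mult: "x \<star> y \<in> T" if "x \<in> T" "y \<in> T" for x y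
    using that follows_mult unfolding T_def by blast
  have T_act: "act h x \<in> T" if "x \<in> T" "h \<in> carrier G" for h x
    using that follows_act unfolding T_def by blast
  have T_one: "\<one> \<in> T" using D_follows(1)[of \<one> e] subgroup.one_closed[OF D_subgroup] e_one by (auto simp: T_def)
  have T_al: "al a b c \<in> T" if "triple n a b c" for a b c
    using follows_cyc[OF that] by (auto simp: T_def)
  have T_\<tau>: "\<tau> a b \<in> T" if ab: "pair n a b" for a b
  proof -
    obtain h where h: "h \<in> carrier G" "\<theta> h 1 = a" "\<theta> h 2 = b"
    proof -
      have "distinct [1, 2 :: nat]" "distinct [a, b]" "set [1, 2 :: nat] \<subseteq> {1..n}" "set [a, b] \<subseteq> {1..n}"
        using ab n4 by (auto simp: pair_def)
      then obtain p where "p permutes {1..n}" "map p [1, 2] = [a, b]"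
        using permutes_extend[of "{1..n}" "[1, 2]" "[a, b]"] by auto
      then show ?thesis using that \<theta>_surj by force
    qed
    have "\<tau> 1 2 \<in> T" using follows_transposition by (auto simp: T_def)
    then have "act h (\<tau> 1 2) \<in> T" by (rule T_act[OF _ h(1)])
    then show ?thesis using act_\<tau>[OF z_one h(1) pairs4(1)] h by simp
  qed
  have T: "subgroup T L"
  proof (rule L.subgroupI)
    show "inv\<^bsub>L\<^esub> x \<in> T" if "x \<in> T" for x using that follows_inv by (auto simp: T_def)
  qed (use T_one T_mult TX in auto)
  \<comment> \<open>Fourteen elements, told apart by their values at 1, 2 and 3; a proper subgroup
    would have at most twelve.\<close>
  define xs where "xs = [\<one>, al 1 2 3, al 3 2 1, al 1 2 4, al 2 3 4, al 3 1 4, al 4 2 1, al 4 3 2, al 4 1 3,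
    \<tau> 1 2, \<tau> 3 4, \<tau> 1 3, \<tau> 1 4, \<tau> 2 3]"
  have "map (\<lambda>x. (\<theta> x 1, \<theta> x 2, \<theta> x 3)) xs =
    [(1, 2, 3), (2, 3, 1), (3, 1, 2), (2, 4, 3), (1, 3, 4), (4, 2, 1), (4, 1, 3), (1, 4, 2), (3, 2, 4),
     (2, 1, 3), (1, 2, 4), (3, 2, 1), (4, 2, 3), (1, 3, 2)]"
    using t4 pairs4 by (simp add: xs_def \<theta>_al \<theta>_\<tau> cyc3_apply Transposition.transpose_def)
  moreover have "distinct \<dots>" by simp
  ultimately have "distinct xs" using distinct_map by metis
  then have "card (set xs) = 14" by (simp add: distinct_card xs_def)
  moreover have "set xs \<subseteq> T" using T_one T_al[OF t4(1)] T_al[OF t4(15)] T_al[OF t4(4)] T_al[OF t4(16)]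
    T_al[OF t4(14)] T_al[OF t4(3)] T_al[OF t4(21)] T_al[OF t4(8)] T_\<tau> pairs4 by (simp add: xs_def)
  then have "card (set xs) \<le> card T" using TX finite_X finite_subset card_mono by metis
  ultimately have cT: "14 \<le> card T" by simp
  obtain m where m: "card X = m * card T"
    using L.lagrange_finite[OF finite_X T] by (metis order_def)
  have "m = 1"
  proof (rule ccontr)
    assume "m \<noteq> 1"
    moreover have "card X \<noteq> 0" using finite_X X_one by auto
    ultimately have "2 \<le> m" using m by (cases m) auto
    then have "2 * 14 \<le> m * card T" using cT by (rule mult_le_mono)
    then show False using m card_X_le by simp
  qed
  then have "T = X" using m card_subset_eq[OF finite_X TX] by simp
  then show ?thesis using assms by (auto simp: T_def)
qed

text \<open>Besides \<open>l\<close>, some conjugate of it in \<open>G\<close> would also centralize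
  all lifted three-cycles. Multiplying these two and the unit by the nine elements coming from A_4
  without double transpositions would give 27 different elements in a group of order at most
  24.\<close>

lemma follows_one:
  assumes "follows \<one> l" shows "l = e"
proof (rule ccontr)
  assume ne: "l \<noteq> e"
  define C where "C = {l. follows \<one> l}"
  have fe: "follows \<one> e" using D_follows(1) subgroup.one_closed[OF D_subgroup] by simp
  have CX: "c \<in> X" if "c \<in> C" for c using that followsD(2) by (simp add: C_def)
  have C_div: "d \<star> inv\<^bsub>L\<^esub> c \<in> C" if "c \<in> C" "d \<in> C" for c d
  proof -
    have "follows \<one> (inv\<^bsub>L\<^esub> c)" using follows_inv_left[OF fe, of c] that CX[OF that(1)] by (simp add: C_def)
    then show ?thesis using follows_mult[of \<one> d \<one> "inv\<^bsub>L\<^esub> c"] that by (simp add: C_def)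
  qed
  have "e \<in> C" using fe by (simp add: C_def)
  have "\<not> (\<forall>g\<in>carrier G. act g l = l)"
    using central[of l] ne e_one z_one followsD(2)[OF assms] by auto
  then obtain g where g: "g \<in> carrier G" "act g l \<noteq> l" by blast
  have "act g l \<noteq> e" 
    using g ne followsD(2)[OF assms] by (metis act_e act_inv(1) X_G inv_closed L.one_closed)
  have "follows \<one> (act g l)" using follows_act[OF assms g(1)] g by (simp add: act_def)
  define N where "N = {e, l, act g l}"
  have N: "N \<subseteq> C" "card N = 3"
    using \<open>e \<in> C\<close> assms \<open>follows \<one> (act g l)\<close> ne g(2) \<open>act g l \<noteq> e\<close> by (auto simp: N_def C_def)
  define ms where "ms = [\<one>, al 1 2 3, al 3 2 1, al 1 2 4, al 2 3 4, al 3 1 4, al 4 2 1, al 4 3 2, al 4 1 3]"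
  have "map (\<lambda>x. (\<theta> x 1, \<theta> x 2, \<theta> x 3)) ms =
    [(1, 2, 3), (2, 3, 1), (3, 1, 2), (2, 4, 3), (1, 3, 4), (4, 2, 1), (4, 1, 3), (1, 4, 2), (3, 2, 4)]"
    using t4 by (simp add: ms_def \<theta>_al cyc3_apply)
  moreover have "distinct \<dots>" by simp
  ultimately have "distinct ms" using distinct_map by metis
  then have cM: "card (set ms) = 9" by (simp add: distinct_card ms_def)
  have M: "\<exists>k. (k, m) \<in> D" if "m \<in> set ms" for m
  proof -
    have "(\<one>, \<one>) \<in> D" using subgroup.one_closed[OF D_subgroup] e_one by simp
    then show ?thesis
      using that D_fam(1)[OF t4(1)] D_fam(1)[OF t4(15)] D_fam(1)[OF t4(4)] D_fam(1)[OF t4(16)]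
        D_fam(1)[OF t4(14)] D_fam(1)[OF t4(3)] D_fam(1)[OF t4(21)] D_fam(1)[OF t4(8)]
      unfolding ms_def by auto
  qed
  have MX: "m \<in> X" if "m \<in> set ms" for m using M[OF that] D_follows(1) followsD(2) by blast
  have DC: "u = e" if "(k, u) \<in> D" "u \<in> C" for k u
  proof -
    have "\<theta> k = id" using follows_\<theta>_eq[OF D_follows(1)[OF that(1)]] that(2) by (simp add: C_def)
    then have "u \<in> {e, w}" using D_kernel[OF that(1)] by auto
    then show ?thesis using w_center e_one z_one by auto
  qed
  \<comment> \<open>Equal products give an element that is both a second component of
    \<open>D\<close> and a centralizer of all lifted three-cycles; by \<open>DC\<close> it is the
    unit.\<close>
  have "inj_on (\<lambda>(m, c). m \<star> c) (set ms \<times> N)"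
  proof (rule inj_onI, clarsimp)
    fix m c m' c' assume h: "m \<in> set ms" "c \<in> N" "m' \<in> set ms" "c' \<in> N" "m \<star> c = m' \<star> c'"
    have cX: "c \<in> C" "c' \<in> C" "c \<in> X" "c' \<in> X" using h N CX by blast+
    obtain k k' where k: "(k, m) \<in> D" "(k', m') \<in> D" using M h by blast
    have "m' \<star> (c' \<star> inv\<^bsub>L\<^esub> c) = m"
      using h(5) cX MX[OF h(1)] MX[OF h(3)] by (metis L.m_assoc L.r_inv L.r_one L.inv_closed)
    then have eq: "inv\<^bsub>L\<^esub> m' \<star> m = c' \<star> inv\<^bsub>L\<^esub> c"
      using cX MX[OF h(1)] MX[OF h(3)] by (intro L.inv_solve_left[THEN iffD2, symmetric]) auto
    have "(inv k' \<otimes> k, inv\<^bsub>L\<^esub> m' \<star> m) \<in> D" using D_mult D_inv k by blast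
    then have "inv\<^bsub>L\<^esub> m' \<star> m = e" using DC C_div[OF cX(1,2)] eq by metis
    then have "m = m'" using MX[OF h(1)] MX[OF h(3)] by (metis L.inv_equality L.inv_inv L.inv_closed)
    then show "m = m' \<and> c = c'" using h(5) cX MX[OF h(3)] by simp
  qed
  then have "card (set ms \<times> N) \<le> card X"
    using MX CX N by (intro card_inj_on_le[OF _ _ finite_X]) auto
  then show False using cM N card_X_le by (simp add: card_cartesian_product)
qed

lemma S4_iso: "G\<lparr>carrier := X\<rparr> \<cong> L"
proof -
  have XG: "X = carrier G" using X_all X_G by blast
  have "L \<cong> G"
  \<comment> \<open>The relation is read from \<open>L\<close> to \<open>G\<close>: every
    \<open>l\<close> has a partner by \<open>follows_total\<close>, and \<open>k\<close> determines
    \<open>l\<close> by \<open>follows_one\<close>.\<close>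
  proof (rule graph_iso[where R = "{(l, k). follows k l}"])
    show "finite (carrier G)" using finite_X XG by simp
    show "card X = card (carrier G)" by (simp only: XG)
    show "{(l, k). follows k l} \<subseteq> X \<times> carrier G" using followsD(1,2) by auto
    show "a = a'" if "(a, b) \<in> {(l, k). follows k l}" "(a', b) \<in> {(l, k). follows k l}" for a a' b
    proof -
      have f: "follows b a" "follows b a'" using that by simp_all
      then have "inv\<^bsub>L\<^esub> a' \<star> a = e" by (rule follows_one[OF follows_inv_left])
      then show ?thesis using followsD(2)[OF f(1)] followsD(2)[OF f(2)]
        by (metis L.inv_equality L.inv_inv L.inv_closed)
    qed
  qed (use follows_total follows_mult L.group_axioms group_axioms in auto)
  then show ?thesis using L.iso_sym XG by simp
qed

end

end

lemma (in twisted_oriented) oriented_iso: "G\<lparr>carrier := X\<rparr> \<cong> L"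
proof (cases all_of_S4)
  case True
  then show ?thesis by (rule S4_iso)
next
  case False
  then show ?thesis using even_iso unfolding all_of_S4_def by simp
qed

section \<open>Reaching the right orientation through the opposite law\<close>

definition opposite :: "'a monoid \<Rightarrow> 'a monoid" where
  "opposite L = L\<lparr>mult := \<lambda>x y. y \<otimes>\<^bsub>L\<^esub> x\<rparr>"

lemma opposite_simps [simp]:
  "carrier (opposite L) = carrier L" "\<one>\<^bsub>opposite L\<^esub> = \<one>\<^bsub>L\<^esub>" "x \<otimes>\<^bsub>opposite L\<^esub> y = y \<otimes>\<^bsub>L\<^esub> x"
  by (simp_all add: opposite_def)

lemma opposite_group: "group L \<Longrightarrow> group (opposite L)"
proof -
  assume "group L"
  then interpret group L .
  show ?thesis
    by (rule groupI) (auto simp: m_assoc intro: r_inv exI[of _ "inv\<^bsub>L\<^esub> _"])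
qed

lemma opposite_inv: "group L \<Longrightarrow> x \<in> carrier L \<Longrightarrow> inv\<^bsub>opposite L\<^esub> x = inv\<^bsub>L\<^esub> x"
  by (rule group.inv_equality[OF opposite_group]) (simp_all add: group.r_inv)

lemma opposite_iso:
  assumes "group L" shows "opposite L \<cong> L"
proof -
  interpret group L by fact
  have "bij_betw (m_inv L) (carrier L) (carrier L)"
    by (rule bij_betw_byWitness[where f' = "m_inv L"]) auto
  then have "m_inv L \<in> iso (opposite L) L" by (simp add: iso_def hom_def inv_mult_group)
  then show ?thesis by (auto simp: is_iso_def)
qed

context twisted_lift
begin

lemma twisted_opposite: "twisted_lift G n z \<tau> \<theta> (opposite L) \<zeta>"
proof -
  interpret O: group "opposite L" by (rule opposite_group[OF L.group_axioms])
  have tw: "twisted G n z \<tau> \<theta> (opposite L)"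
    by unfold_locales (use carrier_L n4 n6 act_hom in auto)
  define y where "y = \<zeta> \<otimes> cyc 1 2 3"
  have "y \<in> X" "y \<noteq> e" "y \<star> y \<star> y = e" using \<zeta>_order3 unfolding order3_def y_def by blast+
  then have "twisted.order3 (opposite L) y"
    unfolding twisted.order3_def[OF tw] by (simp add: L.m_assoc)
  then show ?thesis
    using tw \<zeta> unfolding y_def by (intro twisted_lift.intro twisted_lift_axioms.intro)
qed

theorem lift_iso: "G\<lparr>carrier := X\<rparr> \<cong> L"
proof -
  have t: "triple n 1 2 3" "triple n 1 2 4" "triple n 2 3 4" "triple n 3 1 4" "triple n 2 3 1" by (rule triple4; simp)+
  consider "Ad (al 1 2 3) (al 1 2 4) = al 2 3 4" | "Ad (al 1 2 3) (al 1 2 4) = al 3 1 4"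
    using Ad_al_124 by blast
  then show ?thesis
  proof cases
    case 1
    interpret O: twisted_oriented G n z \<tau> \<theta> L \<zeta> by unfold_locales (rule 1)
    show ?thesis by (rule O.oriented_iso)
  next
    case 2
    note X = t[THEN al_X]
    interpret O: twisted_lift G n z \<tau> \<theta> "opposite L" \<zeta> by (rule twisted_opposite)
    \<comment> \<open>Rotating the equation by (1 2 3) shows that conjugation by the inverse of
      \<open>al 1 2 3\<close> sends \<open>al 1 2 4\<close> to \<open>al 2 3 4\<close>. In the
      opposite law this is conjugation by \<open>al 1 2 3\<close> itself.\<close>
    have "act (cyc 1 2 3) (Ad (al 1 2 3) (al 1 2 4)) = act (cyc 1 2 3) (al 3 1 4)" using 2 by simp
    then have "Ad (al 2 3 1) (al 2 3 4) = al 1 2 4"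
      using act_al[OF cyc_closed[OF t(1)]] t X by (simp add: act_Ad \<theta>_cyc cyc3_apply)
    then have "Ad (al 1 2 3) (al 2 3 4) = al 1 2 4" by (simp only: al_rot[OF t(1)])
    moreover have "Ad (inv\<^bsub>L\<^esub> (al 1 2 3)) (Ad (al 1 2 3) (al 2 3 4)) = al 2 3 4"
      using X by (simp flip: Ad_Ad)
    ultimately have "inv\<^bsub>L\<^esub> (al 1 2 3) \<star> al 1 2 4 \<star> al 1 2 3 = al 2 3 4"
      using X by (simp add: Ad_def)
    then have "O.Ad (al 1 2 3) (al 1 2 4) = al 2 3 4"
      using X by (simp add: O.Ad_def opposite_inv[OF L.group_axioms] L.m_assoc)
    then interpret O: twisted_oriented G n z \<tau> \<theta> "opposite L" \<zeta>
      by unfold_locales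
    have "G\<lparr>carrier := X\<rparr> \<cong> opposite L" using O.oriented_iso by simp
    then show ?thesis using opposite_iso[OF L.group_axioms] by (rule iso_trans)
  qed
qed

end

theorem (in twisted) twisted_iso: "G\<lparr>carrier := X\<rparr> \<cong> L"
proof -
  obtain \<zeta> where "\<zeta> \<in> {\<one>, z}" "order3 (\<zeta> \<otimes> cyc 1 2 3)" using exists_lift by blast
  then interpret twisted_lift G n z \<tau> \<theta> L \<zeta> by unfold_locales
  show ?thesis by (rule lift_iso)
qed

section \<open>Transpositions under the second law\<close>

section \<open>Symmetric groups\<close>

text \<open>The coset of \<open>x\<close> lies in \<open>Y - C\<close> and by counting fills it. If
  the product were outside \<open>C\<close>, it would lie in that coset, and cancelling
  \<open>x\<close> would put \<open>y\<close> into \<open>C\<close>.\<close>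

lemma (in group) index_two_mult:
  assumes C: "subgroup C G" and Y: "subgroup Y G" and CY: "C \<subseteq> Y" and fin: "finite Y"
    and card: "card (Y - C) \<le> card C" and x: "x \<in> Y" "x \<notin> C" and y: "y \<in> Y" "y \<notin> C"
  shows "x \<otimes> y \<in> C"
proof (rule ccontr)
  assume n: "x \<otimes> y \<notin> C"
  have G: "C \<subseteq> carrier G" "Y \<subseteq> carrier G" using C Y subgroup.subset by blast+
  have sub: "(\<otimes>) x ` C \<subseteq> Y - C"
  proof
    fix v assume "v \<in> (\<otimes>) x ` C"
    then obtain c where c: "c \<in> C" "v = x \<otimes> c" by blast
    have "v \<notin> C"
    proof
      assume "v \<in> C"
      then have "v \<otimes> inv c \<in> C" using C c by (simp add: subgroup.m_closed subgroup.m_inv_closed)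
      moreover have "v \<otimes> inv c = x" using c G x by (simp add: m_assoc subset_iff)
      ultimately show False using x by simp
    qed
    then show "v \<in> Y - C" using Y c CY x by (auto simp: subgroup.m_closed)
  qed
  have "inj_on ((\<otimes>) x) C" using G x by (auto intro!: inj_onI simp: subset_iff)
  then have "card ((\<otimes>) x ` C) = card C" by (rule card_image)
  then have "(\<otimes>) x ` C = Y - C"
    using card_subset_eq[OF _ sub] card fin card_mono[OF _ sub] by simp
  then obtain c where "c \<in> C" "x \<otimes> y = x \<otimes> c"
    using n x y subgroup.m_closed[OF Y] by blast
  then have "y = c" using G x y by (simp add: subset_iff)
  then show False using y \<open>c \<in> C\<close> by simp
qed

text \<open>\<open>L\<close> is a second group law on the symmetric group \<open>G\<close> that is invariant under conjugation.\<close>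

locale twisted_symmetric = sym_cover_like G n z \<tau> \<theta> + L: group L
  for G :: "('a, 'c) monoid_scheme" (structure) and n z \<tau> \<theta> and L :: "'a monoid" +
  assumes n3: "3 \<le> n" and not4: "n \<noteq> 4" and z_one: "z = \<one>"
    and carrier_L [simp]: "carrier L = carrier G"
    and act_hom: "g \<in> carrier G \<Longrightarrow> x \<in> carrier G \<Longrightarrow> y \<in> carrier G \<Longrightarrow>
        act g (x \<otimes>\<^bsub>L\<^esub> y) = act g x \<otimes>\<^bsub>L\<^esub> act g y"
begin

abbreviation star (infixl "\<star>" 70) where "x \<star> y \<equiv> x \<otimes>\<^bsub>L\<^esub> y"
abbreviation e where "e \<equiv> \<one>\<^bsub>L\<^esub>"

lemmas L_closed = L.m_closed[unfolded carrier_L] L.inv_closed[unfolded carrier_L] L.one_closed[unfolded carrier_L]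
lemmas L_assoc = L.m_assoc[unfolded carrier_L]

lemma \<theta>_inj: "x \<in> carrier G \<Longrightarrow> y \<in> carrier G \<Longrightarrow> \<theta> x = \<theta> y \<Longrightarrow> x = y"
  using \<theta>_eq[OF n3, of x y] z_one by auto

lemma \<tau>_commute: "pair n a b \<Longrightarrow> \<tau> a b = \<tau> b a"
  using \<tau>_swap[of a b] z_one pair_sym by simp

lemma fixed_subgroup: "H \<subseteq> carrier G \<Longrightarrow> subgroup {x \<in> carrier G. \<forall>g\<in>H. act g x = x} L"
proof (rule L.subgroupI)
  assume H: "H \<subseteq> carrier G"
  have e: "act g e = e" if "g \<in> carrier G" for g
    using that act_hom[of g e e] L.l_cancel_one'[of "act g e" "act g e"] L_closed by simp
  then show "{x \<in> carrier G. \<forall>g\<in>H. act g x = x} \<noteq> {}" using H L_closed by blast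
  show "inv\<^bsub>L\<^esub> x \<in> {x \<in> carrier G. \<forall>g\<in>H. act g x = x}" if x: "x \<in> {x \<in> carrier G. \<forall>g\<in>H. act g x = x}" for x
  proof -
    have "act g (inv\<^bsub>L\<^esub> x) = inv\<^bsub>L\<^esub> x" if "g \<in> H" for g
    proof -
      have g: "g \<in> carrier G" "act g x = x" "x \<in> carrier G" using x that H by auto
      have "act g (inv\<^bsub>L\<^esub> x) \<star> x = e"
        using act_hom[of g "inv\<^bsub>L\<^esub> x" x] g e L_closed L.l_inv by simp
      then show ?thesis using g L.inv_equality[of "act g (inv\<^bsub>L\<^esub> x)" x] L_closed by simp
    qed
    then show ?thesis using x L_closed by simp
  qed
qed (auto simp: subset_iff act_hom L_closed)

definition Y :: "'a set" where
  "Y = {x \<in> carrier G. \<forall>g\<in>{\<tau> i j | i j. pair n i j \<and> 4 \<le> i \<and> 4 \<le> j}. act g x = x}"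

lemma Y_preserves:
  assumes "x \<in> Y" "i \<in> {1, 2, 3}" shows "\<theta> x i \<in> {1, 2, 3}"
proof -
  have xG: "x \<in> carrier G" using assms by (simp add: Y_def)
  note perm = \<theta>_permutes[OF xG]
  have inj: "inj (\<theta> x)" by (rule permutes_inj[OF perm])
  have big: "\<theta> x j \<in> {4..n}" if j: "j \<in> {4..n}" for j
  proof -
    \<comment> \<open>A second point exists because \<open>n\<close> is not 4. For
      \<open>n = 4\<close> there is no transposition of {4..n}, and the point 4 could leave its
      place.\<close>
    obtain k where k: "k \<in> {4..n}" "k \<noteq> j"
    proof (cases "j = 4")
      case True
      then show ?thesis using that[of 5] not4 j by auto
    next
      case False
      then show ?thesis using that[of 4] j by auto
    qed
    have p: "pair n j k" using j k by (auto simp: pair_def)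
    then have "act (\<tau> j k) x = x" using assms(1) j k by (auto simp: Y_def)
    then have "\<theta> x \<circ> transp j k = transp j k \<circ> \<theta> x" using \<theta>_act[of "\<tau> j k" x] p xG by (simp add: \<theta>_\<tau>)
    then have "\<theta> x j \<in> {j, k}" using commute_transp_mem[OF inj] k by blast
    then show ?thesis using j k by auto
  qed
  have "\<theta> x ` {4..n} = {4..n}"
    using big inj by (intro endo_inj_surj) (auto intro: inj_on_subset)
  then have "\<theta> x i \<notin> {4..n}" using inj_image_mem_iff[OF inj, of i "{4..n}"] assms(2) by auto
  moreover have "\<theta> x i \<in> {1..n}" using permutes_in_image[OF perm, of i] assms(2) n3 by auto
  ultimately have "\<theta> x i < 4" "1 \<le> \<theta> x i" by simp_all
  then show ?thesis by auto
qed

lemma t123: "triple n 1 2 3" "triple n 3 2 1" "triple n 2 3 1" "triple n 3 1 2" "triple n 2 1 3" "triple n 1 3 2"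
  using n3 by (auto simp: triple_def)

lemma Y_conj:
  assumes "x \<in> Y" shows "act x (cyc 1 2 3) = cyc 1 2 3 \<or> act x (cyc 1 2 3) = cyc 3 2 1"
proof -
  have xG: "x \<in> carrier G" using assms by (simp add: Y_def)
  have inj: "inj (\<theta> x)" by (rule permutes_inj[OF \<theta>_permutes[OF xG]])
  have d: "\<theta> x 1 \<noteq> \<theta> x 2" "\<theta> x 2 \<noteq> \<theta> x 3" "\<theta> x 1 \<noteq> \<theta> x 3" by (simp_all add: inj_eq[OF inj])
  have m: "\<theta> x 1 \<in> {1, 2, 3}" "\<theta> x 2 \<in> {1, 2, 3}" "\<theta> x 3 \<in> {1, 2, 3}"
    using Y_preserves[OF assms] by blast+
  have r: "cyc 2 3 1 = cyc 1 2 3" "cyc 3 1 2 = cyc 1 2 3" "cyc 2 1 3 = cyc 3 2 1" "cyc 1 3 2 = cyc 3 2 1"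
    using cyc_rot[OF t123(1)] cyc_rot[OF t123(4)] cyc_rot[OF t123(2)] cyc_rot[OF t123(6)] by simp_all
  show ?thesis
    unfolding act_cyc[OF xG t123(1)] using m d r by (elim insertE emptyE) simp_all
qed

lemma \<tau>_Y:
  assumes "{a, b} \<subseteq> {1, 2, 3}" "a \<noteq> b" shows "\<tau> a b \<in> Y"
proof -
  have p: "pair n a b" using assms n3 by (auto simp: pair_def)
  have "act (\<tau> i j) (\<tau> a b) = \<tau> a b" if "pair n i j" "4 \<le> i" "4 \<le> j" for i j
    using \<tau>_conj_disjoint[OF that(1) p] assms that z_one p by (auto simp: act_def inv_\<tau>)
  then show ?thesis using p by (auto simp: Y_def)
qed

text \<open>\<open>\<tau> 1 2\<close> and \<open>\<tau> 1 3\<close> lie in \<open>Y\<close> but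
  invert \<open>c\<close>, so their product in \<open>L\<close> falls into the subgroup
  \<open>C\<close> and is fixed by conjugation with \<open>c\<close>. That conjugation carries the
  two factors to \<open>\<tau> 2 3\<close> and \<open>\<tau> 1 2\<close>.\<close>

lemma braid_base: "\<tau> 1 2 \<star> \<tau> 1 3 = \<tau> 2 3 \<star> \<tau> 1 2"
proof -
  define c where "c = cyc 1 2 3"
  define C where "C = {x \<in> Y. act c x = x}"
  have c: "c \<in> carrier G" using t123 by (simp add: c_def)
  have YG: "Y \<subseteq> carrier G" by (auto simp: Y_def)
  have p: "pair n 1 2" "pair n 1 3" "pair n 2 3" using n3 by (auto simp: pair_def)
  have "C = {x \<in> carrier G. \<forall>g\<in>insert c {\<tau> i j | i j. pair n i j \<and> 4 \<le> i \<and> 4 \<le> j}. act g x = x}"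
    by (auto simp: C_def Y_def)
  moreover have "insert c {\<tau> i j | i j. pair n i j \<and> 4 \<le> i \<and> 4 \<le> j} \<subseteq> carrier G" using c by auto
  ultimately have CL: "subgroup C L" by (simp only: fixed_subgroup)
  have YL: "subgroup Y L" unfolding Y_def by (rule fixed_subgroup) auto
  have C_iff: "x \<in> C \<longleftrightarrow> act x c = c" if "x \<in> Y" for x
    using that YG c by (auto simp: C_def act_fix_iff)
  have c21: "act (\<tau> 1 2) c = c \<otimes> c" and ne: "c \<otimes> c \<noteq> c"
  proof -
    have "act (\<tau> 1 2) c = cyc 2 1 3"
      using act_cyc[OF \<tau>_closed[OF p(1)] t123(1)] p by (simp add: c_def \<theta>_\<tau> Transposition.transpose_def)
    also have "\<dots> = cyc 3 2 1" using cyc_rot[OF t123(2)] by simp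
    also have "\<dots> = c \<otimes> c" using cyc_sq[OF t123(1)] by (simp add: c_def)
    finally show "act (\<tau> 1 2) c = c \<otimes> c" .
    show "c \<otimes> c \<noteq> c"
    proof
      assume "c \<otimes> c = c"
      then have "\<theta> (cyc 3 2 1) 1 = \<theta> (cyc 1 2 3) 1" using cyc_sq[OF t123(1)] by (simp add: c_def)
      then show False using t123 by (simp add: \<theta>_cyc cyc3_apply)
    qed
  qed
  have ccc: "c \<otimes> c \<otimes> (c \<otimes> c) = c"
    using cyc_sq[OF t123(1)] cyc_sq[OF t123(2)] by (simp add: c_def)
  have not_C: "\<tau> 1 2 \<notin> C" using C_iff[OF \<tau>_Y] c21 ne by simp
  have "act (\<tau> 1 3) c \<noteq> c"
  proof
    assume "act (\<tau> 1 3) c = c"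
    then have "cyc 3 2 1 = c"
      using act_cyc[OF \<tau>_closed[OF p(2)] t123(1)] p by (simp add: c_def \<theta>_\<tau> Transposition.transpose_def)
    then show False using ne cyc_sq[OF t123(1)] by (simp add: c_def)
  qed
  then have not_C': "\<tau> 1 3 \<notin> C" using C_iff[OF \<tau>_Y] by simp
  have YG_mult: "x \<otimes> \<tau> 1 2 \<in> Y" if "x \<in> Y" for x
  proof -
    have "act g (x \<otimes> \<tau> 1 2) = x \<otimes> \<tau> 1 2" if "g \<in> {\<tau> i j | i j. pair n i j \<and> 4 \<le> i \<and> 4 \<le> j}" for g
    proof -
      have "g \<in> carrier G" "act g x = x" "act g (\<tau> 1 2) = \<tau> 1 2" "x \<in> carrier G"
        using \<open>x \<in> Y\<close> \<tau>_Y[of 1 2] that by (auto simp: Y_def)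
      then show ?thesis using p by (simp add: act_mult)
    qed
    then show ?thesis using that YG p by (auto simp: Y_def)
  qed
  \<comment> \<open>The size of \<open>Y - C\<close> is bounded by a translation in
    \<open>G\<close>, which turns elements inverting \<open>c\<close> into elements fixing it; the
    bound is then used for the law of \<open>L\<close>.\<close>
  have "(\<lambda>x. x \<otimes> \<tau> 1 2) ` (Y - C) \<subseteq> C"
  proof clarify
    fix x assume x: "x \<in> Y" "x \<notin> C"
    then have "act x c = c \<otimes> c" using Y_conj[OF x(1)] C_iff[OF x(1)] cyc_sq[OF t123(1)] by (auto simp: c_def)
    then have "act (x \<otimes> \<tau> 1 2) c = c"
      using x YG c p c21 ccc by (simp add: act_act act_mult subset_iff)
    then show "x \<otimes> \<tau> 1 2 \<in> C" using C_iff[OF YG_mult[OF x(1)]] by simp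
  qed
  moreover have "inj_on (\<lambda>x. x \<otimes> \<tau> 1 2) (Y - C)"
    using YG p by (auto intro!: inj_onI simp: subset_iff)
  moreover have fin: "finite Y" using finite_carrier[OF n3] YG finite_subset by blast
  ultimately have "card (Y - C) \<le> card C"
    by (intro card_inj_on_le[of "\<lambda>x. x \<otimes> \<tau> 1 2"]) (auto simp: C_def)
  then have "\<tau> 1 2 \<star> \<tau> 1 3 \<in> C"
    using \<tau>_Y not_C not_C' by (intro L.index_two_mult[OF CL YL _ fin]) (auto simp: C_def)
  then have "act c (\<tau> 1 2 \<star> \<tau> 1 3) = \<tau> 1 2 \<star> \<tau> 1 3" by (simp add: C_def)
  moreover have "act c (\<tau> 1 2) = \<tau> 2 3" "act c (\<tau> 1 3) = \<tau> 1 2"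
    using \<tau>_commute[OF p(1)] act_\<tau>[OF z_one c p(1)] act_\<tau>[OF z_one c p(2)] t123 by (simp_all add: c_def \<theta>_cyc cyc3_apply)
  ultimately show ?thesis using act_hom[OF c, of "\<tau> 1 2" "\<tau> 1 3"] p by simp
qed

lemma braid:
  assumes "triple n a b c" shows "\<tau> a b \<star> \<tau> a c = \<tau> b c \<star> \<tau> a b"
proof -
  have "distinct [1, 2, 3 :: nat]" "distinct [a, b, c]" "set [1, 2, 3 :: nat] \<subseteq> {1..n}" "set [a, b, c] \<subseteq> {1..n}"
    using assms n3 by (auto simp: triple_def)
  then obtain p where "p permutes {1..n}" "map p [1, 2, 3] = [a, b, c]"
    using permutes_extend[of "{1..n}" "[1, 2, 3]" "[a, b, c]"] by auto
  then obtain h where h: "h \<in> carrier G" "\<theta> h 1 = a" "\<theta> h 2 = b" "\<theta> h 3 = c" using \<theta>_surj by force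
  have p: "pair n 1 2" "pair n 1 3" "pair n 2 3" using n3 by (auto simp: pair_def)
  have "act h (\<tau> 1 2 \<star> \<tau> 1 3) = act h (\<tau> 2 3 \<star> \<tau> 1 2)" by (simp only: braid_base)
  then show ?thesis
    using act_\<tau>[OF z_one h(1) p(1)] act_\<tau>[OF z_one h(1) p(2)] act_\<tau>[OF z_one h(1) p(3)] h p
    by (simp add: act_hom)
qed

text \<open>The analogue for transpositions of the relation between three-cycles above, written
  without inverses: conjugation in \<open>L\<close> by \<open>l\<close> moves the transpositions as
  \<open>\<theta> k\<close> does.\<close>

definition follows :: "'a \<Rightarrow> 'a \<Rightarrow> bool" where
  "follows k l \<longleftrightarrow> k \<in> carrier G \<and> l \<in> carrier G \<and>
    (\<forall>a b. pair n a b \<longrightarrow> l \<star> \<tau> a b = \<tau> (\<theta> k a) (\<theta> k b) \<star> l)"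

lemma pair_\<theta>: "k \<in> carrier G \<Longrightarrow> pair n a b \<Longrightarrow> pair n (\<theta> k a) (\<theta> k b)"
  using act_\<tau>[OF z_one] by blast

lemma follows_mult:
  assumes "follows k l" "follows k' l'" shows "follows (k \<otimes> k') (l \<star> l')"
proof -
  have c: "k \<in> carrier G" "l \<in> carrier G" "k' \<in> carrier G" "l' \<in> carrier G"
    using assms by (auto simp: follows_def)
  have "l \<star> l' \<star> \<tau> a b = \<tau> (\<theta> (k \<otimes> k') a) (\<theta> (k \<otimes> k') b) \<star> (l \<star> l')" if p: "pair n a b" for a b
  proof -
    note p' = pair_\<theta>[OF c(3) p]
    note p'' = pair_\<theta>[OF c(1) p']
    have "l \<star> l' \<star> \<tau> a b = l \<star> (\<tau> (\<theta> k' a) (\<theta> k' b) \<star> l')"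
      using assms(2) p c by (simp add: L_assoc follows_def)
    also have "\<dots> = \<tau> (\<theta> k (\<theta> k' a)) (\<theta> k (\<theta> k' b)) \<star> l \<star> l'"
      using assms(1) p' c by (simp add: follows_def flip: L_assoc)
    finally show ?thesis using c p'' by (simp add: L_assoc \<theta>_mult)
  qed
  then show ?thesis using c by (simp add: follows_def L_closed)
qed

text \<open>Commutation of disjoint transpositions is a consequence of the braid rule: after
  multiplying by \<open>\<tau> a c\<close> on the right, five applications of \<open>braid\<close>
  carry one order into the other, and \<open>\<tau> a c\<close> cancels.\<close>

lemma disjoint_commute:
  assumes "pair n a b" "pair n c d" "{a, b} \<inter> {c, d} = {}"
  shows "\<tau> a b \<star> \<tau> c d = \<tau> c d \<star> \<tau> a b"
proof -
  have t: "triple n a b c" "triple n a c d" "triple n a b d" "triple n b c d"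
    using assms by (auto simp: triple_def pair_def)
  have p: "pair n a c" "pair n a d" "pair n b c" "pair n b d"
    using t by (auto simp: triple_def pair_def)
  note A = L_assoc L_closed p assms(1,2)
  have "\<tau> a b \<star> \<tau> c d \<star> \<tau> a c = \<tau> a b \<star> (\<tau> a c \<star> \<tau> a d)" using braid[OF t(2)] by (simp add: A)
  also have "\<dots> = \<tau> b c \<star> (\<tau> a b \<star> \<tau> a d)" using braid[OF t(1)] by (simp add: A flip: L_assoc)
  also have "\<dots> = \<tau> b c \<star> \<tau> b d \<star> \<tau> a b" using braid[OF t(3)] by (simp add: A)
  also have "\<dots> = \<tau> c d \<star> (\<tau> b c \<star> \<tau> a b)" using braid[OF t(4)] by (simp add: A)
  also have "\<dots> = \<tau> c d \<star> \<tau> a b \<star> \<tau> a c" using braid[OF t(1)] by (simp add: A)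
  finally show ?thesis
    using L.right_cancel[of "\<tau> a c" "\<tau> a b \<star> \<tau> c d" "\<tau> c d \<star> \<tau> a b"] p assms(1,2) L_closed by simp
qed

lemma follows_\<tau>:
  assumes p: "pair n a b" shows "follows (\<tau> a b) (\<tau> a b)"
proof -
  have "\<tau> a b \<star> \<tau> x y = \<tau> (transp a b x) (transp a b y) \<star> \<tau> a b" if q: "pair n x y" for x y
  proof -
    have meet: "\<tau> a b \<star> \<tau> a y = \<tau> b y \<star> \<tau> a b" "\<tau> a b \<star> \<tau> b y = \<tau> a y \<star> \<tau> a b"
      if "pair n a y" "pair n b y" for y
    proof -
      have "triple n a b y" "triple n b a y" using that p by (auto simp: triple_def pair_def)
      then show "\<tau> a b \<star> \<tau> a y = \<tau> b y \<star> \<tau> a b" "\<tau> a b \<star> \<tau> b y = \<tau> a y \<star> \<tau> a b"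
        using braid \<tau>_commute[OF p] by metis+
    qed
    have sw: "\<tau> y a = \<tau> a y" "\<tau> y b = \<tau> b y" if "pair n a y" "pair n b y" for y
      using \<tau>_commute that pair_sym by metis+
    consider "x \<in> {a, b}" "y \<in> {a, b}" | "x \<in> {a, b}" "y \<notin> {a, b}" | "x \<notin> {a, b}" "y \<in> {a, b}"
      | "{a, b} \<inter> {x, y} = {}" by blast
    then show ?thesis
    proof cases
      case 1
      then have "x = a \<and> y = b \<or> x = b \<and> y = a" using q by (auto simp: pair_def)
      then show ?thesis using \<tau>_commute[OF p] by auto
    next
      case 2
      then have "pair n a y" "pair n b y" using p q by (auto simp: pair_def)
      then show ?thesis using 2 meet[of y] by (auto simp: Transposition.transpose_def)
    next
      case 3
      then have "pair n a x" "pair n b x" using p q by (auto simp: pair_def)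
      then show ?thesis using 3 meet[of x] sw[of x] by (auto simp: Transposition.transpose_def)
    next
      case 4
      then show ?thesis using disjoint_commute[OF p q] by (auto simp: Transposition.transpose_def)
    qed
  qed
  then show ?thesis using p by (simp add: follows_def \<theta>_\<tau>)
qed

lemma follows_total: "k \<in> carrier G \<Longrightarrow> \<exists>l. follows k l"
proof (induction k rule: carrier_induct)
  case one
  have "follows \<one> e" by (simp add: follows_def L_closed)
  then show ?case by blast
next
  case (z x)
  then show ?case using z_one by simp
next
  case (\<tau> a b x)
  then show ?case using follows_\<tau> follows_mult by blast
qed

text \<open>The images of two-point sets determine a permutation of at least three points, as {a} is
  the intersection of {a, b} and {a, c}.\<close>

lemma follows_unique:
  assumes "follows k l" "follows k' l" shows "k = k'"
proof (rule \<theta>_inj)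
  show kG: "k \<in> carrier G" "k' \<in> carrier G" using assms by (auto simp: follows_def)
  have lG: "l \<in> carrier G" using assms by (simp add: follows_def)
  have eq: "{\<theta> k a, \<theta> k b} = {\<theta> k' a, \<theta> k' b}" if p: "pair n a b" for a b
  proof -
    note p' = pair_\<theta>[OF kG(1) p] pair_\<theta>[OF kG(2) p]
    have "\<tau> (\<theta> k a) (\<theta> k b) \<star> l = \<tau> (\<theta> k' a) (\<theta> k' b) \<star> l"
      using assms p by (simp add: follows_def)
    then have "\<tau> (\<theta> k a) (\<theta> k b) = \<tau> (\<theta> k' a) (\<theta> k' b)" using lG p' by simp
    then have "transp (\<theta> k a) (\<theta> k b) = transp (\<theta> k' a) (\<theta> k' b)" using p' by (metis \<theta>_\<tau>)
    moreover have "{v. transp x y v \<noteq> v} = {x, y}" if "x \<noteq> y" for x y :: nat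
      using that by (auto simp: Transposition.transpose_def)
    ultimately show ?thesis using p' by (metis pair_def)
  qed
  have "\<theta> k a = \<theta> k' a" for a
  proof (cases "a \<in> {1..n}")
    case True
    obtain b c where bc: "pair n a b" "pair n a c" "b \<noteq> c"
    proof -
      consider "a = 1" | "a = 2" | "a > 2" using True by fastforce
      then show ?thesis
        using that[of 2 3] that[of 1 3] that[of 1 2] n3 True by cases (auto simp: pair_def)
    qed
    have inj: "inj (\<theta> k)" "inj (\<theta> k')" using \<theta>_permutes kG permutes_inj by blast+
    have I: "{u, x} \<inter> {u, y} = {u}" if "x \<noteq> y" for u x y :: nat using that by auto
    have "{\<theta> k a} = {\<theta> k' a}"
      using I[of "\<theta> k b" "\<theta> k c" "\<theta> k a"] I[of "\<theta> k' b" "\<theta> k' c" "\<theta> k' a"] eq[OF bc(1)] eq[OF bc(2)] bc(3)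
      by (simp add: inj_eq[OF inj(1)] inj_eq[OF inj(2)])
    then show ?thesis by simp
  next
    case False
    then show ?thesis using \<theta>_permutes[OF kG(1)] \<theta>_permutes[OF kG(2)] by (simp add: permutes_def)
  qed
  then show "\<theta> k = \<theta> k'" by (simp add: fun_eq_iff)
qed

theorem symmetric_iso: "G \<cong> L"
proof (rule graph_iso[where R = "{(k, l). follows k l}"])
  show "{(k, l). follows k l} \<subseteq> carrier G \<times> carrier L" by (auto simp: follows_def)
  show "finite (carrier L)" using finite_carrier[OF n3] by simp
  show "\<exists>b. (a, b) \<in> {(k, l). follows k l}" if "a \<in> carrier G" for a
    using follows_total[OF that] by simp
  show "(a \<otimes> a', b \<star> b') \<in> {(k, l). follows k l}"
    if "(a, b) \<in> {(k, l). follows k l}" "(a', b') \<in> {(k, l). follows k l}" for a b a' b'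
    using that by (simp add: follows_mult)
  show "a = a'" if "(a, b) \<in> {(k, l). follows k l}" "(a', b) \<in> {(k, l). follows k l}" for a a' b
    using that by (simp add: follows_unique)
qed (simp_all add: group_axioms L.group_axioms)

end

section \<open>Rigid finite groups\<close>

context sym_cover_like
begin

lemma act_auto:
  assumes X: "subgroup X G" "\<And>g x. g \<in> carrier G \<Longrightarrow> x \<in> X \<Longrightarrow> act g x \<in> X" and g: "g \<in> carrier G"
  shows "restrict (act g) X \<in> auto (G\<lparr>carrier := X\<rparr>)"
proof -
  note XG = subgroup.mem_carrier[OF X(1)] and m = subgroup.m_closed[OF X(1)]
  have "bij_betw (act g) X X"
    by (rule bij_betw_byWitness[where f' = "act (inv g)"])
      (simp_all add: image_subset_iff X(2) XG g act_inv)
  then have "restrict (act g) X \<in> Bij X" by (simp add: Bij_def cong: bij_betw_cong)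
  moreover have "restrict (act g) X \<in> hom (G\<lparr>carrier := X\<rparr>) (G\<lparr>carrier := X\<rparr>)"
    by (rule homI) (simp_all add: X(2) XG m g act_mult)
  ultimately show ?thesis by (simp add: auto_def)
qed

lemma act_hom_of_auto:
  assumes X: "subgroup X G" "\<And>g x. g \<in> carrier G \<Longrightarrow> x \<in> X \<Longrightarrow> act g x \<in> X"
    and L: "group L" "carrier L = X" "auto (G\<lparr>carrier := X\<rparr>) \<subseteq> hom L L"
    and g: "g \<in> carrier G" and xy: "x \<in> X" "y \<in> X"
  shows "act g (x \<otimes>\<^bsub>L\<^esub> y) = act g x \<otimes>\<^bsub>L\<^esub> act g y"
proof -
  have "restrict (act g) X \<in> hom L L" using act_auto[OF X g] L(3) by blast
  moreover have "x \<otimes>\<^bsub>L\<^esub> y \<in> X" using monoid.m_closed[OF group.is_monoid[OF L(1)]] L(2) xy by simp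
  ultimately show ?thesis using xy L(2) hom_mult[of "restrict (act g) X" L L x y] by simp
qed

lemma aut_rigid_of_twisted:
  assumes n: "4 \<le> n" "n = 6 \<Longrightarrow> z = \<one>" and X: "X = even_part \<or> n = 4 \<and> z = \<one> \<and> X = carrier G"
  shows "aut_rigid (G\<lparr>carrier := X\<rparr>)"
  unfolding aut_rigid_def
proof (intro allI impI)
  fix L :: "'a monoid" assume L: "group L" "carrier L = carrier (G\<lparr>carrier := X\<rparr>)"
    "auto (G\<lparr>carrier := X\<rparr>) \<subseteq> hom L L"
  have E: "subgroup even_part G"
    using n generate_is_subgroup[OF C.fam_closed, of n] by (simp add: even_part_eq)
  then have XG: "subgroup X G" using X subgroup_self by auto
  have act: "act g x \<in> X" if "g \<in> carrier G" "x \<in> X" for g x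
  proof (cases "X = carrier G")
    case True
    then show ?thesis using that by simp
  next
    case False
    have "evenperm (\<theta> (g \<otimes> inv g))" using evenperm_id \<theta>_one r_inv[OF that(1)] by metis
    then have "evenperm (\<theta> g) = evenperm (\<theta> (inv g))" using even_mult[of g "inv g"] that by simp
    then show ?thesis using that False X even_mult by (auto simp: even_part_def act_def)
  qed
  have "twisted G n z \<tau> \<theta> L"
  proof (intro twisted.intro twisted_axioms.intro)
    show "sym_cover_like G n z \<tau> \<theta>" by unfold_locales
    fix g x y assume "g \<in> carrier G" "x \<in> carrier L" "y \<in> carrier L"
    then show "act g (x \<otimes>\<^bsub>L\<^esub> y) = act g x \<otimes>\<^bsub>L\<^esub> act g y"
      using act_hom_of_auto[OF XG act L(1)] L by simp
  qed (use n X L in auto)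
  from twisted.twisted_iso[OF this] show "G\<lparr>carrier := X\<rparr> \<cong> L" using L(2) by simp
qed

lemma aut_rigid_of_symmetric:
  assumes n: "3 \<le> n" "n \<noteq> 4" and z: "z = \<one>"
  shows "aut_rigid (G\<lparr>carrier := carrier G\<rparr>)"
  unfolding aut_rigid_def
proof (intro allI impI)
  fix L :: "'a monoid" assume L: "group L" "carrier L = carrier (G\<lparr>carrier := carrier G\<rparr>)"
    "auto (G\<lparr>carrier := carrier G\<rparr>) \<subseteq> hom L L"
  have "twisted_symmetric G n z \<tau> \<theta> L"
  proof (intro twisted_symmetric.intro twisted_symmetric_axioms.intro)
    show "sym_cover_like G n z \<tau> \<theta>" by unfold_locales
    fix g x y assume "g \<in> carrier G" "x \<in> carrier G" "y \<in> carrier G"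
    then show "act g (x \<otimes>\<^bsub>L\<^esub> y) = act g x \<otimes>\<^bsub>L\<^esub> act g y"
      using act_hom_of_auto[OF subgroup_self _ L(1)] L by simp
  qed (use n z L in auto)
  from twisted_symmetric.symmetric_iso[OF this] show "G\<lparr>carrier := carrier G\<rparr> \<cong> L"
    by (auto simp: is_iso_def iso_def hom_def)
qed

end

lemma trivial_card_iso:
  assumes A: "group A" and B: "group B" and card: "card (carrier A) = 1" "card (carrier B) = 1"
  shows "A \<cong> B"
proof -
  have "\<one>\<^bsub>A\<^esub> \<in> carrier A" "\<one>\<^bsub>B\<^esub> \<in> carrier B" using A B group.is_monoid monoid.one_closed by blast+
  then have "carrier A = {\<one>\<^bsub>A\<^esub>}" "carrier B = {\<one>\<^bsub>B\<^esub>}" using card by (auto elim!: card_1_singletonE)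
  then have "(\<lambda>_. \<one>\<^bsub>B\<^esub>) \<in> iso A B"
    using B by (simp add: iso_def hom_def bij_betw_def group.is_monoid monoid.l_one)
  then show ?thesis by (auto simp: is_iso_def)
qed

lemma (in group) prime_card_generated:
  assumes "prime (card (carrier G))" obtains x where "x \<in> carrier G" "ord x = card (carrier G)"
    "carrier G = {x [^] (k :: int) | k. k \<in> UNIV}"
proof -
  have "\<not> carrier G \<subseteq> {\<one>}"
  proof
    assume "carrier G \<subseteq> {\<one>}"
    then have "card (carrier G) \<le> card {\<one>}" by (rule card_mono[rotated]) simp
    then show False using prime_gt_1_nat[OF assms] by simp
  qed
  then obtain x where x: "x \<in> carrier G" "x \<noteq> \<one>" by blast
  have "ord x dvd card (carrier G)" using ord_dvd_group_order[OF x(1)] by (simp add: order_def)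
  then have ord: "ord x = card (carrier G)" using assms ord_eq_1[OF x(1)] x(2) prime_nat_iff by blast
  have "finite (carrier G)" using prime_gt_0_nat[OF assms] card.infinite by fastforce
  moreover have "generate G {x} \<subseteq> carrier G" using generate_incl[of "{x}"] x by simp
  ultimately have "generate G {x} = carrier G"
    by (rule card_subset_eq) (simp only: ord flip: generate_pow_card[OF x(1)])
  then show thesis by (intro that[OF x(1) ord]) (simp only: generate_pow[OF x(1)])
qed

lemma prime_card_iso:
  assumes A: "group A" and B: "group B" and card: "prime (card (carrier A))" "card (carrier B) = card (carrier A)"
  shows "A \<cong> B"
proof -
  interpret A: group A by (rule A)
  interpret B: group B by (rule B)
  obtain x where x: "x \<in> carrier A" "A.ord x = card (carrier A)" "carrier A = {x [^]\<^bsub>A\<^esub> (k :: int) | k. k \<in> UNIV}"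
    using A.prime_card_generated[OF card(1)] .
  obtain y where y: "y \<in> carrier B" "B.ord y = card (carrier A)"
    using B.prime_card_generated card by metis
  show ?thesis
  proof (rule graph_iso[OF A B, where R = "{(x [^]\<^bsub>A\<^esub> k, y [^]\<^bsub>B\<^esub> k) | k. k \<in> (UNIV :: int set)}"])
    show "finite (carrier B)" using card prime_gt_0_nat card.infinite by (metis less_irrefl)
    show "\<exists>b. (a, b) \<in> {(x [^]\<^bsub>A\<^esub> k, y [^]\<^bsub>B\<^esub> k) | k. k \<in> (UNIV :: int set)}" if "a \<in> carrier A" for a
      using that x(3) by auto
    show "a = a'" if "(a, b) \<in> {(x [^]\<^bsub>A\<^esub> k, y [^]\<^bsub>B\<^esub> k) | k. k \<in> (UNIV :: int set)}"
      "(a', b) \<in> {(x [^]\<^bsub>A\<^esub> k, y [^]\<^bsub>B\<^esub> k) | k. k \<in> (UNIV :: int set)}" for a a' b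
      using that A.int_pow_eq[OF x(1)] B.int_pow_eq[OF y(1)] x(2) y(2) by auto
    show "(a \<otimes>\<^bsub>A\<^esub> a', b \<otimes>\<^bsub>B\<^esub> b') \<in> {(x [^]\<^bsub>A\<^esub> k, y [^]\<^bsub>B\<^esub> k) | k. k \<in> (UNIV :: int set)}"
      if ab: "(a, b) \<in> {(x [^]\<^bsub>A\<^esub> k, y [^]\<^bsub>B\<^esub> k) | k. k \<in> (UNIV :: int set)}"
      "(a', b') \<in> {(x [^]\<^bsub>A\<^esub> k, y [^]\<^bsub>B\<^esub> k) | k. k \<in> (UNIV :: int set)}" for a b a' b'
    proof -
      obtain k k' :: int where "a = x [^]\<^bsub>A\<^esub> k" "b = y [^]\<^bsub>B\<^esub> k" "a' = x [^]\<^bsub>A\<^esub> k'" "b' = y [^]\<^bsub>B\<^esub> k'"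
        using ab by auto
      then have "a \<otimes>\<^bsub>A\<^esub> a' = x [^]\<^bsub>A\<^esub> (k + k')" "b \<otimes>\<^bsub>B\<^esub> b' = y [^]\<^bsub>B\<^esub> (k + k')"
        using x y by (simp_all add: A.int_pow_mult B.int_pow_mult)
      then show ?thesis by blast
    qed
  qed (use x(1) y(1) card in auto)
qed

text \<open>Serves the symmetric group of degree 2 and the alternating groups of degrees 2 and 3: a
  group of order 1 or of prime order is determined by its order.\<close>

lemma aut_rigid_small:
  assumes "group K" "card (carrier K) = 1 \<or> prime (card (carrier K))"
  shows "aut_rigid K"
  unfolding aut_rigid_def using assms trivial_card_iso prime_card_iso by metis

lemma sym_group_cover_like: "sym_cover_like (sym_group n) n id transp (\<lambda>x. x)"
proof (intro sym_cover_like.intro sym_cover_like_axioms.intro)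
  interpret group "sym_group n" by (rule sym_group_is_group)
  note simps = sym_group_carrier sym_group_mult sym_group_one
  show "group (sym_group n)" by unfold_locales
  show "transp a b \<in> carrier (sym_group n)" if "pair n a b" for a b
    using that by (simp add: simps pair_def permutes_swap_id)
  show "transp a b = id \<otimes>\<^bsub>sym_group n\<^esub> transp b a" for a b
    by (simp add: simps transpose_commute)
  show "transp a b \<otimes>\<^bsub>sym_group n\<^esub> transp b c \<otimes>\<^bsub>sym_group n\<^esub> transp a b = id \<otimes>\<^bsub>sym_group n\<^esub> transp a c"
    if "triple n a b c" for a b c
    using that by (auto simp: simps triple_def Transposition.transpose_def fun_eq_iff)
  show "carrier (sym_group n) = generate (sym_group n) (insert id {transp a b | a b. pair n a b})" (is "_ = generate _ ?S")
  proof
    show "generate (sym_group n) ?S \<subseteq> carrier (sym_group n)"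
      by (rule generate_incl) (auto simp: simps pair_def permutes_swap_id permutes_id)
    show "carrier (sym_group n) \<subseteq> generate (sym_group n) ?S"
    proof
      fix p assume "p \<in> carrier (sym_group n)"
      then have "p permutes {1..n}" "finite {1..n}" by (simp_all add: simps)
      then show "p \<in> generate (sym_group n) ?S"
      proof (induction rule: permutes_induct)
        case id
        show ?case by (rule generate.incl) simp
      next
        case (swap a b p)
        then have "transp a b \<in> generate (sym_group n) ?S" by (intro generate.incl) (auto simp: pair_def)
        from generate.eng[OF this swap.IH] show ?case by (simp only: simps)
      qed
    qed
  qed
qed (simp_all add: sym_group_carrier sym_group_mult sym_group_one permutes_id)

lemma aut_rigid_sym_group:
  assumes "2 \<le> n" shows "aut_rigid (sym_group n)"
proof -
  interpret S: sym_cover_like "sym_group n" n id transp "\<lambda>x. x" by (rule sym_group_cover_like)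
  have eta: "sym_group n\<lparr>carrier := carrier (sym_group n)\<rparr> = sym_group n" by simp
  consider "n = 2" | "n = 4" | "3 \<le> n" "n \<noteq> 4" using assms by linarith
  then show ?thesis
  proof cases
    case 1
    then have "card (carrier (sym_group n)) = 2" by (simp add: sym_group_card_carrier)
    then show ?thesis using aut_rigid_small[OF sym_group_is_group] by simp
  next
    case 2
    then show ?thesis
      using S.aut_rigid_of_twisted[of "carrier (sym_group n)"] eta by (simp add: sym_group_one)
  next
    case 3
    then show ?thesis using S.aut_rigid_of_symmetric eta by (simp add: sym_group_one)
  qed
qed

lemma aut_rigid_alt_group:
  assumes "2 \<le> n" shows "aut_rigid (alt_group n)"
proof -
  interpret S: sym_cover_like "sym_group n" n id transp "\<lambda>x. x" by (rule sym_group_cover_like)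
  consider "n = 2" | "n = 3" | "4 \<le> n" using assms by linarith
  then show ?thesis
  proof cases
    case 1
    then have "card (carrier (alt_group n)) = 1" using alt_group_card_carrier[of 2] by simp
    then show ?thesis using aut_rigid_small[OF alt_group_is_group] by simp
  next
    case 2
    then have "card (carrier (alt_group n)) = 3" using alt_group_card_carrier[of 3] by (simp add: fact_numeral)
    then show ?thesis using aut_rigid_small[OF alt_group_is_group] by simp
  next
    case 3
    have "alt_group n = sym_group n\<lparr>carrier := S.even_part\<rparr>"
      by (simp add: alt_group_def S.even_part_def sym_group_carrier)
    then show ?thesis using S.aut_rigid_of_twisted[of S.even_part] 3 by (simp add: sym_group_one)
  qed
qed

section \<open>Groups given by generators and relations\<close>

section \<open>Presented groups\<close>

definition formal_inv :: "'x gword \<Rightarrow> 'x gword" where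
  "formal_inv w = rev (map (\<lambda>(e, x). (\<not> e, x)) w)"

locale presentation =
  fixes S :: "'x set" and R :: "('x gword \<times> 'x gword) set"
begin

abbreviation W where "W \<equiv> lists (UNIV \<times> S) :: 'x gword set"
abbreviation eq (infix "\<simeq>" 50) where "u \<simeq> v \<equiv> pres_eq S R u v"

definition cls :: "'x gword \<Rightarrow> 'x gword set" where
  "cls u = {v. u \<simeq> v}"

lemma pres_eq_words: "u \<simeq> v \<Longrightarrow> u \<in> W \<and> v \<in> W"
  by (induction rule: pres_eq.induct) auto

lemma cls_eq_iff: "u \<in> W \<Longrightarrow> cls u = cls v \<longleftrightarrow> u \<simeq> v"
  unfolding cls_def by (auto intro: pres_eq.refl pres_eq.sym pres_eq.trans)

lemma carrier_presented: "carrier (presented_group S R) = cls ` W"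
  by (auto simp: presented_group_def quotient_def cls_def)

lemma mult_presented:
  assumes "u \<in> W" "v \<in> W" shows "cls u \<otimes>\<^bsub>presented_group S R\<^esub> cls v = cls (u @ v)"
proof -
  have "(\<exists>u'\<in>cls u. \<exists>v'\<in>cls v. u' @ v' \<simeq> w) \<longleftrightarrow> u @ v \<simeq> w" for w
    using assms unfolding cls_def by (auto intro: pres_eq.refl pres_eq.sym pres_eq.trans pres_eq.append)
  then show ?thesis unfolding presented_group_def by (simp add: cls_def)
qed

lemma one_presented: "\<one>\<^bsub>presented_group S R\<^esub> = cls []"
  by (simp add: presented_group_def cls_def)

lemma formal_inv_W: "u \<in> W \<Longrightarrow> formal_inv u \<in> W"
  by (auto simp: formal_inv_def in_lists_conv_set)

lemma formal_inv_left: "u \<in> W \<Longrightarrow> formal_inv u @ u \<simeq> []"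
proof (induction u)
  case Nil
  then show ?case by (simp add: formal_inv_def pres_eq.refl)
next
  case (Cons a u)
  obtain e x where a: "a = (e, x)" by (cases a)
  have x: "x \<in> S" "u \<in> W" using Cons.prems a by auto
  have "[(\<not> e, x), (e, x)] \<simeq> []" using pres_eq.cancel[of x S R "\<not> e"] x by simp
  then have "[(\<not> e, x), (e, x)] @ u \<simeq> [] @ u" by (rule pres_eq.append[OF _ pres_eq.refl[OF x(2)]])
  then have "formal_inv u @ ([(\<not> e, x), (e, x)] @ u) \<simeq> formal_inv u @ ([] @ u)"
    by (rule pres_eq.append[OF pres_eq.refl[OF formal_inv_W[OF x(2)]]])
  then show ?case using Cons.IH x by (simp add: formal_inv_def a) (blast intro: pres_eq.trans)
qed

lemma group_presented: "group (presented_group S R)"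
proof (rule groupI)
  fix x y w assume "x \<in> carrier (presented_group S R)" "y \<in> carrier (presented_group S R)" "w \<in> carrier (presented_group S R)"
  then obtain u v t where "u \<in> W" "v \<in> W" "t \<in> W" "x = cls u" "y = cls v" "w = cls t" by (auto simp: carrier_presented)
  then show "x \<otimes>\<^bsub>presented_group S R\<^esub> y \<otimes>\<^bsub>presented_group S R\<^esub> w = x \<otimes>\<^bsub>presented_group S R\<^esub> (y \<otimes>\<^bsub>presented_group S R\<^esub> w)"
    by (simp add: mult_presented)
next
  fix x assume "x \<in> carrier (presented_group S R)"
  then obtain u where u: "u \<in> W" "x = cls u" by (auto simp: carrier_presented)
  then show "\<one>\<^bsub>presented_group S R\<^esub> \<otimes>\<^bsub>presented_group S R\<^esub> x = x" by (simp add: one_presented mult_presented)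
  have "cls (formal_inv u) \<otimes>\<^bsub>presented_group S R\<^esub> x = \<one>\<^bsub>presented_group S R\<^esub>"
    using u formal_inv_left formal_inv_W by (simp add: one_presented mult_presented cls_eq_iff)
  then show "\<exists>y\<in>carrier (presented_group S R). y \<otimes>\<^bsub>presented_group S R\<^esub> x = \<one>\<^bsub>presented_group S R\<^esub>"
    using u formal_inv_W by (auto simp: carrier_presented)
next
  fix x y assume "x \<in> carrier (presented_group S R)" "y \<in> carrier (presented_group S R)"
  then obtain u v where "u \<in> W" "v \<in> W" "x = cls u" "y = cls v" by (auto simp: carrier_presented)
  moreover from this have "u @ v \<in> W" by simp
  ultimately show "x \<otimes>\<^bsub>presented_group S R\<^esub> y \<in> carrier (presented_group S R)"
    by (simp only: carrier_presented mult_presented) blast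
qed (auto simp: carrier_presented one_presented)

lemma relation: "(u, v) \<in> R \<Longrightarrow> u \<in> W \<Longrightarrow> v \<in> W \<Longrightarrow> cls u = cls v"
  by (simp add: cls_eq_iff pres_eq.rel)

lemma generated_presented: "carrier (presented_group S R) = generate (presented_group S R) ((\<lambda>x. cls [(True, x)]) ` S)"
    (is "_ = generate _ ?H")
proof
  interpret group "presented_group S R" by (rule group_presented)
  have H: "?H \<subseteq> carrier (presented_group S R)" by (auto simp: carrier_presented)
  show "generate (presented_group S R) ?H \<subseteq> carrier (presented_group S R)" by (rule generate_incl[OF H])
  have "cls u \<in> generate (presented_group S R) ?H" if "u \<in> W" for u
    using that
  proof (induction u)
    case Nil
    then show ?case using generate.one[of "presented_group S R"] by (simp add: one_presented)
  next
    case (Cons a u)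
    obtain e x where a: "a = (e, x)" by (cases a)
    have x: "x \<in> S" "u \<in> W" using Cons a by auto
    have T: "cls [(True, x)] \<in> ?H" using x by blast
    have "cls [a] \<in> generate (presented_group S R) ?H"
    proof (cases e)
      case True
      then show ?thesis using generate.incl[OF T] a by simp
    next
      case False
      have "[(False, x), (True, x)] \<simeq> []" using pres_eq.cancel[of x S R False] x by simp
      then have "cls [(False, x)] \<otimes>\<^bsub>presented_group S R\<^esub> cls [(True, x)] = \<one>\<^bsub>presented_group S R\<^esub>"
        using x by (simp add: mult_presented one_presented cls_eq_iff)
      then have "inv\<^bsub>presented_group S R\<^esub> (cls [(True, x)]) = cls [(False, x)]"
        using x by (intro inv_equality) (auto simp: carrier_presented)
      then show ?thesis using generate.inv[OF T, of "presented_group S R"] False a by simp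
    qed
    then have "cls [a] \<otimes>\<^bsub>presented_group S R\<^esub> cls u \<in> generate (presented_group S R) ?H"
      using Cons.IH x(2) by (intro generate.eng)
    then show ?case using x a by (simp add: mult_presented)
  qed
  then show "carrier (presented_group S R) \<subseteq> generate (presented_group S R) ?H" by (auto simp: carrier_presented)
qed

lemma word_eval_append:
  assumes "group H" "f ` S \<subseteq> carrier H" "u \<in> W" "v \<in> W"
  shows "word_eval H f (u @ v) = word_eval H f u \<otimes>\<^bsub>H\<^esub> word_eval H f v" "word_eval H f u \<in> carrier H"
proof -
  interpret H: group H by fact
  have closed: "word_eval H f u \<in> carrier H" if "u \<in> W" for u
    using that assms(2) by (induction u) (auto simp: word_eval_def)
  show "word_eval H f u \<in> carrier H" using closed assms(3) .
  show "word_eval H f (u @ v) = word_eval H f u \<otimes>\<^bsub>H\<^esub> word_eval H f v"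
    using assms(3)
  proof (induction u)
    case Nil
    then show ?case using closed[OF assms(4)] by (simp add: word_eval_def)
  next
    case (Cons a u)
    obtain e x where a: "a = (e, x)" by (cases a)
    have x: "f x \<in> carrier H" "u \<in> W" using Cons a assms(2) by auto
    have "word_eval H f (a # u') = (if e then f x else inv\<^bsub>H\<^esub> f x) \<otimes>\<^bsub>H\<^esub> word_eval H f u'" for u'
      by (simp add: word_eval_def a)
    then show ?case using Cons.IH x closed[OF x(2)] closed[OF assms(4)] by (simp add: H.m_assoc)
  qed
qed

lemma word_eval_cong:
  assumes H: "group H" "f ` S \<subseteq> carrier H"
    and rel: "\<And>u v. (u, v) \<in> R \<Longrightarrow> word_eval H f u = word_eval H f v"
    and uv: "u \<simeq> v"
  shows "word_eval H f u = word_eval H f v"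
  using uv
proof (induction rule: pres_eq.induct)
  case (append u v u' v')
  then show ?case using word_eval_append[OF H] pres_eq_words by metis
next
  case (cancel x e)
  interpret H: group H by fact
  have "f x \<in> carrier H" using cancel H by blast
  then show ?case by (cases e) (simp_all add: word_eval_def)
qed (auto intro: rel)

text \<open>\<open>cover_theta\<close> applies \<open>the_elem\<close> to the set of values on a
  class; it is meaningful because evaluation is constant on classes.\<close>

lemma the_elem_cls:
  assumes H: "group H" "f ` S \<subseteq> carrier H"
    and rel: "\<And>u v. (u, v) \<in> R \<Longrightarrow> word_eval H f u = word_eval H f v" and u: "u \<in> W"
  shows "the_elem (word_eval H f ` cls u) = word_eval H f u"
proof -
  have "word_eval H f ` cls u = {word_eval H f u}"
    using word_eval_cong[OF H rel] pres_eq.refl[OF u] by (auto simp: cls_def)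
  then show ?thesis by simp
qed

end

section \<open>The double covers\<close>

text \<open>The computation that makes \<open>cover_theta\<close> a homomorphism is
  \<open>rel\<close>: every defining relation holds for transpositions when \<open>Z\<close> is read
  as the identity. The conditions on \<open>z\<close> and \<open>\<tau>\<close> are the relations
  themselves, read as equations between classes.\<close>

lemma sym_cover_like_sym_cover:
  "sym_cover_like (sym_cover n) n {w. pres_eq (cover_gens n) (cover_rels n) [lz] w}
     (\<lambda>a b. {w. pres_eq (cover_gens n) (cover_rels n) [lt a b] w}) (cover_theta n)"
proof -
  interpret presentation "cover_gens n" "cover_rels n" .
  have cls: "{w. pres_eq (cover_gens n) (cover_rels n) u w} = cls u" for u by (simp add: cls_def)
  have sc: "sym_cover n = presented_group (cover_gens n) (cover_rels n)" by (simp add: sym_cover_def)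
  have Z: "Z \<in> cover_gens n" by (simp add: cover_gens_def)
  have T: "Tr a b \<in> cover_gens n" if "pair n a b" for a b using that by (simp add: cover_gens_def pair_def)
  have H: "group (sym_group n)" "cover_gen_perm ` cover_gens n \<subseteq> carrier (sym_group n)"
    by (auto simp: sym_group_is_group cover_gens_def sym_group_carrier permutes_swap_id permutes_id)
  have ev: "word_eval (sym_group n) cover_gen_perm (map (Pair True) xs) = foldr (\<lambda>x g. cover_gen_perm x \<circ> g) xs id" for xs
    by (induction xs) (simp_all add: word_eval_def sym_group_mult sym_group_one)
  have rel: "word_eval (sym_group n) cover_gen_perm u = word_eval (sym_group n) cover_gen_perm v"
    if "(u, v) \<in> cover_rels n" for u v
    using that by (auto simp: cover_rels_def word_eval_def sym_group_mult sym_group_one fun_eq_iff Transposition.transpose_def)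
  have th: "cover_theta n (cls u) = word_eval (sym_group n) cover_gen_perm u" if "u \<in> W" for u
    unfolding cover_theta_def by (rule the_elem_cls[OF H rel that])
  have r: "cls u = cls v" if "(u, v) \<in> cover_rels n" "u \<in> W" "v \<in> W" for u v by (rule relation[OF that])
  show ?thesis
    unfolding cls
  proof (intro sym_cover_like.intro sym_cover_like_axioms.intro)
    show "group (sym_cover n)" by (simp add: sc group_presented)
    show "cls [lz] \<in> carrier (sym_cover n)" using Z by (auto simp: sc carrier_presented)
    show "cls [lz] \<otimes>\<^bsub>sym_cover n\<^esub> cls [lz] = \<one>\<^bsub>sym_cover n\<^esub>"
      using Z by (simp add: sc mult_presented one_presented) (rule r, auto simp: cover_rels_def)
    show "cover_theta n (cls [lz]) = id"
      using Z th[of "[lz]"] by (simp add: word_eval_def sym_group_mult sym_group_one)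
    show "carrier (sym_cover n) = generate (sym_cover n) (insert (cls [lz]) {cls [lt a b] | a b. pair n a b})"
    proof -
      have "(\<lambda>x. cls [(True, x)]) ` cover_gens n = insert (cls [lz]) {cls [lt a b] | a b. pair n a b}"
        by (auto simp: cover_gens_def pair_def image_iff)
      then show ?thesis using generated_presented by (simp add: sc)
    qed
    show "cover_theta n (g \<otimes>\<^bsub>sym_cover n\<^esub> h) = cover_theta n g \<circ> cover_theta n h"
      if gh: "g \<in> carrier (sym_cover n)" "h \<in> carrier (sym_cover n)" for g h
    proof -
      obtain u v where "u \<in> W" "v \<in> W" "g = cls u" "h = cls v" using gh by (auto simp: sc carrier_presented)
      then show ?thesis using word_eval_append(1)[OF H] by (simp add: sc mult_presented th sym_group_mult)
    qed
    fix a b assume p: "pair n a b"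
    note p' = p[unfolded pair_def]
    have T': "Tr b a \<in> cover_gens n" using T[of b a] p' by (auto simp: pair_def)
    show "cls [lt a b] \<in> carrier (sym_cover n)" using T[OF p] by (auto simp: sc carrier_presented)
    show "cls [lz] \<otimes>\<^bsub>sym_cover n\<^esub> cls [lt a b] = cls [lt a b] \<otimes>\<^bsub>sym_cover n\<^esub> cls [lz]"
      using Z T[OF p] p' by (simp add: sc mult_presented) (rule r, auto simp: cover_rels_def)
    show "cls [lt a b] = cls [lz] \<otimes>\<^bsub>sym_cover n\<^esub> cls [lt b a]"
      using Z T[OF p] T' p' by (simp add: sc mult_presented) (rule r, auto simp: cover_rels_def)
    show "cls [lt a b] \<otimes>\<^bsub>sym_cover n\<^esub> cls [lt a b] = \<one>\<^bsub>sym_cover n\<^esub>"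
      using T[OF p] p' by (simp add: sc mult_presented one_presented) (rule r, auto simp: cover_rels_def)
    show "cover_theta n (cls [lt a b]) = transp a b"
      using T[OF p] th[of "[lt a b]"] by (simp add: word_eval_def sym_group_mult sym_group_one)
  next
    interpret presentation "cover_gens n" "cover_rels n" .
    fix a b c assume t: "triple n a b c"
    note t' = t[unfolded triple_def]
    have "Tr a b \<in> cover_gens n" "Tr b c \<in> cover_gens n" "Tr a c \<in> cover_gens n"
      using T t' by (auto simp: pair_def)
    then show "cls [lt a b] \<otimes>\<^bsub>sym_cover n\<^esub> cls [lt b c] \<otimes>\<^bsub>sym_cover n\<^esub> cls [lt a b] = cls [lz] \<otimes>\<^bsub>sym_cover n\<^esub> cls [lt a c]"
      using Z t' by (simp add: sc mult_presented) (rule r, auto simp: cover_rels_def)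
  qed
qed

theorem aut_rigid_alt_cover:
  assumes "4 \<le> n" "n \<noteq> 6"
  shows "group (alt_cover n)" "finite (carrier (alt_cover n))" "aut_rigid (alt_cover n)"
proof -
  define z where "z = {w. pres_eq (cover_gens n) (cover_rels n) [lz] w}"
  define \<tau> where "\<tau> = (\<lambda>a b. {w. pres_eq (cover_gens n) (cover_rels n) [lt a b] w})"
  interpret S: sym_cover_like "sym_cover n" n z \<tau> "cover_theta n"
    unfolding z_def \<tau>_def by (rule sym_cover_like_sym_cover)
  have eq: "alt_cover n = sym_cover n\<lparr>carrier := S.even_part\<rparr>"
    using S.\<theta>_permutes by (auto simp: alt_cover_def S.even_part_def alt_group_carrier intro!: arg_cong[where f = "\<lambda>c. sym_cover n\<lparr>carrier := c\<rparr>"])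
  \<comment> \<open>Here \<open>n \<noteq> 6\<close> makes the demand for a trivial \<open>z\<close>
    in degree 6 vacuous.\<close>
  show "aut_rigid (alt_cover n)" unfolding eq using assms by (intro S.aut_rigid_of_twisted) auto
  show "group (alt_cover n)"
    unfolding eq using assms S.generate_is_subgroup[OF S.C.fam_closed, of n]
    by (intro S.subgroup_imp_group) (simp add: S.even_part_eq)
  have "S.even_part \<subseteq> carrier (sym_cover n)" by (auto simp: S.even_part_def)
  then show "finite (carrier (alt_cover n))" using S.finite_carrier assms finite_subset by (simp add: eq)
qed

theorem theorem3p9:
  shows "(\<forall>n\<ge>2. rigid_relative_Aut TYPE('j) (sym_group n) \<and>
                rigid_relative_Aut TYPE('j) (alt_group n)) \<and>
         (\<forall>n\<ge>4. n \<noteq> 6 \<longrightarrow> rigid_relative_Aut TYPE('j) (alt_cover n))"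
proof (intro conjI allI impI)
  fix n :: nat
  have fin: "finite (carrier (sym_group n))"
    by (simp add: sym_group_def finite_permutations)
  moreover have "carrier (alt_group n) \<subseteq> carrier (sym_group n)"
    by (auto simp: alt_group_carrier sym_group_carrier)
  ultimately have fin': "finite (carrier (alt_group n))" by (rule finite_subset[rotated])
  assume n: "2 \<le> n"
  show "rigid_relative_Aut TYPE('j) (sym_group n)"
    by (rule aut_rigid_imp_rigid[OF sym_group_is_group fin aut_rigid_sym_group[OF n]])
  show "rigid_relative_Aut TYPE('j) (alt_group n)"
    by (rule aut_rigid_imp_rigid[OF alt_group_is_group fin' aut_rigid_alt_group[OF n]])
next
  fix n :: nat assume "4 \<le> n" "n \<noteq> 6"
  then show "rigid_relative_Aut TYPE('j) (alt_cover n)"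
    by (intro aut_rigid_imp_rigid aut_rigid_alt_cover)
qed

end
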